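(* Let $K$ be a unital commutative ring and let $A$ be an associative unital $K$-superalgebra which is free as a $K$-module with a $K$-basis containing the identity. Let $\mathcal{W}=\Pi(A_2)^6$ and let $\mathfrak{st}(3,1,A)^{\sharp}=\mathfrak{st}(3,1,A)\oplus\mathcal{W}$ be the Lie superalgebra with bracket $[(x,w_1),(y,w_2)]=\big([x,y],\psi(x,y)\big)$, where $\psi$ is the super 2-cocycle on $\mathfrak{st}(3,1,A)$ specified in the context. Then the central extension \[ 0\to\mathcal{W}\to\mathfrak{st}(3,1,A)^{\sharp}\xrightarrow{\ \pi\ }\mathfrak{st}(3,1,A)\to 0, \] with $\pi$ the projection, is universal.
   Context: $K$ is regarded as concentrated in even degree; $A=A_{\bar 0}\oplus A_{\bar 1}$ is $\mathbb{Z}/2$-graded and $|a|$ denotes the degree of a homogeneous element. Lie superalgebras: a Lie superalgebra over $K$ is a $\mathbb{Z}/2$-graded $K$-module $L$ with an even $K$-bilinear bracket such that $[x,y]=-(-1)^{|x||y|}[y,x]$, $[x_{\bar 0},x_{\bar 0}]=0$ for $x_{\bar 0}\in L_{\bar 0}$, and $(-1)^{|x||z|}[[x,y],z]+(-1)^{|x||y|}[[y,z],x]+(-1)^{|y||z|}[[z,x],y]=0$ for homogeneous $x,y,z$. A central extension of $L$ is a surjective (even) Lie superalgebra homomorphism $M\to L$ whose kernel lies in the centre of $M$. It is universal if for every central extension $\tau\colon M'\to L$ there is a unique Lie superalgebra homomorphism $\rho\colon M\to M'$ whose composite with $\tau$ is the given map $M\to L$. Steinberg Lie superalgebra $\mathfrak{st}(3,1,A)$: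 indices $1,2,3$ are even ($|i|=\bar 0$) and $4$ is odd ($|4|=\bar 1$). It is the Lie superalgebra over $K$ generated by homogeneous elements $F_{ij}(a)$, $1\le i\ne j\le 4$, $a\in A$ homogeneous, of degree $|F_{ij}(a)|=|i|+|j|+|a|$, subject to: $a\mapsto F_{ij}(a)$ is $K$-linear; $[F_{ij}(a),F_{jk}(b)]=F_{ik}(ab)$ for distinct $i,j,k$; $[F_{ij}(a),F_{kl}(b)]=0$ for $j\ne k$, $i\ne l$. Put $H_{ij}(a,b)=[F_{ij}(a),F_{ji}(b)]$, let $\mathcal{H}$ be the subalgebra generated by all $H_{ij}(a,b)$, and $F_{ij}(A)=\{F_{ij}(a):a\in A\}$. As a $K$-module, $\mathfrak{st}(3,1,A)=\mathcal{H}\oplus\bigoplus_{1\le i\ne j\le 4}F_{ij}(A)$. $A_2=A/\mathcal{I}_2$, where $\mathcal{I}_2$ is the graded ideal of $A$ generated by all $2a$ and all $ab-(-1)^{|a||b|}ba$; $\bar a$ is the class of $a$. $\Pi(A_2)$ is $A_2$ with the parity changed: $\Pi(A_2)_{\bar 0}=(A_2)_{\bar 1}$, $\Pi(A_2)_{\bar 1}=(A_2)_{\bar 0}$. $\mathcal{W}=\Pi(A_2)^6$ is the direct sum of six copies, and $\epsilon_r\colon\Pi(A_2)\to\mathcal{W}$ is the inclusion in position $r$, $1\le r\le 6$. Partition the set $S_4$ of quadruples $(i,j,k,l)$ of distinct elements of $\{1,2,3,4\}$ into the six cosets of $\{(1,2,3,4),(3,2,1,4),(1,4,3,2),(3,4,1,2)\}$,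 i.e. into the classes $\{(i,j,k,l),(k,j,i,l),(i,l,k,j),(k,l,i,j)\}$, labelled $P_1,\dots,P_6$, and put $\theta((i,j,k,l))=r$ if $(i,j,k,l)\in P_r$. The map $\psi\colon\mathfrak{st}(3,1,A)\times\mathfrak{st}(3,1,A)\to\mathcal{W}$ is the $K$-bilinear map with $\psi\big(F_{ij}(a),F_{kl}(b)\big)=\epsilon_{\theta((i,j,k,l))}(\overline{ab})$ for $i,j,k,l$ distinct, $\psi\big(F_{ij}(a),F_{kl}(b)\big)=0$ if $i,j,k,l$ are not all distinct, and $\psi(x,y)=0$ if $x$ or $y$ belongs to $\mathcal{H}$. *)

theory Defs
  imports "HOL-Algebra.Module" "HOL-Algebra.QuotRing" "HOL-Library.Z2"
begin

section \<open>Superalgebras\<close>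

text \<open>
  Parities are elements of the two-element field \<^typ>\<open>bit\<close>. The product of a
  superalgebra is the field \<^const>\<open>mult\<close>; in a Lie superalgebra it is the bracket.
  As for \<^locale>\<open>module\<close>, the field \<^const>\<open>one\<close> (and, for supermodules, \<^const>\<open>mult\<close>)
  may be junk: it is meaningful only for the associative unital superalgebras below.
\<close>

record ('k, 'v) superalgebra = "('k, 'v) module" +
  grade :: "bit \<Rightarrow> 'v set"

locale supermodule = module K M for K (structure) and M (structure) +
  assumes grade_submodule: "submodule (grade M p) K M"
    and grade_sum: "x \<in> carrier M \<Longrightarrow> \<exists>y\<in>grade M 0. \<exists>z\<in>grade M 1. x = y \<oplus>\<^bsub>M\<^esub> z"
    and grade_Int: "grade M 0 \<inter> grade M 1 = {\<zero>\<^bsub>M\<^esub>}"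

definition bilinear_map ::
    "('k, 'c) ring_scheme \<Rightarrow> ('k, 'u, 'd) module_scheme \<Rightarrow> ('k, 'v, 'e) module_scheme \<Rightarrow>
      ('k, 'w, 'f) module_scheme \<Rightarrow> ('u \<Rightarrow> 'v \<Rightarrow> 'w) \<Rightarrow> bool" where
  "bilinear_map K M N P \<beta> \<longleftrightarrow>
    (\<forall>x\<in>carrier M. \<forall>y\<in>carrier N. \<beta> x y \<in> carrier P) \<and>
    (\<forall>x\<in>carrier M. \<forall>x'\<in>carrier M. \<forall>y\<in>carrier N. \<beta> (x \<oplus>\<^bsub>M\<^esub> x') y = \<beta> x y \<oplus>\<^bsub>P\<^esub> \<beta> x' y) \<and>
    (\<forall>x\<in>carrier M. \<forall>y\<in>carrier N. \<forall>y'\<in>carrier N. \<beta> x (y \<oplus>\<^bsub>N\<^esub> y') = \<beta> x y \<oplus>\<^bsub>P\<^esub> \<beta> x y') \<and>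
    (\<forall>c\<in>carrier K. \<forall>x\<in>carrier M. \<forall>y\<in>carrier N.
      \<beta> (c \<odot>\<^bsub>M\<^esub> x) y = c \<odot>\<^bsub>P\<^esub> \<beta> x y \<and> \<beta> x (c \<odot>\<^bsub>N\<^esub> y) = c \<odot>\<^bsub>P\<^esub> \<beta> x y)"

locale superalgebra = supermodule K L for K (structure) and L (structure) +
  assumes mult_bilinear: "bilinear_map K L L L (mult L)"
    and mult_grade: "\<lbrakk>x \<in> grade L p; y \<in> grade L q\<rbrakk> \<Longrightarrow> x \<otimes>\<^bsub>L\<^esub> y \<in> grade L (p + q)"

locale associative_superalgebra = superalgebra K A + ring A for K (structure) and A (structure)

definition has_basis_with_one :: "('k, 'c) ring_scheme \<Rightarrow> ('k, 'a, 'd) module_scheme \<Rightarrow> bool" where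
  "has_basis_with_one K A \<longleftrightarrow>
    (\<exists>B \<subseteq> carrier A. \<one>\<^bsub>A\<^esub> \<in> B \<and>
      (\<forall>x\<in>carrier A. \<exists>!c. c \<in> B \<rightarrow>\<^sub>E carrier K \<and> finite {b \<in> B. c b \<noteq> \<zero>\<^bsub>K\<^esub>} \<and>
        x = (\<Oplus>\<^bsub>A\<^esub>b\<in>{b \<in> B. c b \<noteq> \<zero>\<^bsub>K\<^esub>}. c b \<odot>\<^bsub>A\<^esub> b)))"

text \<open>The sign \<open>(-1)\<^sup>p\<^sup>q\<close> acting on \<open>x\<close>.\<close>
definition ssign :: "('v, 'c) ring_scheme \<Rightarrow> bit \<Rightarrow> bit \<Rightarrow> 'v \<Rightarrow> 'v" where
  "ssign M p q x = (if p = 1 \<and> q = 1 then \<ominus>\<^bsub>M\<^esub> x else x)"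

text \<open>The left-hand side of the super Jacobi identity, for arguments of degrees \<open>p\<close>, \<open>q\<close>, \<open>r\<close>.\<close>
definition jacobiator ::
    "('v, 'c) ring_scheme \<Rightarrow> bit \<Rightarrow> bit \<Rightarrow> bit \<Rightarrow> 'v \<Rightarrow> 'v \<Rightarrow> 'v \<Rightarrow> 'v" where
  "jacobiator L p q r x y z =
    ssign L p r ((x \<otimes>\<^bsub>L\<^esub> y) \<otimes>\<^bsub>L\<^esub> z) \<oplus>\<^bsub>L\<^esub>
    ssign L p q ((y \<otimes>\<^bsub>L\<^esub> z) \<otimes>\<^bsub>L\<^esub> x) \<oplus>\<^bsub>L\<^esub>
    ssign L q r ((z \<otimes>\<^bsub>L\<^esub> x) \<otimes>\<^bsub>L\<^esub> y)"

locale lie_superalgebra = superalgebra +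
  assumes super_skew:
      "\<lbrakk>x \<in> grade L p; y \<in> grade L q\<rbrakk> \<Longrightarrow> x \<otimes>\<^bsub>L\<^esub> y = \<ominus>\<^bsub>L\<^esub> ssign L p q (y \<otimes>\<^bsub>L\<^esub> x)"
    and even_alternating: "x \<in> grade L 0 \<Longrightarrow> x \<otimes>\<^bsub>L\<^esub> x = \<zero>\<^bsub>L\<^esub>"
    and super_jacobi:
      "\<lbrakk>x \<in> grade L p; y \<in> grade L q; z \<in> grade L r\<rbrakk> \<Longrightarrow> jacobiator L p q r x y z = \<zero>\<^bsub>L\<^esub>"

definition lie_superalgebra_hom ::
    "('k, 'c) ring_scheme \<Rightarrow> ('k, 'u) superalgebra \<Rightarrow> ('k, 'v) superalgebra \<Rightarrow> ('u \<Rightarrow> 'v) set" where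
  "lie_superalgebra_hom K L M =
    {f. f \<in> carrier L \<rightarrow> carrier M \<and>
        (\<forall>x\<in>carrier L. \<forall>y\<in>carrier L. f (x \<oplus>\<^bsub>L\<^esub> y) = f x \<oplus>\<^bsub>M\<^esub> f y) \<and>
        (\<forall>c\<in>carrier K. \<forall>x\<in>carrier L. f (c \<odot>\<^bsub>L\<^esub> x) = c \<odot>\<^bsub>M\<^esub> f x) \<and>
        (\<forall>x\<in>carrier L. \<forall>y\<in>carrier L. f (x \<otimes>\<^bsub>L\<^esub> y) = f x \<otimes>\<^bsub>M\<^esub> f y) \<and>
        (\<forall>p. f ` grade L p \<subseteq> grade M p)}"

definition lie_centre :: "('v, 'c) ring_scheme \<Rightarrow> 'v set" where
  "lie_centre L = {x \<in> carrier L. \<forall>y\<in>carrier L. x \<otimes>\<^bsub>L\<^esub> y = \<zero>\<^bsub>L\<^esub>}"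

definition central_extension ::
    "('k, 'c) ring_scheme \<Rightarrow> ('k, 'u) superalgebra \<Rightarrow> ('k, 'v) superalgebra \<Rightarrow> ('u \<Rightarrow> 'v) \<Rightarrow> bool" where
  "central_extension K M L \<pi> \<longleftrightarrow>
    lie_superalgebra K M \<and> lie_superalgebra K L \<and>
    \<pi> \<in> lie_superalgebra_hom K M L \<and> \<pi> ` carrier M = carrier L \<and>
    a_kernel M L \<pi> \<subseteq> lie_centre M"

text \<open>
  The type argument is the type carrying the competing central extensions; a statement that leaves
  it a type variable quantifies over all central extensions. Functions are compared on the
  carrier only, whence \<^const>\<open>extensional\<close>.
\<close>
definition universal_central_extension ::
    "'m itself \<Rightarrow> ('k, 'c) ring_scheme \<Rightarrow> ('k, 'u) superalgebra \<Rightarrow> ('k, 'v) superalgebra \<Rightarrow>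
      ('u \<Rightarrow> 'v) \<Rightarrow> bool" where
  "universal_central_extension T K M L \<pi> \<longleftrightarrow>
    central_extension K M L \<pi> \<and>
    (\<forall>(M' :: ('k, 'm) superalgebra) \<tau>. central_extension K M' L \<tau> \<longrightarrow>
      (\<exists>!\<rho>. \<rho> \<in> extensional (carrier M) \<and> \<rho> \<in> lie_superalgebra_hom K M M' \<and>
        (\<forall>x\<in>carrier M. \<tau> (\<rho> x) = \<pi> x)))"


section \<open>Quotients and presentations\<close>

text \<open>The library's quotient \<^term>\<open>M Quot I\<close>, with the induced scalar action and grading.\<close>
definition super_quot :: "('k, 'v) superalgebra \<Rightarrow> 'v set \<Rightarrow> ('k, 'v set) superalgebra" where
  "super_quot M I =
    \<lparr>carrier = carrier (M Quot I), mult = mult (M Quot I), one = one (M Quot I),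
     zero = zero (M Quot I), add = add (M Quot I),
     smult = (\<lambda>c X. \<Union>x\<in>X. I +>\<^bsub>M\<^esub> (c \<odot>\<^bsub>M\<^esub> x)),
     grade = (\<lambda>p. (\<lambda>x. I +>\<^bsub>M\<^esub> x) ` grade M p)\<rparr>"

text \<open>Two-sided ideals and subalgebras of a not necessarily associative \<open>K\<close>-algebra.\<close>
definition nonassoc_ideal_gen ::
    "('k, 'c) ring_scheme \<Rightarrow> ('k, 'v, 'd) module_scheme \<Rightarrow> 'v set \<Rightarrow> 'v set" where
  "nonassoc_ideal_gen K N S =
    \<Inter>{I. submodule I K N \<and> (\<forall>x\<in>I. \<forall>y\<in>carrier N. x \<otimes>\<^bsub>N\<^esub> y \<in> I \<and> y \<otimes>\<^bsub>N\<^esub> x \<in> I) \<and> S \<subseteq> I}"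

definition subalgebra_gen ::
    "('k, 'c) ring_scheme \<Rightarrow> ('k, 'v, 'd) module_scheme \<Rightarrow> 'v set \<Rightarrow> 'v set" where
  "subalgebra_gen K N S =
    \<Inter>{T. submodule T K N \<and> (\<forall>x\<in>T. \<forall>y\<in>T. x \<otimes>\<^bsub>N\<^esub> y \<in> T) \<and> S \<subseteq> T}"

text \<open>Nonassociative monomials, i.e. elements of the free magma.\<close>
datatype (letters: 'g) monomial = Letter 'g | Times "'g monomial" "'g monomial"

primrec monomial_degree :: "('g \<Rightarrow> bit) \<Rightarrow> 'g monomial \<Rightarrow> bit" where
  "monomial_degree d (Letter g) = d g"
| "monomial_degree d (Times s t) = monomial_degree d s + monomial_degree d t"

text \<open>
  The free nonassociative \<open>K\<close>-superalgebra on a set \<open>G\<close> of generators of degrees \<open>d\<close>: finitely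
  supported \<open>K\<close>-valued functions on the monomials in \<open>G\<close>. Factorisation of monomials being unique,
  each coefficient of a product is a single term.
\<close>
definition free_superalgebra ::
    "('k, 'c) ring_scheme \<Rightarrow> 'g set \<Rightarrow> ('g \<Rightarrow> bit) \<Rightarrow> ('k, 'g monomial \<Rightarrow> 'k) superalgebra" where
  "free_superalgebra K G d =
    (let C = {f. (\<forall>t. f t \<in> carrier K) \<and> finite {t. f t \<noteq> \<zero>\<^bsub>K\<^esub>} \<and>
                 (\<forall>t. f t \<noteq> \<zero>\<^bsub>K\<^esub> \<longrightarrow> letters t \<subseteq> G)}
     in \<lparr>carrier = C,
         mult = (\<lambda>f g t. case t of Letter _ \<Rightarrow> \<zero>\<^bsub>K\<^esub> | Times u v \<Rightarrow> f u \<otimes>\<^bsub>K\<^esub> g v),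
         one = (\<lambda>_. \<zero>\<^bsub>K\<^esub>),
         zero = (\<lambda>_. \<zero>\<^bsub>K\<^esub>),
         add = (\<lambda>f g t. f t \<oplus>\<^bsub>K\<^esub> g t),
         smult = (\<lambda>c f t. c \<otimes>\<^bsub>K\<^esub> f t),
         grade = (\<lambda>p. {f \<in> C. \<forall>t. f t \<noteq> \<zero>\<^bsub>K\<^esub> \<longrightarrow> monomial_degree d t = p})\<rparr>)"

definition free_gen :: "('k, 'c) ring_scheme \<Rightarrow> 'g \<Rightarrow> 'g monomial \<Rightarrow> 'k" where
  "free_gen K g = (\<lambda>t. if t = Letter g then \<one>\<^bsub>K\<^esub> else \<zero>\<^bsub>K\<^esub>)"

definition lie_identities :: "('k, 'v) superalgebra \<Rightarrow> 'v set" where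
  "lie_identities N =
    {x \<otimes>\<^bsub>N\<^esub> y \<oplus>\<^bsub>N\<^esub> ssign N p q (y \<otimes>\<^bsub>N\<^esub> x) | p q x y. x \<in> grade N p \<and> y \<in> grade N q} \<union>
    {x \<otimes>\<^bsub>N\<^esub> x | x. x \<in> grade N 0} \<union>
    {jacobiator N p q r x y z | p q r x y z. x \<in> grade N p \<and> y \<in> grade N q \<and> z \<in> grade N r}"

definition lie_presentation_ideal ::
    "('k, 'c) ring_scheme \<Rightarrow> 'g set \<Rightarrow> ('g \<Rightarrow> bit) \<Rightarrow> ('g monomial \<Rightarrow> 'k) set \<Rightarrow>
      ('g monomial \<Rightarrow> 'k) set" where
  "lie_presentation_ideal K G d R =
    nonassoc_ideal_gen K (free_superalgebra K G d) (lie_identities (free_superalgebra K G d) \<union> R)"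

text \<open>
  The Lie superalgebra with generators \<open>G\<close> of degrees \<open>d\<close> and relators \<open>R\<close> (elements of the free
  superalgebra on \<open>G\<close>).
\<close>
definition lie_presentation ::
    "('k, 'c) ring_scheme \<Rightarrow> 'g set \<Rightarrow> ('g \<Rightarrow> bit) \<Rightarrow> ('g monomial \<Rightarrow> 'k) set \<Rightarrow>
      ('k, ('g monomial \<Rightarrow> 'k) set) superalgebra" where
  "lie_presentation K G d R =
    super_quot (free_superalgebra K G d) (lie_presentation_ideal K G d R)"


section \<open>The Steinberg Lie superalgebra \<open>st(3,1,A)\<close>\<close>

definition idx_parity :: "nat \<Rightarrow> bit" where
  "idx_parity i = (if i = 4 then 1 else 0)"

text \<open>
  The letter \<open>(i, j, p, a)\<close> stands for \<open>F\<^sub>i\<^sub>j(a)\<close> with \<open>a\<close> homogeneous of degree \<open>p\<close>. The degree is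
  recorded because \<open>0 \<in> A\<close> is homogeneous of both degrees; by linearity both letters for
  \<open>F\<^sub>i\<^sub>j(0)\<close> vanish in the quotient.
\<close>
type_synonym 'a st_letter = "nat \<times> nat \<times> bit \<times> 'a"

definition st_letters :: "('k, 'a) superalgebra \<Rightarrow> 'a st_letter set" where
  "st_letters A = {(i, j, p, a). i \<in> {1..4} \<and> j \<in> {1..4} \<and> i \<noteq> j \<and> a \<in> grade A p}"

definition st_degree :: "'a st_letter \<Rightarrow> bit" where
  "st_degree = (\<lambda>(i, j, p, a). idx_parity i + idx_parity j + p)"

definition st_relators ::
    "('k, 'c) ring_scheme \<Rightarrow> ('k, 'a) superalgebra \<Rightarrow> ('a st_letter monomial \<Rightarrow> 'k) set" where
  "st_relators K A =
    (let N = free_superalgebra K (st_letters A) st_degree;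
         F = (\<lambda>i j p a. free_gen K (i, j, p, a));
         I = {1..4}
     in {F i j p (a \<oplus>\<^bsub>A\<^esub> b) \<ominus>\<^bsub>N\<^esub> (F i j p a \<oplus>\<^bsub>N\<^esub> F i j p b) | i j p a b.
           i \<in> I \<and> j \<in> I \<and> i \<noteq> j \<and> a \<in> grade A p \<and> b \<in> grade A p} \<union>
        {F i j p (c \<odot>\<^bsub>A\<^esub> a) \<ominus>\<^bsub>N\<^esub> c \<odot>\<^bsub>N\<^esub> F i j p a | i j p c a.
           i \<in> I \<and> j \<in> I \<and> i \<noteq> j \<and> c \<in> carrier K \<and> a \<in> grade A p} \<union>
        {F i j p a \<otimes>\<^bsub>N\<^esub> F j k q b \<ominus>\<^bsub>N\<^esub> F i k (p + q) (a \<otimes>\<^bsub>A\<^esub> b) | i j k p q a b.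
           i \<in> I \<and> j \<in> I \<and> k \<in> I \<and> distinct [i, j, k] \<and> a \<in> grade A p \<and> b \<in> grade A q} \<union>
        {F i j p a \<otimes>\<^bsub>N\<^esub> F k l q b | i j k l p q a b.
           i \<in> I \<and> j \<in> I \<and> k \<in> I \<and> l \<in> I \<and> i \<noteq> j \<and> k \<noteq> l \<and> j \<noteq> k \<and> i \<noteq> l \<and>
           a \<in> grade A p \<and> b \<in> grade A q})"

definition steinberg ::
    "('k, 'c) ring_scheme \<Rightarrow> ('k, 'a) superalgebra \<Rightarrow>
      ('k, ('a st_letter monomial \<Rightarrow> 'k) set) superalgebra" where
  "steinberg K A = lie_presentation K (st_letters A) st_degree (st_relators K A)"

text \<open>\<open>F\<^sub>i\<^sub>j(a)\<close> for \<open>a\<close> homogeneous of degree \<open>p\<close>.\<close>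
definition st_F ::
    "('k, 'c) ring_scheme \<Rightarrow> ('k, 'a) superalgebra \<Rightarrow> nat \<Rightarrow> nat \<Rightarrow> bit \<Rightarrow> 'a \<Rightarrow>
      ('a st_letter monomial \<Rightarrow> 'k) set" where
  "st_F K A i j p a =
    lie_presentation_ideal K (st_letters A) st_degree (st_relators K A)
      +>\<^bsub>free_superalgebra K (st_letters A) st_degree\<^esub> free_gen K (i, j, p, a)"

definition st_H_subalgebra ::
    "('k, 'c) ring_scheme \<Rightarrow> ('k, 'a) superalgebra \<Rightarrow> ('a st_letter monomial \<Rightarrow> 'k) set set" where
  "st_H_subalgebra K A =
    subalgebra_gen K (steinberg K A)
      {st_F K A i j p a \<otimes>\<^bsub>steinberg K A\<^esub> st_F K A j i q b | i j p q a b.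
        i \<in> {1..4} \<and> j \<in> {1..4} \<and> i \<noteq> j \<and> a \<in> grade A p \<and> b \<in> grade A q}"


section \<open>The kernel \<open>W\<close> and the cocycle\<close>

definition ideal2 :: "('k, 'a) superalgebra \<Rightarrow> 'a set" where
  "ideal2 A = Idl\<^bsub>A\<^esub> ({a \<oplus>\<^bsub>A\<^esub> a | a. a \<in> carrier A} \<union>
    {a \<otimes>\<^bsub>A\<^esub> b \<ominus>\<^bsub>A\<^esub> ssign A p q (b \<otimes>\<^bsub>A\<^esub> a) | p q a b. a \<in> grade A p \<and> b \<in> grade A q})"

definition A2 :: "('k, 'a) superalgebra \<Rightarrow> ('k, 'a set) superalgebra" where
  "A2 A = super_quot A (ideal2 A)"

definition parity_change :: "('k, 'v) superalgebra \<Rightarrow> ('k, 'v) superalgebra" where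
  "parity_change M = M\<lparr>grade := (\<lambda>p. grade M (p + 1))\<rparr>"

text \<open>The direct sum of \<open>n\<close> copies of a supermodule, with zero bracket.\<close>
definition super_power :: "nat \<Rightarrow> ('k, 'v) superalgebra \<Rightarrow> ('k, nat \<Rightarrow> 'v) superalgebra" where
  "super_power n M =
    \<lparr>carrier = {1..n} \<rightarrow>\<^sub>E carrier M,
     mult = (\<lambda>_ _. \<lambda>r\<in>{1..n}. \<zero>\<^bsub>M\<^esub>),
     one = (\<lambda>r\<in>{1..n}. \<zero>\<^bsub>M\<^esub>),
     zero = (\<lambda>r\<in>{1..n}. \<zero>\<^bsub>M\<^esub>),
     add = (\<lambda>v w. \<lambda>r\<in>{1..n}. v r \<oplus>\<^bsub>M\<^esub> w r),
     smult = (\<lambda>c v. \<lambda>r\<in>{1..n}. c \<odot>\<^bsub>M\<^esub> v r),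
     grade = (\<lambda>p. {1..n} \<rightarrow>\<^sub>E grade M p)\<rparr>"

definition W_mod :: "('k, 'a) superalgebra \<Rightarrow> ('k, nat \<Rightarrow> 'a set) superalgebra" where
  "W_mod A = super_power 6 (parity_change (A2 A))"

definition W_incl :: "('k, 'a) superalgebra \<Rightarrow> nat \<Rightarrow> 'a set \<Rightarrow> nat \<Rightarrow> 'a set" where
  "W_incl A r x = (\<lambda>s\<in>{1..6}. if s = r then x else \<zero>\<^bsub>A2 A\<^esub>)"

definition quadruples :: "(nat \<times> nat \<times> nat \<times> nat) set" where
  "quadruples = {(i, j, k, l). {i, j, k, l} \<subseteq> {1..4} \<and> distinct [i, j, k, l]}"

fun quadruple_class :: "nat \<times> nat \<times> nat \<times> nat \<Rightarrow> (nat \<times> nat \<times> nat \<times> nat) set" where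
  "quadruple_class (i, j, k, l) = {(i, j, k, l), (k, j, i, l), (i, l, k, j), (k, l, i, j)}"

text \<open>
  \<open>\<theta>\<close> is the class map of some labelling \<open>P\<^sub>1, \<dots>, P\<^sub>6\<close> of the six classes; no particular
  order of the classes is prescribed.
\<close>
definition class_labelling :: "(nat \<times> nat \<times> nat \<times> nat \<Rightarrow> nat) \<Rightarrow> bool" where
  "class_labelling \<theta> \<longleftrightarrow> \<theta> ` quadruples = {1..6} \<and>
    (\<forall>s\<in>quadruples. \<forall>t\<in>quadruples. \<theta> s = \<theta> t \<longleftrightarrow> t \<in> quadruple_class s)"

definition is_st_cocycle ::
    "('k, 'c) ring_scheme \<Rightarrow> ('k, 'a) superalgebra \<Rightarrow> (nat \<times> nat \<times> nat \<times> nat \<Rightarrow> nat) \<Rightarrow>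
      (('a st_letter monomial \<Rightarrow> 'k) set \<Rightarrow> ('a st_letter monomial \<Rightarrow> 'k) set \<Rightarrow> nat \<Rightarrow> 'a set) \<Rightarrow> bool"
  where
  "is_st_cocycle K A \<theta> \<psi> \<longleftrightarrow>
    bilinear_map K (steinberg K A) (steinberg K A) (W_mod A) \<psi> \<and>
    (\<forall>i\<in>{1..4}. \<forall>j\<in>{1..4}. \<forall>k\<in>{1..4}. \<forall>l\<in>{1..4}. \<forall>p q. \<forall>a\<in>grade A p. \<forall>b\<in>grade A q.
      i \<noteq> j \<and> k \<noteq> l \<longrightarrow>
      \<psi> (st_F K A i j p a) (st_F K A k l q b) =
        (if distinct [i, j, k, l]
         then W_incl A (\<theta> (i, j, k, l)) (ideal2 A +>\<^bsub>A\<^esub> (a \<otimes>\<^bsub>A\<^esub> b))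
         else \<zero>\<^bsub>W_mod A\<^esub>)) \<and>
    (\<forall>x\<in>carrier (steinberg K A). \<forall>y\<in>carrier (steinberg K A).
      x \<in> st_H_subalgebra K A \<or> y \<in> st_H_subalgebra K A \<longrightarrow> \<psi> x y = \<zero>\<^bsub>W_mod A\<^esub>)"

text \<open>
  The map \<open>\<psi>\<close>: the defining conditions determine it on the carrier, because
  \<open>st(3,1,A)\<close> is the direct sum of the subalgebra \<open>H\<close> and the \<open>F\<^sub>i\<^sub>j(A)\<close>, and the function
  space \<open>\<rightarrow>\<^sub>E\<close> fixes its values elsewhere.
\<close>
definition st_cocycle ::
    "('k, 'c) ring_scheme \<Rightarrow> ('k, 'a) superalgebra \<Rightarrow> (nat \<times> nat \<times> nat \<times> nat \<Rightarrow> nat) \<Rightarrow>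
      ('a st_letter monomial \<Rightarrow> 'k) set \<Rightarrow> ('a st_letter monomial \<Rightarrow> 'k) set \<Rightarrow> nat \<Rightarrow> 'a set" where
  "st_cocycle K A \<theta> =
    (THE \<psi>. \<psi> \<in> carrier (steinberg K A) \<rightarrow>\<^sub>E (carrier (steinberg K A) \<rightarrow>\<^sub>E carrier (W_mod A)) \<and>
      is_st_cocycle K A \<theta> \<psi>)"

definition st_sharp ::
    "('k, 'c) ring_scheme \<Rightarrow> ('k, 'a) superalgebra \<Rightarrow> (nat \<times> nat \<times> nat \<times> nat \<Rightarrow> nat) \<Rightarrow>
      ('k, ('a st_letter monomial \<Rightarrow> 'k) set \<times> (nat \<Rightarrow> 'a set)) superalgebra" where
  "st_sharp K A \<theta> =
    (let L = steinberg K A; W = W_mod A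
     in \<lparr>carrier = carrier L \<times> carrier W,
         mult = (\<lambda>(x, v) (y, w). (x \<otimes>\<^bsub>L\<^esub> y, st_cocycle K A \<theta> x y)),
         one = (\<zero>\<^bsub>L\<^esub>, \<zero>\<^bsub>W\<^esub>),
         zero = (\<zero>\<^bsub>L\<^esub>, \<zero>\<^bsub>W\<^esub>),
         add = (\<lambda>(x, v) (y, w). (x \<oplus>\<^bsub>L\<^esub> y, v \<oplus>\<^bsub>W\<^esub> w)),
         smult = (\<lambda>c (x, v). (c \<odot>\<^bsub>L\<^esub> x, c \<odot>\<^bsub>W\<^esub> v)),
         grade = (\<lambda>p. grade L p \<times> grade W p)\<rparr>)"

end

theory Submission
  imports Defs
begin

text \<open>
  Two things have to be proved: that the prescribed values define a cocycle \<open>\<psi>\<close>, and that the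
  resulting central extension is universal.

  \<^bold>\<open>The cocycle.\<close> The ring \<open>A\<^sub>2\<close> is commutative of characteristic two, so over it a Lie superalgebra
  of matrices has neither signs nor supercommutators. The elementary matrices act on the exterior
  square of the natural representation of rank four, whose basis consists of the six two-element
  subsets of \<open>{1..4}\<close>; this defines a homomorphism \<open>\<phi>\<close> from the Steinberg Lie superalgebra to the
  \<open>6 \<times> 6\<close> matrices over \<open>A\<^sub>2\<close> (\<open>exterior_square_exists\<close>). The image consists of matrices that are skew
  for the wedge pairing of the exterior square with itself, as in the isomorphism of \<open>sl\<^sub>4\<close> with
  \<open>so\<^sub>6\<close>. A product \<open>\<phi>(x) \<phi>(y)\<close> is no longer skew, and its entries at the positions
  (pair, complementary pair) are the six components of \<open>\<psi>(x, y)\<close>. As products of three skew matrices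
  have the same such entries as their reversals, the Jacobi identity for \<open>\<psi>\<close> is a cancellation in
  pairs (\<open>psi_jacobi\<close>). The subalgebra generated by the \<open>H\<^sub>i\<^sub>j(a, b)\<close> acts by diagonal matrices, whence
  \<open>\<psi>\<close> vanishes on it. Conversely the \<open>F\<^sub>i\<^sub>j(a)\<close> and \<open>H\<^sub>i\<^sub>j(a, b)\<close> span the Steinberg Lie superalgebra
  (\<open>st_span_all\<close>), so the prescribed values determine \<open>\<psi>\<close>.

  \<^bold>\<open>Universality.\<close> Let \<open>\<tau>: X \<rightarrow> st(3,1,A)\<close> be a central extension. The bracket of \<open>X\<close> depends only on
  the images under \<open>\<tau>\<close>, hence is a map \<open>\<beta>\<close> on \<open>st(3,1,A)\<close> that satisfies the identities of a bracket.
  If \<open>[x, z] = 0\<close>, the Jacobi identity becomes \<open>\<beta>([x, y], z) = \<beta>(x, [y, z])\<close>. With it one finds that the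
  elements \<open>\<beta>(F\<^sub>i\<^sub>k(a), F\<^sub>k\<^sub>j(1))\<close> of \<open>X\<close> satisfy all the relations of the \<open>F\<^sub>i\<^sub>j(a)\<close>, except that
  \<open>\<beta>(F\<^sub>i\<^sub>j(a), F\<^sub>k\<^sub>l(b))\<close> need not vanish if the four indices are distinct. There, two ways of moving
  coefficients around (\<open>P_swap\<close> and \<open>P_rotate\<close>) agree only up to a sign, which forces these elements to
  have exponent two (\<open>P_double\<close>); after that, they are seen to depend only on the class of
  \<open>(i, j, k, l)\<close> and on the class of \<open>ab\<close> in \<open>A\<^sub>2\<close> (\<open>Q_hom_pair\<close>, \<open>Q_lin_ideal2\<close>). This gives a linear
  map \<open>W_map\<close> from \<open>\<W>\<close> to the kernel of \<open>\<tau>\<close>.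

  The free superalgebra on the letters \<open>F\<^sub>i\<^sub>j(a)\<close> now maps to \<open>X\<close> and to \<open>st(3,1,A)\<^sup>\<sharp>\<close>. On the ideal of
  relations the two maps correspond to each other under \<open>W_map\<close>, since they do so on the generators of
  the ideal (\<open>ideal_agreement\<close>). The homomorphism from \<open>st(3,1,A)\<^sup>\<sharp>\<close> to \<open>X\<close> is therefore well
  defined by lifting to the free superalgebra. It is unique because \<open>st(3,1,A)\<^sup>\<sharp>\<close> is spanned by brackets
  (\<open>extension_perfect\<close>) and brackets in \<open>X\<close> depend only on the images under \<open>\<tau>\<close>.
\<close>

section \<open>Supermodules and homogeneous components\<close>

text \<open>Parities are added, so a sum of parities should stay a sum.\<close>
declare add_bit_eq_xor [simp del]

lemma bit_cases: "p = 0 \<or> p = (1::bit)"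
  by (cases p) auto

lemma bilinear_mapD:
  assumes "bilinear_map K M N P \<beta>"
  shows bilinear_map_closed: "\<lbrakk>x \<in> carrier M; y \<in> carrier N\<rbrakk> \<Longrightarrow> \<beta> x y \<in> carrier P"
    and bilinear_map_add_left: "\<lbrakk>x \<in> carrier M; x' \<in> carrier M; y \<in> carrier N\<rbrakk>
      \<Longrightarrow> \<beta> (x \<oplus>\<^bsub>M\<^esub> x') y = \<beta> x y \<oplus>\<^bsub>P\<^esub> \<beta> x' y"
    and bilinear_map_add_right: "\<lbrakk>x \<in> carrier M; y \<in> carrier N; y' \<in> carrier N\<rbrakk>
      \<Longrightarrow> \<beta> x (y \<oplus>\<^bsub>N\<^esub> y') = \<beta> x y \<oplus>\<^bsub>P\<^esub> \<beta> x y'"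
    and bilinear_map_smult_left: "\<lbrakk>c \<in> carrier K; x \<in> carrier M; y \<in> carrier N\<rbrakk>
      \<Longrightarrow> \<beta> (c \<odot>\<^bsub>M\<^esub> x) y = c \<odot>\<^bsub>P\<^esub> \<beta> x y"
    and bilinear_map_smult_right: "\<lbrakk>c \<in> carrier K; x \<in> carrier M; y \<in> carrier N\<rbrakk>
      \<Longrightarrow> \<beta> x (c \<odot>\<^bsub>N\<^esub> y) = c \<odot>\<^bsub>P\<^esub> \<beta> x y"
  using assms unfolding bilinear_map_def by blast+

lemma additive_map_zero_minus:
  assumes "abelian_group G" "abelian_group H"
    and closed: "\<And>x. x \<in> carrier G \<Longrightarrow> f x \<in> carrier H"
    and add: "\<And>x y. \<lbrakk>x \<in> carrier G; y \<in> carrier G\<rbrakk> \<Longrightarrow> f (x \<oplus>\<^bsub>G\<^esub> y) = f x \<oplus>\<^bsub>H\<^esub> f y"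
  shows "f \<zero>\<^bsub>G\<^esub> = \<zero>\<^bsub>H\<^esub>"
    and "x \<in> carrier G \<Longrightarrow> f (\<ominus>\<^bsub>G\<^esub> x) = \<ominus>\<^bsub>H\<^esub> f x"
    and "\<lbrakk>x \<in> carrier G; y \<in> carrier G\<rbrakk> \<Longrightarrow> f (x \<ominus>\<^bsub>G\<^esub> y) = f x \<ominus>\<^bsub>H\<^esub> f y"
proof -
  interpret G: abelian_group G by fact
  interpret H: abelian_group H by fact
  have "f \<zero>\<^bsub>G\<^esub> \<oplus>\<^bsub>H\<^esub> f \<zero>\<^bsub>G\<^esub> = f \<zero>\<^bsub>G\<^esub>"
    using add[of "\<zero>\<^bsub>G\<^esub>" "\<zero>\<^bsub>G\<^esub>"] by simp
  then show 0: "f \<zero>\<^bsub>G\<^esub> = \<zero>\<^bsub>H\<^esub>"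
    using closed by (metis G.zero_closed H.add.r_cancel_one')
  show 1: "f (\<ominus>\<^bsub>G\<^esub> x) = \<ominus>\<^bsub>H\<^esub> f x" if "x \<in> carrier G" for x
    using add[of "\<ominus>\<^bsub>G\<^esub> x" x] that 0 closed
    by (metis G.a_inv_closed G.l_neg H.minus_equality)
  show "f (x \<ominus>\<^bsub>G\<^esub> y) = f x \<ominus>\<^bsub>H\<^esub> f y" if "x \<in> carrier G" "y \<in> carrier G"
    using that by (simp add: a_minus_def add 1)
qed

lemma bilinear_map_zero_minus:
  assumes "bilinear_map K M N P \<beta>" "abelian_group M" "abelian_group N" "abelian_group P"
  shows bilinear_map_zero_left: "y \<in> carrier N \<Longrightarrow> \<beta> \<zero>\<^bsub>M\<^esub> y = \<zero>\<^bsub>P\<^esub>"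
    and bilinear_map_zero_right: "x \<in> carrier M \<Longrightarrow> \<beta> x \<zero>\<^bsub>N\<^esub> = \<zero>\<^bsub>P\<^esub>"
    and bilinear_map_minus_left:
      "\<lbrakk>x \<in> carrier M; y \<in> carrier N\<rbrakk> \<Longrightarrow> \<beta> (\<ominus>\<^bsub>M\<^esub> x) y = \<ominus>\<^bsub>P\<^esub> \<beta> x y"
    and bilinear_map_minus_right:
      "\<lbrakk>x \<in> carrier M; y \<in> carrier N\<rbrakk> \<Longrightarrow> \<beta> x (\<ominus>\<^bsub>N\<^esub> y) = \<ominus>\<^bsub>P\<^esub> \<beta> x y"
  using bilinear_mapD[OF assms(1)]
    additive_map_zero_minus(1,2)[OF assms(2,4), of "\<lambda>x. \<beta> x y"]
    additive_map_zero_minus(1,2)[OF assms(3,4), of "\<beta> x"]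
  by auto

context abelian_group
begin

lemma minus_eq_zero_iff: "\<lbrakk>x \<in> carrier G; y \<in> carrier G\<rbrakk> \<Longrightarrow> x \<ominus> y = \<zero> \<longleftrightarrow> x = y"
  unfolding a_minus_def by (metis a_inv_closed minus_equality minus_minus r_neg)

lemma add_diff_cancel_left:
  assumes "x \<in> carrier G" "y \<in> carrier G" "z \<in> carrier G"
  shows "(x \<oplus> y) \<ominus> (x \<oplus> z) = y \<ominus> z"
proof -
  have "(x \<oplus> y) \<ominus> (x \<oplus> z) = (y \<oplus> x) \<oplus> (\<ominus> x \<oplus> \<ominus> z)"
    using assms by (simp add: a_minus_def minus_add a_comm)
  also have "\<dots> = y \<oplus> (x \<oplus> (\<ominus> x \<oplus> \<ominus> z))"
    using assms by (simp add: a_assoc)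
  finally show ?thesis using assms by (simp add: r_neg2 a_minus_def)
qed

end

text \<open>
  The homogeneous component of degree \<open>p\<close>; by \<open>hpart_eqI\<close> below it does not depend on the
  decomposition of \<open>x\<close>.
\<close>
definition hpart :: "('k, 'v, 'd) superalgebra_scheme \<Rightarrow> bit \<Rightarrow> 'v \<Rightarrow> 'v" where
  "hpart M p x = (THE y. y \<in> grade M p \<and> (\<exists>z\<in>grade M (p + 1). x = y \<oplus>\<^bsub>M\<^esub> z))"

context supermodule
begin

lemma grade_carrier: "x \<in> grade M p \<Longrightarrow> x \<in> carrier M"
  using submoduleE(1)[OF grade_submodule] by blast

lemma grade_add: "\<lbrakk>x \<in> grade M p; y \<in> grade M p\<rbrakk> \<Longrightarrow> x \<oplus>\<^bsub>M\<^esub> y \<in> grade M p"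
  using submoduleE(5)[OF grade_submodule] .

lemma grade_uminus: "x \<in> grade M p \<Longrightarrow> \<ominus>\<^bsub>M\<^esub> x \<in> grade M p"
  using submoduleE(3)[OF grade_submodule] .

lemma grade_smult: "\<lbrakk>c \<in> carrier K; x \<in> grade M p\<rbrakk> \<Longrightarrow> c \<odot>\<^bsub>M\<^esub> x \<in> grade M p"
  using submoduleE(4)[OF grade_submodule] .

lemma grade_zero: "\<zero>\<^bsub>M\<^esub> \<in> grade M p"
proof -
  have "\<zero>\<^bsub>M\<^esub> \<in> grade M 0 \<inter> grade M 1" using grade_Int by simp
  then show ?thesis using bit_cases[of p] by auto
qed

lemma grade_minus: "\<lbrakk>x \<in> grade M p; y \<in> grade M p\<rbrakk> \<Longrightarrow> x \<ominus>\<^bsub>M\<^esub> y \<in> grade M p"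
  by (simp add: a_minus_def grade_add grade_uminus)

lemma grade_ssign: "x \<in> grade M r \<Longrightarrow> ssign M p q x \<in> grade M r"
  by (simp add: ssign_def grade_uminus)

lemma grade_disjoint: "\<lbrakk>x \<in> grade M p; x \<in> grade M q; p \<noteq> q\<rbrakk> \<Longrightarrow> x = \<zero>\<^bsub>M\<^esub>"
  using grade_Int bit_cases[of p] bit_cases[of q] by auto

lemma hpart_eqI:
  assumes y: "y \<in> grade M p" and z: "z \<in> grade M (p + 1)"
  shows "hpart M p (y \<oplus>\<^bsub>M\<^esub> z) = y"
proof -
  have "y' = y" if y': "y' \<in> grade M p" and z': "z' \<in> grade M (p + 1)"
    and eq: "y \<oplus>\<^bsub>M\<^esub> z = y' \<oplus>\<^bsub>M\<^esub> z'" for y' z'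
  proof -
    note c = y[THEN grade_carrier] z[THEN grade_carrier] y'[THEN grade_carrier] z'[THEN grade_carrier]
    have "y' \<ominus>\<^bsub>M\<^esub> y = (z' \<oplus>\<^bsub>M\<^esub> y') \<ominus>\<^bsub>M\<^esub> (z' \<oplus>\<^bsub>M\<^esub> y)"
      using c by (simp add: M.add_diff_cancel_left)
    also have "\<dots> = (y \<oplus>\<^bsub>M\<^esub> z) \<ominus>\<^bsub>M\<^esub> (y \<oplus>\<^bsub>M\<^esub> z')"
      using c by (simp add: eq M.a_comm)
    also have "\<dots> = z \<ominus>\<^bsub>M\<^esub> z'"
      using c by (simp add: M.add_diff_cancel_left)
    finally have "y' \<ominus>\<^bsub>M\<^esub> y = \<zero>\<^bsub>M\<^esub>"
      using grade_disjoint[of "y' \<ominus>\<^bsub>M\<^esub> y" p "p + 1"] grade_minus[OF y' y] grade_minus[OF z z'] 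
      by (cases p) auto
    then show ?thesis using c by (simp add: M.minus_eq_zero_iff)
  qed
  then show ?thesis unfolding hpart_def using assms by (intro the_equality) blast+
qed

lemma hpart_exE:
  assumes "x \<in> carrier M"
  obtains y z where "y \<in> grade M p" "z \<in> grade M (p + 1)" "x = y \<oplus>\<^bsub>M\<^esub> z"
proof -
  obtain y z where "y \<in> grade M 0" "z \<in> grade M 1" "x = y \<oplus>\<^bsub>M\<^esub> z"
    using grade_sum[OF assms] by blast
  moreover have "x = z \<oplus>\<^bsub>M\<^esub> y" using calculation by (simp add: M.a_comm grade_carrier)
  ultimately show thesis using that[of y z] that[of z y] bit_cases[of p] by auto
qed

lemma hpart_grade: "x \<in> carrier M \<Longrightarrow> hpart M p x \<in> grade M p"
  by (metis hpart_exE hpart_eqI)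

lemma hpart_closed: "x \<in> carrier M \<Longrightarrow> hpart M p x \<in> carrier M"
  by (metis hpart_grade grade_carrier)

lemma hpart_sum:
  assumes "x \<in> carrier M"
  shows "x = hpart M 0 x \<oplus>\<^bsub>M\<^esub> hpart M 1 x"
proof -
  obtain y z where yz: "y \<in> grade M 0" "z \<in> grade M 1" "x = y \<oplus>\<^bsub>M\<^esub> z"
    using grade_sum[OF assms] by blast
  have "hpart M 0 x = y" using yz hpart_eqI[of y 0 z] by simp
  moreover have "x = z \<oplus>\<^bsub>M\<^esub> y" using yz by (simp add: M.a_comm grade_carrier)
  then have "hpart M 1 x = z" using yz hpart_eqI[of z 1 y] by simp
  ultimately show ?thesis using yz by blast
qed

lemma hpart_add:
  assumes "x \<in> carrier M" "y \<in> carrier M"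
  shows "hpart M p (x \<oplus>\<^bsub>M\<^esub> y) = hpart M p x \<oplus>\<^bsub>M\<^esub> hpart M p y"
proof -
  obtain a b where x: "a \<in> grade M p" "b \<in> grade M (p + 1)" "x = a \<oplus>\<^bsub>M\<^esub> b"
    using hpart_exE[OF assms(1)] .
  obtain c d where y: "c \<in> grade M p" "d \<in> grade M (p + 1)" "y = c \<oplus>\<^bsub>M\<^esub> d"
    using hpart_exE[OF assms(2)] .
  have "x \<oplus>\<^bsub>M\<^esub> y = (a \<oplus>\<^bsub>M\<^esub> c) \<oplus>\<^bsub>M\<^esub> (b \<oplus>\<^bsub>M\<^esub> d)"
    using x y by (simp add: M.a_ac grade_carrier)
  then show ?thesis using x y by (simp add: hpart_eqI grade_add)
qed

lemma hpart_smult: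
  assumes "c \<in> carrier K" "x \<in> carrier M"
  shows "hpart M p (c \<odot>\<^bsub>M\<^esub> x) = c \<odot>\<^bsub>M\<^esub> hpart M p x"
proof -
  obtain a b where x: "a \<in> grade M p" "b \<in> grade M (p + 1)" "x = a \<oplus>\<^bsub>M\<^esub> b"
    using hpart_exE[OF assms(2)] .
  then show ?thesis using assms by (simp add: smult_r_distr grade_carrier hpart_eqI grade_smult)
qed

lemma hpart_same: "x \<in> grade M p \<Longrightarrow> hpart M p x = x"
  using hpart_eqI[of x p "\<zero>\<^bsub>M\<^esub>", OF _ grade_zero] by (simp add: grade_carrier)

lemma hpart_other: "\<lbrakk>x \<in> grade M q; q \<noteq> p\<rbrakk> \<Longrightarrow> hpart M p x = \<zero>\<^bsub>M\<^esub>"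
  using hpart_eqI[of "\<zero>\<^bsub>M\<^esub>" p x, OF grade_zero] grade_carrier[of x q] bit_cases[of p] bit_cases[of q]
  by auto

lemma homogeneous_induct [consumes 1, case_names homogeneous add]:
  assumes "x \<in> carrier M"
    and "\<And>p x. x \<in> grade M p \<Longrightarrow> P x"
    and "\<And>x y. \<lbrakk>x \<in> carrier M; y \<in> carrier M; P x; P y\<rbrakk> \<Longrightarrow> P (x \<oplus>\<^bsub>M\<^esub> y)"
  shows "P x"
proof -
  have "P (hpart M 0 x \<oplus>\<^bsub>M\<^esub> hpart M 1 x)"
    using assms(1) by (intro assms(3) assms(2)[OF hpart_grade] hpart_closed)
  then show ?thesis using hpart_sum[OF assms(1)] by simp
qed

lemma ssign_closed: "x \<in> carrier M \<Longrightarrow> ssign M p q x \<in> carrier M"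
  by (simp add: ssign_def)

end

lemma supermoduleI:
  assumes "module K M" "\<And>p. submodule (grade M p) K M"
    and "\<And>x. x \<in> carrier M \<Longrightarrow> \<exists>y\<in>grade M 0. \<exists>z\<in>grade M 1. x = y \<oplus>\<^bsub>M\<^esub> z"
    and "\<And>x. \<lbrakk>x \<in> grade M 0; x \<in> grade M 1\<rbrakk> \<Longrightarrow> x = \<zero>\<^bsub>M\<^esub>"
  shows "supermodule K M"
proof -
  interpret module K M by fact
  have "\<zero>\<^bsub>M\<^esub> \<in> grade M p" for p
    using subgroup.one_closed[OF submodule.axioms(1)[OF assms(2)]] by simp
  then have "grade M 0 \<inter> grade M 1 = {\<zero>\<^bsub>M\<^esub>}" using assms(4) by blast
  then show ?thesis
    by (intro supermodule.intro supermodule_axioms.intro assms(1,2) assms(3))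
qed

context superalgebra
begin

lemmas mult_closed = bilinear_map_closed[OF mult_bilinear]
  and add_mult = bilinear_map_add_left[OF mult_bilinear]
  and mult_add = bilinear_map_add_right[OF mult_bilinear]
  and smult_mult = bilinear_map_smult_left[OF mult_bilinear]
  and mult_smult = bilinear_map_smult_right[OF mult_bilinear]
  and zero_mult = bilinear_map_zero_left[OF mult_bilinear M.abelian_group_axioms M.abelian_group_axioms M.abelian_group_axioms]
  and mult_zero = bilinear_map_zero_right[OF mult_bilinear M.abelian_group_axioms M.abelian_group_axioms M.abelian_group_axioms]
  and uminus_mult = bilinear_map_minus_left[OF mult_bilinear M.abelian_group_axioms M.abelian_group_axioms M.abelian_group_axioms]
  and mult_uminus = bilinear_map_minus_right[OF mult_bilinear M.abelian_group_axioms M.abelian_group_axioms M.abelian_group_axioms]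

end

section \<open>Quotients by graded ideals\<close>

lemma lie_identities_memI:
  "\<lbrakk>x \<in> grade N p; y \<in> grade N q\<rbrakk> \<Longrightarrow> x \<otimes>\<^bsub>N\<^esub> y \<oplus>\<^bsub>N\<^esub> ssign N p q (y \<otimes>\<^bsub>N\<^esub> x) \<in> lie_identities N"
  "x \<in> grade N 0 \<Longrightarrow> x \<otimes>\<^bsub>N\<^esub> x \<in> lie_identities N"
  "\<lbrakk>x \<in> grade N p; y \<in> grade N q; z \<in> grade N r\<rbrakk> \<Longrightarrow> jacobiator N p q r x y z \<in> lie_identities N"
  unfolding lie_identities_def by blast+

text \<open>
  Stability under \<open>hpart\<close> is what makes the grading descend to the quotient.
\<close>
definition graded_ideal :: "('k, 'c) ring_scheme \<Rightarrow> ('k, 'v, 'd) superalgebra_scheme \<Rightarrow> 'v set \<Rightarrow> bool" where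
  "graded_ideal K N I \<longleftrightarrow> submodule I K N \<and>
    (\<forall>x\<in>I. \<forall>y\<in>carrier N. x \<otimes>\<^bsub>N\<^esub> y \<in> I \<and> y \<otimes>\<^bsub>N\<^esub> x \<in> I) \<and> (\<forall>x\<in>I. \<forall>p. hpart N p x \<in> I)"

locale graded_quotient = superalgebra K N
  for K :: "('k, 'c) ring_scheme" (structure) and N :: "('k, 'v) superalgebra" (structure) +
  fixes I
  assumes graded_ideal: "graded_ideal K N I"
begin

abbreviation "Q \<equiv> super_quot N I"

lemma ideal_submodule: "submodule I K N"
  and ideal_mult_right: "\<lbrakk>x \<in> I; y \<in> carrier N\<rbrakk> \<Longrightarrow> x \<otimes>\<^bsub>N\<^esub> y \<in> I"
  and ideal_mult_left: "\<lbrakk>x \<in> I; y \<in> carrier N\<rbrakk> \<Longrightarrow> y \<otimes>\<^bsub>N\<^esub> x \<in> I"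
  and ideal_hpart: "x \<in> I \<Longrightarrow> hpart N p x \<in> I"
  using graded_ideal unfolding graded_ideal_def by blast+

sublocale I: abelian_subgroup I N
  by (intro abelian_subgroupI3 additive_subgroupI submodule.axioms(1)[OF ideal_submodule]
      M.abelian_group_axioms)

lemma ideal_carrier: "x \<in> I \<Longrightarrow> x \<in> carrier N"
  using I.a_subset by blast

lemma coset_eq_iff:
  assumes "x \<in> carrier N" "y \<in> carrier N"
  shows "I +>\<^bsub>N\<^esub> x = I +>\<^bsub>N\<^esub> y \<longleftrightarrow> x \<ominus>\<^bsub>N\<^esub> y \<in> I"
proof
  assume "I +>\<^bsub>N\<^esub> x = I +>\<^bsub>N\<^esub> y"
  then have "I +>\<^bsub>N\<^esub> (x \<ominus>\<^bsub>N\<^esub> y) = I"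
    using M.a_coset_add_inv2[OF _ assms I.a_subset] by (simp add: a_minus_def)
  then show "x \<ominus>\<^bsub>N\<^esub> y \<in> I"
    using M.a_coset_join1[OF _ _ I.a_subgroup] assms by simp
next
  assume "x \<ominus>\<^bsub>N\<^esub> y \<in> I"
  then have "I +>\<^bsub>N\<^esub> (x \<ominus>\<^bsub>N\<^esub> y) = I"
    using M.a_coset_join2[OF _ I.a_subgroup] assms by simp
  then show "I +>\<^bsub>N\<^esub> x = I +>\<^bsub>N\<^esub> y"
    using M.a_coset_add_inv1[OF _ assms I.a_subset] by (simp add: a_minus_def)
qed

lemma coset_memE:
  assumes "a \<in> I +>\<^bsub>N\<^esub> x"
  obtains h where "h \<in> I" "a = h \<oplus>\<^bsub>N\<^esub> x"
  using assms by (auto simp: a_r_coset_def')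

lemma coset_self: "x \<in> carrier N \<Longrightarrow> x \<in> I +>\<^bsub>N\<^esub> x"
  by (rule I.a_rcos_self)

lemma coset_zero_iff: "x \<in> carrier N \<Longrightarrow> I +>\<^bsub>N\<^esub> x = I \<longleftrightarrow> x \<in> I"
  using M.a_coset_join1[OF _ _ I.a_subgroup] M.a_coset_join2[OF _ I.a_subgroup] by blast

lemma quot_carrier: "carrier Q = (\<lambda>x. I +>\<^bsub>N\<^esub> x) ` carrier N"
  by (auto simp: super_quot_def FactRing_def A_RCOSETS_def')

lemma quot_zero: "\<zero>\<^bsub>Q\<^esub> = I"
  by (simp add: super_quot_def FactRing_def)

lemma quot_grade: "grade Q p = (\<lambda>x. I +>\<^bsub>N\<^esub> x) ` grade N p"
  by (simp add: super_quot_def)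

lemma quot_add:
  "\<lbrakk>x \<in> carrier N; y \<in> carrier N\<rbrakk> \<Longrightarrow> (I +>\<^bsub>N\<^esub> x) \<oplus>\<^bsub>Q\<^esub> (I +>\<^bsub>N\<^esub> y) = I +>\<^bsub>N\<^esub> (x \<oplus>\<^bsub>N\<^esub> y)"
  by (simp add: super_quot_def FactRing_def I.a_rcos_sum)

lemma coset_absorb:
  assumes "h \<in> I" "x \<in> carrier N"
  shows "I +>\<^bsub>N\<^esub> (h \<oplus>\<^bsub>N\<^esub> x) = I +>\<^bsub>N\<^esub> x"
proof -
  have "(h \<oplus>\<^bsub>N\<^esub> x) \<ominus>\<^bsub>N\<^esub> x = h"
    using assms ideal_carrier by (simp add: a_minus_def M.a_assoc M.r_neg)
  then show ?thesis using assms ideal_carrier by (simp add: coset_eq_iff)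
qed

lemma quot_smult:
  assumes "c \<in> carrier K" "x \<in> carrier N"
  shows "c \<odot>\<^bsub>Q\<^esub> (I +>\<^bsub>N\<^esub> x) = I +>\<^bsub>N\<^esub> (c \<odot>\<^bsub>N\<^esub> x)"
proof -
  have "I +>\<^bsub>N\<^esub> (c \<odot>\<^bsub>N\<^esub> a) = I +>\<^bsub>N\<^esub> (c \<odot>\<^bsub>N\<^esub> x)" if a: "a \<in> I +>\<^bsub>N\<^esub> x" for a
  proof -
    obtain h where h: "h \<in> I" "a = h \<oplus>\<^bsub>N\<^esub> x" using a by (rule coset_memE)
    have "c \<odot>\<^bsub>N\<^esub> h \<in> I" using submoduleE(4)[OF ideal_submodule assms(1) h(1)] .
    then show ?thesis
      using assms h ideal_carrier by (simp add: smult_r_distr coset_absorb)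
  qed
  then have "(\<Union>a\<in>I +>\<^bsub>N\<^esub> x. I +>\<^bsub>N\<^esub> (c \<odot>\<^bsub>N\<^esub> a)) = I +>\<^bsub>N\<^esub> (c \<odot>\<^bsub>N\<^esub> x)"
    using coset_self[OF assms(2)] by blast
  then show ?thesis by (simp add: super_quot_def)
qed

lemma quot_mult:
  assumes "x \<in> carrier N" "y \<in> carrier N"
  shows "(I +>\<^bsub>N\<^esub> x) \<otimes>\<^bsub>Q\<^esub> (I +>\<^bsub>N\<^esub> y) = I +>\<^bsub>N\<^esub> (x \<otimes>\<^bsub>N\<^esub> y)"
proof -
  have "I +>\<^bsub>N\<^esub> (a \<otimes>\<^bsub>N\<^esub> b) = I +>\<^bsub>N\<^esub> (x \<otimes>\<^bsub>N\<^esub> y)" if ab: "a \<in> I +>\<^bsub>N\<^esub> x" "b \<in> I +>\<^bsub>N\<^esub> y" for a b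
  proof -
    obtain h where h: "h \<in> I" "a = h \<oplus>\<^bsub>N\<^esub> x" using ab(1) by (rule coset_memE)
    obtain k where k: "k \<in> I" "b = k \<oplus>\<^bsub>N\<^esub> y" using ab(2) by (rule coset_memE)
    have hk: "h \<otimes>\<^bsub>N\<^esub> k \<in> I" "h \<otimes>\<^bsub>N\<^esub> y \<in> I" "x \<otimes>\<^bsub>N\<^esub> k \<in> I"
      using h k assms by (simp_all add: ideal_mult_left ideal_mult_right ideal_carrier)
    have "a \<otimes>\<^bsub>N\<^esub> b = h \<otimes>\<^bsub>N\<^esub> k \<oplus>\<^bsub>N\<^esub> (h \<otimes>\<^bsub>N\<^esub> y \<oplus>\<^bsub>N\<^esub> (x \<otimes>\<^bsub>N\<^esub> k \<oplus>\<^bsub>N\<^esub> x \<otimes>\<^bsub>N\<^esub> y))"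
      using assms h k ideal_carrier
      by (simp add: add_mult mult_add M.a_assoc M.a_lcomm[of "x \<otimes>\<^bsub>N\<^esub> k"] mult_closed)
    then show ?thesis using hk assms ideal_carrier by (simp add: coset_absorb mult_closed)
  qed
  then have "(\<Union>a\<in>I +>\<^bsub>N\<^esub> x. \<Union>b\<in>I +>\<^bsub>N\<^esub> y. I +>\<^bsub>N\<^esub> (a \<otimes>\<^bsub>N\<^esub> b)) = I +>\<^bsub>N\<^esub> (x \<otimes>\<^bsub>N\<^esub> y)"
    using coset_self[OF assms(1)] coset_self[OF assms(2)] by blast
  then show ?thesis by (simp add: super_quot_def FactRing_def rcoset_mult_def)
qed

lemma quot_abelian_group: "abelian_group Q"
proof (rule abelian_groupI)
  fix X assume "X \<in> carrier Q"
  then obtain x where x: "x \<in> carrier N" "X = I +>\<^bsub>N\<^esub> x" by (auto simp: quot_carrier)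
  have zero: "\<zero>\<^bsub>Q\<^esub> = I +>\<^bsub>N\<^esub> \<zero>\<^bsub>N\<^esub>" by (simp add: quot_zero I.a_subset)
  show "\<zero>\<^bsub>Q\<^esub> \<oplus>\<^bsub>Q\<^esub> X = X" using x by (simp add: zero quot_add)
  show "\<exists>Y\<in>carrier Q. Y \<oplus>\<^bsub>Q\<^esub> X = \<zero>\<^bsub>Q\<^esub>"
    using x by (intro bexI[of _ "I +>\<^bsub>N\<^esub> (\<ominus>\<^bsub>N\<^esub> x)"]) (auto simp: zero quot_add quot_carrier M.l_neg)
next
  show "\<zero>\<^bsub>Q\<^esub> \<in> carrier Q" 
    unfolding quot_zero quot_carrier
    using M.zero_closed I.a_subset M.a_coset_add_zero by (metis imageI)
qed (auto simp: quot_carrier quot_add M.a_ac)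

lemma quot_uminus: "x \<in> carrier N \<Longrightarrow> \<ominus>\<^bsub>Q\<^esub> (I +>\<^bsub>N\<^esub> x) = I +>\<^bsub>N\<^esub> (\<ominus>\<^bsub>N\<^esub> x)"
  using additive_map_zero_minus(2)[OF M.abelian_group_axioms quot_abelian_group, of "\<lambda>x. I +>\<^bsub>N\<^esub> x"]
  by (simp add: quot_carrier quot_add)

lemma quot_ssign: "x \<in> carrier N \<Longrightarrow> ssign Q p q (I +>\<^bsub>N\<^esub> x) = I +>\<^bsub>N\<^esub> ssign N p q x"
  by (simp add: ssign_def quot_uminus)

lemma quot_module: "module K Q"
  by (rule moduleI[OF R.is_cring quot_abelian_group])
    (auto simp: quot_carrier quot_add quot_smult smult_l_distr smult_r_distr smult_assoc1)

lemma quot_superalgebra: "superalgebra K Q"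
proof -
  interpret Q: module K Q by (rule quot_module)
  have sup: "supermodule K Q"
  proof (rule supermoduleI[OF quot_module])
    fix p
    show "submodule (grade Q p) K Q"
    proof (rule Q.submoduleI)
      show "\<zero>\<^bsub>Q\<^esub> \<in> grade Q p"
        unfolding quot_grade quot_zero using grade_zero[of p] M.a_coset_add_zero[OF I.a_subset] 
        by (metis imageI)
    qed (auto simp: quot_grade quot_carrier quot_add quot_smult quot_uminus grade_carrier
        grade_add grade_uminus grade_smult)
  next
    fix X assume "X \<in> carrier Q"
    then obtain x where x: "x \<in> carrier N" "X = I +>\<^bsub>N\<^esub> x" by (auto simp: quot_carrier)
    obtain y z where yz: "y \<in> grade N 0" "z \<in> grade N 1" "x = y \<oplus>\<^bsub>N\<^esub> z"
      using grade_sum[OF x(1)] by blast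
    then show "\<exists>Y\<in>grade Q 0. \<exists>Z\<in>grade Q 1. X = Y \<oplus>\<^bsub>Q\<^esub> Z"
      using x by (auto simp: quot_grade quot_add grade_carrier)
  next
    fix X assume "X \<in> grade Q 0" "X \<in> grade Q 1"
    then obtain x y where xy: "x \<in> grade N 0" "y \<in> grade N 1" "X = I +>\<^bsub>N\<^esub> x" "X = I +>\<^bsub>N\<^esub> y"
      by (auto simp: quot_grade)
    then have "x \<ominus>\<^bsub>N\<^esub> y \<in> I" using coset_eq_iff[of x y] grade_carrier by auto
    moreover have "hpart N 0 (x \<ominus>\<^bsub>N\<^esub> y) = x"
      using xy hpart_eqI[of x 0 "\<ominus>\<^bsub>N\<^esub> y"] by (simp add: grade_uminus a_minus_def)
    ultimately have "x \<in> I" using ideal_hpart by metis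
    then show "X = \<zero>\<^bsub>Q\<^esub>" using xy by (simp add: coset_zero_iff grade_carrier quot_zero)
  qed
  have "bilinear_map K Q Q Q (mult Q)"
    unfolding bilinear_map_def
    by (auto simp: quot_carrier quot_mult quot_add quot_smult mult_closed add_mult mult_add
        smult_mult mult_smult)
  moreover have "X \<otimes>\<^bsub>Q\<^esub> Y \<in> grade Q (p + q)" if "X \<in> grade Q p" "Y \<in> grade Q q" for X Y p q
    using that mult_grade[of _ p _ q] unfolding quot_grade by (force simp: quot_mult grade_carrier)
  ultimately show ?thesis
    by (intro superalgebra.intro sup superalgebra_axioms.intro)
qed

lemma quot_jacobiator:
  assumes "x \<in> carrier N" "y \<in> carrier N" "z \<in> carrier N"
  shows "jacobiator Q p q r (I +>\<^bsub>N\<^esub> x) (I +>\<^bsub>N\<^esub> y) (I +>\<^bsub>N\<^esub> z) = I +>\<^bsub>N\<^esub> jacobiator N p q r x y z"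
  using assms by (simp add: jacobiator_def quot_mult quot_add quot_ssign mult_closed ssign_closed)

lemma quot_lie_superalgebra:
  assumes "lie_identities N \<subseteq> I"
  shows "lie_superalgebra K Q"
proof -
  interpret Q: superalgebra K Q by (rule quot_superalgebra)
  have "X \<otimes>\<^bsub>Q\<^esub> Y = \<ominus>\<^bsub>Q\<^esub> ssign Q p q (Y \<otimes>\<^bsub>Q\<^esub> X)" if XY: "X \<in> grade Q p" "Y \<in> grade Q q" for X Y p q
  proof -
    obtain x y where xy: "x \<in> grade N p" "y \<in> grade N q" "X = I +>\<^bsub>N\<^esub> x" "Y = I +>\<^bsub>N\<^esub> y"
      using XY by (auto simp: quot_grade)
    note c = xy(1,2)[THEN grade_carrier]
    have "x \<otimes>\<^bsub>N\<^esub> y \<oplus>\<^bsub>N\<^esub> ssign N p q (y \<otimes>\<^bsub>N\<^esub> x) \<in> I"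
      using assms lie_identities_memI(1)[OF xy(1,2)] by blast
    moreover have "x \<otimes>\<^bsub>N\<^esub> y \<oplus>\<^bsub>N\<^esub> ssign N p q (y \<otimes>\<^bsub>N\<^esub> x) = x \<otimes>\<^bsub>N\<^esub> y \<ominus>\<^bsub>N\<^esub> (\<ominus>\<^bsub>N\<^esub> ssign N p q (y \<otimes>\<^bsub>N\<^esub> x))"
      using c by (simp add: a_minus_def mult_closed ssign_closed)
    ultimately have "I +>\<^bsub>N\<^esub> (x \<otimes>\<^bsub>N\<^esub> y) = I +>\<^bsub>N\<^esub> (\<ominus>\<^bsub>N\<^esub> ssign N p q (y \<otimes>\<^bsub>N\<^esub> x))"
      using c by (simp add: coset_eq_iff mult_closed ssign_closed)
    then show ?thesis using c xy by (simp add: quot_mult quot_ssign quot_uminus mult_closed ssign_closed)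
  qed
  moreover have "X \<otimes>\<^bsub>Q\<^esub> X = \<zero>\<^bsub>Q\<^esub>" if "X \<in> grade Q 0" for X
  proof -
    obtain x where x: "x \<in> grade N 0" "X = I +>\<^bsub>N\<^esub> x" using \<open>X \<in> grade Q 0\<close> by (auto simp: quot_grade)
    have "x \<otimes>\<^bsub>N\<^esub> x \<in> I" using assms lie_identities_memI(2)[OF x(1)] by blast
    then show ?thesis using x by (simp add: quot_mult quot_zero grade_carrier coset_zero_iff mult_closed)
  qed
  moreover have "jacobiator Q p q r X Y Z = \<zero>\<^bsub>Q\<^esub>"
    if XYZ: "X \<in> grade Q p" "Y \<in> grade Q q" "Z \<in> grade Q r" for X Y Z p q r
  proof -
    obtain x y z where x: "x \<in> grade N p" "y \<in> grade N q" "z \<in> grade N r"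
        "X = I +>\<^bsub>N\<^esub> x" "Y = I +>\<^bsub>N\<^esub> y" "Z = I +>\<^bsub>N\<^esub> z"
      using XYZ by (auto simp: quot_grade)
    have "jacobiator N p q r x y z \<in> I" using assms lie_identities_memI(3)[OF x(1-3)] by blast
    then show ?thesis using x by (simp add: quot_jacobiator grade_carrier coset_zero_iff quot_zero ideal_carrier)
  qed
  ultimately show ?thesis
    by (intro lie_superalgebra.intro quot_superalgebra lie_superalgebra_axioms.intro)
qed

end

context superalgebra
begin

lemma hpart_mult_left:
  assumes "x \<in> carrier L" "y \<in> grade L q"
  shows "hpart L p (x \<otimes>\<^bsub>L\<^esub> y) = hpart L (p + q) x \<otimes>\<^bsub>L\<^esub> y"
proof -
  obtain a b where x: "a \<in> grade L (p + q)" "b \<in> grade L (p + q + 1)" "x = a \<oplus>\<^bsub>L\<^esub> b"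
    using hpart_exE[OF assms(1)] .
  have "a \<otimes>\<^bsub>L\<^esub> y \<in> grade L (p + q + q)" "b \<otimes>\<^bsub>L\<^esub> y \<in> grade L (p + q + 1 + q)"
    using x assms mult_grade by blast+
  moreover have "p + q + q = p" "p + q + 1 + q = p + 1" by (cases p; cases q; simp)+
  ultimately show ?thesis
    using x assms by (simp add: hpart_eqI add_mult grade_carrier)
qed

lemma hpart_mult_right:
  assumes "x \<in> carrier L" "y \<in> grade L q"
  shows "hpart L p (y \<otimes>\<^bsub>L\<^esub> x) = y \<otimes>\<^bsub>L\<^esub> hpart L (p + q) x"
proof -
  obtain a b where x: "a \<in> grade L (p + q)" "b \<in> grade L (p + q + 1)" "x = a \<oplus>\<^bsub>L\<^esub> b"
    using hpart_exE[OF assms(1)] .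
  have "y \<otimes>\<^bsub>L\<^esub> a \<in> grade L (q + (p + q))" "y \<otimes>\<^bsub>L\<^esub> b \<in> grade L (q + (p + q + 1))"
    using x assms mult_grade by blast+
  moreover have "q + (p + q) = p" "q + (p + q + 1) = p + 1" by (cases p; cases q; simp)+
  ultimately show ?thesis
    using x assms by (simp add: hpart_eqI mult_add grade_carrier)
qed

lemma nonassoc_ideal_gen_minimal:
  assumes "submodule J K L" "\<And>x y. \<lbrakk>x \<in> J; y \<in> carrier L\<rbrakk> \<Longrightarrow> x \<otimes>\<^bsub>L\<^esub> y \<in> J"
    "\<And>x y. \<lbrakk>x \<in> J; y \<in> carrier L\<rbrakk> \<Longrightarrow> y \<otimes>\<^bsub>L\<^esub> x \<in> J" "S \<subseteq> J"
  shows "nonassoc_ideal_gen K L S \<subseteq> J"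
  unfolding nonassoc_ideal_gen_def using assms by (intro Inter_lower) auto

lemma nonassoc_ideal_gen_superset: "S \<subseteq> nonassoc_ideal_gen K L S"
  unfolding nonassoc_ideal_gen_def by blast

lemma nonassoc_ideal_gen_ideal:
  assumes "S \<subseteq> carrier L"
  shows "submodule (nonassoc_ideal_gen K L S) K L"
    and "\<lbrakk>x \<in> nonassoc_ideal_gen K L S; y \<in> carrier L\<rbrakk> \<Longrightarrow> x \<otimes>\<^bsub>L\<^esub> y \<in> nonassoc_ideal_gen K L S"
    and "\<lbrakk>x \<in> nonassoc_ideal_gen K L S; y \<in> carrier L\<rbrakk> \<Longrightarrow> y \<otimes>\<^bsub>L\<^esub> x \<in> nonassoc_ideal_gen K L S"
proof -
  let ?X = "{I. submodule I K L \<and> (\<forall>x\<in>I. \<forall>y\<in>carrier L. x \<otimes>\<^bsub>L\<^esub> y \<in> I \<and> y \<otimes>\<^bsub>L\<^esub> x \<in> I) \<and> S \<subseteq> I}"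
  have G: "nonassoc_ideal_gen K L S = \<Inter>?X" by (simp add: nonassoc_ideal_gen_def)
  have X: "carrier L \<in> ?X" using assms carrier_is_submodule mult_closed by auto
  have zero: "\<zero>\<^bsub>L\<^esub> \<in> J" if "submodule J K L" for J
    using subgroup.one_closed[OF submodule.axioms(1)[OF that]] by simp
  show "submodule (nonassoc_ideal_gen K L S) K L"
  proof (rule submoduleI)
    show "nonassoc_ideal_gen K L S \<subseteq> carrier L" using X unfolding G by blast
  qed (unfold G, auto intro: zero submoduleE(3,4,5))
  show "x \<otimes>\<^bsub>L\<^esub> y \<in> nonassoc_ideal_gen K L S" "y \<otimes>\<^bsub>L\<^esub> x \<in> nonassoc_ideal_gen K L S"
    if "x \<in> nonassoc_ideal_gen K L S" "y \<in> carrier L"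
    using that unfolding G by auto
qed

text \<open>
  The elements of an ideal whose homogeneous components lie in it again form an ideal; for a
  homogeneous generating set this smaller ideal is everything.
\<close>
lemma nonassoc_ideal_gen_graded:
  assumes hom: "\<And>s. s \<in> S \<Longrightarrow> \<exists>p. s \<in> grade L p"
  shows "graded_ideal K L (nonassoc_ideal_gen K L S)"
proof -
  have S: "S \<subseteq> carrier L" using hom grade_carrier by blast
  let ?I = "nonassoc_ideal_gen K L S"
  let ?J = "{x \<in> carrier L. \<forall>p. hpart L p x \<in> ?I}"
  note I = nonassoc_ideal_gen_ideal[OF S]
  have zero: "\<zero>\<^bsub>L\<^esub> \<in> ?I"
    using subgroup.one_closed[OF submodule.axioms(1)[OF I(1)]] by simp
  have "?I \<subseteq> ?J"
  proof (rule nonassoc_ideal_gen_minimal)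
    show "submodule ?J K L"
    proof (rule submoduleI)
      show "\<zero>\<^bsub>L\<^esub> \<in> ?J" using zero by (simp add: hpart_same grade_zero)
      fix a assume a: "a \<in> ?J"
      have "hpart L p (\<ominus>\<^bsub>L\<^esub> a) = \<ominus>\<^bsub>L\<^esub> hpart L p a" for p
        using a by (intro additive_map_zero_minus(2)[OF M.abelian_group_axioms M.abelian_group_axioms])
          (auto simp: hpart_closed hpart_add)
      then show "\<ominus>\<^bsub>L\<^esub> a \<in> ?J" using a submoduleE(3)[OF I(1)] by auto
    qed (auto simp: hpart_add hpart_smult submoduleE(4,5)[OF I(1)])
    fix x y assume x: "x \<in> ?J" and y: "y \<in> carrier L"
    have x': "x \<in> carrier L" using x by simp
    show "x \<otimes>\<^bsub>L\<^esub> y \<in> ?J" using y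
    proof (induction rule: homogeneous_induct)
      case (homogeneous q y)
      then show ?case using x by (auto simp: hpart_mult_left mult_closed grade_carrier intro!: I(2))
    next
      case (add y z)
      then show ?case using x' by (auto simp: mult_add hpart_add mult_closed submoduleE(5)[OF I(1)])
    qed
    show "y \<otimes>\<^bsub>L\<^esub> x \<in> ?J" using y
    proof (induction rule: homogeneous_induct)
      case (homogeneous q y)
      then show ?case using x by (auto simp: hpart_mult_right mult_closed grade_carrier intro!: I(3))
    next
      case (add y z)
      then show ?case using x' by (auto simp: add_mult hpart_add mult_closed submoduleE(5)[OF I(1)])
    qed
  next
    show "S \<subseteq> ?J"
    proof
      fix s assume s: "s \<in> S"
      then obtain q where q: "s \<in> grade L q" using hom by blast
      have "hpart L p s \<in> ?I" for p
        using s q zero nonassoc_ideal_gen_superset[of S] by (cases "p = q") (auto simp: hpart_same hpart_other)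
      then show "s \<in> ?J" using q grade_carrier by blast
    qed
  qed
  then show ?thesis using I unfolding graded_ideal_def by blast
qed

lemma jacobiator_grade:
  assumes "x \<in> grade L p" "y \<in> grade L q" "z \<in> grade L r"
  shows "jacobiator L p q r x y z \<in> grade L (p + q + r)"
proof -
  have "(x \<otimes>\<^bsub>L\<^esub> y) \<otimes>\<^bsub>L\<^esub> z \<in> grade L (p + q + r)" using assms mult_grade by blast
  moreover have "(y \<otimes>\<^bsub>L\<^esub> z) \<otimes>\<^bsub>L\<^esub> x \<in> grade L (p + q + r)"
    using mult_grade[OF mult_grade[OF assms(2,3)] assms(1)] by (simp only: ac_simps)
  moreover have "(z \<otimes>\<^bsub>L\<^esub> x) \<otimes>\<^bsub>L\<^esub> y \<in> grade L (p + q + r)"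
    using mult_grade[OF mult_grade[OF assms(3,1)] assms(2)] by (simp only: ac_simps)
  ultimately show ?thesis unfolding jacobiator_def by (intro grade_add grade_ssign)
qed

end

lemma lie_identities_homogeneous:
  assumes "superalgebra K N" "s \<in> lie_identities N"
  shows "\<exists>p. s \<in> grade N p"
proof -
  interpret N: superalgebra K N by fact
  have swap: "y \<otimes>\<^bsub>N\<^esub> x \<in> grade N (p + q)" if "x \<in> grade N p" "y \<in> grade N q" for x y p q
    using N.mult_grade[OF that(2,1)] by (simp only: ac_simps)
  consider (skew) p q x y where "s = x \<otimes>\<^bsub>N\<^esub> y \<oplus>\<^bsub>N\<^esub> ssign N p q (y \<otimes>\<^bsub>N\<^esub> x)" "x \<in> grade N p" "y \<in> grade N q"
    | (alt) x where "s = x \<otimes>\<^bsub>N\<^esub> x" "x \<in> grade N 0"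
    | (jac) p q r x y z where "s = jacobiator N p q r x y z" "x \<in> grade N p" "y \<in> grade N q" "z \<in> grade N r"
    using assms(2) unfolding lie_identities_def by blast
  then show ?thesis
  proof cases
    case skew
    then show ?thesis using N.grade_add[OF N.mult_grade N.grade_ssign[OF swap]] by blast
  next
    case alt
    then show ?thesis using N.mult_grade by blast
  next
    case jac
    then show ?thesis using N.jacobiator_grade by blast
  qed
qed

section \<open>Free superalgebras\<close>

lemma lie_superalgebra_homD:
  assumes "f \<in> lie_superalgebra_hom K L M"
  shows lie_hom_closed: "x \<in> carrier L \<Longrightarrow> f x \<in> carrier M"
    and lie_hom_add: "\<lbrakk>x \<in> carrier L; y \<in> carrier L\<rbrakk> \<Longrightarrow> f (x \<oplus>\<^bsub>L\<^esub> y) = f x \<oplus>\<^bsub>M\<^esub> f y"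
    and lie_hom_smult: "\<lbrakk>c \<in> carrier K; x \<in> carrier L\<rbrakk> \<Longrightarrow> f (c \<odot>\<^bsub>L\<^esub> x) = c \<odot>\<^bsub>M\<^esub> f x"
    and lie_hom_mult: "\<lbrakk>x \<in> carrier L; y \<in> carrier L\<rbrakk> \<Longrightarrow> f (x \<otimes>\<^bsub>L\<^esub> y) = f x \<otimes>\<^bsub>M\<^esub> f y"
    and lie_hom_grade: "x \<in> grade L p \<Longrightarrow> f x \<in> grade M p"
  using assms unfolding lie_superalgebra_hom_def by (auto simp: image_subset_iff)

lemma lie_superalgebra_homI:
  assumes "\<And>x. x \<in> carrier L \<Longrightarrow> f x \<in> carrier M"
    "\<And>x y. \<lbrakk>x \<in> carrier L; y \<in> carrier L\<rbrakk> \<Longrightarrow> f (x \<oplus>\<^bsub>L\<^esub> y) = f x \<oplus>\<^bsub>M\<^esub> f y"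
    "\<And>c x. \<lbrakk>c \<in> carrier K; x \<in> carrier L\<rbrakk> \<Longrightarrow> f (c \<odot>\<^bsub>L\<^esub> x) = c \<odot>\<^bsub>M\<^esub> f x"
    "\<And>x y. \<lbrakk>x \<in> carrier L; y \<in> carrier L\<rbrakk> \<Longrightarrow> f (x \<otimes>\<^bsub>L\<^esub> y) = f x \<otimes>\<^bsub>M\<^esub> f y"
    "\<And>p x. x \<in> grade L p \<Longrightarrow> f x \<in> grade M p"
  shows "f \<in> lie_superalgebra_hom K L M"
  using assms unfolding lie_superalgebra_hom_def by auto

primrec mono_eval :: "('v, 'e) monoid_scheme \<Rightarrow> ('g \<Rightarrow> 'v) \<Rightarrow> 'g monomial \<Rightarrow> 'v" where
  "mono_eval M v (Letter g) = v g"
| "mono_eval M v (Times s t) = mono_eval M v s \<otimes>\<^bsub>M\<^esub> mono_eval M v t"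

text \<open>
  The linear extension of the evaluation of monomials, that is, the homomorphism that sends each
  letter \<open>g\<close> to \<open>v g\<close>.
\<close>
definition free_ext ::
    "('k, 'c) ring_scheme \<Rightarrow> ('k, 'v) superalgebra \<Rightarrow> ('g \<Rightarrow> 'v) \<Rightarrow> ('g monomial \<Rightarrow> 'k) \<Rightarrow> 'v" where
  "free_ext K M v f = finsum M (\<lambda>t. f t \<odot>\<^bsub>M\<^esub> mono_eval M v t) {t. f t \<noteq> \<zero>\<^bsub>K\<^esub>}"

definition free_mono :: "('k, 'c) ring_scheme \<Rightarrow> 'g monomial \<Rightarrow> 'g monomial \<Rightarrow> 'k" where
  "free_mono K t = (\<lambda>s. if s = t then \<one>\<^bsub>K\<^esub> else \<zero>\<^bsub>K\<^esub>)"

lemma free_gen_mono: "free_gen K g = free_mono K (Letter g)"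
  by (simp add: free_gen_def free_mono_def)

lemma (in supermodule) finsum_grade:
  "\<lbrakk>finite S; \<And>t. t \<in> S \<Longrightarrow> h t \<in> grade M p\<rbrakk> \<Longrightarrow> finsum M h S \<in> grade M p"
proof (induction S rule: finite_induct)
  case empty
  then show ?case by (simp add: grade_zero)
next
  case (insert t S)
  then have "h \<in> insert t S \<rightarrow> carrier M" using grade_carrier by blast
  then show ?case using insert by (simp add: grade_add)
qed

locale free_generators = cring K for K :: "('k, 'c) ring_scheme" (structure) +
  fixes G :: "'g set" and d :: "'g \<Rightarrow> bit"
begin

abbreviation "N \<equiv> free_superalgebra K G d"

lemma free_carrier: "carrier N = {f. (\<forall>t. f t \<in> carrier K) \<and> finite {t. f t \<noteq> \<zero>} \<and>
                 (\<forall>t. f t \<noteq> \<zero> \<longrightarrow> letters t \<subseteq> G)}"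
  and free_mult: "f \<otimes>\<^bsub>N\<^esub> g = (\<lambda>t. case t of Letter _ \<Rightarrow> \<zero> | Times u v \<Rightarrow> f u \<otimes> g v)"
  and free_zero: "\<zero>\<^bsub>N\<^esub> = (\<lambda>_. \<zero>)"
  and free_add: "f \<oplus>\<^bsub>N\<^esub> g = (\<lambda>t. f t \<oplus> g t)"
  and free_smult: "c \<odot>\<^bsub>N\<^esub> f = (\<lambda>t. c \<otimes> f t)"
  and free_grade: "grade N p = {f \<in> carrier N. \<forall>t. f t \<noteq> \<zero> \<longrightarrow> monomial_degree d t = p}"
  by (simp_all add: free_superalgebra_def Let_def)

lemma free_carrierI:
  assumes "\<And>t. f t \<in> carrier K" "finite S" "\<And>t. f t \<noteq> \<zero> \<Longrightarrow> t \<in> S" "\<And>t. f t \<noteq> \<zero> \<Longrightarrow> letters t \<subseteq> G"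
  shows "f \<in> carrier N"
  using assms finite_subset[of "{t. f t \<noteq> \<zero>}" S] unfolding free_carrier by blast

lemma free_carrierD:
  assumes "f \<in> carrier N"
  shows free_coeff: "f t \<in> carrier K" and free_finite: "finite {t. f t \<noteq> \<zero>}"
    and free_letters: "f t \<noteq> \<zero> \<Longrightarrow> letters t \<subseteq> G"
  using assms unfolding free_carrier by auto

lemma free_add_closed:
  assumes f: "f \<in> carrier N" and g: "g \<in> carrier N"
  shows "f \<oplus>\<^bsub>N\<^esub> g \<in> carrier N"
  unfolding free_add
proof (rule free_carrierI[of _ "{t. f t \<noteq> \<zero>} \<union> {t. g t \<noteq> \<zero>}"])
  fix t
  show "f t \<oplus> g t \<in> carrier K" using free_coeff[OF f] free_coeff[OF g] by simp
  assume "f t \<oplus> g t \<noteq> \<zero>"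
  then have *: "f t \<noteq> \<zero> \<or> g t \<noteq> \<zero>" by auto
  then show "t \<in> {t. f t \<noteq> \<zero>} \<union> {t. g t \<noteq> \<zero>}" by simp
  show "letters t \<subseteq> G" using * free_letters[OF f] free_letters[OF g] by blast
qed (use free_finite f g in simp)

lemma free_smult_closed:
  assumes c: "c \<in> carrier K" and f: "f \<in> carrier N"
  shows "c \<odot>\<^bsub>N\<^esub> f \<in> carrier N"
  unfolding free_smult
proof (rule free_carrierI[of _ "{t. f t \<noteq> \<zero>}"])
  fix t
  show "c \<otimes> f t \<in> carrier K" using free_coeff[OF f] c by simp
  assume "c \<otimes> f t \<noteq> \<zero>"
  then have *: "f t \<noteq> \<zero>" using c by auto
  then show "t \<in> {t. f t \<noteq> \<zero>}" by simp
  show "letters t \<subseteq> G" using * free_letters[OF f] by blast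
qed (use free_finite f in simp)

lemma free_zero_closed: "\<zero>\<^bsub>N\<^esub> \<in> carrier N"
  unfolding free_zero by (rule free_carrierI[of _ "{}"]) auto

lemma free_mult_closed:
  assumes "f \<in> carrier N" "g \<in> carrier N"
  shows "f \<otimes>\<^bsub>N\<^esub> g \<in> carrier N"
proof (rule free_carrierI[of _ "(\<lambda>(u, v). Times u v) ` ({t. f t \<noteq> \<zero>} \<times> {t. g t \<noteq> \<zero>})"])
  note [simp] = free_coeff[OF assms(1)] free_coeff[OF assms(2)]
  fix t
  show "(f \<otimes>\<^bsub>N\<^esub> g) t \<in> carrier K" by (simp add: free_mult split: monomial.split)
  assume t: "(f \<otimes>\<^bsub>N\<^esub> g) t \<noteq> \<zero>"
  then obtain u v where uv: "t = Times u v" "f u \<otimes> g v \<noteq> \<zero>"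
    by (auto simp: free_mult split: monomial.splits)
  then have "f u \<noteq> \<zero>" "g v \<noteq> \<zero>" by auto
  then show "t \<in> (\<lambda>(u, v). Times u v) ` ({t. f t \<noteq> \<zero>} \<times> {t. g t \<noteq> \<zero>})" "letters t \<subseteq> G"
    using uv free_letters[OF assms(1)] free_letters[OF assms(2)] by auto
qed (use free_finite assms in auto)

lemma free_abelian_group: "abelian_group N"
proof (rule abelian_groupI)
  fix f g h assume fgh: "f \<in> carrier N" "g \<in> carrier N" "h \<in> carrier N"
  note [simp] = free_coeff[OF fgh(1)] free_coeff[OF fgh(2)] free_coeff[OF fgh(3)]
  show "f \<oplus>\<^bsub>N\<^esub> g \<oplus>\<^bsub>N\<^esub> h = f \<oplus>\<^bsub>N\<^esub> (g \<oplus>\<^bsub>N\<^esub> h)" by (simp add: free_add a_assoc)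
next
  fix f g assume fg: "f \<in> carrier N" "g \<in> carrier N"
  note [simp] = free_coeff[OF fg(1)] free_coeff[OF fg(2)]
  show "f \<oplus>\<^bsub>N\<^esub> g = g \<oplus>\<^bsub>N\<^esub> f" by (simp add: free_add a_comm)
  show "f \<oplus>\<^bsub>N\<^esub> g \<in> carrier N" using fg by (rule free_add_closed)
next
  fix f assume f: "f \<in> carrier N"
  note [simp] = free_coeff[OF f]
  show "\<zero>\<^bsub>N\<^esub> \<oplus>\<^bsub>N\<^esub> f = f" by (simp add: free_add free_zero)
  have "(\<ominus> \<one>) \<odot>\<^bsub>N\<^esub> f \<oplus>\<^bsub>N\<^esub> f = \<zero>\<^bsub>N\<^esub>"
    by (simp add: free_add free_smult free_zero l_minus l_neg)
  moreover have "(\<ominus> \<one>) \<odot>\<^bsub>N\<^esub> f \<in> carrier N" using f by (intro free_smult_closed) auto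
  ultimately show "\<exists>g\<in>carrier N. g \<oplus>\<^bsub>N\<^esub> f = \<zero>\<^bsub>N\<^esub>" by blast
qed (rule free_zero_closed)

lemma free_module: "module K N"
proof (rule moduleI[OF is_cring free_abelian_group])
  show "a \<odot>\<^bsub>N\<^esub> (f \<oplus>\<^bsub>N\<^esub> g) = a \<odot>\<^bsub>N\<^esub> f \<oplus>\<^bsub>N\<^esub> a \<odot>\<^bsub>N\<^esub> g"
    if "a \<in> carrier K" "f \<in> carrier N" "g \<in> carrier N" for a f g
    using that(1) free_coeff[OF that(2)] free_coeff[OF that(3)] by (simp add: free_add free_smult r_distr)
  show "(a \<oplus> b) \<odot>\<^bsub>N\<^esub> f = a \<odot>\<^bsub>N\<^esub> f \<oplus>\<^bsub>N\<^esub> b \<odot>\<^bsub>N\<^esub> f"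
    if "a \<in> carrier K" "b \<in> carrier K" "f \<in> carrier N" for a b f
    using that(1,2) free_coeff[OF that(3)] by (simp add: free_add free_smult l_distr)
  show "(a \<otimes> b) \<odot>\<^bsub>N\<^esub> f = a \<odot>\<^bsub>N\<^esub> (b \<odot>\<^bsub>N\<^esub> f)"
    if "a \<in> carrier K" "b \<in> carrier K" "f \<in> carrier N" for a b f
    using that(1,2) free_coeff[OF that(3)] by (simp add: free_smult m_assoc)
  show "\<one> \<odot>\<^bsub>N\<^esub> f = f" if "f \<in> carrier N" for f
    using free_coeff[OF that] by (simp add: free_smult)
qed (rule free_smult_closed)

lemma free_supermodule: "supermodule K N"
proof (rule supermoduleI[OF free_module])
  interpret N: module K N by (rule free_module)
  fix p
  show "submodule (grade N p) K N"
  proof (rule N.submoduleI)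
    show "\<zero>\<^bsub>N\<^esub> \<in> grade N p" by (simp add: free_grade free_zero_closed) (simp add: free_zero)
    have smult: "c \<odot>\<^bsub>N\<^esub> f \<in> grade N p" if c: "c \<in> carrier K" and f: "f \<in> grade N p" for c f
    proof -
      have "(c \<odot>\<^bsub>N\<^esub> f) t = \<zero>" if "monomial_degree d t \<noteq> p" for t
      proof -
        have "f t = \<zero>" using f that unfolding free_grade by blast
        then show ?thesis using c by (simp add: free_smult)
      qed
      moreover have "c \<odot>\<^bsub>N\<^esub> f \<in> carrier N" using f free_smult_closed[OF c] unfolding free_grade by blast
      ultimately show ?thesis unfolding free_grade by blast
    qed
    show "c \<odot>\<^bsub>N\<^esub> f \<in> grade N p" if "c \<in> carrier K" "f \<in> grade N p" for c f
      using smult that .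
    show "\<ominus>\<^bsub>N\<^esub> f \<in> grade N p" if "f \<in> grade N p" for f
      using smult[OF _ that, of "\<ominus> \<one>"] that by (simp add: free_grade N.smult_l_minus)
    show "f \<oplus>\<^bsub>N\<^esub> g \<in> grade N p" if fg: "f \<in> grade N p" "g \<in> grade N p" for f g
    proof -
      have "(f \<oplus>\<^bsub>N\<^esub> g) t = \<zero>" if "monomial_degree d t \<noteq> p" for t
      proof -
        have "f t = \<zero>" "g t = \<zero>" using fg that unfolding free_grade by blast+
        then show ?thesis by (simp add: free_add)
      qed
      moreover have "f \<oplus>\<^bsub>N\<^esub> g \<in> carrier N" using fg free_add_closed unfolding free_grade by blast
      ultimately show ?thesis unfolding free_grade by blast
    qed
  qed (auto simp: free_grade)
next
  fix f assume f: "f \<in> carrier N"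
  let ?part = "\<lambda>p t. if monomial_degree d t = p then f t else \<zero>"
  have "?part p \<in> grade N p" for p
  proof -
    have "?part p \<in> carrier N"
    proof (rule free_carrierI[of _ "{t. f t \<noteq> \<zero>}"])
      show "letters t \<subseteq> G" if "?part p t \<noteq> \<zero>" for t
        using that free_letters[OF f, of t] by (auto split: if_splits)
    qed (use free_carrierD(1,2)[OF f] in \<open>auto split: if_splits\<close>)
    then show ?thesis by (simp add: free_grade)
  qed
  moreover have "f = ?part 0 \<oplus>\<^bsub>N\<^esub> ?part 1"
  proof
    fix t
    show "f t = (?part 0 \<oplus>\<^bsub>N\<^esub> ?part 1) t"
      using free_coeff[OF f] bit_cases[of "monomial_degree d t"] by (auto simp: free_add)
  qed
  ultimately show "\<exists>g\<in>grade N 0. \<exists>h\<in>grade N 1. f = g \<oplus>\<^bsub>N\<^esub> h" by blast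
next
  fix f assume f: "f \<in> grade N 0" "f \<in> grade N 1"
  have "f t = \<zero>" for t
  proof (rule ccontr)
    assume "f t \<noteq> \<zero>"
    then have "monomial_degree d t = 0" "monomial_degree d t = 1" using f unfolding free_grade by blast+
    then show False by simp
  qed
  then show "f = \<zero>\<^bsub>N\<^esub>" by (auto simp: free_zero)
qed

lemma free_superalgebra: "superalgebra K N"
proof (intro superalgebra.intro superalgebra_axioms.intro free_supermodule)
  show "bilinear_map K N N N (mult N)"
    unfolding bilinear_map_def
  proof (intro conjI ballI)
    show "f \<otimes>\<^bsub>N\<^esub> (g \<oplus>\<^bsub>N\<^esub> h) = f \<otimes>\<^bsub>N\<^esub> g \<oplus>\<^bsub>N\<^esub> f \<otimes>\<^bsub>N\<^esub> h"
      if "f \<in> carrier N" "g \<in> carrier N" "h \<in> carrier N" for f g h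
      using that[THEN free_coeff]
      by (simp add: free_add free_mult r_distr fun_eq_iff split: monomial.split)
    show "(f \<oplus>\<^bsub>N\<^esub> g) \<otimes>\<^bsub>N\<^esub> h = f \<otimes>\<^bsub>N\<^esub> h \<oplus>\<^bsub>N\<^esub> g \<otimes>\<^bsub>N\<^esub> h"
      if "f \<in> carrier N" "g \<in> carrier N" "h \<in> carrier N" for f g h
      using that[THEN free_coeff]
      by (simp add: free_add free_mult l_distr fun_eq_iff split: monomial.split)
    show "(c \<odot>\<^bsub>N\<^esub> f) \<otimes>\<^bsub>N\<^esub> g = c \<odot>\<^bsub>N\<^esub> (f \<otimes>\<^bsub>N\<^esub> g)"
      if "c \<in> carrier K" "f \<in> carrier N" "g \<in> carrier N" for c f g
      using that(1) that(2,3)[THEN free_coeff]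
      by (simp add: free_smult free_mult m_assoc fun_eq_iff split: monomial.split)
    show "f \<otimes>\<^bsub>N\<^esub> (c \<odot>\<^bsub>N\<^esub> g) = c \<odot>\<^bsub>N\<^esub> (f \<otimes>\<^bsub>N\<^esub> g)"
      if "c \<in> carrier K" "f \<in> carrier N" "g \<in> carrier N" for c f g
      using that(1) that(2,3)[THEN free_coeff]
      by (simp add: free_smult free_mult m_lcomm fun_eq_iff split: monomial.split)
  qed (rule free_mult_closed)
  fix f g p q assume fg: "f \<in> grade N p" "g \<in> grade N q"
  have "monomial_degree d t = p + q" if nz: "(f \<otimes>\<^bsub>N\<^esub> g) t \<noteq> \<zero>" for t
  proof -
    obtain u v where uv: "t = Times u v" "f u \<otimes> g v \<noteq> \<zero>"
      using nz by (auto simp: free_mult split: monomial.splits)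
    have "f u \<in> carrier K" "g v \<in> carrier K" using fg free_coeff unfolding free_grade by blast+
    then have "f u \<noteq> \<zero>" "g v \<noteq> \<zero>" using uv by auto
    then have "monomial_degree d u = p" "monomial_degree d v = q" using fg unfolding free_grade by blast+
    then show ?thesis using uv by simp
  qed
  then show "f \<otimes>\<^bsub>N\<^esub> g \<in> grade N (p + q)" 
    using fg free_mult_closed unfolding free_grade by blast
qed

sublocale N: superalgebra K N by (rule free_superalgebra)

lemma free_mono_grade: "letters t \<subseteq> G \<Longrightarrow> free_mono K t \<in> grade N (monomial_degree d t)"
  unfolding free_grade free_mono_def
  by (auto intro!: free_carrierI[of _ "{t}"] split: if_splits)

lemma free_mono_closed: "letters t \<subseteq> G \<Longrightarrow> free_mono K t \<in> carrier N"
  using free_mono_grade N.grade_carrier by blast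

lemma free_mono_Times: "free_mono K (Times s t) = free_mono K s \<otimes>\<^bsub>N\<^esub> free_mono K t"
  by (auto simp: free_mono_def free_mult fun_eq_iff split: monomial.split)

lemma free_gen_grade: "g \<in> G \<Longrightarrow> free_gen K g \<in> grade N (d g)"
  using free_mono_grade[of "Letter g"] by (simp add: free_gen_mono)

lemma free_gen_closed: "g \<in> G \<Longrightarrow> free_gen K g \<in> carrier N"
  using free_gen_grade N.grade_carrier by blast

lemma free_linear_induct [consumes 1, case_names zero mono add]:
  assumes "f \<in> carrier N"
    and zero: "P \<zero>\<^bsub>N\<^esub>"
    and mono: "\<And>c t. \<lbrakk>c \<in> carrier K; letters t \<subseteq> G\<rbrakk> \<Longrightarrow> P (c \<odot>\<^bsub>N\<^esub> free_mono K t)"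
    and add: "\<And>f g. \<lbrakk>f \<in> carrier N; g \<in> carrier N; P f; P g\<rbrakk> \<Longrightarrow> P (f \<oplus>\<^bsub>N\<^esub> g)"
  shows "P f"
proof -
  have "\<forall>f\<in>carrier N. {t. f t \<noteq> \<zero>} \<subseteq> S \<longrightarrow> P f" if "finite S" for S
    using that
  proof (induction S rule: finite_induct)
    case empty
    then show ?case using zero by (auto simp: free_zero fun_eq_iff)
  next
    case (insert t S)
    show ?case
    proof (intro ballI impI)
      fix f assume f: "f \<in> carrier N" and S: "{s. f s \<noteq> \<zero>} \<subseteq> insert t S"
      show "P f"
      proof (cases "f t = \<zero>")
        case True
        then have "{s. f s \<noteq> \<zero>} \<subseteq> S" using S by auto
        then show ?thesis using insert.IH f by blast
      next
        case False
        have t: "letters t \<subseteq> G" "f t \<in> carrier K" using False free_carrierD[OF f] by auto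
        let ?g = "f(t := \<zero>)" and ?h = "f t \<odot>\<^bsub>N\<^esub> free_mono K t"
        have g: "?g \<in> carrier N"
        proof (rule free_carrierI[of _ "{t. f t \<noteq> \<zero>}"])
          show "letters s \<subseteq> G" if "(f(t := \<zero>)) s \<noteq> \<zero>" for s
            using that free_letters[OF f, of s] by (auto split: if_splits)
        qed (use free_carrierD(1,2)[OF f] in \<open>auto split: if_splits\<close>)
        have "{s. ?g s \<noteq> \<zero>} \<subseteq> S" using S by auto
        then have "P ?g" using insert.IH g by blast
        moreover have "P ?h" using mono t by blast
        ultimately have "P (?g \<oplus>\<^bsub>N\<^esub> ?h)"
          using add g free_smult_closed[OF t(2) free_mono_closed[OF t(1)]] by blast
        moreover have "?g \<oplus>\<^bsub>N\<^esub> ?h = f"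
          using free_coeff[OF f] by (auto simp: free_add free_smult free_mono_def fun_eq_iff)
        ultimately show ?thesis by simp
      qed
    qed
  qed
  then show ?thesis using assms(1) free_finite by blast
qed

text \<open>
  The subalgebra generated by the letters contains all monomials. Homomorphisms are compared, and
  images located, by this rule.
\<close>
lemma free_subalgebra_induct [consumes 1, case_names gen zero add smult mult]:
  assumes "f \<in> carrier N"
    and gen: "\<And>g. g \<in> G \<Longrightarrow> P (free_gen K g)"
    and zero: "P \<zero>\<^bsub>N\<^esub>"
    and add: "\<And>f g. \<lbrakk>f \<in> carrier N; g \<in> carrier N; P f; P g\<rbrakk> \<Longrightarrow> P (f \<oplus>\<^bsub>N\<^esub> g)"
    and smult: "\<And>c f. \<lbrakk>c \<in> carrier K; f \<in> carrier N; P f\<rbrakk> \<Longrightarrow> P (c \<odot>\<^bsub>N\<^esub> f)"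
    and mult: "\<And>f g. \<lbrakk>f \<in> carrier N; g \<in> carrier N; P f; P g\<rbrakk> \<Longrightarrow> P (f \<otimes>\<^bsub>N\<^esub> g)"
  shows "P f"
proof -
  have mono: "P (free_mono K t)" if "letters t \<subseteq> G" for t
    using that
  proof (induction t)
    case (Letter g)
    then show ?case using gen[of g] by (simp add: free_gen_mono)
  next
    case (Times s t)
    then show ?case using mult[of "free_mono K s" "free_mono K t"] by (simp add: free_mono_Times free_mono_closed)
  qed
  show ?thesis using assms(1)
    by (induction rule: free_linear_induct) (auto intro: zero smult mono add free_mono_closed)
qed

end

locale free_extension = free_generators K G d + M: superalgebra K M
  for K :: "('k, 'c) ring_scheme" (structure) and G :: "'g set" and d :: "'g \<Rightarrow> bit"
    and M :: "('k, 'v) superalgebra" +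
  fixes v :: "'g \<Rightarrow> 'v"
  assumes v_grade: "g \<in> G \<Longrightarrow> v g \<in> grade M (d g)"
begin

abbreviation "ev \<equiv> mono_eval M v"
abbreviation "ext \<equiv> free_ext K M v"

lemma mono_eval_grade: "letters t \<subseteq> G \<Longrightarrow> ev t \<in> grade M (monomial_degree d t)"
  by (induction t) (auto simp: v_grade M.mult_grade)

lemma mono_eval_closed: "letters t \<subseteq> G \<Longrightarrow> ev t \<in> carrier M"
  using mono_eval_grade M.grade_carrier by blast

lemma free_ext_eq_finsum:
  assumes f: "f \<in> carrier N" and S: "finite S" "{t. f t \<noteq> \<zero>} \<subseteq> S" "\<And>t. t \<in> S \<Longrightarrow> letters t \<subseteq> G"
  shows "ext f = finsum M (\<lambda>t. f t \<odot>\<^bsub>M\<^esub> ev t) S"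
  unfolding free_ext_def
  by (rule M.add.finprod_mono_neutral_cong_left)
    (use S free_coeff[OF f] mono_eval_closed in auto)

lemma free_ext_closed: "f \<in> carrier N \<Longrightarrow> ext f \<in> carrier M"
  unfolding free_ext_def using free_coeff free_letters mono_eval_closed
  by (intro M.finsum_closed) auto

lemma free_ext_add:
  assumes f: "f \<in> carrier N" and g: "g \<in> carrier N"
  shows "ext (f \<oplus>\<^bsub>N\<^esub> g) = ext f \<oplus>\<^bsub>M\<^esub> ext g"
proof -
  let ?S = "{t. f t \<noteq> \<zero>} \<union> {t. g t \<noteq> \<zero>}"
  have S: "finite ?S" "\<And>t. t \<in> ?S \<Longrightarrow> letters t \<subseteq> G"
    using free_finite[OF f] free_finite[OF g] free_letters[OF f] free_letters[OF g] by auto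
  have fg: "f \<oplus>\<^bsub>N\<^esub> g \<in> carrier N" using f g by (rule free_add_closed)
  have supp: "{t. (f \<oplus>\<^bsub>N\<^esub> g) t \<noteq> \<zero>} \<subseteq> ?S" by (auto simp: free_add)
  have cl: "(\<lambda>t. f t \<odot>\<^bsub>M\<^esub> ev t) \<in> ?S \<rightarrow> carrier M" "(\<lambda>t. g t \<odot>\<^bsub>M\<^esub> ev t) \<in> ?S \<rightarrow> carrier M"
    using free_coeff[OF f] free_coeff[OF g] mono_eval_closed S(2) by auto
  have "ext f = finsum M (\<lambda>t. f t \<odot>\<^bsub>M\<^esub> ev t) ?S" "ext g = finsum M (\<lambda>t. g t \<odot>\<^bsub>M\<^esub> ev t) ?S"
    "ext (f \<oplus>\<^bsub>N\<^esub> g) = finsum M (\<lambda>t. (f \<oplus>\<^bsub>N\<^esub> g) t \<odot>\<^bsub>M\<^esub> ev t) ?S"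
    by (rule free_ext_eq_finsum[OF f S(1) _ S(2)], blast, assumption,
        rule free_ext_eq_finsum[OF g S(1) _ S(2)], blast, assumption,
        rule free_ext_eq_finsum[OF fg S(1) supp S(2)], assumption)
  moreover have "finsum M (\<lambda>t. (f \<oplus>\<^bsub>N\<^esub> g) t \<odot>\<^bsub>M\<^esub> ev t) ?S
      = finsum M (\<lambda>t. f t \<odot>\<^bsub>M\<^esub> ev t \<oplus>\<^bsub>M\<^esub> g t \<odot>\<^bsub>M\<^esub> ev t) ?S"
    using cl S(2) free_coeff[OF f] free_coeff[OF g] mono_eval_closed
    by (intro M.finsum_cong) (auto simp: free_add M.smult_l_distr simp_implies_def)
  ultimately show ?thesis using M.finsum_addf[OF cl] by simp
qed

lemma free_ext_smult:
  assumes c: "c \<in> carrier K" and f: "f \<in> carrier N"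
  shows "ext (c \<odot>\<^bsub>N\<^esub> f) = c \<odot>\<^bsub>M\<^esub> ext f"
proof -
  let ?S = "{t. f t \<noteq> \<zero>}"
  note S = free_finite[OF f] and l = free_letters[OF f]
  have cl: "(\<lambda>t. f t \<odot>\<^bsub>M\<^esub> ev t) \<in> ?S \<rightarrow> carrier M"
    using free_coeff[OF f] mono_eval_closed l by auto
  have "ext (c \<odot>\<^bsub>N\<^esub> f) = finsum M (\<lambda>t. (c \<odot>\<^bsub>N\<^esub> f) t \<odot>\<^bsub>M\<^esub> ev t) ?S"
    by (rule free_ext_eq_finsum[OF free_smult_closed[OF c f] S]) (use l c in \<open>auto simp: free_smult\<close>)
  also have "\<dots> = finsum M (\<lambda>t. c \<odot>\<^bsub>M\<^esub> (f t \<odot>\<^bsub>M\<^esub> ev t)) ?S"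
    using c cl l free_coeff[OF f] mono_eval_closed
    by (intro M.finsum_cong) (auto simp: free_smult M.smult_assoc1 simp_implies_def)
  also have "\<dots> = c \<odot>\<^bsub>M\<^esub> ext f"
    using M.finsum_smult_ldistr[OF S c cl] by (simp add: free_ext_def)
  finally show ?thesis .
qed

lemma free_ext_mono:
  assumes "letters t \<subseteq> G"
  shows "ext (free_mono K t) = ev t"
proof -
  have "{s. free_mono K t s \<noteq> \<zero>} \<subseteq> {t}" by (auto simp: free_mono_def)
  then have "ext (free_mono K t) = finsum M (\<lambda>s. free_mono K t s \<odot>\<^bsub>M\<^esub> ev s) {t}"
    using assms by (intro free_ext_eq_finsum free_mono_closed) auto
  also have "\<dots> = free_mono K t t \<odot>\<^bsub>M\<^esub> ev t"
    using mono_eval_closed[OF assms] by (subst M.finsum_insert) (auto simp: free_mono_def)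
  finally show ?thesis using mono_eval_closed[OF assms] by (simp add: free_mono_def)
qed

lemma free_ext_gen: "g \<in> G \<Longrightarrow> ext (free_gen K g) = v g"
  by (simp add: free_gen_mono free_ext_mono)

lemma free_ext_zero: "ext \<zero>\<^bsub>N\<^esub> = \<zero>\<^bsub>M\<^esub>"
  by (simp add: free_ext_def free_zero)

lemma free_ext_mult:
  assumes f: "f \<in> carrier N" and g: "g \<in> carrier N"
  shows "ext (f \<otimes>\<^bsub>N\<^esub> g) = ext f \<otimes>\<^bsub>M\<^esub> ext g"
proof -
  have 1: "ext (free_mono K s \<otimes>\<^bsub>N\<^esub> g) = ext (free_mono K s) \<otimes>\<^bsub>M\<^esub> ext g" if s: "letters s \<subseteq> G" for s
    using g
  proof (induction rule: free_linear_induct)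
    case zero
    then show ?case using s by (simp add: N.mult_zero M.mult_zero free_mono_closed free_ext_closed free_ext_zero)
  next
    case (mono c t)
    then show ?case using s
      by (simp add: N.mult_smult M.mult_smult free_mono_closed free_ext_closed free_ext_smult N.mult_closed
          free_ext_mono mono_eval_closed free_mono_Times[symmetric])
  next
    case (add f g)
    then show ?case using s
      by (simp add: N.mult_add M.mult_add free_mono_closed free_ext_closed free_ext_add N.mult_closed)
  qed
  show ?thesis using f
  proof (induction rule: free_linear_induct)
    case zero
    then show ?case using g by (simp add: N.zero_mult M.zero_mult free_ext_closed free_ext_zero)
  next
    case (mono c t)
    then show ?case using g
      by (simp add: N.smult_mult M.smult_mult free_mono_closed free_ext_closed free_ext_smult N.mult_closed 1)
  next
    case (add f h)
    then show ?case using g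
      by (simp add: N.add_mult M.add_mult free_mono_closed free_ext_closed free_ext_add N.mult_closed)
  qed
qed

lemma free_ext_grade:
  assumes "f \<in> grade N p"
  shows "ext f \<in> grade M p"
  unfolding free_ext_def
proof (rule M.finsum_grade)
  have f: "f \<in> carrier N" using assms N.grade_carrier by blast
  show "finite {t. f t \<noteq> \<zero>}" using free_finite f .
  fix t assume t: "t \<in> {t. f t \<noteq> \<zero>}"
  then have "monomial_degree d t = p" using assms unfolding free_grade by blast
  then show "f t \<odot>\<^bsub>M\<^esub> ev t \<in> grade M p"
    using M.grade_smult free_coeff[OF f] mono_eval_grade[of t] free_letters[OF f] t by blast
qed

lemma free_ext_hom: "ext \<in> lie_superalgebra_hom K N M"
  by (intro lie_superalgebra_homI free_ext_closed free_ext_add free_ext_smult free_ext_mult free_ext_grade)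

end

section \<open>Presented Lie superalgebras\<close>

lemma lie_hom_zero_minus:
  assumes "f \<in> lie_superalgebra_hom K L M" "abelian_group L" "abelian_group M"
  shows lie_hom_zero: "f \<zero>\<^bsub>L\<^esub> = \<zero>\<^bsub>M\<^esub>"
    and lie_hom_uminus: "x \<in> carrier L \<Longrightarrow> f (\<ominus>\<^bsub>L\<^esub> x) = \<ominus>\<^bsub>M\<^esub> f x"
    and lie_hom_minus: "\<lbrakk>x \<in> carrier L; y \<in> carrier L\<rbrakk> \<Longrightarrow> f (x \<ominus>\<^bsub>L\<^esub> y) = f x \<ominus>\<^bsub>M\<^esub> f y"
    and lie_hom_ssign: "x \<in> carrier L \<Longrightarrow> f (ssign L p q x) = ssign M p q (f x)"
  using additive_map_zero_minus[OF assms(2,3), of f] lie_superalgebra_homD[OF assms(1)]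
  by (auto simp: ssign_def)

lemma lie_hom_kills_lie_identities:
  assumes f: "f \<in> lie_superalgebra_hom K N M" and "superalgebra K N" "lie_superalgebra K M"
    and s: "s \<in> lie_identities N"
  shows "f s = \<zero>\<^bsub>M\<^esub>"
proof -
  interpret N: superalgebra K N by fact
  interpret M: lie_superalgebra K M by fact
  note hom = lie_superalgebra_homD[OF f]
    lie_hom_zero_minus[OF f N.M.abelian_group_axioms M.M.abelian_group_axioms]
  consider (skew) p q x y where "s = x \<otimes>\<^bsub>N\<^esub> y \<oplus>\<^bsub>N\<^esub> ssign N p q (y \<otimes>\<^bsub>N\<^esub> x)" "x \<in> grade N p" "y \<in> grade N q"
    | (alt) x where "s = x \<otimes>\<^bsub>N\<^esub> x" "x \<in> grade N 0"
    | (jac) p q r x y z where "s = jacobiator N p q r x y z" "x \<in> grade N p" "y \<in> grade N q" "z \<in> grade N r"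
    using s unfolding lie_identities_def by blast
  then show ?thesis
  proof cases
    case skew
    note c = skew(2,3)[THEN N.grade_carrier]
    have "f s = f x \<otimes>\<^bsub>M\<^esub> f y \<oplus>\<^bsub>M\<^esub> ssign M p q (f y \<otimes>\<^bsub>M\<^esub> f x)"
      using c by (simp add: skew(1) hom N.mult_closed N.ssign_closed)
    also have "\<dots> = \<zero>\<^bsub>M\<^esub>"
      using M.super_skew[OF hom(5)[OF skew(2)] hom(5)[OF skew(3)]] c
      by (simp add: M.M.l_neg M.ssign_closed M.mult_closed hom(1))
    finally show ?thesis .
  next
    case alt
    then show ?thesis using M.even_alternating[OF hom(5)[OF alt(2)]] hom(4) N.grade_carrier by simp
  next
    case jac
    note c = jac(2-4)[THEN N.grade_carrier]
    have "f s = jacobiator M p q r (f x) (f y) (f z)"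
      using c by (simp add: jac(1) jacobiator_def hom N.mult_closed N.ssign_closed)
    then show ?thesis using M.super_jacobi jac hom(5) by simp
  qed
qed

context graded_quotient
begin

lemma quot_lift:
  assumes f: "f \<in> lie_superalgebra_hom K N M" and "superalgebra K M"
    and I: "\<And>x. x \<in> I \<Longrightarrow> f x = \<zero>\<^bsub>M\<^esub>"
  obtains g where "g \<in> lie_superalgebra_hom K Q M" "\<And>x. x \<in> carrier N \<Longrightarrow> g (I +>\<^bsub>N\<^esub> x) = f x"
proof -
  interpret T: superalgebra K M by fact
  note hom = lie_superalgebra_homD[OF f]
    lie_hom_zero_minus[OF f M.abelian_group_axioms T.M.abelian_group_axioms]
  define g where "g = (\<lambda>X. f (SOME x. x \<in> carrier N \<and> X = I +>\<^bsub>N\<^esub> x))"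
  have g: "g (I +>\<^bsub>N\<^esub> x) = f x" if x: "x \<in> carrier N" for x
  proof -
    let ?y = "SOME y. y \<in> carrier N \<and> I +>\<^bsub>N\<^esub> x = I +>\<^bsub>N\<^esub> y"
    have y: "?y \<in> carrier N \<and> I +>\<^bsub>N\<^esub> x = I +>\<^bsub>N\<^esub> ?y" by (rule someI[of _ x]) (simp add: x)
    then have "x \<ominus>\<^bsub>N\<^esub> ?y \<in> I" using coset_eq_iff x by blast
    then have "f x \<ominus>\<^bsub>M\<^esub> f ?y = \<zero>\<^bsub>M\<^esub>" using I hom(8)[of x ?y] x y by simp
    then show ?thesis using T.M.minus_eq_zero_iff hom(1) x y by (simp add: g_def)
  qed
  have "g \<in> lie_superalgebra_hom K Q M"
  proof (rule lie_superalgebra_homI)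
    show "g X \<in> grade M p" if "X \<in> grade Q p" for p X
      using that hom(5) by (auto simp: quot_grade g grade_carrier)
  qed (auto simp: quot_carrier quot_add quot_smult quot_mult g hom mult_closed)
  then show thesis using that g by blast
qed

end

locale lie_presented = free_generators K G d
  for K :: "('k, 'c) ring_scheme" (structure) and G :: "'g set" and d :: "'g \<Rightarrow> bit" +
  fixes R
  assumes relators_homogeneous: "r \<in> R \<Longrightarrow> \<exists>p. r \<in> grade N p"
begin

abbreviation "PI \<equiv> lie_presentation_ideal K G d R"

lemma relators_in_ideal: "lie_identities N \<union> R \<subseteq> PI"
  unfolding lie_presentation_ideal_def by (rule N.nonassoc_ideal_gen_superset)

sublocale quot: graded_quotient K N PI
proof
  show "graded_ideal K N PI"
    unfolding lie_presentation_ideal_def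
    using lie_identities_homogeneous[OF N.superalgebra_axioms] relators_homogeneous
    by (intro N.nonassoc_ideal_gen_graded) auto
qed

lemma presented_lie: "lie_superalgebra K (super_quot N PI)"
  by (rule quot.quot_lie_superalgebra) (use relators_in_ideal in simp)

text \<open>Generation by the letters passes to the quotient.\<close>
lemma presented_induct [consumes 1, case_names gen zero add smult mult]:
  assumes "X \<in> carrier (super_quot N PI)"
    and gen: "\<And>g. g \<in> G \<Longrightarrow> P (PI +>\<^bsub>N\<^esub> free_gen K g)"
    and zero: "P \<zero>\<^bsub>super_quot N PI\<^esub>"
    and add: "\<And>X Y. \<lbrakk>X \<in> carrier (super_quot N PI); Y \<in> carrier (super_quot N PI); P X; P Y\<rbrakk>
      \<Longrightarrow> P (X \<oplus>\<^bsub>super_quot N PI\<^esub> Y)"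
    and smult: "\<And>c X. \<lbrakk>c \<in> carrier K; X \<in> carrier (super_quot N PI); P X\<rbrakk>
      \<Longrightarrow> P (c \<odot>\<^bsub>super_quot N PI\<^esub> X)"
    and mult: "\<And>X Y. \<lbrakk>X \<in> carrier (super_quot N PI); Y \<in> carrier (super_quot N PI); P X; P Y\<rbrakk>
      \<Longrightarrow> P (X \<otimes>\<^bsub>super_quot N PI\<^esub> Y)"
  shows "P X"
proof -
  obtain x where x: "x \<in> carrier N" "X = PI +>\<^bsub>N\<^esub> x" using assms(1) by (auto simp: quot.quot_carrier)
  have cl: "PI +>\<^bsub>N\<^esub> f \<in> carrier (super_quot N PI)" if "f \<in> carrier N" for f
    using that by (auto simp: quot.quot_carrier)
  have "P (PI +>\<^bsub>N\<^esub> x)" using x(1)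
  proof (induction rule: free_subalgebra_induct)
    case zero
    have "PI +>\<^bsub>N\<^esub> \<zero>\<^bsub>N\<^esub> = \<zero>\<^bsub>super_quot N PI\<^esub>" by (simp add: quot.quot_zero quot.I.a_subset)
    then show ?case using assms(3) by simp
  next
    case (add f g)
    then show ?case using assms(4)[OF cl cl, of f g] by (simp add: quot.quot_add)
  next
    case (smult c f)
    then show ?case using assms(5)[OF _ cl, of c f] by (simp add: quot.quot_smult)
  next
    case (mult f g)
    then show ?case using assms(6)[OF cl cl, of f g] by (simp add: quot.quot_mult)
  qed (rule gen)
  then show ?thesis by (simp add: x(2))
qed

text \<open>
  The universal property of a presentation: the kernel of the homomorphism from the free
  superalgebra is an ideal, and it contains the Lie identities because \<open>M\<close> is a Lie superalgebra.
\<close>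
lemma presented_hom:
  assumes "lie_superalgebra K M" and v: "\<And>g. g \<in> G \<Longrightarrow> v g \<in> grade M (d g)"
    and R: "\<And>r. r \<in> R \<Longrightarrow> free_ext K M v r = \<zero>\<^bsub>M\<^esub>"
  obtains h where "h \<in> lie_superalgebra_hom K (super_quot N PI) M"
    "\<And>g. g \<in> G \<Longrightarrow> h (PI +>\<^bsub>N\<^esub> free_gen K g) = v g"
proof -
  interpret M: lie_superalgebra K M by fact
  interpret E: free_extension K G d M v by unfold_locales (rule v)
  note f = E.free_ext_hom
  note hom = lie_superalgebra_homD[OF f]
    lie_hom_zero_minus[OF f N.M.abelian_group_axioms M.M.abelian_group_axioms]
  let ?J = "{x \<in> carrier N. E.ext x = \<zero>\<^bsub>M\<^esub>}"
  have "PI \<subseteq> ?J"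
    unfolding lie_presentation_ideal_def
  proof (rule N.nonassoc_ideal_gen_minimal)
    show "submodule ?J K N"
      by (rule N.submoduleI) (auto simp: hom)
    show "lie_identities N \<union> R \<subseteq> ?J"
      using lie_hom_kills_lie_identities[OF f N.superalgebra_axioms M.lie_superalgebra_axioms] R
        relators_in_ideal quot.ideal_carrier by blast
  qed (auto simp: hom N.mult_closed M.zero_mult M.mult_zero)
  then have "\<And>x. x \<in> PI \<Longrightarrow> E.ext x = \<zero>\<^bsub>M\<^esub>" by blast
  then obtain h where h: "h \<in> lie_superalgebra_hom K (super_quot N PI) M"
    "\<And>x. x \<in> carrier N \<Longrightarrow> h (PI +>\<^bsub>N\<^esub> x) = E.ext x"
    using quot.quot_lift[OF f M.superalgebra_axioms] by blast
  then show thesis using that free_gen_closed E.free_ext_gen by auto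
qed

end

section \<open>Central extensions by a cocycle\<close>

definition cocycle_extension ::
    "('k, 'u) superalgebra \<Rightarrow> ('k, 'w) superalgebra \<Rightarrow> ('u \<Rightarrow> 'u \<Rightarrow> 'w) \<Rightarrow> ('k, 'u \<times> 'w) superalgebra" where
  "cocycle_extension L W \<psi> =
     \<lparr>carrier = carrier L \<times> carrier W,
         mult = (\<lambda>(x, v) (y, w). (x \<otimes>\<^bsub>L\<^esub> y, \<psi> x y)),
         one = (\<zero>\<^bsub>L\<^esub>, \<zero>\<^bsub>W\<^esub>),
         zero = (\<zero>\<^bsub>L\<^esub>, \<zero>\<^bsub>W\<^esub>),
         add = (\<lambda>(x, v) (y, w). (x \<oplus>\<^bsub>L\<^esub> y, v \<oplus>\<^bsub>W\<^esub> w)),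
         smult = (\<lambda>c (x, v). (c \<odot>\<^bsub>L\<^esub> x, c \<odot>\<^bsub>W\<^esub> v)),
         grade = (\<lambda>p. grade L p \<times> grade W p)\<rparr>"

locale lie_cocycle = L: lie_superalgebra K L + W: supermodule K W
  for K :: "('k, 'c) ring_scheme" (structure) and L :: "('k, 'u) superalgebra"
    and W :: "('k, 'w) superalgebra" +
  fixes \<psi>
  assumes cocycle_bilinear: "bilinear_map K L L W \<psi>"
    and cocycle_grade: "\<lbrakk>x \<in> grade L p; y \<in> grade L q\<rbrakk> \<Longrightarrow> \<psi> x y \<in> grade W (p + q)"
    and cocycle_skew: "\<lbrakk>x \<in> grade L p; y \<in> grade L q\<rbrakk> \<Longrightarrow> \<psi> x y = \<ominus>\<^bsub>W\<^esub> ssign W p q (\<psi> y x)"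
    and cocycle_alternating: "x \<in> grade L 0 \<Longrightarrow> \<psi> x x = \<zero>\<^bsub>W\<^esub>"
    and cocycle_jacobi: "\<lbrakk>x \<in> grade L p; y \<in> grade L q; z \<in> grade L r\<rbrakk> \<Longrightarrow>
      ssign W p r (\<psi> (x \<otimes>\<^bsub>L\<^esub> y) z) \<oplus>\<^bsub>W\<^esub> ssign W p q (\<psi> (y \<otimes>\<^bsub>L\<^esub> z) x)
        \<oplus>\<^bsub>W\<^esub> ssign W q r (\<psi> (z \<otimes>\<^bsub>L\<^esub> x) y) = \<zero>\<^bsub>W\<^esub>"
begin

abbreviation "E \<equiv> cocycle_extension L W \<psi>"

lemma ext_simps:
  "carrier E = carrier L \<times> carrier W"
  "(x, v) \<otimes>\<^bsub>E\<^esub> (y, w) = (x \<otimes>\<^bsub>L\<^esub> y, \<psi> x y)"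
  "\<zero>\<^bsub>E\<^esub> = (\<zero>\<^bsub>L\<^esub>, \<zero>\<^bsub>W\<^esub>)"
  "(x, v) \<oplus>\<^bsub>E\<^esub> (y, w) = (x \<oplus>\<^bsub>L\<^esub> y, v \<oplus>\<^bsub>W\<^esub> w)"
  "c \<odot>\<^bsub>E\<^esub> (x, v) = (c \<odot>\<^bsub>L\<^esub> x, c \<odot>\<^bsub>W\<^esub> v)"
  "grade E p = grade L p \<times> grade W p"
  by (simp_all add: cocycle_extension_def)

lemma ext_abelian_group: "abelian_group E"
proof (rule abelian_groupI)
  fix x assume x: "x \<in> carrier E"
  obtain a b where ab: "x = (a, b)" by (cases x)
  show "\<exists>y\<in>carrier E. y \<oplus>\<^bsub>E\<^esub> x = \<zero>\<^bsub>E\<^esub>"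
    by (rule bexI[of _ "(\<ominus>\<^bsub>L\<^esub> a, \<ominus>\<^bsub>W\<^esub> b)"]) (use x in \<open>auto simp: ab ext_simps L.M.l_neg W.M.l_neg\<close>)
qed (auto simp: ext_simps L.M.a_assoc W.M.a_assoc intro: L.M.a_comm W.M.a_comm)

sublocale E: module K E
  by (rule moduleI[OF L.R.is_cring ext_abelian_group])
    (auto simp: ext_simps L.smult_l_distr W.smult_l_distr L.smult_r_distr W.smult_r_distr
      L.smult_assoc1 W.smult_assoc1)

lemma ext_uminus: "\<lbrakk>x \<in> carrier L; w \<in> carrier W\<rbrakk> \<Longrightarrow> \<ominus>\<^bsub>E\<^esub> (x, w) = (\<ominus>\<^bsub>L\<^esub> x, \<ominus>\<^bsub>W\<^esub> w)"
  by (rule E.M.minus_equality) (auto simp: ext_simps L.M.l_neg W.M.l_neg)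

lemma ext_ssign: "\<lbrakk>x \<in> carrier L; w \<in> carrier W\<rbrakk> \<Longrightarrow> ssign E p q (x, w) = (ssign L p q x, ssign W p q w)"
  by (simp add: ssign_def ext_uminus)

lemma ext_supermodule: "supermodule K E"
proof (rule supermoduleI[OF E.module_axioms])
  fix p
  show "submodule (grade E p) K E"
  proof (rule E.submoduleI)
    show "grade E p \<subseteq> carrier E" by (auto simp: ext_simps L.grade_carrier W.grade_carrier)
    show "\<ominus>\<^bsub>E\<^esub> x \<in> grade E p" if "x \<in> grade E p" for x
      using that by (auto simp: ext_simps ext_uminus L.grade_carrier W.grade_carrier L.grade_uminus W.grade_uminus)
  qed (auto simp: ext_simps L.grade_zero W.grade_zero L.grade_add W.grade_add L.grade_smult W.grade_smult)
next
  fix x assume "x \<in> carrier E"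
  then obtain a b where ab: "x = (a, b)" "a \<in> carrier L" "b \<in> carrier W" by (auto simp: ext_simps)
  have "x = (hpart L 0 a, hpart W 0 b) \<oplus>\<^bsub>E\<^esub> (hpart L 1 a, hpart W 1 b)"
    using L.hpart_sum[OF ab(2)] W.hpart_sum[OF ab(3)] by (simp add: ab(1) ext_simps)
  moreover have "(hpart L p a, hpart W p b) \<in> grade E p" for p
    using ab by (simp add: ext_simps L.hpart_grade W.hpart_grade)
  ultimately show "\<exists>y\<in>grade E 0. \<exists>z\<in>grade E 1. x = y \<oplus>\<^bsub>E\<^esub> z" by blast
next
  fix x assume "x \<in> grade E 0" "x \<in> grade E 1"
  then show "x = \<zero>\<^bsub>E\<^esub>" using L.grade_Int W.grade_Int by (auto simp: ext_simps)
qed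

lemmas cocycle_closed = bilinear_map_closed[OF cocycle_bilinear]
  and cocycle_add_left = bilinear_map_add_left[OF cocycle_bilinear]
  and cocycle_add_right = bilinear_map_add_right[OF cocycle_bilinear]
  and cocycle_smult_left = bilinear_map_smult_left[OF cocycle_bilinear]
  and cocycle_smult_right = bilinear_map_smult_right[OF cocycle_bilinear]
  and cocycle_zero_left = bilinear_map_zero_left[OF cocycle_bilinear L.M.abelian_group_axioms
    L.M.abelian_group_axioms W.M.abelian_group_axioms]
  and cocycle_zero_right = bilinear_map_zero_right[OF cocycle_bilinear L.M.abelian_group_axioms
    L.M.abelian_group_axioms W.M.abelian_group_axioms]

lemma ext_superalgebra: "superalgebra K E"
proof (intro superalgebra.intro superalgebra_axioms.intro ext_supermodule)
  show "bilinear_map K E E E (mult E)"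
    unfolding bilinear_map_def
    by (auto simp: ext_simps L.mult_closed cocycle_closed L.add_mult L.mult_add L.smult_mult
        L.mult_smult cocycle_add_left cocycle_add_right cocycle_smult_left cocycle_smult_right)
  show "x \<otimes>\<^bsub>E\<^esub> y \<in> grade E (p + q)" if "x \<in> grade E p" "y \<in> grade E q" for x y p q
    using that by (auto simp: ext_simps L.mult_grade cocycle_grade)
qed

lemma ext_lie_superalgebra: "lie_superalgebra K E"
proof (intro lie_superalgebra.intro lie_superalgebra_axioms.intro ext_superalgebra)
  fix x y p q assume "x \<in> grade E p" "y \<in> grade E q"
  then obtain a v b w where x: "x = (a, v)" "a \<in> grade L p" "v \<in> grade W p"
    and y: "y = (b, w)" "b \<in> grade L q" "w \<in> grade W q" by (auto simp: ext_simps)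
  note c = x(2)[THEN L.grade_carrier] y(2)[THEN L.grade_carrier]
  show "x \<otimes>\<^bsub>E\<^esub> y = \<ominus>\<^bsub>E\<^esub> ssign E p q (y \<otimes>\<^bsub>E\<^esub> x)"
    using c L.super_skew[OF x(2) y(2)] cocycle_skew[OF x(2) y(2)]
    by (simp add: x(1) y(1) ext_simps ext_ssign ext_uminus L.mult_closed cocycle_closed L.ssign_closed W.ssign_closed)
next
  fix x assume "x \<in> grade E 0"
  then show "x \<otimes>\<^bsub>E\<^esub> x = \<zero>\<^bsub>E\<^esub>" by (auto simp: ext_simps L.even_alternating cocycle_alternating)
next
  fix x y z p q r assume "x \<in> grade E p" "y \<in> grade E q" "z \<in> grade E r"
  then obtain a v b w c u where x: "x = (a, v)" "a \<in> grade L p" "v \<in> grade W p"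
    and y: "y = (b, w)" "b \<in> grade L q" "w \<in> grade W q"
    and z: "z = (c, u)" "c \<in> grade L r" "u \<in> grade W r" by (auto simp: ext_simps)
  note cl = x(2)[THEN L.grade_carrier] y(2)[THEN L.grade_carrier] z(2)[THEN L.grade_carrier]
  show "jacobiator E p q r x y z = \<zero>\<^bsub>E\<^esub>"
    using cl L.super_jacobi[OF x(2) y(2) z(2)] cocycle_jacobi[OF x(2) y(2) z(2)]
    by (simp add: jacobiator_def x(1) y(1) z(1) ext_simps ext_ssign L.mult_closed cocycle_closed)
qed

end

lemma cocycle_extension_central:
  assumes "lie_cocycle K L W \<psi>"
  shows "a_kernel (cocycle_extension L W \<psi>) L fst = {\<zero>\<^bsub>L\<^esub>} \<times> carrier W"
    and "central_extension K (cocycle_extension L W \<psi>) L fst"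
proof -
  interpret lie_cocycle K L W \<psi> by fact
  show ker: "a_kernel E L fst = {\<zero>\<^bsub>L\<^esub>} \<times> carrier W"
    by (auto simp: a_kernel_def kernel_def ext_simps)
  have "fst \<in> lie_superalgebra_hom K E L"
    by (rule lie_superalgebra_homI) (auto simp: ext_simps)
  moreover have "fst ` carrier E = carrier L"
    using W.M.zero_closed by (auto simp: ext_simps image_iff)
  moreover have "a_kernel E L fst \<subseteq> lie_centre E"
    unfolding ker by (auto simp: lie_centre_def ext_simps L.zero_mult cocycle_zero_left)
  ultimately show "central_extension K E L fst"
    unfolding central_extension_def using ext_lie_superalgebra L.lie_superalgebra_axioms by blast
qed

section \<open>The coefficient ring of characteristic two and its matrices\<close>

locale coefficient_superalgebra = superalgebra K A + A: ring A
  for K :: "('k, 'c) ring_scheme" (structure) and A :: "('k, 'a) superalgebra" (structure)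
begin

text \<open>
  Let \<open>\<one> = e + f\<close> with \<open>e\<close> even and \<open>f\<close> odd. For homogeneous \<open>x\<close> the product \<open>x f\<close> has the wrong
  degree to contribute to \<open>x = x e + x f\<close>, so \<open>e\<close> is a right unit.
\<close>
lemma one_grade: "\<one>\<^bsub>A\<^esub> \<in> grade A 0"
proof -
  let ?e = "hpart A 0 \<one>\<^bsub>A\<^esub>" and ?f = "hpart A 1 \<one>\<^bsub>A\<^esub>"
  have c: "?e \<in> carrier A" "?f \<in> carrier A" by (simp_all add: hpart_closed)
  have sum: "?e \<oplus>\<^bsub>A\<^esub> ?f = \<one>\<^bsub>A\<^esub>" using hpart_sum[of "\<one>\<^bsub>A\<^esub>"] by simp
  have hom: "x \<otimes>\<^bsub>A\<^esub> ?e = x" if x: "x \<in> grade A p" for x p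
  proof -
    have "x \<otimes>\<^bsub>A\<^esub> ?e \<in> grade A p" "x \<otimes>\<^bsub>A\<^esub> ?f \<in> grade A (p + 1)"
      using mult_grade[OF x hpart_grade[of "\<one>\<^bsub>A\<^esub>" 0]] mult_grade[OF x hpart_grade[of "\<one>\<^bsub>A\<^esub>" 1]] by simp_all
    then have "hpart A p (x \<otimes>\<^bsub>A\<^esub> ?e \<oplus>\<^bsub>A\<^esub> x \<otimes>\<^bsub>A\<^esub> ?f) = x \<otimes>\<^bsub>A\<^esub> ?e" by (rule hpart_eqI)
    moreover have "x \<otimes>\<^bsub>A\<^esub> ?e \<oplus>\<^bsub>A\<^esub> x \<otimes>\<^bsub>A\<^esub> ?f = x"
      using c x grade_carrier by (simp add: mult_add[symmetric] sum)
    ultimately show ?thesis using hpart_same[OF x] by simp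
  qed
  have "x \<otimes>\<^bsub>A\<^esub> ?e = x" if "x \<in> carrier A" for x
    using that by (induction rule: homogeneous_induct) (use hom c in \<open>auto simp: add_mult\<close>)
  then have "?e = \<one>\<^bsub>A\<^esub>" using c A.l_one[of ?e] by (metis A.one_closed)
  then show ?thesis using hpart_grade[of "\<one>\<^bsub>A\<^esub>" 0] by simp
qed

abbreviation "I2 \<equiv> ideal2 A"

lemma ideal2_gens:
  "{a \<oplus>\<^bsub>A\<^esub> a | a. a \<in> carrier A} \<union>
    {a \<otimes>\<^bsub>A\<^esub> b \<ominus>\<^bsub>A\<^esub> ssign A p q (b \<otimes>\<^bsub>A\<^esub> a) | p q a b. a \<in> grade A p \<and> b \<in> grade A q} \<subseteq> carrier A"
  by (auto simp: grade_carrier ssign_closed)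

lemma ideal2_ideal: "ideal I2 A"
  unfolding ideal2_def by (rule A.genideal_ideal[OF ideal2_gens])

lemma ideal2_double: "a \<in> carrier A \<Longrightarrow> a \<oplus>\<^bsub>A\<^esub> a \<in> I2"
  unfolding ideal2_def using A.genideal_self[OF ideal2_gens] by blast

lemma ideal2_commutator:
  "\<lbrakk>a \<in> grade A p; b \<in> grade A q\<rbrakk> \<Longrightarrow> a \<otimes>\<^bsub>A\<^esub> b \<ominus>\<^bsub>A\<^esub> ssign A p q (b \<otimes>\<^bsub>A\<^esub> a) \<in> I2"
  unfolding ideal2_def using A.genideal_self[OF ideal2_gens] by blast

lemma ideal2_minimal:
  assumes "ideal J A" "\<And>a. a \<in> carrier A \<Longrightarrow> a \<oplus>\<^bsub>A\<^esub> a \<in> J"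
    "\<And>p q a b. \<lbrakk>a \<in> grade A p; b \<in> grade A q\<rbrakk> \<Longrightarrow> a \<otimes>\<^bsub>A\<^esub> b \<ominus>\<^bsub>A\<^esub> ssign A p q (b \<otimes>\<^bsub>A\<^esub> a) \<in> J"
  shows "I2 \<subseteq> J"
  unfolding ideal2_def by (rule A.genideal_minimal[OF assms(1)]) (use assms(2,3) in blast)

lemma ideal_of_closed:
  assumes "J \<subseteq> carrier A" "\<zero>\<^bsub>A\<^esub> \<in> J" "\<And>x y. \<lbrakk>x \<in> J; y \<in> J\<rbrakk> \<Longrightarrow> x \<oplus>\<^bsub>A\<^esub> y \<in> J"
    and l: "\<And>x y. \<lbrakk>x \<in> J; y \<in> carrier A\<rbrakk> \<Longrightarrow> y \<otimes>\<^bsub>A\<^esub> x \<in> J"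
    and r: "\<And>x y. \<lbrakk>x \<in> J; y \<in> carrier A\<rbrakk> \<Longrightarrow> x \<otimes>\<^bsub>A\<^esub> y \<in> J"
  shows "ideal J A"
proof (rule idealI)
  have uminus: "\<ominus>\<^bsub>A\<^esub> x \<in> J" if "x \<in> J" for x
  proof -
    have "(\<ominus>\<^bsub>A\<^esub> \<one>\<^bsub>A\<^esub>) \<otimes>\<^bsub>A\<^esub> x \<in> J" using l that by simp
    moreover have "(\<ominus>\<^bsub>A\<^esub> \<one>\<^bsub>A\<^esub>) \<otimes>\<^bsub>A\<^esub> x = \<ominus>\<^bsub>A\<^esub> x" using that assms(1) by (simp add: A.l_minus subset_iff)
    ultimately show ?thesis by simp
  qed
  show "subgroup J (add_monoid A)"
    by (rule group.subgroupI[OF M.a_group]) (use assms(1-3) uminus in \<open>auto simp: a_inv_def\<close>)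
qed (use A.ring_axioms l r in auto)

text \<open>
  As for ideals generated by homogeneous elements: the elements all of whose components lie in
  \<open>I2\<close> form an ideal. The generators \<open>a \<oplus> a\<close> need not be homogeneous, but their components are
  again of this form.
\<close>
lemma ideal2_graded: "graded_ideal K A I2"
proof -
  interpret I: ideal I2 A by (rule ideal2_ideal)
  let ?J = "{x \<in> carrier A. \<forall>p. hpart A p x \<in> I2}"
  have "I2 \<subseteq> ?J"
  proof (rule ideal2_minimal)
    show "ideal ?J A"
    proof (rule ideal_of_closed)
      show "\<zero>\<^bsub>A\<^esub> \<in> ?J" by (simp add: hpart_same grade_zero)
      fix x y assume x: "x \<in> ?J" and y: "y \<in> carrier A"
      have x': "x \<in> carrier A" using x by simp
      show "x \<otimes>\<^bsub>A\<^esub> y \<in> ?J" using y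
      proof (induction rule: homogeneous_induct)
        case (homogeneous q y)
        then show ?case using x by (auto simp: hpart_mult_left mult_closed grade_carrier intro!: I.I_r_closed)
      next
        case (add y z)
        then show ?case using x' by (auto simp: mult_add hpart_add mult_closed)
      qed
      show "y \<otimes>\<^bsub>A\<^esub> x \<in> ?J" using y
      proof (induction rule: homogeneous_induct)
        case (homogeneous q y)
        then show ?case using x by (auto simp: hpart_mult_right mult_closed grade_carrier intro!: I.I_l_closed)
      next
        case (add y z)
        then show ?case using x' by (auto simp: add_mult hpart_add mult_closed)
      qed
    qed (auto simp: hpart_add)
    show "a \<oplus>\<^bsub>A\<^esub> a \<in> ?J" if "a \<in> carrier A" for a
      using that by (simp add: hpart_add ideal2_double hpart_closed)
    show "a \<otimes>\<^bsub>A\<^esub> b \<ominus>\<^bsub>A\<^esub> ssign A p q (b \<otimes>\<^bsub>A\<^esub> a) \<in> ?J"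
      if ab: "a \<in> grade A p" "b \<in> grade A q" for p q a b
    proof -
      let ?x = "a \<otimes>\<^bsub>A\<^esub> b \<ominus>\<^bsub>A\<^esub> ssign A p q (b \<otimes>\<^bsub>A\<^esub> a)"
      have "b \<otimes>\<^bsub>A\<^esub> a \<in> grade A (p + q)" using mult_grade[OF ab(2,1)] by (simp add: add.commute)
      then have x: "?x \<in> grade A (p + q)" using mult_grade[OF ab] by (intro grade_minus grade_ssign)
      have "hpart A r ?x \<in> I2" for r
        using hpart_same[OF x] hpart_other[OF x, of r] ideal2_commutator[OF ab] I.zero_closed
        by (cases "p + q = r") auto
      then show ?thesis using x grade_carrier by blast
    qed
  qed
  moreover have "submodule I2 K A"
  proof (rule submoduleI)
    show "c \<odot>\<^bsub>A\<^esub> x \<in> I2" if "c \<in> carrier K" "x \<in> I2" for c x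
    proof -
      have "c \<odot>\<^bsub>A\<^esub> x = (c \<odot>\<^bsub>A\<^esub> \<one>\<^bsub>A\<^esub>) \<otimes>\<^bsub>A\<^esub> x" using that I.a_Hcarr by (simp add: smult_mult)
      then show ?thesis using that I.I_l_closed by simp
    qed
  qed (use I.a_subset in auto)
  ultimately show ?thesis unfolding graded_ideal_def
    by (intro conjI ballI allI I.I_l_closed I.I_r_closed) auto
qed

sublocale A2: graded_quotient K A I2
  by unfold_locales (rule ideal2_graded)

abbreviation "B \<equiv> super_quot A I2"
abbreviation cls ("\<langle>_\<rangle>") where "cls x \<equiv> I2 +>\<^bsub>A\<^esub> x"

lemma A2_quot: "A2 A = B" by (simp add: A2_def)

lemma B_one: "\<one>\<^bsub>B\<^esub> = cls \<one>\<^bsub>A\<^esub>"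
  by (simp add: super_quot_def FactRing_def)

lemma B_double:
  assumes "x \<in> carrier B"
  shows "x \<oplus>\<^bsub>B\<^esub> x = \<zero>\<^bsub>B\<^esub>"
proof -
  obtain a where a: "a \<in> carrier A" "x = cls a" using assms by (auto simp: A2.quot_carrier)
  then have "cls (a \<oplus>\<^bsub>A\<^esub> a) = I2" by (simp only: A2.coset_zero_iff M.a_closed ideal2_double)
  then show ?thesis using a by (simp only: A2.quot_add A2.quot_zero)
qed

lemma B_uminus: "x \<in> carrier B \<Longrightarrow> \<ominus>\<^bsub>B\<^esub> x = x"
  using abelian_group.minus_equality[OF A2.quot_abelian_group B_double] by simp

text \<open>
  Supercommutators vanish in \<open>A\<^sub>2\<close>, and there a sign does not change an element.
\<close>
lemma B_comm:
  assumes "x \<in> carrier B" "y \<in> carrier B"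
  shows "x \<otimes>\<^bsub>B\<^esub> y = y \<otimes>\<^bsub>B\<^esub> x"
proof -
  interpret Q: superalgebra K B by (rule A2.quot_superalgebra)
  have hom: "x \<otimes>\<^bsub>B\<^esub> y = y \<otimes>\<^bsub>B\<^esub> x" if xy: "x \<in> grade B p" "y \<in> grade B q" for x y p q
  proof -
    obtain a b where ab: "a \<in> grade A p" "b \<in> grade A q" "x = cls a" "y = cls b"
      using xy by (auto simp: A2.quot_grade)
    note c = ab(1,2)[THEN grade_carrier]
    have "cls (a \<otimes>\<^bsub>A\<^esub> b) = ssign B p q (cls (b \<otimes>\<^bsub>A\<^esub> a))"
      using A2.coset_eq_iff ideal2_commutator[OF ab(1,2)] c by (simp add: A2.quot_ssign ssign_closed)
    also have "\<dots> = cls (b \<otimes>\<^bsub>A\<^esub> a)" using c B_uminus by (simp add: ssign_def A2.quot_carrier)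
    finally show ?thesis using ab c by (simp add: A2.quot_mult)
  qed
  show ?thesis using assms(1)
  proof (induction rule: Q.homogeneous_induct)
    case (homogeneous p x)
    show ?case using assms(2)
      by (induction rule: Q.homogeneous_induct)
        (use homogeneous hom Q.grade_carrier in \<open>auto simp: Q.add_mult Q.mult_add\<close>)
  next
    case (add x z)
    then show ?case using assms(2) by (simp add: Q.add_mult Q.mult_add)
  qed
qed

lemma B_cring: "cring B"
proof (rule cringI[OF A2.quot_abelian_group])
  show "comm_monoid B"
  proof (rule comm_monoidI)
    show "x \<otimes>\<^bsub>B\<^esub> y = y \<otimes>\<^bsub>B\<^esub> x" if "x \<in> carrier B" "y \<in> carrier B" for x y
      using that by (rule B_comm)
  qed (auto simp: A2.quot_carrier A2.quot_mult B_one A.m_assoc)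
qed (auto simp: A2.quot_carrier A2.quot_add A2.quot_mult mult_closed add_mult)

end

lemma coefficient_superalgebraI: "associative_superalgebra K A \<Longrightarrow> coefficient_superalgebra K A"
  unfolding associative_superalgebra_def coefficient_superalgebra_def .

text \<open>
  The supermodules of matrices over \<open>A\<^sub>2\<close> and the kernel \<open>\<W>\<close> are both families of this kind; the
  shift \<open>e\<close> accounts for the parities of matrix positions, respectively for the change of parity.
\<close>
lemma supermodule_PiE:
  fixes S :: "('k, 'i \<Rightarrow> 'v) superalgebra"
  assumes "supermodule K M"
    and carrier: "carrier S = I \<rightarrow>\<^sub>E carrier M"
    and zero: "\<zero>\<^bsub>S\<^esub> = (\<lambda>i\<in>I. \<zero>\<^bsub>M\<^esub>)"
    and add: "\<And>v w. v \<oplus>\<^bsub>S\<^esub> w = (\<lambda>i\<in>I. v i \<oplus>\<^bsub>M\<^esub> w i)"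
    and smult: "\<And>c v. c \<odot>\<^bsub>S\<^esub> v = (\<lambda>i\<in>I. c \<odot>\<^bsub>M\<^esub> v i)"
    and grade: "\<And>p. grade S p = (\<Pi>\<^sub>E i\<in>I. grade M (p + e i))"
  shows "supermodule K S"
proof -
  interpret M: supermodule K M by fact
  note simps = carrier zero add smult grade
  have ext: "v = w \<longleftrightarrow> (\<forall>i\<in>I. v i = w i)" if "v \<in> carrier S" "w \<in> carrier S" for v w
    using that unfolding carrier by (metis PiE_ext)
  have val: "v i \<in> carrier M" if "v \<in> carrier S" "i \<in> I" for v i using that by (auto simp: carrier)
  have closed: "v \<oplus>\<^bsub>S\<^esub> w \<in> carrier S" if "v \<in> carrier S" "w \<in> carrier S" for v w
    using that by (auto simp: simps)
  have sclosed: "c \<odot>\<^bsub>S\<^esub> v \<in> carrier S" if "c \<in> carrier K" "v \<in> carrier S" for c v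
    using that by (auto simp: simps)
  have zclosed: "\<zero>\<^bsub>S\<^esub> \<in> carrier S" by (auto simp: simps)
  have ab: "abelian_group S"
  proof (rule abelian_groupI)
    fix v w u assume *: "v \<in> carrier S" "w \<in> carrier S" "u \<in> carrier S"
    show "v \<oplus>\<^bsub>S\<^esub> w \<oplus>\<^bsub>S\<^esub> u = v \<oplus>\<^bsub>S\<^esub> (w \<oplus>\<^bsub>S\<^esub> u)"
      using * val by (auto simp: add M.M.a_assoc)
  next
    fix v w assume *: "v \<in> carrier S" "w \<in> carrier S"
    show "v \<oplus>\<^bsub>S\<^esub> w = w \<oplus>\<^bsub>S\<^esub> v"
      using * val by (auto simp: add M.M.a_comm)
  next
    fix v assume v: "v \<in> carrier S"
    have "\<zero>\<^bsub>S\<^esub> \<oplus>\<^bsub>S\<^esub> v \<in> carrier S" using v closed zclosed by blast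
    then show "\<zero>\<^bsub>S\<^esub> \<oplus>\<^bsub>S\<^esub> v = v" using v val by (subst ext) (auto simp: add zero)
    have "(\<lambda>i\<in>I. \<ominus>\<^bsub>M\<^esub> v i) \<oplus>\<^bsub>S\<^esub> v = \<zero>\<^bsub>S\<^esub>" using v val by (auto simp: add zero M.M.l_neg)
    moreover have "(\<lambda>i\<in>I. \<ominus>\<^bsub>M\<^esub> v i) \<in> carrier S" using v by (auto simp: carrier)
    ultimately show "\<exists>w\<in>carrier S. w \<oplus>\<^bsub>S\<^esub> v = \<zero>\<^bsub>S\<^esub>" by blast
  qed (use closed zclosed in auto)
  have mod: "module K S"
  proof (rule moduleI[OF M.R.is_cring ab])
    show "\<one>\<^bsub>K\<^esub> \<odot>\<^bsub>S\<^esub> v = v" if "v \<in> carrier S" for v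
      using that sclosed[of "\<one>\<^bsub>K\<^esub>" v] val by (subst ext) (auto simp: smult)
  qed (use val sclosed in \<open>auto simp: add smult M.smult_l_distr M.smult_r_distr M.smult_assoc1\<close>)
  interpret S: module K S by (rule mod)
  have uminus: "\<ominus>\<^bsub>S\<^esub> v = (\<lambda>i\<in>I. \<ominus>\<^bsub>M\<^esub> v i)" if v: "v \<in> carrier S" for v
  proof (rule S.M.minus_equality)
    show "(\<lambda>i\<in>I. \<ominus>\<^bsub>M\<^esub> v i) \<oplus>\<^bsub>S\<^esub> v = \<zero>\<^bsub>S\<^esub>"
      using val[OF v] by (auto simp: add zero M.M.l_neg restrict_def)
  qed (use v in \<open>auto simp: carrier\<close>)
  show ?thesis
  proof (rule supermoduleI[OF mod])
    fix p
    have sub: "grade S p \<subseteq> carrier S" using M.grade_carrier by (auto simp: grade carrier intro!: PiE_mono)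
    show "submodule (grade S p) K S"
    proof (rule S.submoduleI[OF sub])
      show "\<ominus>\<^bsub>S\<^esub> v \<in> grade S p" if "v \<in> grade S p" for v
      proof -
        have "v \<in> carrier S" using that sub by blast
        then show ?thesis using that by (auto simp: uminus grade intro!: M.grade_uminus)
      qed
    qed (auto simp: simps intro!: M.grade_zero M.grade_add M.grade_smult)
  next
    fix v assume v: "v \<in> carrier S"
    let ?part = "\<lambda>p. \<lambda>i\<in>I. hpart M (p + e i) (v i)"
    have "?part p \<in> grade S p" for p using v by (auto simp: grade carrier intro!: M.hpart_grade)
    moreover have "v = ?part 0 \<oplus>\<^bsub>S\<^esub> ?part 1"
    proof -
      have "?part 0 \<oplus>\<^bsub>S\<^esub> ?part 1 \<in> carrier S"
        using val[OF v] by (auto simp: add carrier M.hpart_closed)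
      moreover have "v i = hpart M (e i) (v i) \<oplus>\<^bsub>M\<^esub> hpart M (1 + e i) (v i)" if i: "i \<in> I" for i
      proof (cases "e i = 0")
        case True
        show ?thesis unfolding True add_0_right by (rule M.hpart_sum[OF val[OF v i]])
      next
        case False
        then have e: "e i = 1" "1 + 1 = (0::bit)" by simp_all
        have cl: "hpart M p (v i) \<in> carrier M" for p using M.hpart_closed[OF val[OF v i]] .
        show ?thesis unfolding e
          by (rule trans[OF M.hpart_sum[OF val[OF v i]] M.M.a_comm[OF cl cl]])
      qed
      ultimately show ?thesis using v by (subst ext) (simp_all add: add)
    qed
    ultimately show "\<exists>y\<in>grade S 0. \<exists>z\<in>grade S 1. v = y \<oplus>\<^bsub>S\<^esub> z" by blast
  next
    fix v assume v: "v \<in> grade S 0" "v \<in> grade S 1"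
    have "v \<in> carrier S" using v(1) M.grade_carrier by (auto simp: grade carrier PiE_mem intro!: PiE_I)
    moreover have "v i = \<zero>\<^bsub>M\<^esub>" if "i \<in> I" for i
      using v that M.grade_disjoint[of "v i" "0 + e i" "1 + e i"] by (auto simp: grade PiE_mem)
    ultimately show "v = \<zero>\<^bsub>S\<^esub>" using zclosed by (subst ext) (auto simp: zero)
  qed
qed

lemma (in abelian_monoid) finsum_swap:
  assumes "finite S" "finite T" "\<And>i j. \<lbrakk>i \<in> S; j \<in> T\<rbrakk> \<Longrightarrow> f i j \<in> carrier G"
  shows "(\<Oplus>i\<in>S. \<Oplus>j\<in>T. f i j) = (\<Oplus>j\<in>T. \<Oplus>i\<in>S. f i j)"
  using assms(1,3)
proof (induction S rule: finite_induct)
  case empty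
  then show ?case by (simp add: finsum_zero)
next
  case (insert x S)
  have "(\<Oplus>j\<in>T. \<Oplus>i\<in>insert x S. f i j) = (\<Oplus>j\<in>T. f x j \<oplus> (\<Oplus>i\<in>S. f i j))"
    using insert by (intro finsum_cong') (auto intro!: finsum_closed)
  also have "\<dots> = (\<Oplus>j\<in>T. f x j) \<oplus> (\<Oplus>j\<in>T. \<Oplus>i\<in>S. f i j)"
    using insert by (intro finsum_addf) (auto intro!: finsum_closed)
  finally show ?case using insert by (subst finsum_insert) (auto intro!: finsum_closed)
qed

definition mat_mult :: "('b, 'd) ring_scheme \<Rightarrow> 'u set \<Rightarrow> ('u \<times> 'u \<Rightarrow> 'b) \<Rightarrow> ('u \<times> 'u \<Rightarrow> 'b) \<Rightarrow> 'u \<times> 'u \<Rightarrow> 'b" where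
  "mat_mult B U X Y = (\<lambda>(u, v)\<in>U \<times> U. \<Oplus>\<^bsub>B\<^esub>w\<in>U. X (u, w) \<otimes>\<^bsub>B\<^esub> Y (w, v))"

text \<open>
  Over a commutative ring of characteristic two, signs and supercommutators are invisible: the
  bracket of matrices is \<open>XY + YX\<close>.
\<close>
definition gl_superalgebra :: "('k, 'b) superalgebra \<Rightarrow> 'u set \<Rightarrow> ('u \<Rightarrow> bit) \<Rightarrow> ('k, 'u \<times> 'u \<Rightarrow> 'b) superalgebra" where
  "gl_superalgebra B U e =
    \<lparr>carrier = U \<times> U \<rightarrow>\<^sub>E carrier B,
     mult = (\<lambda>X Y. \<lambda>i\<in>U \<times> U. mat_mult B U X Y i \<oplus>\<^bsub>B\<^esub> mat_mult B U Y X i),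
     one = (\<lambda>_\<in>U \<times> U. \<zero>\<^bsub>B\<^esub>),
     zero = (\<lambda>_\<in>U \<times> U. \<zero>\<^bsub>B\<^esub>),
     add = (\<lambda>X Y. \<lambda>i\<in>U \<times> U. X i \<oplus>\<^bsub>B\<^esub> Y i),
     smult = (\<lambda>c X. \<lambda>i\<in>U \<times> U. c \<odot>\<^bsub>B\<^esub> X i),
     grade = (\<lambda>p. \<Pi>\<^sub>E i\<in>U \<times> U. grade B (p + (e (fst i) + e (snd i))))\<rparr>"

locale char2_matrices = superalgebra K B + B: cring B
  for K :: "('k, 'c) ring_scheme" (structure) and B :: "('k, 'b) superalgebra" (structure) +
  fixes U :: "'u set" and e :: "'u \<Rightarrow> bit"
  assumes char2: "x \<in> carrier B \<Longrightarrow> x \<oplus>\<^bsub>B\<^esub> x = \<zero>\<^bsub>B\<^esub>"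
    and finite_U: "finite U"
begin

abbreviation "gl \<equiv> gl_superalgebra B U e"
abbreviation mm (infixl "\<bullet>" 70) where "X \<bullet> Y \<equiv> mat_mult B U X Y"

lemma gl_simps:
  "carrier gl = U \<times> U \<rightarrow>\<^sub>E carrier B"
  "\<zero>\<^bsub>gl\<^esub> = (\<lambda>i\<in>U \<times> U. \<zero>\<^bsub>B\<^esub>)"
  "X \<oplus>\<^bsub>gl\<^esub> Y = (\<lambda>i\<in>U \<times> U. X i \<oplus>\<^bsub>B\<^esub> Y i)"
  "c \<odot>\<^bsub>gl\<^esub> X = (\<lambda>i\<in>U \<times> U. c \<odot>\<^bsub>B\<^esub> X i)"
  "grade gl p = (\<Pi>\<^sub>E i\<in>U \<times> U. grade B (p + (e (fst i) + e (snd i))))"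
  by (simp_all add: gl_superalgebra_def)

sublocale gl: supermodule K gl
  by (rule supermodule_PiE[OF supermodule_axioms gl_simps])

lemma gl_entry: "\<lbrakk>X \<in> carrier gl; u \<in> U; v \<in> U\<rbrakk> \<Longrightarrow> X (u, v) \<in> carrier B"
  by (auto simp: gl_simps)

lemma gl_eqI: "\<lbrakk>X \<in> carrier gl; Y \<in> carrier gl; \<And>u v. \<lbrakk>u \<in> U; v \<in> U\<rbrakk> \<Longrightarrow> X (u, v) = Y (u, v)\<rbrakk> \<Longrightarrow> X = Y"
  unfolding gl_simps by (rule PiE_ext) auto

lemma mm_entry: "\<lbrakk>u \<in> U; v \<in> U\<rbrakk> \<Longrightarrow> (X \<bullet> Y) (u, v) = (\<Oplus>\<^bsub>B\<^esub>w\<in>U. X (u, w) \<otimes>\<^bsub>B\<^esub> Y (w, v))"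
  by (simp add: mat_mult_def)

lemma mm_closed:
  assumes "X \<in> carrier gl" "Y \<in> carrier gl"
  shows "X \<bullet> Y \<in> carrier gl"
  using gl_entry[OF assms(1)] gl_entry[OF assms(2)]
  unfolding gl_simps mat_mult_def by (auto intro!: M.finsum_closed)

lemma gl_add_entry: "\<lbrakk>u \<in> U; v \<in> U\<rbrakk> \<Longrightarrow> (X \<oplus>\<^bsub>gl\<^esub> Y) (u, v) = X (u, v) \<oplus>\<^bsub>B\<^esub> Y (u, v)"
  by (simp add: gl_simps)

lemma gl_bracket: "X \<otimes>\<^bsub>gl\<^esub> Y = X \<bullet> Y \<oplus>\<^bsub>gl\<^esub> Y \<bullet> X"
  by (simp add: gl_superalgebra_def)

lemma mm_add_left:
  assumes "X \<in> carrier gl" "Y \<in> carrier gl" "Z \<in> carrier gl"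
  shows "(X \<oplus>\<^bsub>gl\<^esub> Y) \<bullet> Z = X \<bullet> Z \<oplus>\<^bsub>gl\<^esub> Y \<bullet> Z"
proof (rule gl_eqI)
  fix u v assume uv: "u \<in> U" "v \<in> U"
  have "((X \<oplus>\<^bsub>gl\<^esub> Y) \<bullet> Z) (u, v) =
      (\<Oplus>\<^bsub>B\<^esub>w\<in>U. X (u, w) \<otimes>\<^bsub>B\<^esub> Z (w, v) \<oplus>\<^bsub>B\<^esub> Y (u, w) \<otimes>\<^bsub>B\<^esub> Z (w, v))"
    unfolding mm_entry[OF uv] using uv assms
    by (intro M.finsum_cong') (auto simp: gl_add_entry B.l_distr gl_entry)
  also have "\<dots> = (X \<bullet> Z) (u, v) \<oplus>\<^bsub>B\<^esub> (Y \<bullet> Z) (u, v)"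
    unfolding mm_entry[OF uv] using uv assms by (intro M.finsum_addf) (auto simp: gl_entry)
  finally show "((X \<oplus>\<^bsub>gl\<^esub> Y) \<bullet> Z) (u, v) = (X \<bullet> Z \<oplus>\<^bsub>gl\<^esub> Y \<bullet> Z) (u, v)"
    using uv by (simp add: gl_add_entry)
qed (use assms in \<open>auto intro: mm_closed\<close>)

lemma mm_add_right:
  assumes "X \<in> carrier gl" "Y \<in> carrier gl" "Z \<in> carrier gl"
  shows "X \<bullet> (Y \<oplus>\<^bsub>gl\<^esub> Z) = X \<bullet> Y \<oplus>\<^bsub>gl\<^esub> X \<bullet> Z"
proof (rule gl_eqI)
  fix u v assume uv: "u \<in> U" "v \<in> U"
  have "(X \<bullet> (Y \<oplus>\<^bsub>gl\<^esub> Z)) (u, v) =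
      (\<Oplus>\<^bsub>B\<^esub>w\<in>U. X (u, w) \<otimes>\<^bsub>B\<^esub> Y (w, v) \<oplus>\<^bsub>B\<^esub> X (u, w) \<otimes>\<^bsub>B\<^esub> Z (w, v))"
    unfolding mm_entry[OF uv] using uv assms
    by (intro M.finsum_cong') (auto simp: gl_add_entry B.r_distr gl_entry)
  also have "\<dots> = (X \<bullet> Y) (u, v) \<oplus>\<^bsub>B\<^esub> (X \<bullet> Z) (u, v)"
    unfolding mm_entry[OF uv] using uv assms by (intro M.finsum_addf) (auto simp: gl_entry)
  finally show "(X \<bullet> (Y \<oplus>\<^bsub>gl\<^esub> Z)) (u, v) = (X \<bullet> Y \<oplus>\<^bsub>gl\<^esub> X \<bullet> Z) (u, v)"
    using uv by (simp add: gl_add_entry)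
qed (use assms in \<open>auto intro: mm_closed\<close>)

lemma mm_smult:
  assumes "c \<in> carrier K" "X \<in> carrier gl" "Y \<in> carrier gl"
  shows "(c \<odot>\<^bsub>gl\<^esub> X) \<bullet> Y = c \<odot>\<^bsub>gl\<^esub> (X \<bullet> Y)" "X \<bullet> (c \<odot>\<^bsub>gl\<^esub> Y) = c \<odot>\<^bsub>gl\<^esub> (X \<bullet> Y)"
proof -
  have c: "c \<odot>\<^bsub>gl\<^esub> X \<in> carrier gl" "c \<odot>\<^bsub>gl\<^esub> Y \<in> carrier gl" "c \<odot>\<^bsub>gl\<^esub> (X \<bullet> Y) \<in> carrier gl"
    using assms by (auto intro: mm_closed)
  have *: "c \<odot>\<^bsub>B\<^esub> (X \<bullet> Y) (u, v) = (\<Oplus>\<^bsub>B\<^esub>w\<in>U. c \<odot>\<^bsub>B\<^esub> (X (u, w) \<otimes>\<^bsub>B\<^esub> Y (w, v)))" if "u \<in> U" "v \<in> U" for u v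
    unfolding mm_entry[OF that] using that assms finite_U
    by (intro finsum_smult_ldistr) (auto simp: gl_entry)
  show "(c \<odot>\<^bsub>gl\<^esub> X) \<bullet> Y = c \<odot>\<^bsub>gl\<^esub> (X \<bullet> Y)"
  proof (rule gl_eqI[OF mm_closed[OF c(1) assms(3)] c(3)])
    fix u v assume uv: "u \<in> U" "v \<in> U"
    have "((c \<odot>\<^bsub>gl\<^esub> X) \<bullet> Y) (u, v) = (\<Oplus>\<^bsub>B\<^esub>w\<in>U. c \<odot>\<^bsub>B\<^esub> (X (u, w) \<otimes>\<^bsub>B\<^esub> Y (w, v)))"
      unfolding mm_entry[OF uv] using uv assms
      by (intro M.finsum_cong') (auto simp: gl_simps(4) smult_mult gl_entry)
    then show "((c \<odot>\<^bsub>gl\<^esub> X) \<bullet> Y) (u, v) = (c \<odot>\<^bsub>gl\<^esub> (X \<bullet> Y)) (u, v)"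
      using uv *[OF uv] by (simp add: gl_simps(4))
  qed
  show "X \<bullet> (c \<odot>\<^bsub>gl\<^esub> Y) = c \<odot>\<^bsub>gl\<^esub> (X \<bullet> Y)"
  proof (rule gl_eqI[OF mm_closed[OF assms(2) c(2)] c(3)])
    fix u v assume uv: "u \<in> U" "v \<in> U"
    have "(X \<bullet> (c \<odot>\<^bsub>gl\<^esub> Y)) (u, v) = (\<Oplus>\<^bsub>B\<^esub>w\<in>U. c \<odot>\<^bsub>B\<^esub> (X (u, w) \<otimes>\<^bsub>B\<^esub> Y (w, v)))"
      unfolding mm_entry[OF uv] using uv assms
      by (intro M.finsum_cong') (auto simp: gl_simps(4) mult_smult gl_entry)
    then show "(X \<bullet> (c \<odot>\<^bsub>gl\<^esub> Y)) (u, v) = (c \<odot>\<^bsub>gl\<^esub> (X \<bullet> Y)) (u, v)"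
      using uv *[OF uv] by (simp add: gl_simps(4))
  qed
qed

lemma mm_assoc:
  assumes X: "X \<in> carrier gl" and Y: "Y \<in> carrier gl" and Z: "Z \<in> carrier gl"
  shows "X \<bullet> Y \<bullet> Z = X \<bullet> (Y \<bullet> Z)"
proof (rule gl_eqI)
  fix u v assume uv: "u \<in> U" "v \<in> U"
  note en = gl_entry[OF X] gl_entry[OF Y] gl_entry[OF Z]
  have "(X \<bullet> Y \<bullet> Z) (u, v) = (\<Oplus>\<^bsub>B\<^esub>w\<in>U. \<Oplus>\<^bsub>B\<^esub>x\<in>U. X (u, x) \<otimes>\<^bsub>B\<^esub> Y (x, w) \<otimes>\<^bsub>B\<^esub> Z (w, v))"
    unfolding mm_entry[OF uv]
    using uv en finite_U by (intro M.finsum_cong') (auto simp: mm_entry B.finsum_ldistr Pi_def)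
  also have "\<dots> = (\<Oplus>\<^bsub>B\<^esub>x\<in>U. \<Oplus>\<^bsub>B\<^esub>w\<in>U. X (u, x) \<otimes>\<^bsub>B\<^esub> Y (x, w) \<otimes>\<^bsub>B\<^esub> Z (w, v))"
    using uv en finite_U by (intro M.finsum_swap) auto
  also have "\<dots> = (\<Oplus>\<^bsub>B\<^esub>x\<in>U. X (u, x) \<otimes>\<^bsub>B\<^esub> (\<Oplus>\<^bsub>B\<^esub>w\<in>U. Y (x, w) \<otimes>\<^bsub>B\<^esub> Z (w, v)))"
    using uv en finite_U by (intro M.finsum_cong') (auto simp: B.finsum_rdistr B.m_assoc Pi_def intro!: M.finsum_cong')
  also have "\<dots> = (X \<bullet> (Y \<bullet> Z)) (u, v)"
    unfolding mm_entry[OF uv] using uv en by (intro M.finsum_cong') (auto simp: mm_entry intro!: M.finsum_closed)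
  finally show "(X \<bullet> Y \<bullet> Z) (u, v) = (X \<bullet> (Y \<bullet> Z)) (u, v)" .
qed (use assms in \<open>auto intro: mm_closed\<close>)

lemma gl_double: "X \<in> carrier gl \<Longrightarrow> X \<oplus>\<^bsub>gl\<^esub> X = \<zero>\<^bsub>gl\<^esub>"
  unfolding gl_simps by (intro restrict_ext char2) (auto dest: PiE_mem)

lemma gl_uminus: "X \<in> carrier gl \<Longrightarrow> \<ominus>\<^bsub>gl\<^esub> X = X"
  using gl.M.minus_equality[OF gl_double] by simp

lemma gl_ssign: "X \<in> carrier gl \<Longrightarrow> ssign gl p q X = X"
  by (simp add: ssign_def gl_uminus)

lemma gl_cancel: "\<lbrakk>X \<in> carrier gl; Y \<in> carrier gl\<rbrakk> \<Longrightarrow> X \<oplus>\<^bsub>gl\<^esub> (X \<oplus>\<^bsub>gl\<^esub> Y) = Y"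
  by (simp add: gl.M.a_assoc[symmetric] gl_double)

lemma mm_grade:
  assumes X: "X \<in> grade gl p" and Y: "Y \<in> grade gl q"
  shows "X \<bullet> Y \<in> grade gl (p + q)"
proof -
  have "(X \<bullet> Y) (u, v) \<in> grade B (p + q + (e u + e v))" if uv: "u \<in> U" "v \<in> U" for u v
    unfolding mm_entry[OF uv]
  proof (rule finsum_grade[OF finite_U])
    fix w assume w: "w \<in> U"
    have "X (u, w) \<in> grade B (p + (e u + e w))" "Y (w, v) \<in> grade B (q + (e w + e v))"
      using PiE_mem[OF X[unfolded gl_simps(5)], of "(u, w)"] PiE_mem[OF Y[unfolded gl_simps(5)], of "(w, v)"] uv w
      by simp_all
    then have "X (u, w) \<otimes>\<^bsub>B\<^esub> Y (w, v) \<in> grade B (p + (e u + e w) + (q + (e w + e v)))"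
      by (rule mult_grade)
    moreover have "p + (e u + e w) + (q + (e w + e v)) = p + q + (e u + e v)"
      using bit_cases[of "e w"] by (auto simp: ac_simps)
    ultimately show "X (u, w) \<otimes>\<^bsub>B\<^esub> Y (w, v) \<in> grade B (p + q + (e u + e v))" by simp
  qed
  moreover have "X \<bullet> Y \<in> carrier gl" using X Y gl.grade_carrier mm_closed by blast
  ultimately show ?thesis unfolding gl_simps(1,5) PiE_iff by auto
qed

lemma gl_superalgebra: "superalgebra K gl"
proof (intro superalgebra.intro superalgebra_axioms.intro gl.supermodule_axioms)
  show "bilinear_map K gl gl gl (mult gl)"
    unfolding bilinear_map_def
    by (auto simp: gl_bracket mm_closed mm_add_left mm_add_right mm_smult gl.smult_r_distr gl.M.a_ac)
  fix X Y p q assume XY: "X \<in> grade gl p" "Y \<in> grade gl q"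
  show "X \<otimes>\<^bsub>gl\<^esub> Y \<in> grade gl (p + q)"
    unfolding gl_bracket using mm_grade[OF XY] mm_grade[OF XY(2,1)]
    by (simp add: gl.grade_add add.commute[of q])
qed

text \<open>
  Expanding the three brackets of brackets gives each of the six products of \<open>X\<close>, \<open>Y\<close>, \<open>Z\<close> twice.
\<close>
lemma gl_lie_superalgebra: "lie_superalgebra K gl"
proof (intro lie_superalgebra.intro lie_superalgebra_axioms.intro gl_superalgebra)
  fix X Y p q assume "X \<in> grade gl p" "Y \<in> grade gl q"
  then have "X \<in> carrier gl" "Y \<in> carrier gl" using gl.grade_carrier by blast+
  then show "X \<otimes>\<^bsub>gl\<^esub> Y = \<ominus>\<^bsub>gl\<^esub> ssign gl p q (Y \<otimes>\<^bsub>gl\<^esub> X)"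
    by (simp add: gl_bracket gl_ssign gl_uminus mm_closed gl.M.a_comm)
next
  fix X assume "X \<in> grade gl 0"
  then show "X \<otimes>\<^bsub>gl\<^esub> X = \<zero>\<^bsub>gl\<^esub>" using gl.grade_carrier by (simp add: gl_bracket gl_double mm_closed)
next
  fix X Y Z p q r assume "X \<in> grade gl p" "Y \<in> grade gl q" "Z \<in> grade gl r"
  then have c: "X \<in> carrier gl" "Y \<in> carrier gl" "Z \<in> carrier gl" using gl.grade_carrier by blast+
  let ?a = "X \<bullet> (Y \<bullet> Z)" and ?b = "Y \<bullet> (X \<bullet> Z)" and ?c = "Z \<bullet> (X \<bullet> Y)"
    and ?d = "Z \<bullet> (Y \<bullet> X)" and ?e = "X \<bullet> (Z \<bullet> Y)" and ?f = "Y \<bullet> (Z \<bullet> X)"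
  have cl: "?a \<in> carrier gl" "?b \<in> carrier gl" "?c \<in> carrier gl" "?d \<in> carrier gl" "?e \<in> carrier gl" "?f \<in> carrier gl"
    using c by (auto intro!: mm_closed)
  have "jacobiator gl p q r X Y Z =
     (?a \<oplus>\<^bsub>gl\<^esub> ?b \<oplus>\<^bsub>gl\<^esub> (?c \<oplus>\<^bsub>gl\<^esub> ?d)) \<oplus>\<^bsub>gl\<^esub> (?f \<oplus>\<^bsub>gl\<^esub> ?d \<oplus>\<^bsub>gl\<^esub> (?a \<oplus>\<^bsub>gl\<^esub> ?e)) \<oplus>\<^bsub>gl\<^esub> (?c \<oplus>\<^bsub>gl\<^esub> ?e \<oplus>\<^bsub>gl\<^esub> (?f \<oplus>\<^bsub>gl\<^esub> ?b))"
    using c by (simp add: jacobiator_def gl_ssign gl_bracket mm_closed mm_add_left mm_add_right mm_assoc)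
  also have "\<dots> = \<zero>\<^bsub>gl\<^esub>"
    using cl by (simp add: gl.M.a_ac gl_cancel gl_double)
  finally show "jacobiator gl p q r X Y Z = \<zero>\<^bsub>gl\<^esub>" .
qed

end

section \<open>Relations and a spanning set of the Steinberg Lie superalgebra\<close>

lemma (in abelian_group) solve_middle:
  assumes "a \<in> carrier G" "b \<in> carrier G" "c \<in> carrier G"
  shows "a \<oplus> \<ominus> b \<oplus> c = \<zero> \<Longrightarrow> b = a \<oplus> c" "\<ominus> a \<oplus> b \<oplus> \<ominus> c = \<zero> \<Longrightarrow> b = a \<oplus> c"
proof -
  assume "a \<oplus> \<ominus> b \<oplus> c = \<zero>"
  then have "(a \<oplus> c) \<ominus> b = \<zero>" using assms by (simp add: a_minus_def a_ac)
  then show "b = a \<oplus> c" using assms minus_eq_zero_iff[of "a \<oplus> c" b] by simp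
next
  assume "\<ominus> a \<oplus> b \<oplus> \<ominus> c = \<zero>"
  then have "b \<ominus> (a \<oplus> c) = \<zero>" using assms by (simp add: a_minus_def a_ac minus_add)
  then show "b = a \<oplus> c" using assms minus_eq_zero_iff[of b "a \<oplus> c"] by simp
qed

context lie_cocycle
begin

lemmas cocycle_uminus_right = bilinear_map_minus_right[OF cocycle_bilinear L.M.abelian_group_axioms
    L.M.abelian_group_axioms W.M.abelian_group_axioms]

lemma cocycle_ssign_right: "\<lbrakk>x \<in> carrier L; y \<in> carrier L\<rbrakk> \<Longrightarrow> \<psi> x (ssign L p q y) = ssign W p q (\<psi> x y)"
  by (simp add: ssign_def cocycle_uminus_right)

text \<open>The super Jacobi identity says that \<open>\<psi> x\<close> is a superderivation.\<close>
lemma cocycle_leibniz: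
  assumes x: "x \<in> grade L p" and y: "y \<in> grade L q" and z: "z \<in> grade L r"
  shows "\<psi> x (y \<otimes>\<^bsub>L\<^esub> z) = \<psi> (x \<otimes>\<^bsub>L\<^esub> y) z \<oplus>\<^bsub>W\<^esub> ssign W p q (\<psi> y (x \<otimes>\<^bsub>L\<^esub> z))"
proof -
  note c = assms[THEN L.grade_carrier]
  let ?A = "\<psi> (x \<otimes>\<^bsub>L\<^esub> y) z" and ?B = "\<psi> x (y \<otimes>\<^bsub>L\<^esub> z)" and ?C = "\<psi> y (x \<otimes>\<^bsub>L\<^esub> z)"
  have cl: "?A \<in> carrier W" "?B \<in> carrier W" "?C \<in> carrier W"
    using c by (simp_all add: cocycle_closed L.mult_closed)
  have B: "\<psi> (y \<otimes>\<^bsub>L\<^esub> z) x = \<ominus>\<^bsub>W\<^esub> ssign W (q + r) p ?B"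
    using cocycle_skew[OF L.mult_grade[OF y z] x] .
  have "\<psi> (z \<otimes>\<^bsub>L\<^esub> x) y = \<ominus>\<^bsub>W\<^esub> ssign W (r + p) q (\<psi> y (z \<otimes>\<^bsub>L\<^esub> x))"
    using cocycle_skew[OF L.mult_grade[OF z x] y] .
  also have "\<psi> y (z \<otimes>\<^bsub>L\<^esub> x) = \<ominus>\<^bsub>W\<^esub> ssign W r p ?C"
    unfolding L.super_skew[OF z x] using c
    by (simp add: cocycle_uminus_right cocycle_ssign_right L.mult_closed L.ssign_closed)
  finally have C: "\<psi> (z \<otimes>\<^bsub>L\<^esub> x) y = \<ominus>\<^bsub>W\<^esub> ssign W (r + p) q (\<ominus>\<^bsub>W\<^esub> ssign W r p ?C)" .
  have J: "ssign W p r ?A \<oplus>\<^bsub>W\<^esub> ssign W p q (\<ominus>\<^bsub>W\<^esub> ssign W (q + r) p ?B)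
      \<oplus>\<^bsub>W\<^esub> ssign W q r (\<ominus>\<^bsub>W\<^esub> ssign W (r + p) q (\<ominus>\<^bsub>W\<^esub> ssign W r p ?C)) = \<zero>\<^bsub>W\<^esub>"
    using cocycle_jacobi[OF x y z] unfolding B C .
  have cl': "\<ominus>\<^bsub>W\<^esub> ?C \<in> carrier W" using cl by simp
  show ?thesis
    using bit_cases[of p] bit_cases[of q] bit_cases[of r] J cl
      W.M.solve_middle[OF cl] W.M.solve_middle[OF cl(1,2) cl']
    by (elim disjE) (simp_all add: ssign_def)
qed

text \<open>
  The computations with root elements below use the Jacobi identity almost only through this rule
  and the next one, in which one of its three terms vanishes.
\<close>
lemma cocycle_assoc:
  assumes x: "x \<in> grade L p" and y: "y \<in> grade L q" and z: "z \<in> grade L r"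
    and "x \<otimes>\<^bsub>L\<^esub> z = \<zero>\<^bsub>L\<^esub>"
  shows "\<psi> (x \<otimes>\<^bsub>L\<^esub> y) z = \<psi> x (y \<otimes>\<^bsub>L\<^esub> z)"
  using cocycle_leibniz[OF x y z] assms(4) assms(1-3)[THEN L.grade_carrier]
  by (simp add: cocycle_zero_right cocycle_closed L.mult_closed ssign_def)

lemma cocycle_swap:
  assumes x: "x \<in> grade L p" and y: "y \<in> grade L q" and z: "z \<in> grade L r"
    and "y \<otimes>\<^bsub>L\<^esub> z = \<zero>\<^bsub>L\<^esub>"
  shows "\<psi> (x \<otimes>\<^bsub>L\<^esub> y) z = ssign W q r (\<psi> (x \<otimes>\<^bsub>L\<^esub> z) y)"
proof -
  note c = assms(1-3)[THEN L.grade_carrier]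
  let ?A = "\<psi> (x \<otimes>\<^bsub>L\<^esub> y) z" and ?C = "\<psi> (x \<otimes>\<^bsub>L\<^esub> z) y"
  have cl: "?A \<in> carrier W" "?C \<in> carrier W" using c by (simp_all add: cocycle_closed L.mult_closed)
  have skew: "\<psi> y (x \<otimes>\<^bsub>L\<^esub> z) = \<ominus>\<^bsub>W\<^esub> ssign W q (p + r) ?C"
    using cocycle_skew[OF y L.mult_grade[OF x z]] .
  have "\<zero>\<^bsub>W\<^esub> = ?A \<oplus>\<^bsub>W\<^esub> ssign W p q (\<ominus>\<^bsub>W\<^esub> ssign W q (p + r) ?C)"
    using cocycle_leibniz[OF x y z] assms(4) c by (simp add: cocycle_zero_right skew)
  then have "\<zero>\<^bsub>W\<^esub> = ?A \<ominus>\<^bsub>W\<^esub> ssign W q r ?C"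
    using bit_cases[of p] bit_cases[of q] bit_cases[of r] cl
    by (elim disjE) (simp_all add: ssign_def a_minus_def)
  then show ?thesis using cl W.M.minus_eq_zero_iff[of ?A "ssign W q r ?C"] by (simp add: W.ssign_closed)
qed

end

text \<open>
  This makes the preceding rules available for the bracket of a Lie superalgebra as well.
\<close>
lemma bracket_cocycle:
  fixes L :: "('k, 'u) superalgebra"
  assumes "lie_superalgebra K L"
  shows "lie_cocycle K L L (mult L)"
proof -
  interpret lie_superalgebra K L by fact
  show ?thesis
    by (intro lie_cocycle.intro lie_cocycle_axioms.intro lie_superalgebra_axioms supermodule_axioms
        mult_bilinear mult_grade super_skew even_alternating super_jacobi[unfolded jacobiator_def])
qed

lemma exists_fourth: "\<exists>m\<in>{1..4::nat}. m \<noteq> i \<and> m \<noteq> j \<and> m \<noteq> k"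
proof (rule ccontr)
  assume "\<not> ?thesis"
  then have "{1..4} \<subseteq> {i, j, k}" by auto
  then have "card {1..4::nat} \<le> card {i, j, k}" by (intro card_mono) auto
  moreover have "card {i, j, k} \<le> 3" by (simp add: card_insert_if)
  ultimately show False by simp
qed

locale steinberg_algebra = coefficient_superalgebra K A
  for K :: "('k, 'c) ring_scheme" (structure) and A :: "('k, 'a) superalgebra" (structure)
begin

abbreviation "N \<equiv> free_superalgebra K (st_letters A) st_degree"
abbreviation "gen i j p a \<equiv> free_gen K (i, j, p, a)"

sublocale fr: free_generators K "st_letters A" st_degree by unfold_locales

lemma st_letterI: "\<lbrakk>i \<in> {1..4}; j \<in> {1..4}; i \<noteq> j; a \<in> grade A p\<rbrakk> \<Longrightarrow> (i, j, p, a) \<in> st_letters A"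
  by (simp add: st_letters_def)

lemma gen_grade: "\<lbrakk>i \<in> {1..4}; j \<in> {1..4}; i \<noteq> j; a \<in> grade A p\<rbrakk>
    \<Longrightarrow> gen i j p a \<in> grade N (idx_parity i + idx_parity j + p)"
  using fr.free_gen_grade[OF st_letterI] by (simp add: st_degree_def)

lemma gen_closed: "\<lbrakk>i \<in> {1..4}; j \<in> {1..4}; i \<noteq> j; a \<in> grade A p\<rbrakk> \<Longrightarrow> gen i j p a \<in> carrier N"
  using gen_grade fr.N.grade_carrier by blast

lemma st_relatorsE [consumes 1, case_names add smult comp zero]:
  assumes "r \<in> st_relators K A"
  obtains i j p a b where "r = gen i j p (a \<oplus>\<^bsub>A\<^esub> b) \<ominus>\<^bsub>N\<^esub> (gen i j p a \<oplus>\<^bsub>N\<^esub> gen i j p b)"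
      "i \<in> {1..4}" "j \<in> {1..4}" "i \<noteq> j" "a \<in> grade A p" "b \<in> grade A p"
    | i j p c a where "r = gen i j p (c \<odot>\<^bsub>A\<^esub> a) \<ominus>\<^bsub>N\<^esub> c \<odot>\<^bsub>N\<^esub> gen i j p a"
      "i \<in> {1..4}" "j \<in> {1..4}" "i \<noteq> j" "c \<in> carrier K" "a \<in> grade A p"
    | i j k p q a b where "r = gen i j p a \<otimes>\<^bsub>N\<^esub> gen j k q b \<ominus>\<^bsub>N\<^esub> gen i k (p + q) (a \<otimes>\<^bsub>A\<^esub> b)"
      "i \<in> {1..4}" "j \<in> {1..4}" "k \<in> {1..4}" "i \<noteq> j" "j \<noteq> k" "i \<noteq> k" "a \<in> grade A p" "b \<in> grade A q"
    | i j k l p q a b where "r = gen i j p a \<otimes>\<^bsub>N\<^esub> gen k l q b"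
      "i \<in> {1..4}" "j \<in> {1..4}" "k \<in> {1..4}" "l \<in> {1..4}" "i \<noteq> j" "k \<noteq> l" "j \<noteq> k" "i \<noteq> l"
      "a \<in> grade A p" "b \<in> grade A q"
  using assms unfolding st_relators_def Let_def by auto

lemma st_relators_memI:
  "\<lbrakk>i \<in> {1..4}; j \<in> {1..4}; i \<noteq> j; a \<in> grade A p; b \<in> grade A p\<rbrakk> \<Longrightarrow>
    gen i j p (a \<oplus>\<^bsub>A\<^esub> b) \<ominus>\<^bsub>N\<^esub> (gen i j p a \<oplus>\<^bsub>N\<^esub> gen i j p b) \<in> st_relators K A"
  "\<lbrakk>i \<in> {1..4}; j \<in> {1..4}; i \<noteq> j; c \<in> carrier K; a \<in> grade A p\<rbrakk> \<Longrightarrow>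
    gen i j p (c \<odot>\<^bsub>A\<^esub> a) \<ominus>\<^bsub>N\<^esub> c \<odot>\<^bsub>N\<^esub> gen i j p a \<in> st_relators K A"
  "\<lbrakk>i \<in> {1..4}; j \<in> {1..4}; k \<in> {1..4}; i \<noteq> j; j \<noteq> k; i \<noteq> k; a \<in> grade A p; b \<in> grade A q\<rbrakk> \<Longrightarrow>
    gen i j p a \<otimes>\<^bsub>N\<^esub> gen j k q b \<ominus>\<^bsub>N\<^esub> gen i k (p + q) (a \<otimes>\<^bsub>A\<^esub> b) \<in> st_relators K A"
  "\<lbrakk>i \<in> {1..4}; j \<in> {1..4}; k \<in> {1..4}; l \<in> {1..4}; i \<noteq> j; k \<noteq> l; j \<noteq> k; i \<noteq> l;
      a \<in> grade A p; b \<in> grade A q\<rbrakk> \<Longrightarrow> gen i j p a \<otimes>\<^bsub>N\<^esub> gen k l q b \<in> st_relators K A"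
  unfolding st_relators_def Let_def
  subgoal by (rule UnI1, rule UnI1, rule UnI1, rule CollectI, intro exI conjI, rule refl, assumption+)
  subgoal by (rule UnI1, rule UnI1, rule UnI2, rule CollectI, intro exI conjI, rule refl, assumption+)
  subgoal by (rule UnI1, rule UnI2, rule CollectI, intro exI conjI, rule refl, assumption+, simp, assumption+)
  subgoal by (rule UnI2, rule CollectI, intro exI conjI, rule refl, assumption+)
  done

lemma st_relators_homogeneous:
  assumes "r \<in> st_relators K A"
  shows "\<exists>p. r \<in> grade N p"
  using assms
proof (cases rule: st_relatorsE)
  case (add i j p a b)
  then show ?thesis by (blast intro: fr.N.grade_minus fr.N.grade_add gen_grade grade_add)
next
  case (smult i j p c a)
  then show ?thesis by (blast intro: fr.N.grade_minus fr.N.grade_smult gen_grade grade_smult)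
next
  case (comp i j k p q a b)
  have "gen i j p a \<otimes>\<^bsub>N\<^esub> gen j k q b \<in> grade N (idx_parity i + idx_parity j + p + (idx_parity j + idx_parity k + q))"
    using comp by (intro fr.N.mult_grade gen_grade)
  also have "idx_parity i + idx_parity j + p + (idx_parity j + idx_parity k + q) = idx_parity i + idx_parity k + (p + q)"
    using bit_cases[of "idx_parity j"] by (auto simp: ac_simps)
  finally show ?thesis using comp(1) fr.N.grade_minus gen_grade[OF comp(2,4,7) mult_grade[OF comp(8,9)]] by blast
next
  case (zero i j k l p q a b)
  then show ?thesis by (blast intro: fr.N.mult_grade gen_grade)
qed

sublocale pr: lie_presented K "st_letters A" st_degree "st_relators K A"
  by unfold_locales (rule st_relators_homogeneous)

abbreviation "L \<equiv> super_quot N pr.PI"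

lemma steinberg_quot: "steinberg K A = L"
  by (simp add: steinberg_def lie_presentation_def)

sublocale L: lie_superalgebra K L by (rule pr.presented_lie)

abbreviation "F \<equiv> st_F K A"

lemma F_coset: "F i j p a = pr.PI +>\<^bsub>N\<^esub> gen i j p a"
  by (simp add: st_F_def)

lemma F_grade: "\<lbrakk>i \<in> {1..4}; j \<in> {1..4}; i \<noteq> j; a \<in> grade A p\<rbrakk>
    \<Longrightarrow> F i j p a \<in> grade L (idx_parity i + idx_parity j + p)"
  using gen_grade by (auto simp: F_coset pr.quot.quot_grade)

lemma F_closed: "\<lbrakk>i \<in> {1..4}; j \<in> {1..4}; i \<noteq> j; a \<in> grade A p\<rbrakk> \<Longrightarrow> F i j p a \<in> carrier L"
  using F_grade L.grade_carrier by blast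

lemma relator_coset_eq:
  "\<lbrakk>x \<ominus>\<^bsub>N\<^esub> y \<in> st_relators K A; x \<in> carrier N; y \<in> carrier N\<rbrakk> \<Longrightarrow> pr.PI +>\<^bsub>N\<^esub> x = pr.PI +>\<^bsub>N\<^esub> y"
  using pr.quot.coset_eq_iff pr.relators_in_ideal by blast

lemma F_add:
  assumes "i \<in> {1..4}" "j \<in> {1..4}" "i \<noteq> j" "a \<in> grade A p" "b \<in> grade A p"
  shows "F i j p (a \<oplus>\<^bsub>A\<^esub> b) = F i j p a \<oplus>\<^bsub>L\<^esub> F i j p b"
  using relator_coset_eq[OF st_relators_memI(1)[OF assms]] assms
  by (simp add: F_coset pr.quot.quot_add gen_closed grade_add)

lemma F_smult:
  assumes "i \<in> {1..4}" "j \<in> {1..4}" "i \<noteq> j" "c \<in> carrier K" "a \<in> grade A p"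
  shows "F i j p (c \<odot>\<^bsub>A\<^esub> a) = c \<odot>\<^bsub>L\<^esub> F i j p a"
  using relator_coset_eq[OF st_relators_memI(2)[OF assms]] assms
  by (simp add: F_coset pr.quot.quot_smult gen_closed grade_smult)

lemma F_mult:
  assumes "i \<in> {1..4}" "j \<in> {1..4}" "k \<in> {1..4}" "i \<noteq> j" "j \<noteq> k" "i \<noteq> k" "a \<in> grade A p" "b \<in> grade A q"
  shows "F i j p a \<otimes>\<^bsub>L\<^esub> F j k q b = F i k (p + q) (a \<otimes>\<^bsub>A\<^esub> b)"
  using relator_coset_eq[OF st_relators_memI(3)[OF assms]] assms
  by (simp add: F_coset pr.quot.quot_mult gen_closed mult_grade fr.N.mult_closed)

lemma F_commute:
  assumes "i \<in> {1..4}" "j \<in> {1..4}" "k \<in> {1..4}" "l \<in> {1..4}" "i \<noteq> j" "k \<noteq> l" "j \<noteq> k" "i \<noteq> l"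
    "a \<in> grade A p" "b \<in> grade A q"
  shows "F i j p a \<otimes>\<^bsub>L\<^esub> F k l q b = \<zero>\<^bsub>L\<^esub>"
proof -
  have "gen i j p a \<otimes>\<^bsub>N\<^esub> gen k l q b \<in> pr.PI"
    using st_relators_memI(4)[OF assms] pr.relators_in_ideal by blast
  then have "pr.PI +>\<^bsub>N\<^esub> (gen i j p a \<otimes>\<^bsub>N\<^esub> gen k l q b) = pr.PI"
    using pr.quot.coset_zero_iff pr.quot.ideal_carrier by blast
  then show ?thesis using assms by (simp add: F_coset pr.quot.quot_mult gen_closed pr.quot.quot_zero)
qed

lemma F_zero: 
  assumes "i \<in> {1..4}" "j \<in> {1..4}" "i \<noteq> j"
  shows "F i j p \<zero>\<^bsub>A\<^esub> = \<zero>\<^bsub>L\<^esub>"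
proof -
  have "F i j p \<zero>\<^bsub>A\<^esub> = F i j p (\<zero>\<^bsub>K\<^esub> \<odot>\<^bsub>A\<^esub> \<zero>\<^bsub>A\<^esub>)" by simp
  also have "\<dots> = \<zero>\<^bsub>K\<^esub> \<odot>\<^bsub>L\<^esub> F i j p \<zero>\<^bsub>A\<^esub>" using assms grade_zero by (intro F_smult) auto
  finally show ?thesis using F_closed[OF assms grade_zero] by simp
qed

lemma F_uminus: 
  assumes "i \<in> {1..4}" "j \<in> {1..4}" "i \<noteq> j" "a \<in> grade A p"
  shows "F i j p (\<ominus>\<^bsub>A\<^esub> a) = \<ominus>\<^bsub>L\<^esub> F i j p a"
proof -
  have "\<ominus>\<^bsub>A\<^esub> a = (\<ominus>\<^bsub>K\<^esub> \<one>\<^bsub>K\<^esub>) \<odot>\<^bsub>A\<^esub> a" using assms grade_carrier by (simp add: smult_l_minus)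
  then show ?thesis using assms F_smult[of i j "\<ominus>\<^bsub>K\<^esub> \<one>\<^bsub>K\<^esub>" a p] F_closed by (simp add: L.smult_l_minus)
qed

lemma F_ssign: "\<lbrakk>i \<in> {1..4}; j \<in> {1..4}; i \<noteq> j; a \<in> grade A p\<rbrakk>
    \<Longrightarrow> ssign L r s (F i j p a) = F i j p (ssign A r s a)"
  by (simp add: ssign_def F_uminus)

lemma F_mult_opposite:
  assumes "i \<in> {1..4}" "j \<in> {1..4}" "k \<in> {1..4}" "i \<noteq> j" "j \<noteq> k" "i \<noteq> k" "a \<in> grade A p" "b \<in> grade A q"
  shows "F j k q b \<otimes>\<^bsub>L\<^esub> F i j p a =
    F i k (p + q) (\<ominus>\<^bsub>A\<^esub> ssign A (idx_parity j + idx_parity k + q) (idx_parity i + idx_parity j + p) (a \<otimes>\<^bsub>A\<^esub> b))"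
  using L.super_skew[OF F_grade[OF assms(2,3,5,8)] F_grade[OF assms(1,2,4,7)]] assms
  by (simp add: F_mult F_ssign F_uminus mult_grade grade_ssign)

text \<open>
  \<open>H\<^sub>i\<^sub>j(a, b)\<close> preserves each root space. If \<open>{k, l}\<close> differs from \<open>{i, j}\<close>, then \<open>F\<^sub>k\<^sub>l\<close> commutes with
  \<open>F\<^sub>i\<^sub>j\<close> or with \<open>F\<^sub>j\<^sub>i\<close>, and the Jacobi identity reduces the double bracket to two of the defining
  relations. Otherwise \<open>F\<^sub>k\<^sub>l = [F\<^sub>k\<^sub>m, F\<^sub>m\<^sub>l]\<close> with \<open>m\<close> outside \<open>{i, j}\<close>, and the Leibniz rule reduces
  to the first case.
\<close>
lemma H_root_space:
  assumes ij: "i \<in> {1..4}" "j \<in> {1..4}" "i \<noteq> j" and kl: "k \<in> {1..4}" "l \<in> {1..4}" "k \<noteq> l"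
    and a: "a \<in> grade A p" and b: "b \<in> grade A q" and c: "c \<in> grade A r"
  shows "\<exists>d\<in>grade A (p + q + r). (F i j p a \<otimes>\<^bsub>L\<^esub> F j i q b) \<otimes>\<^bsub>L\<^esub> F k l r c = F k l (p + q + r) d"
proof -
  interpret br: lie_cocycle K L L "mult L" by (rule bracket_cocycle[OF L.lie_superalgebra_axioms])
  define P where "P k l r c \<longleftrightarrow>
    (\<exists>d\<in>grade A (p + q + r). (F i j p a \<otimes>\<^bsub>L\<^esub> F j i q b) \<otimes>\<^bsub>L\<^esub> F k l r c = F k l (p + q + r) d)" for k l r c
  note x = F_grade[OF ij a] and y = F_grade[OF ij(2,1) ij(3)[symmetric] b]
  have mixed: "P k l r c"
    if kl: "k \<in> {1..4}" "l \<in> {1..4}" "k \<noteq> l" and c: "c \<in> grade A r" and ne: "(k, l) \<noteq> (i, j)" "(k, l) \<noteq> (j, i)"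
    for k l r c
  proof -
    \<comment> \<open>The bracket with \<open>H\<close> turns into \<open>d\<close> times a root element; \<open>d\<close> is computed in each case.\<close>
    note z = F_grade[OF kl c]
    have PI: "P k l r c" if "(F i j p a \<otimes>\<^bsub>L\<^esub> F j i q b) \<otimes>\<^bsub>L\<^esub> F k l r c = F k l s d" "d \<in> grade A s" "s = p + q + r" for s d
      using that unfolding P_def by blast
    consider "k = i" "l \<noteq> j" | "k = j" "l \<noteq> i" | "l = j" "k \<noteq> i" | "l = i" "k \<noteq> j"
      | "k \<notin> {i, j}" "l \<notin> {i, j}" using ne by auto
    then show ?thesis
    proof cases
      case 1
      have "F i j p a \<otimes>\<^bsub>L\<^esub> F k l r c = \<zero>\<^bsub>L\<^esub>" using 1 ij kl a c by (intro F_commute) auto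
      moreover have "F j i q b \<otimes>\<^bsub>L\<^esub> F k l r c = F j l (q + r) (b \<otimes>\<^bsub>A\<^esub> c)"
        unfolding 1(1) using 1 ij kl b c by (intro F_mult) auto
      moreover have "F i j p a \<otimes>\<^bsub>L\<^esub> F j l (q + r) (b \<otimes>\<^bsub>A\<^esub> c) = F k l (p + (q + r)) (a \<otimes>\<^bsub>A\<^esub> (b \<otimes>\<^bsub>A\<^esub> c))"
        unfolding 1(1) using 1 ij kl a mult_grade[OF b c] by (intro F_mult) auto
      ultimately show ?thesis
        using br.cocycle_assoc[OF x y z] mult_grade[OF a mult_grade[OF b c]] by (intro PI) (auto simp: add.assoc)
    next
      case 2
      define d where "d = \<ominus>\<^bsub>A\<^esub> ssign A (idx_parity i + idx_parity l + (p + r)) (idx_parity j + idx_parity i + q) (b \<otimes>\<^bsub>A\<^esub> (a \<otimes>\<^bsub>A\<^esub> c))"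
      let ?s = "ssign A (idx_parity j + idx_parity i + q) (idx_parity k + idx_parity l + r)"
      have d: "d \<in> grade A (q + (p + r))" unfolding d_def by (intro grade_uminus grade_ssign mult_grade a b c)
      have "F j i q b \<otimes>\<^bsub>L\<^esub> F k l r c = \<zero>\<^bsub>L\<^esub>" using 2 ij kl b c by (intro F_commute) auto
      moreover have "F i j p a \<otimes>\<^bsub>L\<^esub> F k l r c = F i l (p + r) (a \<otimes>\<^bsub>A\<^esub> c)"
        unfolding 2(1) using 2 ij kl a c by (intro F_mult) auto
      moreover have "F i l (p + r) (a \<otimes>\<^bsub>A\<^esub> c) \<otimes>\<^bsub>L\<^esub> F j i q b = F k l (q + (p + r)) d"
        unfolding d_def 2(1) using 2 ij kl b mult_grade[OF a c] by (intro F_mult_opposite) auto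
      ultimately have "(F i j p a \<otimes>\<^bsub>L\<^esub> F j i q b) \<otimes>\<^bsub>L\<^esub> F k l r c = F k l (q + (p + r)) (?s d)"
        using br.cocycle_swap[OF x y z] F_ssign[OF kl d] by simp
      then show ?thesis by (rule PI[OF _ grade_ssign[OF d]]) (simp add: ac_simps)
    next
      case 3
      define d where "d = \<ominus>\<^bsub>A\<^esub> ssign A (idx_parity j + idx_parity i + q) (idx_parity k + idx_parity j + r) (c \<otimes>\<^bsub>A\<^esub> b)"
      define d' where "d' = \<ominus>\<^bsub>A\<^esub> ssign A (idx_parity i + idx_parity j + p) (idx_parity k + idx_parity i + (r + q)) (d \<otimes>\<^bsub>A\<^esub> a)"
      have d: "d \<in> grade A (r + q)" unfolding d_def by (intro grade_uminus grade_ssign mult_grade c b)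
      have d': "d' \<in> grade A (r + q + p)" unfolding d'_def by (intro grade_uminus grade_ssign mult_grade d a)
      have "F i j p a \<otimes>\<^bsub>L\<^esub> F k l r c = \<zero>\<^bsub>L\<^esub>" using 3 ij kl a c by (intro F_commute) auto
      moreover have "F j i q b \<otimes>\<^bsub>L\<^esub> F k l r c = F k i (r + q) d"
        unfolding d_def 3(1) using 3 ij kl b c by (intro F_mult_opposite) auto
      moreover have "F i j p a \<otimes>\<^bsub>L\<^esub> F k i (r + q) d = F k l (r + q + p) d'"
        unfolding d'_def 3(1) using 3 ij kl a d by (intro F_mult_opposite) auto
      ultimately show ?thesis
        using br.cocycle_assoc[OF x y z] by (intro PI[OF _ d']) (auto simp: ac_simps)
    next
      case 4
      define d where "d = \<ominus>\<^bsub>A\<^esub> ssign A (idx_parity i + idx_parity j + p) (idx_parity k + idx_parity i + r) (c \<otimes>\<^bsub>A\<^esub> a)"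
      let ?s = "ssign A (idx_parity j + idx_parity i + q) (idx_parity k + idx_parity l + r)"
      have d: "d \<in> grade A (r + p)" unfolding d_def by (intro grade_uminus grade_ssign mult_grade c a)
      note db = mult_grade[OF d b]
      have "F j i q b \<otimes>\<^bsub>L\<^esub> F k l r c = \<zero>\<^bsub>L\<^esub>" using 4 ij kl b c by (intro F_commute) auto
      moreover have "F i j p a \<otimes>\<^bsub>L\<^esub> F k l r c = F k j (r + p) d"
        unfolding d_def 4(1) using 4 ij kl a c by (intro F_mult_opposite) auto
      moreover have "F k j (r + p) d \<otimes>\<^bsub>L\<^esub> F j i q b = F k l (r + p + q) (d \<otimes>\<^bsub>A\<^esub> b)"
        unfolding 4(1) using 4 ij kl b d by (intro F_mult) auto
      ultimately have "(F i j p a \<otimes>\<^bsub>L\<^esub> F j i q b) \<otimes>\<^bsub>L\<^esub> F k l r c = F k l (r + p + q) (?s (d \<otimes>\<^bsub>A\<^esub> b))"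
        using br.cocycle_swap[OF x y z] F_ssign[OF kl db] by simp
      then show ?thesis by (rule PI[OF _ grade_ssign[OF db]]) (simp add: ac_simps)
    next
      case 5
      have "F i j p a \<otimes>\<^bsub>L\<^esub> F k l r c = \<zero>\<^bsub>L\<^esub>" "F j i q b \<otimes>\<^bsub>L\<^esub> F k l r c = \<zero>\<^bsub>L\<^esub>"
        using 5 ij kl a b c by (intro F_commute; auto)+
      then have "(F i j p a \<otimes>\<^bsub>L\<^esub> F j i q b) \<otimes>\<^bsub>L\<^esub> F k l r c = \<zero>\<^bsub>L\<^esub>"
        using br.cocycle_assoc[OF x y z] F_closed[OF ij a] by (simp add: L.mult_zero)
      then show ?thesis using F_zero[OF kl] by (intro PI[OF _ grade_zero refl]) simp
    qed
  qed
  show ?thesis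
  proof (cases "(k, l) = (i, j) \<or> (k, l) = (j, i)")
    case False
    then show ?thesis using mixed[OF kl c] by (auto simp: P_def)
  next
    case True
    obtain m where m: "m \<in> {1..4}" "m \<noteq> i" "m \<noteq> j" using exists_fourth[of i j i] by auto
    have mkl: "m \<noteq> k" "m \<noteq> l" using True m by auto
    let ?H = "F i j p a \<otimes>\<^bsub>L\<^esub> F j i q b"
    have H: "?H \<in> grade L (p + q)"
    proof -
      have "?H \<in> grade L (idx_parity i + idx_parity j + p + (idx_parity j + idx_parity i + q))"
        by (rule L.mult_grade[OF x y])
      moreover have "idx_parity i + idx_parity j + p + (idx_parity j + idx_parity i + q) = p + q"
        using bit_cases[of "idx_parity i"] bit_cases[of "idx_parity j"] by (auto simp: ac_simps)
      ultimately show ?thesis by simp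
    qed
    have "P k m r c" using m mkl kl c by (intro mixed) auto
    then obtain d where d: "d \<in> grade A (p + q + r)" "?H \<otimes>\<^bsub>L\<^esub> F k m r c = F k m (p + q + r) d"
      unfolding P_def by blast
    have "P m l 0 \<one>\<^bsub>A\<^esub>" using m mkl kl one_grade by (intro mixed) auto
    then obtain d' where d': "d' \<in> grade A (p + q)" "?H \<otimes>\<^bsub>L\<^esub> F m l 0 \<one>\<^bsub>A\<^esub> = F m l (p + q) d'"
      unfolding P_def by auto
    have cd: "c \<otimes>\<^bsub>A\<^esub> d' \<in> grade A (p + q + r)" using mult_grade[OF c d'(1)] by (simp add: ac_simps)
    have F: "F k l r c = F k m r c \<otimes>\<^bsub>L\<^esub> F m l 0 \<one>\<^bsub>A\<^esub>"
      using m mkl kl c one_grade grade_carrier by (simp add: F_mult)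
    have g: "F k m r c \<in> grade L (idx_parity k + idx_parity m + r)" "F m l 0 \<one>\<^bsub>A\<^esub> \<in> grade L (idx_parity m + idx_parity l + 0)"
      using F_grade[OF kl(1) m(1) mkl(1)[symmetric] c] F_grade[OF m(1) kl(2) mkl(2) one_grade] .
    have "?H \<otimes>\<^bsub>L\<^esub> F k l r c = F k m (p + q + r) d \<otimes>\<^bsub>L\<^esub> F m l 0 \<one>\<^bsub>A\<^esub> \<oplus>\<^bsub>L\<^esub>
        ssign L (p + q) (idx_parity k + idx_parity m + r) (F k m r c \<otimes>\<^bsub>L\<^esub> F m l (p + q) d')"
      unfolding F br.cocycle_leibniz[OF H g] d(2) d'(2) ..
    also have "\<dots> = F k l (p + q + r) (d \<oplus>\<^bsub>A\<^esub> ssign A (p + q) (idx_parity k + idx_parity m + r) (c \<otimes>\<^bsub>A\<^esub> d'))"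
      using m mkl kl c d(1) d'(1) one_grade cd grade_carrier
      by (simp add: F_mult F_ssign F_add grade_ssign add.commute[of r])
    finally show ?thesis using d(1) cd by (blast intro: grade_add grade_ssign)
  qed
qed

text \<open>
  The linear span of the root elements \<open>F\<^sub>i\<^sub>j(a)\<close> and of the elements \<open>H\<^sub>i\<^sub>j(a, b)\<close>. It is closed under
  the bracket, hence everything.
\<close>
inductive st_span where
  H: "\<lbrakk>i \<in> {1..4}; j \<in> {1..4}; i \<noteq> j; a \<in> grade A p; b \<in> grade A q\<rbrakk>
    \<Longrightarrow> st_span (F i j p a \<otimes>\<^bsub>L\<^esub> F j i q b)"
| F: "\<lbrakk>i \<in> {1..4}; j \<in> {1..4}; i \<noteq> j; a \<in> grade A p\<rbrakk> \<Longrightarrow> st_span (F i j p a)"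
| add: "\<lbrakk>st_span x; st_span y\<rbrakk> \<Longrightarrow> st_span (x \<oplus>\<^bsub>L\<^esub> y)"
| smult: "\<lbrakk>c \<in> carrier K; st_span x\<rbrakk> \<Longrightarrow> st_span (c \<odot>\<^bsub>L\<^esub> x)"

lemma st_span_closed: "st_span x \<Longrightarrow> x \<in> carrier L"
  by (induction rule: st_span.induct) (auto simp: L.mult_closed F_closed)

lemma st_span_uminus: "st_span x \<Longrightarrow> st_span (\<ominus>\<^bsub>L\<^esub> x)"
  using st_span.smult[of "\<ominus>\<^bsub>K\<^esub> \<one>\<^bsub>K\<^esub>" x] st_span_closed[of x] by (simp add: L.smult_l_minus)

lemma st_span_ssign: "st_span x \<Longrightarrow> st_span (ssign L p q x)"
  by (simp add: ssign_def st_span_uminus)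

lemma st_span_swap:
  assumes "x \<in> grade L p" "y \<in> grade L q" "st_span (y \<otimes>\<^bsub>L\<^esub> x)"
  shows "st_span (x \<otimes>\<^bsub>L\<^esub> y)"
  unfolding L.super_skew[OF assms(1,2)] using assms(3) by (intro st_span_uminus st_span_ssign)

lemma st_span_F_F:
  assumes ij: "i \<in> {1..4}" "j \<in> {1..4}" "i \<noteq> j" and kl: "k \<in> {1..4}" "l \<in> {1..4}" "k \<noteq> l"
    and ab: "a \<in> grade A p" "b \<in> grade A q"
  shows "st_span (F i j p a \<otimes>\<^bsub>L\<^esub> F k l q b)"
proof -
  consider "j = k" "i = l" | "j = k" "i \<noteq> l" | "j \<noteq> k" "i = l" | "j \<noteq> k" "i \<noteq> l" by blast
  then show ?thesis
  proof cases
    case 1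
    then show ?thesis using st_span.H[OF ij ab] by simp
  next
    case 2
    then show ?thesis using assms by (auto simp: F_mult intro!: st_span.F mult_grade)
  next
    case 3
    then show ?thesis using assms
      by (auto simp: F_mult_opposite intro!: st_span.F mult_grade grade_uminus grade_ssign)
  next
    case 4
    then show ?thesis using assms F_zero[OF ij] st_span.F[OF ij grade_zero] by (simp add: F_commute)
  qed
qed

lemma st_span_H_F:
  assumes ij: "i \<in> {1..4}" "j \<in> {1..4}" "i \<noteq> j" and kl: "k \<in> {1..4}" "l \<in> {1..4}" "k \<noteq> l"
    and a: "a \<in> grade A p" and b: "b \<in> grade A q" and c: "c \<in> grade A r"
  shows "st_span ((F i j p a \<otimes>\<^bsub>L\<^esub> F j i q b) \<otimes>\<^bsub>L\<^esub> F k l r c)"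
  using H_root_space[OF assms] st_span.F[OF kl] by force

lemma st_span_H_H:
  assumes ij: "i \<in> {1..4}" "j \<in> {1..4}" "i \<noteq> j" and kl: "k \<in> {1..4}" "l \<in> {1..4}" "k \<noteq> l"
    and a: "a \<in> grade A p" and b: "b \<in> grade A q" and c: "c \<in> grade A r" and d: "d \<in> grade A s"
  shows "st_span ((F i j p a \<otimes>\<^bsub>L\<^esub> F j i q b) \<otimes>\<^bsub>L\<^esub> (F k l r c \<otimes>\<^bsub>L\<^esub> F l k s d))"
proof -
  interpret br: lie_cocycle K L L "mult L" by (rule bracket_cocycle[OF L.lie_superalgebra_axioms])
  note H = L.mult_grade[OF F_grade[OF ij a] F_grade[OF ij(2,1) ij(3)[symmetric] b]]
  obtain c' where c': "c' \<in> grade A (p + q + r)"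
    "(F i j p a \<otimes>\<^bsub>L\<^esub> F j i q b) \<otimes>\<^bsub>L\<^esub> F k l r c = F k l (p + q + r) c'"
    using H_root_space[OF ij kl a b c] by blast
  obtain d' where d': "d' \<in> grade A (p + q + s)"
    "(F i j p a \<otimes>\<^bsub>L\<^esub> F j i q b) \<otimes>\<^bsub>L\<^esub> F l k s d = F l k (p + q + s) d'"
    using H_root_space[OF ij kl(2,1) kl(3)[symmetric] a b d] by blast
  show ?thesis
    unfolding br.cocycle_leibniz[OF H F_grade[OF kl c] F_grade[OF kl(2,1) kl(3)[symmetric] d]] c'(2) d'(2)
    by (intro st_span.add st_span_ssign st_span.H kl c c'(1) d d'(1))
qed

lemma st_span_mult:
  assumes "st_span x" "st_span y"
  shows "st_span (x \<otimes>\<^bsub>L\<^esub> y)"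
  using assms(2)
proof (induction rule: st_span.induct)
  case (H k l c r d s)
  note y = L.mult_grade[OF F_grade[OF H(1-4)] F_grade[OF H(2,1) H(3)[symmetric] H(5)]]
  show ?case using assms(1)
  proof (induction rule: st_span.induct)
    case (F i j a p)
    show ?case by (rule st_span_swap[OF F_grade[OF F] y st_span_H_F[OF H(1-3) F(1-3) H(4,5) F(4)]])
  qed (use H in \<open>auto simp: L.add_mult L.smult_mult st_span_closed L.mult_closed F_closed
      intro: st_span_H_H st_span.add st_span.smult\<close>)
next
  case (F k l c r)
  show ?case using assms(1)
    by (induction rule: st_span.induct)
      (use F in \<open>auto simp: L.add_mult L.smult_mult st_span_closed F_closed
        intro: st_span_H_F st_span_F_F st_span.add st_span.smult\<close>)
qed (use assms(1) in \<open>auto simp: L.mult_add L.mult_smult st_span_closed intro: st_span.add st_span.smult\<close>)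

lemma st_span_all:
  assumes "x \<in> carrier L"
  shows "st_span x"
  using assms
proof (induction rule: pr.presented_induct)
  case (gen g)
  obtain i j p a where g: "g = (i, j, p, a)" by (cases g)
  then show ?case using gen st_span.F[of i j a p] by (simp add: st_letters_def F_coset)
next
  case zero
  have "st_span (F 1 2 0 \<zero>\<^bsub>A\<^esub>)" by (intro st_span.F grade_zero) auto
  then show ?case using F_zero[of 1 2 0] by simp
qed (auto intro: st_span.add st_span.smult st_span_mult)

end

section \<open>The exterior square representation\<close>

text \<open>
  The two-element subsets index the standard basis of the exterior square.
\<close>
definition pairs :: "nat set set" where
  "pairs = {u. u \<subseteq> {1..4} \<and> card u = 2}"

definition pair_parity :: "nat set \<Rightarrow> bit" where
  "pair_parity u = (if 4 \<in> u then 1 else 0)"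

definition copair :: "nat set \<Rightarrow> nat set" where
  "copair u = {1..4} - u"

lemma finite_pairs: "finite pairs"
  by (rule finite_subset[of _ "Pow {1..4}"]) (auto simp: pairs_def)

lemma pairsE:
  assumes "u \<in> pairs" "i \<in> u"
  obtains m where "m \<in> {1..4}" "m \<noteq> i" "u = {i, m}" "i \<in> {1..4}"
proof -
  from assms obtain x y where "u = {x, y}" "x \<noteq> y" "u \<subseteq> {1..4}" by (auto simp: pairs_def card_2_iff)
  then show thesis using that[of x] that[of y] assms(2) by auto
qed

lemma pairs_replace: "\<lbrakk>u \<in> pairs; i \<in> u; j \<notin> u; j \<in> {1..4}\<rbrakk> \<Longrightarrow> insert j (u - {i}) \<in> pairs"
  by (erule pairsE, assumption) (auto simp: pairs_def insert_Diff_if)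

lemma copair_pairs: "u \<in> pairs \<Longrightarrow> copair u \<in> pairs"
  by (auto simp: pairs_def copair_def card_Diff_subset finite_subset)

lemma copair_copair: "u \<in> pairs \<Longrightarrow> copair (copair u) = u"
  by (auto simp: pairs_def copair_def)

lemma replace_ne_co: "u \<in> pairs \<Longrightarrow> i \<in> u \<Longrightarrow> copair u \<noteq> insert j (u - {i})"
  by (erule pairsE, assumption) (auto simp: copair_def)

lemma pair_parity_replace:
  "\<lbrakk>i \<in> u; j \<notin> u\<rbrakk> \<Longrightarrow> pair_parity u + pair_parity (insert j (u - {i})) = idx_parity i + idx_parity j"
  by (auto simp: pair_parity_def idx_parity_def)

text \<open>
  Two successive replacements lead from \<open>u\<close> to its complement only if they replace its two
  elements, \<open>i\<close> and then \<open>k\<close>, by the two elements \<open>j\<close> and \<open>l\<close> of the complement.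
\<close>
lemma replace_twice_co:
  assumes u: "u \<in> pairs" and i: "i \<in> u" and j: "j \<notin> u" "j \<in> {1..4}"
    and l: "l \<in> {1..4}" and kl: "k \<in> insert j (u - {i})" "l \<notin> insert j (u - {i})"
  shows "copair u = insert l (insert j (u - {i}) - {k}) \<longleftrightarrow> distinct [i, j, k, l] \<and> u = {i, k}"
proof -
  obtain m where m: "m \<in> {1..4}" "m \<noteq> i" "u = {i, m}" "i \<in> {1..4}" using pairsE[OF u i] .
  have jm: "j \<noteq> m" "j \<noteq> i" using j m by auto
  have u': "insert j (u - {i}) = {j, m}" using m by auto
  have lm: "l \<noteq> j" "l \<noteq> m" using kl u' by auto
  show ?thesis
    unfolding copair_def
  proof
    assume eq: "{1..4} - u = insert l (insert j (u - {i}) - {k})"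
    have "m \<notin> insert l ({j, m} - {k})" using eq m u' by auto
    then have k: "k = m" by auto
    have "l \<in> {1..4} - u" using eq by auto
    then show "distinct [i, j, k, l] \<and> u = {i, k}" using k m jm lm by auto
  next
    assume d: "distinct [i, j, k, l] \<and> u = {i, k}"
    then have k: "k = m" using m by auto
    have "{i, m, j, l} = {1..4}"
      by (rule card_subset_eq) (use m j l d k lm jm in auto)
    then have "{1..4} - u = {j, l}" using m d k jm lm by auto
    then show "{1..4} - u = insert l (insert j (u - {i}) - {k})" unfolding u' k using jm by auto
  qed
qed

context steinberg_algebra
begin

sublocale mat: char2_matrices K B pairs pair_parity
  by (intro char2_matrices.intro char2_matrices_axioms.intro A2.quot_superalgebra B_cring B_double finite_pairs)

abbreviation "gl \<equiv> gl_superalgebra B pairs pair_parity"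
abbreviation "mm \<equiv> mat_mult B pairs"

lemma gl_smult_entry: "\<lbrakk>u \<in> pairs; v \<in> pairs\<rbrakk> \<Longrightarrow> (c \<odot>\<^bsub>gl\<^esub> X) (u, v) = c \<odot>\<^bsub>B\<^esub> X (u, v)"
  and gl_zero_entry: "\<lbrakk>u \<in> pairs; v \<in> pairs\<rbrakk> \<Longrightarrow> \<zero>\<^bsub>gl\<^esub> (u, v) = \<zero>\<^bsub>B\<^esub>"
  by (simp_all add: mat.gl_simps(2,4))

lemma cls_closed: "a \<in> carrier A \<Longrightarrow> cls a \<in> carrier B"
  by (auto simp: A2.quot_carrier)

text \<open>
  The action of \<open>a\<close> times the elementary matrix \<open>E\<^sub>i\<^sub>j\<close> on the exterior square: the basis vector of a pair
  \<open>v\<close> that contains \<open>j\<close> but not \<open>i\<close> goes to that of \<open>v\<close> with \<open>j\<close> replaced by \<open>i\<close>. In characteristic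
  two the ordering of the two wedge factors does not matter.
\<close>
definition wedge :: "nat \<Rightarrow> nat \<Rightarrow> 'a \<Rightarrow> nat set \<times> nat set \<Rightarrow> 'a set" where
  "wedge i j a = (\<lambda>(u, v)\<in>pairs \<times> pairs. if i \<in> u \<and> j \<notin> u \<and> v = insert j (u - {i}) then cls a else \<zero>\<^bsub>B\<^esub>)"

lemma wedge_entry: "\<lbrakk>u \<in> pairs; v \<in> pairs\<rbrakk> \<Longrightarrow>
    wedge i j a (u, v) = (if i \<in> u \<and> j \<notin> u \<and> v = insert j (u - {i}) then cls a else \<zero>\<^bsub>B\<^esub>)"
  by (simp add: wedge_def)

lemma wedge_closed: "a \<in> carrier A \<Longrightarrow> wedge i j a \<in> carrier gl"
  unfolding mat.gl_simps(1) wedge_def by (auto simp: cls_closed)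

lemma wedge_grade:
  assumes "a \<in> grade A p"
  shows "wedge i j a \<in> grade gl (idx_parity i + idx_parity j + p)"
  unfolding mat.gl_simps(5)
proof (rule PiE_I)
  fix w assume w: "w \<in> pairs \<times> pairs"
  obtain u v where uv: "w = (u, v)" "u \<in> pairs" "v \<in> pairs" using w by auto
  show "wedge i j a w \<in> grade B (idx_parity i + idx_parity j + p + (pair_parity (fst w) + pair_parity (snd w)))"
  proof (cases "i \<in> u \<and> j \<notin> u \<and> v = insert j (u - {i})")
    case True
    then have eq: "idx_parity i + idx_parity j + p + (pair_parity u + pair_parity v) = p"
      using pair_parity_replace[of i u j] bit_cases[of "idx_parity i"] bit_cases[of "idx_parity j"]
      by (auto simp: ac_simps)
    show ?thesis
      using assms uv(2,3) True unfolding uv(1) fst_conv snd_conv eq by (simp add: wedge_entry A2.quot_grade)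
  next
    case False
    then have "wedge i j a w = \<zero>\<^bsub>B\<^esub>" using uv by (auto simp: wedge_entry)
    then show ?thesis using mat.grade_zero by simp
  qed
qed (simp add: wedge_def)

lemma wedge_mm:
  assumes a: "a \<in> carrier A" and Y: "Y \<in> carrier gl" and j: "j \<in> {1..4}" and uv: "u \<in> pairs" "v \<in> pairs"
  shows "mm (wedge i j a) Y (u, v) = (if i \<in> u \<and> j \<notin> u then cls a \<otimes>\<^bsub>B\<^esub> Y (insert j (u - {i}), v) else \<zero>\<^bsub>B\<^esub>)"
proof (cases "i \<in> u \<and> j \<notin> u")
  case True
  let ?w = "insert j (u - {i})"
  have w: "?w \<in> pairs" using True uv j by (intro pairs_replace) auto
  have "mm (wedge i j a) Y (u, v) = (\<Oplus>\<^bsub>B\<^esub>w\<in>pairs. if ?w = w then cls a \<otimes>\<^bsub>B\<^esub> Y (w, v) else \<zero>\<^bsub>B\<^esub>)"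
    unfolding mat.mm_entry[OF uv] using uv True a Y
    by (intro mat.M.finsum_cong') (auto simp: wedge_entry cls_closed mat.gl_entry)
  also have "\<dots> = cls a \<otimes>\<^bsub>B\<^esub> Y (?w, v)"
    using mat.M.finsum_singleton[OF w finite_pairs, of "\<lambda>w. cls a \<otimes>\<^bsub>B\<^esub> Y (w, v)"] a Y uv
    by (auto simp: cls_closed mat.gl_entry)
  finally show ?thesis using True by simp
next
  case False
  have "mm (wedge i j a) Y (u, v) = (\<Oplus>\<^bsub>B\<^esub>w\<in>pairs. \<zero>\<^bsub>B\<^esub>)"
    unfolding mat.mm_entry[OF uv] using uv False a Y
    by (intro mat.M.finsum_cong') (auto simp: wedge_entry mat.gl_entry)
  then show ?thesis using False by (auto simp: mat.M.finsum_zero)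
qed

lemma wedge_wedge:
  assumes a: "a \<in> carrier A" "b \<in> carrier A" and jl: "j \<in> {1..4}" "l \<in> {1..4}" and uv: "u \<in> pairs" "v \<in> pairs"
  shows "mm (wedge i j a) (wedge k l b) (u, v) =
    (if i \<in> u \<and> j \<notin> u \<and> k \<in> insert j (u - {i}) \<and> l \<notin> insert j (u - {i}) \<and>
        v = insert l (insert j (u - {i}) - {k}) then cls (a \<otimes>\<^bsub>A\<^esub> b) else \<zero>\<^bsub>B\<^esub>)"
proof (cases "i \<in> u \<and> j \<notin> u")
  case True
  then have "insert j (u - {i}) \<in> pairs" using uv jl by (intro pairs_replace) auto
  then show ?thesis
    using wedge_mm[OF a(1) wedge_closed[OF a(2)] jl(1) uv, of i k l] True uv a
    by (simp add: wedge_entry cls_closed A2.quot_mult)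
next
  case False
  then show ?thesis using wedge_mm[OF a(1) wedge_closed[OF a(2)] jl(1) uv, of i k l] by auto
qed

lemma cls_comm: "\<lbrakk>a \<in> carrier A; b \<in> carrier A\<rbrakk> \<Longrightarrow> cls (b \<otimes>\<^bsub>A\<^esub> a) = cls (a \<otimes>\<^bsub>A\<^esub> b)"
  using B_comm[OF cls_closed cls_closed] by (simp add: A2.quot_mult)

lemma wedge_comp:
  assumes a: "a \<in> carrier A" "b \<in> carrier A" and i: "i \<in> {1..4}" "j \<in> {1..4}" "k \<in> {1..4}" "i \<noteq> j" "j \<noteq> k" "i \<noteq> k"
  shows "wedge i j a \<otimes>\<^bsub>gl\<^esub> wedge j k b = wedge i k (a \<otimes>\<^bsub>A\<^esub> b)"
proof (rule mat.gl_eqI)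
  show "wedge i j a \<otimes>\<^bsub>gl\<^esub> wedge j k b \<in> carrier gl"
    using a by (simp add: mat.gl_bracket mat.mm_closed wedge_closed)
  show "wedge i k (a \<otimes>\<^bsub>A\<^esub> b) \<in> carrier gl" using a by (simp add: wedge_closed)
  fix u v assume uv: "u \<in> pairs" "v \<in> pairs"
  let ?c = "i \<in> u \<and> k \<notin> u \<and> v = insert k (u - {i})"
  have 1: "mm (wedge i j a) (wedge j k b) (u, v) = (if ?c \<and> j \<notin> u then cls (a \<otimes>\<^bsub>A\<^esub> b) else \<zero>\<^bsub>B\<^esub>)"
    using i by (subst wedge_wedge[OF a i(2,3) uv], intro if_cong) auto
  have 2: "mm (wedge j k b) (wedge i j a) (u, v) = (if ?c \<and> j \<in> u then cls (a \<otimes>\<^bsub>A\<^esub> b) else \<zero>\<^bsub>B\<^esub>)"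
    unfolding cls_comm[OF a, symmetric] using i
    by (subst wedge_wedge[OF a(2,1) i(3,2) uv], intro if_cong) auto
  show "(wedge i j a \<otimes>\<^bsub>gl\<^esub> wedge j k b) (u, v) = wedge i k (a \<otimes>\<^bsub>A\<^esub> b) (u, v)"
    unfolding mat.gl_bracket mat.gl_add_entry[OF uv] 1 2 wedge_entry[OF uv]
    using cls_closed[of "a \<otimes>\<^bsub>A\<^esub> b"] a by (cases "j \<in> u") auto
qed

lemma wedge_commute:
  assumes a: "a \<in> carrier A" "b \<in> carrier A" and i: "j \<in> {1..4}" "l \<in> {1..4}" "j \<noteq> k" "i \<noteq> l"
  shows "wedge i j a \<otimes>\<^bsub>gl\<^esub> wedge k l b = \<zero>\<^bsub>gl\<^esub>"
proof (rule mat.gl_eqI)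
  show "wedge i j a \<otimes>\<^bsub>gl\<^esub> wedge k l b \<in> carrier gl"
    using a by (simp add: mat.gl_bracket mat.mm_closed wedge_closed)
  fix u v assume uv: "u \<in> pairs" "v \<in> pairs"
  have 2: "mm (wedge k l b) (wedge i j a) (u, v) = mm (wedge i j a) (wedge k l b) (u, v)"
    unfolding wedge_wedge[OF a i(1,2) uv] wedge_wedge[OF a(2,1) i(2,1) uv] cls_comm[OF a]
    using i by (intro if_cong) auto
  show "(wedge i j a \<otimes>\<^bsub>gl\<^esub> wedge k l b) (u, v) = \<zero>\<^bsub>gl\<^esub> (u, v)"
    unfolding mat.gl_bracket mat.gl_add_entry[OF uv] 2
    using B_double[OF mat.gl_entry[OF mat.mm_closed[OF wedge_closed[OF a(1)] wedge_closed[OF a(2)]] uv]] uv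
    by (simp add: gl_zero_entry)
qed simp

lemma wedge_add: "\<lbrakk>a \<in> carrier A; b \<in> carrier A\<rbrakk> \<Longrightarrow> wedge i j (a \<oplus>\<^bsub>A\<^esub> b) = wedge i j a \<oplus>\<^bsub>gl\<^esub> wedge i j b"
  by (rule mat.gl_eqI) (auto simp: wedge_closed mat.gl_add_entry wedge_entry A2.quot_add)

lemma wedge_smult: "\<lbrakk>c \<in> carrier K; a \<in> carrier A\<rbrakk> \<Longrightarrow> wedge i j (c \<odot>\<^bsub>A\<^esub> a) = c \<odot>\<^bsub>gl\<^esub> wedge i j a"
  by (rule mat.gl_eqI) (auto simp: wedge_closed gl_smult_entry wedge_entry A2.quot_smult)

text \<open>
  The matrices \<open>wedge i j a\<close> satisfy the defining relations. For disjoint pairs of indices,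
  \<open>wedge i j a\<close> and \<open>wedge k l b\<close> commute because their product replaces \<open>{i, k}\<close> by \<open>{j, l}\<close> in either order.
\<close>
lemma exterior_square_exists:
  obtains \<phi> where "\<phi> \<in> lie_superalgebra_hom K L gl"
    "\<And>i j p a. \<lbrakk>i \<in> {1..4}; j \<in> {1..4}; i \<noteq> j; a \<in> grade A p\<rbrakk> \<Longrightarrow> \<phi> (F i j p a) = wedge i j a"
proof -
  define v where "v = (\<lambda>(i, j, p :: bit, a). wedge i j a)"
  have gens_E: "v g \<in> grade gl (st_degree g)" if "g \<in> st_letters A" for g
    using that wedge_grade by (auto simp: v_def st_letters_def st_degree_def)
  interpret gll: lie_superalgebra K gl by (rule mat.gl_lie_superalgebra)
  interpret E: free_extension K "st_letters A" st_degree gl v by unfold_locales (rule gens_E)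
  note f = E.free_ext_hom
  note hom = lie_superalgebra_homD[OF f]
    lie_hom_zero_minus[OF f fr.N.M.abelian_group_axioms mat.gl.M.abelian_group_axioms]
  have gen: "E.ext (gen i j p a) = wedge i j a" if "i \<in> {1..4}" "j \<in> {1..4}" "i \<noteq> j" "a \<in> grade A p" for i j p a
    using E.free_ext_gen[OF st_letterI[OF that]] by (simp add: v_def)
  have "E.ext r = \<zero>\<^bsub>gl\<^esub>" if "r \<in> st_relators K A" for r
    using that
  proof (cases rule: st_relatorsE)
    case (add i j p a b)
    then show ?thesis
      by (simp add: hom gen gen_closed grade_add grade_carrier wedge_add wedge_closed mat.gl.M.minus_eq_zero_iff)
  next
    case (smult i j p c a)
    then show ?thesis
      by (simp add: hom gen gen_closed grade_smult grade_carrier wedge_smult wedge_closed mat.gl.M.minus_eq_zero_iff)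
  next
    case (comp i j k p q a b)
    then show ?thesis
      by (simp add: hom gen gen_closed mult_grade grade_carrier wedge_comp wedge_closed
          fr.N.mult_closed mat.gl.M.minus_eq_zero_iff)
  next
    case (zero i j k l p q a b)
    then show ?thesis by (simp add: hom gen gen_closed grade_carrier wedge_commute)
  qed
  then obtain h where "h \<in> lie_superalgebra_hom K L gl"
    "\<And>g. g \<in> st_letters A \<Longrightarrow> h (pr.PI +>\<^bsub>N\<^esub> free_gen K g) = v g"
    using pr.presented_hom[OF mat.gl_lie_superalgebra gens_E] by blast
  then show thesis using that st_letterI by (auto simp: F_coset v_def)
qed

text \<open>
  One such homomorphism; its values on the carrier are determined by those on the generators.
\<close>
definition \<phi> :: "('a st_letter monomial \<Rightarrow> 'k) set \<Rightarrow> nat set \<times> nat set \<Rightarrow> 'a set" where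
  "\<phi> = (SOME \<phi>. \<phi> \<in> lie_superalgebra_hom K L gl \<and>
    (\<forall>i j p a. i \<in> {1..4} \<and> j \<in> {1..4} \<and> i \<noteq> j \<and> a \<in> grade A p \<longrightarrow> \<phi> (F i j p a) = wedge i j a))"

lemma \<phi>_props: "\<phi> \<in> lie_superalgebra_hom K L gl"
    "\<lbrakk>i \<in> {1..4}; j \<in> {1..4}; i \<noteq> j; a \<in> grade A p\<rbrakk> \<Longrightarrow> \<phi> (F i j p a) = wedge i j a"
proof -
  let ?P = "\<lambda>\<phi>. \<phi> \<in> lie_superalgebra_hom K L gl \<and>
    (\<forall>i j p a. i \<in> {1..4} \<and> j \<in> {1..4} \<and> i \<noteq> j \<and> a \<in> grade A p \<longrightarrow> \<phi> (F i j p a) = wedge i j a)"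
  have "\<exists>\<phi>. ?P \<phi>" by (rule exterior_square_exists) blast
  then have P: "?P \<phi>" unfolding \<phi>_def by (rule someI_ex)
  show "\<phi> \<in> lie_superalgebra_hom K L gl" using P by blast
  show "\<phi> (F i j p a) = wedge i j a" if "i \<in> {1..4}" "j \<in> {1..4}" "i \<noteq> j" "a \<in> grade A p"
    using P that by blast
qed

lemmas \<phi>_hom = lie_superalgebra_homD[OF \<phi>_props(1)]

text \<open>
  Matrices that are skew for the wedge pairing of the exterior square with itself; in
  characteristic two, skewness includes the vanishing of the entries at complementary pairs.
\<close>
definition skew_matrices :: "(nat set \<times> nat set \<Rightarrow> 'a set) set" where
  "skew_matrices = {X \<in> carrier gl. \<forall>u\<in>pairs. X (u, copair u) = \<zero>\<^bsub>B\<^esub> \<and> (\<forall>v\<in>pairs. X (copair v, copair u) = X (u, v))}"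

lemma skew_matricesD:
  assumes "X \<in> skew_matrices"
  shows "X \<in> carrier gl" "u \<in> pairs \<Longrightarrow> X (u, copair u) = \<zero>\<^bsub>B\<^esub>"
    "\<lbrakk>u \<in> pairs; v \<in> pairs\<rbrakk> \<Longrightarrow> X (copair v, copair u) = X (u, v)"
  using assms by (auto simp: skew_matrices_def)

text \<open>
  Transposition with respect to the wedge pairing moves the entry at \<open>(u, v)\<close> to \<open>(copair v, copair u)\<close>.
  Like ordinary transposition over a commutative ring, it reverses products.
\<close>
lemma mm_transpose:
  assumes X: "X \<in> carrier gl" "\<And>u v. \<lbrakk>u \<in> pairs; v \<in> pairs\<rbrakk> \<Longrightarrow> X (copair v, copair u) = X' (u, v)"
    and Y: "Y \<in> carrier gl" "\<And>u v. \<lbrakk>u \<in> pairs; v \<in> pairs\<rbrakk> \<Longrightarrow> Y (copair v, copair u) = Y' (u, v)"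
    and uv: "u \<in> pairs" "v \<in> pairs"
  shows "mm X Y (copair v, copair u) = mm Y' X' (u, v)"
proof -
  have "u \<in> copair ` pairs" if "u \<in> pairs" for u
    by (rule image_eqI[of u copair "copair u"]) (simp_all only: copair_copair copair_pairs that)
  then have img: "copair ` pairs = pairs" using copair_pairs by blast
  have inj: "inj_on copair pairs" by (rule inj_onI) (metis copair_copair)
  note cov = copair_pairs[OF uv(2)] copair_pairs[OF uv(1)]
  have "mm X Y (copair v, copair u) = (\<Oplus>\<^bsub>B\<^esub>w\<in>copair ` pairs. X (copair v, w) \<otimes>\<^bsub>B\<^esub> Y (w, copair u))"
    unfolding mat.mm_entry[OF cov] img ..
  also have "\<dots> = (\<Oplus>\<^bsub>B\<^esub>w\<in>pairs. X (copair v, copair w) \<otimes>\<^bsub>B\<^esub> Y (copair w, copair u))"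
    using X(1) Y(1) cov by (intro mat.M.finsum_reindex[OF _ inj]) (auto simp: img mat.gl_entry copair_pairs)
  also have "\<dots> = (\<Oplus>\<^bsub>B\<^esub>w\<in>pairs. Y' (u, w) \<otimes>\<^bsub>B\<^esub> X' (w, v))"
  proof (rule mat.M.finsum_cong'[OF refl])
    fix w assume w: "w \<in> pairs"
    have cl: "X (copair v, copair w) \<in> carrier B" "Y (copair w, copair u) \<in> carrier B"
      using X(1) Y(1) cov copair_pairs[OF w] by (auto intro: mat.gl_entry)
    show "X (copair v, copair w) \<otimes>\<^bsub>B\<^esub> Y (copair w, copair u) = Y' (u, w) \<otimes>\<^bsub>B\<^esub> X' (w, v)"
      using B_comm[OF cl] X(2)[OF w uv(2)] Y(2)[OF uv(1) w] by simp
  next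
    show "(\<lambda>w. Y' (u, w) \<otimes>\<^bsub>B\<^esub> X' (w, v)) \<in> pairs \<rightarrow> carrier B"
    proof
      fix w assume w: "w \<in> pairs"
      have "X (copair v, copair w) \<in> carrier B" "Y (copair w, copair u) \<in> carrier B"
        using X(1) Y(1) cov copair_pairs[OF w] by (auto intro: mat.gl_entry)
      then show "Y' (u, w) \<otimes>\<^bsub>B\<^esub> X' (w, v) \<in> carrier B"
        using X(2)[OF w uv(2)] Y(2)[OF uv(1) w] by simp
    qed
  qed
  finally show ?thesis unfolding mat.mm_entry[OF uv] .
qed

lemma mm_transpose_skew:
  "\<lbrakk>X \<in> skew_matrices; Y \<in> skew_matrices; u \<in> pairs; v \<in> pairs\<rbrakk> \<Longrightarrow> mm X Y (copair v, copair u) = mm Y X (u, v)"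
  by (rule mm_transpose) (auto dest: skew_matricesD)

lemma mm_skew_comm:
  "\<lbrakk>X \<in> skew_matrices; Y \<in> skew_matrices; u \<in> pairs\<rbrakk> \<Longrightarrow> mm X Y (u, copair u) = mm Y X (u, copair u)"
  using mm_transpose_skew[of X Y u "copair u"] by (simp add: copair_pairs copair_copair)

text \<open>
  The reversed product is the transpose, and transposition fixes each entry at a pair and its
  complement.
\<close>
lemma mm3_skew:
  assumes "X \<in> skew_matrices" "Y \<in> skew_matrices" "Z \<in> skew_matrices" and u: "u \<in> pairs"
  shows "mm X (mm Y Z) (u, copair u) = mm Z (mm Y X) (u, copair u)"
proof -
  note c = assms(1-3)[THEN skew_matricesD(1)]
  have "mm X (mm Y Z) (copair (copair u), copair u) = mm (mm Z Y) X (u, copair u)"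
    by (rule mm_transpose)
      (use assms c mm_transpose_skew u in \<open>auto intro: mat.mm_closed copair_pairs dest: skew_matricesD\<close>)
  then show ?thesis using u c by (simp add: copair_copair mat.mm_assoc)
qed

lemma skew_bracket: "\<lbrakk>X \<in> skew_matrices; Y \<in> skew_matrices\<rbrakk> \<Longrightarrow> X \<otimes>\<^bsub>gl\<^esub> Y \<in> skew_matrices"
proof -
  assume X: "X \<in> skew_matrices" and Y: "Y \<in> skew_matrices"
  note c = X[THEN skew_matricesD(1)] Y[THEN skew_matricesD(1)]
  have cl: "mm X Y \<in> carrier gl" "mm Y X \<in> carrier gl" using c by (simp_all add: mat.mm_closed)
  have "(X \<otimes>\<^bsub>gl\<^esub> Y) (u, copair u) = \<zero>\<^bsub>B\<^esub>" if u: "u \<in> pairs" for u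
    using mm_skew_comm[OF X Y u] B_double mat.gl_entry[OF cl(2) u copair_pairs[OF u]]
    by (simp add: mat.gl_bracket mat.gl_add_entry u copair_pairs)
  moreover have "(X \<otimes>\<^bsub>gl\<^esub> Y) (copair v, copair u) = (X \<otimes>\<^bsub>gl\<^esub> Y) (u, v)" if uv: "u \<in> pairs" "v \<in> pairs" for u v
    using mm_transpose_skew[OF X Y uv] mm_transpose_skew[OF Y X uv]
      mat.M.a_comm[OF mat.gl_entry[OF cl(1) uv] mat.gl_entry[OF cl(2) uv]] uv
    by (simp add: mat.gl_bracket mat.gl_add_entry copair_pairs)
  moreover have "X \<otimes>\<^bsub>gl\<^esub> Y \<in> carrier gl" using cl by (simp add: mat.gl_bracket)
  ultimately show ?thesis by (simp add: skew_matrices_def)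
qed

lemma wedge_skew:
  assumes "a \<in> carrier A" "i \<in> {1..4}" "j \<in> {1..4}" "i \<noteq> j"
  shows "wedge i j a \<in> skew_matrices"
proof -
  have "wedge i j a (u, copair u) = \<zero>\<^bsub>B\<^esub>" if u: "u \<in> pairs" for u
    using u replace_ne_co by (auto simp: wedge_entry copair_pairs)
  moreover have "wedge i j a (copair v, copair u) = wedge i j a (u, v)" if uv: "u \<in> pairs" "v \<in> pairs" for u v
  proof -
    have "u \<subseteq> {1..4}" "v \<subseteq> {1..4}" using uv by (auto simp: pairs_def)
    then have "i \<in> copair v \<and> j \<notin> copair v \<and> copair u = insert j (copair v - {i}) \<longleftrightarrow> i \<in> u \<and> j \<notin> u \<and> v = insert j (u - {i})"
      using assms unfolding copair_def by blast
    then show ?thesis by (simp add: wedge_entry uv copair_pairs)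
  qed
  ultimately show ?thesis using wedge_closed assms(1) by (simp add: skew_matrices_def)
qed

lemma skew_lin:
  "\<zero>\<^bsub>gl\<^esub> \<in> skew_matrices"
  "\<lbrakk>X \<in> skew_matrices; Y \<in> skew_matrices\<rbrakk> \<Longrightarrow> X \<oplus>\<^bsub>gl\<^esub> Y \<in> skew_matrices"
  "\<lbrakk>c \<in> carrier K; X \<in> skew_matrices\<rbrakk> \<Longrightarrow> c \<odot>\<^bsub>gl\<^esub> X \<in> skew_matrices"
  by (auto simp: skew_matrices_def mat.gl_add_entry copair_pairs gl_zero_entry gl_smult_entry)

text \<open>
  On the exterior square, \<open>sl\<^sub>4\<close> acts by transformations that are skew for the wedge pairing.
\<close>
lemma \<phi>_skew: "x \<in> carrier L \<Longrightarrow> \<phi> x \<in> skew_matrices"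
proof (induction rule: pr.presented_induct)
  case (gen g)
  obtain i j p a where g: "g = (i, j, p, a)" "i \<in> {1..4}" "j \<in> {1..4}" "i \<noteq> j" "a \<in> grade A p"
    using gen by (auto simp: st_letters_def)
  then show ?case
    unfolding g(1) F_coset[symmetric] \<phi>_props(2)[OF g(2-5)] by (intro wedge_skew grade_carrier)
next
  case zero
  show ?case using lie_hom_zero[OF \<phi>_props(1) L.M.abelian_group_axioms mat.gl.M.abelian_group_axioms]
    skew_lin(1) by simp
qed (auto simp: \<phi>_hom skew_lin skew_bracket)

definition "diagonal_matrices = {X \<in> carrier gl. \<forall>u\<in>pairs. \<forall>v\<in>pairs. u \<noteq> v \<longrightarrow> X (u, v) = \<zero>\<^bsub>B\<^esub>}"

lemma diagonal_mm:
  assumes "D \<in> diagonal_matrices" "Y \<in> carrier gl" and uv: "u \<in> pairs" "v \<in> pairs"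
  shows "mm D Y (u, v) = D (u, u) \<otimes>\<^bsub>B\<^esub> Y (u, v)" "mm Y D (u, v) = Y (u, v) \<otimes>\<^bsub>B\<^esub> D (v, v)"
proof -
  have D: "D \<in> carrier gl" "\<And>u v. \<lbrakk>u \<in> pairs; v \<in> pairs; u \<noteq> v\<rbrakk> \<Longrightarrow> D (u, v) = \<zero>\<^bsub>B\<^esub>"
    using assms(1) by (auto simp: diagonal_matrices_def)
  have "mm D Y (u, v) = (\<Oplus>\<^bsub>B\<^esub>w\<in>pairs. if u = w then D (u, w) \<otimes>\<^bsub>B\<^esub> Y (w, v) else \<zero>\<^bsub>B\<^esub>)"
    unfolding mat.mm_entry[OF uv] using uv D assms(2)
    by (intro mat.M.finsum_cong') (auto simp: mat.gl_entry)
  also have "\<dots> = D (u, u) \<otimes>\<^bsub>B\<^esub> Y (u, v)"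
    using mat.M.finsum_singleton[OF uv(1) finite_pairs, of "\<lambda>w. D (u, w) \<otimes>\<^bsub>B\<^esub> Y (w, v)"] D(1) assms(2) uv
    by (auto simp: mat.gl_entry)
  finally show "mm D Y (u, v) = D (u, u) \<otimes>\<^bsub>B\<^esub> Y (u, v)" .
  have "mm Y D (u, v) = (\<Oplus>\<^bsub>B\<^esub>w\<in>pairs. if v = w then Y (u, w) \<otimes>\<^bsub>B\<^esub> D (w, v) else \<zero>\<^bsub>B\<^esub>)"
    unfolding mat.mm_entry[OF uv] using uv D assms(2)
    by (intro mat.M.finsum_cong') (auto simp: mat.gl_entry)
  also have "\<dots> = Y (u, v) \<otimes>\<^bsub>B\<^esub> D (v, v)"
    using mat.M.finsum_singleton[OF uv(2) finite_pairs, of "\<lambda>w. Y (u, w) \<otimes>\<^bsub>B\<^esub> D (w, v)"] D(1) assms(2) uv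
    by (auto simp: mat.gl_entry)
  finally show "mm Y D (u, v) = Y (u, v) \<otimes>\<^bsub>B\<^esub> D (v, v)" .
qed

lemma \<phi>_H_diagonal: "x \<in> st_H_subalgebra K A \<Longrightarrow> x \<in> carrier L \<and> \<phi> x \<in> diagonal_matrices"
proof -
  let ?T = "{x \<in> carrier L. \<phi> x \<in> diagonal_matrices}"
  let ?S = "{F i j p a \<otimes>\<^bsub>L\<^esub> F j i q b | i j p q a b.
        i \<in> {1..4} \<and> j \<in> {1..4} \<and> i \<noteq> j \<and> a \<in> grade A p \<and> b \<in> grade A q}"
  have "submodule ?T K L"
  proof (rule L.submoduleI)
    have 0: "\<phi> \<zero>\<^bsub>L\<^esub> = \<zero>\<^bsub>gl\<^esub>" and neg: "\<And>x. x \<in> carrier L \<Longrightarrow> \<phi> (\<ominus>\<^bsub>L\<^esub> x) = \<phi> x"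
      using lie_hom_zero_minus(1,2)[OF \<phi>_props(1) L.M.abelian_group_axioms mat.gl.M.abelian_group_axioms]
      by (auto simp: mat.gl_uminus \<phi>_hom)
    show "\<zero>\<^bsub>L\<^esub> \<in> ?T" by (simp add: 0 diagonal_matrices_def gl_zero_entry)
    show "\<ominus>\<^bsub>L\<^esub> x \<in> ?T" if "x \<in> ?T" for x using that by (simp add: neg)
    show "x \<oplus>\<^bsub>L\<^esub> y \<in> ?T" if "x \<in> ?T" "y \<in> ?T" for x y
      using that by (auto simp: \<phi>_hom diagonal_matrices_def mat.gl_add_entry)
    show "c \<odot>\<^bsub>L\<^esub> x \<in> ?T" if "c \<in> carrier K" "x \<in> ?T" for c x
      using that by (auto simp: \<phi>_hom diagonal_matrices_def gl_smult_entry)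
  qed auto
  moreover have "x \<otimes>\<^bsub>L\<^esub> y \<in> ?T" if "x \<in> ?T" "y \<in> ?T" for x y
  proof -
    have xy: "x \<in> carrier L" "y \<in> carrier L" "\<phi> x \<in> diagonal_matrices" "\<phi> y \<in> diagonal_matrices"
      "\<phi> x \<in> carrier gl" "\<phi> y \<in> carrier gl"
      using that by (auto simp: diagonal_matrices_def)
    have "(\<phi> x \<otimes>\<^bsub>gl\<^esub> \<phi> y) (u, v) = \<zero>\<^bsub>B\<^esub>" if uv: "u \<in> pairs" "v \<in> pairs" "u \<noteq> v" for u v
    proof -
      have "\<phi> x (u, v) = \<zero>\<^bsub>B\<^esub>" "\<phi> y (u, v) = \<zero>\<^bsub>B\<^esub>"
        using xy uv by (auto simp: diagonal_matrices_def)
      then show ?thesis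
        using xy uv mat.gl_entry by (simp add: mat.gl_bracket mat.gl_add_entry diagonal_mm)
    qed
    then have "\<phi> x \<otimes>\<^bsub>gl\<^esub> \<phi> y \<in> diagonal_matrices"
      using xy by (auto simp: diagonal_matrices_def mat.gl_bracket mat.mm_closed)
    then show ?thesis using xy by (simp add: \<phi>_hom L.mult_closed)
  qed
  moreover have "?S \<subseteq> ?T"
  proof
    fix x assume "x \<in> ?S"
    then obtain i j p q a b where x: "x = F i j p a \<otimes>\<^bsub>L\<^esub> F j i q b" and
      ij: "i \<in> {1..4}" "j \<in> {1..4}" "i \<noteq> j" "a \<in> grade A p" "b \<in> grade A q" by blast
    note c = ij(4,5)[THEN grade_carrier]
    have "\<phi> x = wedge i j a \<otimes>\<^bsub>gl\<^esub> wedge j i b"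
      using ij by (simp add: x \<phi>_hom F_closed \<phi>_props(2))
    moreover have "(wedge i j a \<otimes>\<^bsub>gl\<^esub> wedge j i b) (u, v) = \<zero>\<^bsub>B\<^esub>" if uv: "u \<in> pairs" "v \<in> pairs" "u \<noteq> v" for u v
    proof -
      have "mm (wedge i j a) (wedge j i b) (u, v) = \<zero>\<^bsub>B\<^esub>"
        unfolding wedge_wedge[OF c ij(2,1) uv(1,2)] using uv(3) by (intro if_not_P) auto
      moreover have "mm (wedge j i b) (wedge i j a) (u, v) = \<zero>\<^bsub>B\<^esub>"
        unfolding wedge_wedge[OF c(2,1) ij(1,2) uv(1,2)] using uv(3) by (intro if_not_P) auto
      ultimately show ?thesis by (simp add: mat.gl_bracket mat.gl_add_entry uv)
    qed
    moreover have "wedge i j a \<otimes>\<^bsub>gl\<^esub> wedge j i b \<in> carrier gl"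
      using c by (simp add: mat.gl_bracket mat.mm_closed wedge_closed)
    ultimately show "x \<in> ?T" using ij by (simp add: diagonal_matrices_def x L.mult_closed F_closed)
  qed
  ultimately have "st_H_subalgebra K A \<subseteq> ?T"
    unfolding st_H_subalgebra_def subalgebra_gen_def steinberg_quot by (intro Inter_lower) auto
  then show "x \<in> st_H_subalgebra K A \<Longrightarrow> ?thesis" by blast
qed

end

section \<open>Existence and uniqueness of the cocycle\<close>

lemma quadruplesD:
  assumes "(i, j, k, l) \<in> quadruples"
  shows "i \<in> {1..4}" "j \<in> {1..4}" "k \<in> {1..4}" "l \<in> {1..4}" "distinct [i, j, k, l]" "copair {i, k} = {j, l}"
proof -
  have "{i, j, k, l} = {1..4}"
    by (rule card_subset_eq) (use assms in \<open>auto simp: quadruples_def\<close>)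
  then show "copair {i, k} = {j, l}" using assms unfolding copair_def quadruples_def by auto
qed (use assms in \<open>auto simp: quadruples_def\<close>)

lemma quadruples_pair: "(i, j, k, l) \<in> quadruples \<Longrightarrow> {i, k} \<in> pairs"
  by (auto simp: pairs_def quadruples_def)

text \<open>
  A class of quadruples is the same thing as the set \<open>{i, k}\<close> of its first and third index: the
  other two indices form the complement.
\<close>
lemma quadruple_class_iff:
  assumes "(i, j, k, l) \<in> quadruples" "(i', j', k', l') \<in> quadruples"
  shows "(i', j', k', l') \<in> quadruple_class (i, j, k, l) \<longleftrightarrow> {i', k'} = {i, k}"
proof
  assume "(i', j', k', l') \<in> quadruple_class (i, j, k, l)"
  then show "{i', k'} = {i, k}" by auto
next
  assume eq: "{i', k'} = {i, k}"
  have "{j', l'} = {j, l}" using quadruplesD(6)[OF assms(1)] quadruplesD(6)[OF assms(2)] eq by simp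
  then show "(i', j', k', l') \<in> quadruple_class (i, j, k, l)"
    using eq unfolding doubleton_eq_iff by auto
qed

locale steinberg_labelled = steinberg_algebra K A
  for K :: "('k, 'c) ring_scheme" (structure) and A :: "('k, 'a) superalgebra" (structure) +
  fixes \<theta> :: "nat \<times> nat \<times> nat \<times> nat \<Rightarrow> nat"
  assumes labelling: "class_labelling \<theta>"
begin

lemma \<theta>_image: "\<theta> ` quadruples = {1..6}"
  using labelling unfolding class_labelling_def by blast

lemma \<theta>_range: "s \<in> quadruples \<Longrightarrow> \<theta> s \<in> {1..6}"
  using \<theta>_image by blast

lemma \<theta>_surj: "r \<in> {1..6} \<Longrightarrow> \<exists>s\<in>quadruples. \<theta> s = r"
  unfolding \<theta>_image[symmetric] by blast

lemma \<theta>_eq_iff: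
  "\<lbrakk>(i, j, k, l) \<in> quadruples; (i', j', k', l') \<in> quadruples\<rbrakk>
    \<Longrightarrow> \<theta> (i, j, k, l) = \<theta> (i', j', k', l') \<longleftrightarrow> {i', k'} = {i, k}"
  using labelling quadruple_class_iff[of i j k l i' j' k' l'] unfolding class_labelling_def by blast

text \<open>By \<open>\<theta>_eq_iff\<close>, the six classes correspond to the two-element subsets.\<close>
definition pair_of :: "nat \<Rightarrow> nat set" where
  "pair_of r = (SOME u. \<exists>i j k l. (i, j, k, l) \<in> quadruples \<and> \<theta> (i, j, k, l) = r \<and> u = {i, k})"

lemma pair_of_\<theta>:
  assumes "(i, j, k, l) \<in> quadruples"
  shows "pair_of (\<theta> (i, j, k, l)) = {i, k}"
proof -
  have "\<exists>u i' j' k' l'. (i', j', k', l') \<in> quadruples \<and> \<theta> (i', j', k', l') = \<theta> (i, j, k, l) \<and> u = {i', k'}"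
    using assms by blast
  from someI_ex[OF this, folded pair_of_def] obtain i' j' k' l'
    where "(i', j', k', l') \<in> quadruples" "\<theta> (i', j', k', l') = \<theta> (i, j, k, l)" "pair_of (\<theta> (i, j, k, l)) = {i', k'}"
    by blast
  then show ?thesis using \<theta>_eq_iff[OF _ assms] by auto
qed

lemma pair_of_eq_iff:
  assumes "(i, j, k, l) \<in> quadruples" "r \<in> {1..6}"
  shows "pair_of r = {i, k} \<longleftrightarrow> r = \<theta> (i, j, k, l)"
proof -
  obtain i' j' k' l' where s: "(i', j', k', l') \<in> quadruples" "\<theta> (i', j', k', l') = r"
    using \<theta>_surj[OF assms(2)] by auto
  have eq: "pair_of r = {i', k'}" using pair_of_\<theta>[OF s(1)] s(2) by simp
  show ?thesis unfolding eq \<theta>_eq_iff[OF assms(1) s(1), unfolded s(2), symmetric] by (rule eq_commute)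
qed

lemma pair_of_pairs:
  assumes "r \<in> {1..6}"
  shows "pair_of r \<in> pairs"
proof -
  obtain i j k l where s: "(i, j, k, l) \<in> quadruples" "\<theta> (i, j, k, l) = r"
    using \<theta>_surj[OF assms] by auto
  show ?thesis using pair_of_\<theta>[OF s(1)] quadruples_pair[OF s(1)] s(2) by simp
qed

abbreviation "W \<equiv> W_mod A"

lemma W_simps:
  "carrier W = {1..6} \<rightarrow>\<^sub>E carrier B"
  "\<zero>\<^bsub>W\<^esub> = (\<lambda>r\<in>{1..6}. \<zero>\<^bsub>B\<^esub>)"
  "v \<oplus>\<^bsub>W\<^esub> w = (\<lambda>r\<in>{1..6}. v r \<oplus>\<^bsub>B\<^esub> w r)"
  "c \<odot>\<^bsub>W\<^esub> v = (\<lambda>r\<in>{1..6}. c \<odot>\<^bsub>B\<^esub> v r)"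
  "grade W p = (\<Pi>\<^sub>E r\<in>{1..6}. grade B (p + 1))"
  by (simp_all add: W_mod_def super_power_def parity_change_def A2_quot)

sublocale W: supermodule K W
  by (rule supermodule_PiE[OF mat.supermodule_axioms W_simps])

lemma W_entry: "\<lbrakk>w \<in> carrier W; r \<in> {1..6}\<rbrakk> \<Longrightarrow> w r \<in> carrier B"
  unfolding W_simps by (rule PiE_mem)

lemma W_eqI: "\<lbrakk>v \<in> carrier W; w \<in> carrier W; \<And>r. r \<in> {1..6} \<Longrightarrow> v r = w r\<rbrakk> \<Longrightarrow> v = w"
  unfolding W_simps by (rule PiE_ext) auto

lemma W_entries:
  "r \<in> {1..6} \<Longrightarrow> \<zero>\<^bsub>W\<^esub> r = \<zero>\<^bsub>B\<^esub>"
  "r \<in> {1..6} \<Longrightarrow> (v \<oplus>\<^bsub>W\<^esub> w) r = v r \<oplus>\<^bsub>B\<^esub> w r"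
  "r \<in> {1..6} \<Longrightarrow> (c \<odot>\<^bsub>W\<^esub> v) r = c \<odot>\<^bsub>B\<^esub> v r"
  by (simp_all add: W_simps)

lemma W_double: "w \<in> carrier W \<Longrightarrow> w \<oplus>\<^bsub>W\<^esub> w = \<zero>\<^bsub>W\<^esub>"
  by (rule W_eqI) (auto simp del: atLeastAtMost_iff simp: W_entries B_double W_entry)

lemma W_uminus: "w \<in> carrier W \<Longrightarrow> \<ominus>\<^bsub>W\<^esub> w = w"
  using W.M.minus_equality[OF W_double] by simp

lemma W_ssign: "w \<in> carrier W \<Longrightarrow> ssign W p q w = w"
  by (simp add: ssign_def W_uminus)

text \<open>
  A product of two skew matrices need not be skew. Its entries at complementary pairs measure the
  failure, and they are the components of the cocycle.
\<close>
definition psi where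
  "psi x y = (\<lambda>r\<in>{1..6}. mm (\<phi> x) (\<phi> y) (pair_of r, copair (pair_of r)))"

lemma psi_entry: "r \<in> {1..6} \<Longrightarrow> psi x y r = mm (\<phi> x) (\<phi> y) (pair_of r, copair (pair_of r))"
  by (simp add: psi_def)

lemma \<phi>_gl: "x \<in> carrier L \<Longrightarrow> \<phi> x \<in> carrier gl"
  by (rule \<phi>_hom(1))

lemma psi_closed:
  assumes "x \<in> carrier L" "y \<in> carrier L"
  shows "psi x y \<in> carrier W"
  unfolding W_simps psi_def
  using mat.gl_entry[OF mat.mm_closed[OF \<phi>_gl[OF assms(1)] \<phi>_gl[OF assms(2)]] pair_of_pairs copair_pairs[OF pair_of_pairs]]
  by (auto simp del: atLeastAtMost_iff)

lemma psi_bilinear: "bilinear_map K L L W psi"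
  unfolding bilinear_map_def
proof (intro conjI ballI)
  note entry = mat.gl_add_entry[OF pair_of_pairs copair_pairs[OF pair_of_pairs]]
    gl_smult_entry[OF pair_of_pairs copair_pairs[OF pair_of_pairs]]
  show "psi (x \<oplus>\<^bsub>L\<^esub> x') y = psi x y \<oplus>\<^bsub>W\<^esub> psi x' y"
    if "x \<in> carrier L" "x' \<in> carrier L" "y \<in> carrier L" for x x' y
    using that
    by (intro W_eqI psi_closed W.M.a_closed L.M.a_closed)
      (simp_all del: atLeastAtMost_iff add: psi_entry W_entries \<phi>_hom(2) mat.mm_add_left \<phi>_gl entry)
  show "psi x (y \<oplus>\<^bsub>L\<^esub> y') = psi x y \<oplus>\<^bsub>W\<^esub> psi x y'"
    if "x \<in> carrier L" "y \<in> carrier L" "y' \<in> carrier L" for x y y'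
    using that
    by (intro W_eqI psi_closed W.M.a_closed L.M.a_closed)
      (simp_all del: atLeastAtMost_iff add: psi_entry W_entries \<phi>_hom(2) mat.mm_add_right \<phi>_gl entry)
  show "psi (c \<odot>\<^bsub>L\<^esub> x) y = c \<odot>\<^bsub>W\<^esub> psi x y" "psi x (c \<odot>\<^bsub>L\<^esub> y) = c \<odot>\<^bsub>W\<^esub> psi x y"
    if "c \<in> carrier K" "x \<in> carrier L" "y \<in> carrier L" for c x y
    using that
    by (intro W_eqI psi_closed W.smult_closed L.smult_closed,
      simp_all del: atLeastAtMost_iff add: psi_entry W_entries \<phi>_hom(3) mat.mm_smult \<phi>_gl entry)+
qed (rule psi_closed)

lemma W_incl_simp: "W_incl A r x = (\<lambda>s\<in>{1..6}. if s = r then x else \<zero>\<^bsub>B\<^esub>)"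
  unfolding W_incl_def A2_quot ..

lemma W_incl_closed: "x \<in> carrier B \<Longrightarrow> W_incl A r x \<in> carrier W"
  unfolding W_incl_simp W_simps(1) using mat.M.zero_closed by auto

text \<open>
  By \<open>replace_twice_co\<close>, the product of two root matrices has a nonzero entry at a pair and its
  complement only if the four indices are distinct, and then only at the pair \<open>{i, k}\<close>.
\<close>
lemma psi_F:
  assumes ij: "i \<in> {1..4}" "j \<in> {1..4}" "i \<noteq> j" and kl: "k \<in> {1..4}" "l \<in> {1..4}" "k \<noteq> l"
    and a: "a \<in> grade A p" and b: "b \<in> grade A q"
  shows "psi (F i j p a) (F k l q b) =
    (if distinct [i, j, k, l] then W_incl A (\<theta> (i, j, k, l)) (cls (a \<otimes>\<^bsub>A\<^esub> b)) else \<zero>\<^bsub>W\<^esub>)"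
proof (rule W_eqI)
  note ab = grade_carrier[OF a] grade_carrier[OF b]
  show "psi (F i j p a) (F k l q b) \<in> carrier W" using assms by (intro psi_closed F_closed)
  show "(if distinct [i, j, k, l] then W_incl A (\<theta> (i, j, k, l)) (cls (a \<otimes>\<^bsub>A\<^esub> b)) else \<zero>\<^bsub>W\<^esub>) \<in> carrier W"
    using ab W_incl_closed cls_closed by (cases "distinct [i, j, k, l]") auto
  fix r :: nat assume r: "r \<in> {1..6}"
  let ?u = "pair_of r"
  note u = pair_of_pairs[OF r]
  have iff: "i \<in> ?u \<and> j \<notin> ?u \<and> k \<in> insert j (?u - {i}) \<and> l \<notin> insert j (?u - {i}) \<and>
      copair ?u = insert l (insert j (?u - {i}) - {k}) \<longleftrightarrow> distinct [i, j, k, l] \<and> ?u = {i, k}"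
    (is "?A \<longleftrightarrow> ?D")
  proof
    assume ?A
    then show ?D using replace_twice_co[OF u _ _ ij(2) kl(2), of i k] by blast
  next
    assume D: ?D
    then have "i \<in> ?u" "j \<notin> ?u" "k \<in> insert j (?u - {i})" "l \<notin> insert j (?u - {i})" by auto
    then show ?A using D replace_twice_co[OF u _ _ ij(2) kl(2), of i k] by blast
  qed
  have q: "distinct [i, j, k, l] \<Longrightarrow> (i, j, k, l) \<in> quadruples"
    using ij kl by (auto simp: quadruples_def)
  have "psi (F i j p a) (F k l q b) r = mm (wedge i j a) (wedge k l b) (?u, copair ?u)"
    unfolding psi_entry[OF r] \<phi>_props(2)[OF ij a] \<phi>_props(2)[OF kl b] ..
  also have "\<dots> = (if distinct [i, j, k, l] \<and> ?u = {i, k} then cls (a \<otimes>\<^bsub>A\<^esub> b) else \<zero>\<^bsub>B\<^esub>)"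
    unfolding wedge_wedge[OF ab ij(2) kl(2) u copair_pairs[OF u]] iff ..
  also have "\<dots> = (if distinct [i, j, k, l] then W_incl A (\<theta> (i, j, k, l)) (cls (a \<otimes>\<^bsub>A\<^esub> b)) else \<zero>\<^bsub>W\<^esub>) r"
    using pair_of_eq_iff[OF q r] r
    by (cases "distinct [i, j, k, l]") (auto simp del: atLeastAtMost_iff simp: W_incl_simp W_entries)
  finally show "psi (F i j p a) (F k l q b) r = \<dots>" .
qed

lemma psi_H:
  assumes "x \<in> carrier L" "y \<in> carrier L" "x \<in> st_H_subalgebra K A \<or> y \<in> st_H_subalgebra K A"
  shows "psi x y = \<zero>\<^bsub>W\<^esub>"
proof (rule W_eqI)
  fix r :: nat assume r: "r \<in> {1..6}"
  let ?u = "pair_of r"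
  note u = pair_of_pairs[OF r] copair_pairs[OF pair_of_pairs[OF r]]
  note skew = assms(1,2)[THEN \<phi>_skew]
  note c = skew[THEN skew_matricesD(1)]
  have z: "\<phi> x (?u, copair ?u) = \<zero>\<^bsub>B\<^esub>" "\<phi> y (?u, copair ?u) = \<zero>\<^bsub>B\<^esub>"
    using skew u(1) by (auto dest: skew_matricesD(2))
  have "mm (\<phi> x) (\<phi> y) (?u, copair ?u) = \<zero>\<^bsub>B\<^esub>"
    using assms(3)
  proof
    assume "x \<in> st_H_subalgebra K A"
    then have "\<phi> x \<in> diagonal_matrices" using \<phi>_H_diagonal by blast
    then show ?thesis using diagonal_mm(1)[OF _ c(2) u] z mat.gl_entry[OF c(1) u(1) u(1)] by (simp add: mat.mult_zero)
  next
    assume "y \<in> st_H_subalgebra K A"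
    then have "\<phi> y \<in> diagonal_matrices" using \<phi>_H_diagonal by blast
    then show ?thesis using diagonal_mm(2)[OF _ c(1) u] z mat.gl_entry[OF c(2) u(2) u(2)] by (simp add: mat.zero_mult)
  qed
  then show "psi x y r = \<zero>\<^bsub>W\<^esub> r" using r by (simp only: psi_entry W_entries)
qed (use assms psi_closed in auto)

lemma H_gen_in_subalgebra:
  assumes "i \<in> {1..4}" "j \<in> {1..4}" "i \<noteq> j" "a \<in> grade A p" "b \<in> grade A q"
  shows "F i j p a \<otimes>\<^bsub>L\<^esub> F j i q b \<in> st_H_subalgebra K A"
  unfolding st_H_subalgebra_def subalgebra_gen_def steinberg_quot using assms by blast

lemma psi_sym:
  assumes "x \<in> carrier L" "y \<in> carrier L"
  shows "psi x y = psi y x"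
proof (rule W_eqI)
  fix r :: nat assume r: "r \<in> {1..6}"
  show "psi x y r = psi y x r"
    unfolding psi_entry[OF r] by (intro mm_skew_comm \<phi>_skew pair_of_pairs assms r)
qed (use assms psi_closed in auto)

text \<open>
  Since \<open>psi\<close> is symmetric and twice every element of \<open>\<W>\<close> is zero, \<open>psi x x\<close> is additive in \<open>x\<close>; it
  suffices to look at the spanning set.
\<close>
lemma psi_alternating: "x \<in> carrier L \<Longrightarrow> psi x x = \<zero>\<^bsub>W\<^esub>"
proof -
  have "psi x x = \<zero>\<^bsub>W\<^esub>" if "st_span x" for x
    using that
  proof (induction rule: st_span.induct)
    case (H i j a p b q)
    note h = H_gen_in_subalgebra[OF H]
    have "F i j p a \<otimes>\<^bsub>L\<^esub> F j i q b \<in> carrier L" using H by (intro L.mult_closed F_closed) auto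
    then show ?case using psi_H h by blast
  next
    case (F i j a p)
    then show ?case using psi_F[of i j i j a p a p] by simp
  next
    case (add x y)
    note c = add(1,2)[THEN st_span_closed]
    have "psi (x \<oplus>\<^bsub>L\<^esub> y) (x \<oplus>\<^bsub>L\<^esub> y) = psi x x \<oplus>\<^bsub>W\<^esub> psi x y \<oplus>\<^bsub>W\<^esub> (psi y x \<oplus>\<^bsub>W\<^esub> psi y y)"
      using c by (simp add: bilinear_mapD(2,3)[OF psi_bilinear] psi_closed W.M.a_ac)
    then show ?case using c by (simp add: add(3,4) psi_sym[of y x] W_double psi_closed)
  next
    case (smult c x)
    note cl = smult(2)[THEN st_span_closed]
    then show ?case using smult(1,3) by (simp add: bilinear_mapD(4,5)[OF psi_bilinear])
  qed
  then show "x \<in> carrier L \<Longrightarrow> ?thesis" using st_span_all by blast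
qed

lemma psi_grade:
  assumes "x \<in> grade L p" "y \<in> grade L q"
  shows "psi x y \<in> grade W (p + q)"
proof -
  have "psi x y r \<in> grade B (p + q + 1)" if r: "r \<in> {1..6}" for r
  proof -
    note u = pair_of_pairs[OF r]
    have "mm (\<phi> x) (\<phi> y) \<in> grade gl (p + q)" using assms by (intro mat.mm_grade \<phi>_hom(5))
    from PiE_mem[OF this[unfolded mat.gl_simps(5)], of "(pair_of r, copair (pair_of r))"]
    have "mm (\<phi> x) (\<phi> y) (pair_of r, copair (pair_of r)) \<in>
        grade B (p + q + (pair_parity (pair_of r) + pair_parity (copair (pair_of r))))"
      using u copair_pairs[OF u] by simp
    moreover have "pair_parity (pair_of r) + pair_parity (copair (pair_of r)) = 1"
      by (auto simp: pair_parity_def copair_def)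
    ultimately show ?thesis using r by (simp only: psi_entry)
  qed
  then show ?thesis unfolding W_simps(5) psi_def by (auto simp del: atLeastAtMost_iff)
qed

text \<open>
  The three terms contribute all six products of \<open>\<phi> x\<close>, \<open>\<phi> y\<close>, \<open>\<phi> z\<close>. By \<open>mm3_skew\<close> each of them has the
  same entries at complementary pairs as its reversal, so that they cancel in pairs.
\<close>
lemma psi_jacobi:
  assumes "x \<in> carrier L" "y \<in> carrier L" "z \<in> carrier L"
  shows "psi (x \<otimes>\<^bsub>L\<^esub> y) z \<oplus>\<^bsub>W\<^esub> psi (y \<otimes>\<^bsub>L\<^esub> z) x \<oplus>\<^bsub>W\<^esub> psi (z \<otimes>\<^bsub>L\<^esub> x) y = \<zero>\<^bsub>W\<^esub>"
proof (rule W_eqI)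
  fix r :: nat assume r: "r \<in> {1..6}"
  let ?u = "pair_of r"
  let ?e = "\<lambda>X. X (?u, copair ?u)"
  note u = pair_of_pairs[OF r] copair_pairs[OF pair_of_pairs[OF r]]
  note s = assms[THEN \<phi>_skew]
  note c = assms[THEN \<phi>_gl]
  have bracket: "psi (x \<otimes>\<^bsub>L\<^esub> y) z r = ?e (mm (\<phi> x) (mm (\<phi> y) (\<phi> z))) \<oplus>\<^bsub>B\<^esub> ?e (mm (\<phi> y) (mm (\<phi> x) (\<phi> z)))"
    if "x \<in> carrier L" "y \<in> carrier L" "z \<in> carrier L" for x y z
    using that r u
    by (simp only: psi_entry \<phi>_hom(4) mat.gl_bracket mat.mm_add_left mat.mm_closed \<phi>_gl mat.gl_add_entry mat.mm_assoc)
  let ?a = "?e (mm (\<phi> x) (mm (\<phi> y) (\<phi> z)))" and ?b = "?e (mm (\<phi> y) (mm (\<phi> x) (\<phi> z)))"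
    and ?c = "?e (mm (\<phi> y) (mm (\<phi> z) (\<phi> x)))"
  have eq: "?e (mm (\<phi> z) (mm (\<phi> y) (\<phi> x))) = ?a" "?e (mm (\<phi> z) (mm (\<phi> x) (\<phi> y))) = ?b"
    "?e (mm (\<phi> x) (mm (\<phi> z) (\<phi> y))) = ?c"
    using mm3_skew s u(1) by blast+
  have cl: "?a \<in> carrier B" "?b \<in> carrier B" "?c \<in> carrier B"
    using c by (auto intro!: mat.gl_entry[OF _ u] mat.mm_closed)
  have "(psi (x \<otimes>\<^bsub>L\<^esub> y) z \<oplus>\<^bsub>W\<^esub> psi (y \<otimes>\<^bsub>L\<^esub> z) x \<oplus>\<^bsub>W\<^esub> psi (z \<otimes>\<^bsub>L\<^esub> x) y) r
      = (?a \<oplus>\<^bsub>B\<^esub> ?b) \<oplus>\<^bsub>B\<^esub> (?c \<oplus>\<^bsub>B\<^esub> ?a) \<oplus>\<^bsub>B\<^esub> (?b \<oplus>\<^bsub>B\<^esub> ?c)"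
    using r assms by (simp only: W_entries bracket eq)
  also have "\<dots> = (?a \<oplus>\<^bsub>B\<^esub> ?a) \<oplus>\<^bsub>B\<^esub> ((?b \<oplus>\<^bsub>B\<^esub> ?b) \<oplus>\<^bsub>B\<^esub> (?c \<oplus>\<^bsub>B\<^esub> ?c))"
    using cl by (simp add: mat.M.a_ac)
  also have "\<dots> = \<zero>\<^bsub>B\<^esub>" using cl by (simp add: B_double)
  finally show "(psi (x \<otimes>\<^bsub>L\<^esub> y) z \<oplus>\<^bsub>W\<^esub> psi (y \<otimes>\<^bsub>L\<^esub> z) x \<oplus>\<^bsub>W\<^esub> psi (z \<otimes>\<^bsub>L\<^esub> x) y) r = \<zero>\<^bsub>W\<^esub> r"
    using r by (simp only: W_entries)
qed (use assms in \<open>auto simp: psi_closed L.mult_closed\<close>)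

lemma is_st_cocycle_cong:
  assumes "\<And>x y. \<lbrakk>x \<in> carrier L; y \<in> carrier L\<rbrakk> \<Longrightarrow> \<psi> x y = psi x y"
  shows "is_st_cocycle K A \<theta> \<psi>"
  unfolding is_st_cocycle_def steinberg_quot
proof (intro conjI ballI allI impI)
  show "bilinear_map K L L W \<psi>"
    using psi_bilinear unfolding bilinear_map_def
    by (simp only: assms L.M.a_closed L.smult_closed Ball_def) (simp add: assms)
qed (use assms psi_F psi_H F_closed in \<open>auto simp del: atLeastAtMost_iff distinct.simps\<close>)

text \<open>
  The prescribed values cover the spanning set of \<open>st_span_all\<close>, as \<open>H\<^sub>i\<^sub>j(a, b)\<close> lies in the subalgebra
  on which the cocycle vanishes.
\<close>
lemma st_cocycle_unique:
  assumes "is_st_cocycle K A \<theta> \<psi>" "x \<in> carrier L" "y \<in> carrier L"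
  shows "\<psi> x y = psi x y"
proof -
  have bil: "bilinear_map K L L W \<psi>"
    and F: "\<And>i j k l p q a b. \<lbrakk>i \<in> {1..4}; j \<in> {1..4}; k \<in> {1..4}; l \<in> {1..4}; i \<noteq> j; k \<noteq> l;
        a \<in> grade A p; b \<in> grade A q\<rbrakk> \<Longrightarrow> \<psi> (F i j p a) (F k l q b) =
        (if distinct [i, j, k, l] then W_incl A (\<theta> (i, j, k, l)) (cls (a \<otimes>\<^bsub>A\<^esub> b)) else \<zero>\<^bsub>W\<^esub>)"
    and H: "\<And>x y. \<lbrakk>x \<in> carrier L; y \<in> carrier L; x \<in> st_H_subalgebra K A \<or> y \<in> st_H_subalgebra K A\<rbrakk>
        \<Longrightarrow> \<psi> x y = \<zero>\<^bsub>W\<^esub>"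
    using assms(1) unfolding is_st_cocycle_def steinberg_quot by blast+
  note lin = bilinear_mapD[OF bil] bilinear_mapD[OF psi_bilinear]
  have hc: "F i j p a \<otimes>\<^bsub>L\<^esub> F j i q b \<in> carrier L"
    if "i \<in> {1..4}" "j \<in> {1..4}" "i \<noteq> j" "a \<in> grade A p" "b \<in> grade A q" for i j p q a b
    using that by (intro L.mult_closed F_closed) auto
  have "st_span x" "st_span y" using assms(2,3) st_span_all by blast+
  then show ?thesis
  proof (induction rule: st_span.induct)
    case (H i j a p b q)
    note h = H_gen_in_subalgebra[OF H(1-5)] hc[OF H(1-5)]
    show ?case using H.prems st_span_closed h psi_H \<open>\<And>x y. _ \<Longrightarrow> _ \<Longrightarrow> _ \<Longrightarrow> \<psi> x y = \<zero>\<^bsub>W\<^esub>\<close> by metis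
  next
    case (F i j a p)
    note Fij = F(1-4)
    show ?case using F(5)
    proof (induction rule: st_span.induct)
      case (H k l b q c r)
      note h = H_gen_in_subalgebra[OF H(1-5)] hc[OF H(1-5)]
      show ?case using h psi_H F_closed[OF Fij] \<open>\<And>x y. _ \<Longrightarrow> _ \<Longrightarrow> _ \<Longrightarrow> \<psi> x y = \<zero>\<^bsub>W\<^esub>\<close> by metis
    next
      case (F k l b q)
      then show ?case using psi_F[OF Fij(1-3) F(1-3) Fij(4) F(4)]
        \<open>\<And>i j k l p q a b. _ \<Longrightarrow> _ \<Longrightarrow> _ \<Longrightarrow> _ \<Longrightarrow> _ \<Longrightarrow> _ \<Longrightarrow> _ \<Longrightarrow> _ \<Longrightarrow> \<psi> (F i j p a) (F k l q b) = _\<close> Fij by metis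
    next
      case (add y z)
      then show ?case using F_closed[OF Fij] by (simp add: lin st_span_closed)
    next
      case (smult c y)
      then show ?case using F_closed[OF Fij] by (simp add: lin st_span_closed)
    qed
  qed (simp_all add: lin st_span_closed)
qed

lemma st_cocycle_psi:
  assumes "x \<in> carrier L" "y \<in> carrier L"
  shows "st_cocycle K A \<theta> x y = psi x y"
proof -
  let ?psi = "\<lambda>x\<in>carrier L. \<lambda>y\<in>carrier L. psi x y"
  have "st_cocycle K A \<theta> = ?psi"
    unfolding st_cocycle_def steinberg_quot
  proof (rule the_equality)
    show "?psi \<in> carrier L \<rightarrow>\<^sub>E carrier L \<rightarrow>\<^sub>E carrier W \<and> is_st_cocycle K A \<theta> ?psi"
      using psi_closed by (intro conjI is_st_cocycle_cong) auto
    fix \<psi> assume "\<psi> \<in> carrier L \<rightarrow>\<^sub>E carrier L \<rightarrow>\<^sub>E carrier W \<and> is_st_cocycle K A \<theta> \<psi>"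
    then have \<psi>: "\<psi> \<in> carrier L \<rightarrow>\<^sub>E carrier L \<rightarrow>\<^sub>E carrier W" "is_st_cocycle K A \<theta> \<psi>" by auto
    show "\<psi> = ?psi"
    proof (rule PiE_ext[OF \<psi>(1)])
      show "?psi \<in> carrier L \<rightarrow>\<^sub>E carrier L \<rightarrow>\<^sub>E carrier W" using psi_closed by auto
      fix x assume x: "x \<in> carrier L"
      show "\<psi> x = ?psi x"
      proof (rule PiE_ext)
        show "\<psi> x \<in> carrier L \<rightarrow>\<^sub>E carrier W" using PiE_mem[OF \<psi>(1) x] .
        show "?psi x \<in> carrier L \<rightarrow>\<^sub>E carrier W" using x psi_closed by auto
        show "\<psi> x y = ?psi x y" if "y \<in> carrier L" for y
          using x that st_cocycle_unique[OF \<psi>(2)] by simp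
      qed
    qed
  qed
  then show ?thesis using assms by simp
qed

sublocale sharp: lie_cocycle K L W "st_cocycle K A \<theta>"
proof (intro lie_cocycle.intro lie_cocycle_axioms.intro L.lie_superalgebra_axioms W.supermodule_axioms)
  have "is_st_cocycle K A \<theta> (st_cocycle K A \<theta>)" by (rule is_st_cocycle_cong) (rule st_cocycle_psi)
  then show "bilinear_map K L L W (st_cocycle K A \<theta>)" unfolding is_st_cocycle_def steinberg_quot by blast
  show "st_cocycle K A \<theta> x y \<in> grade W (p + q)" if "x \<in> grade L p" "y \<in> grade L q" for x y p q
    using that by (simp add: st_cocycle_psi L.grade_carrier psi_grade)
  show "st_cocycle K A \<theta> x y = \<ominus>\<^bsub>W\<^esub> ssign W p q (st_cocycle K A \<theta> y x)"
    if "x \<in> grade L p" "y \<in> grade L q" for x y p q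
    using that[THEN L.grade_carrier] psi_sym[of x y] by (simp add: st_cocycle_psi W_ssign W_uminus psi_closed)
  show "st_cocycle K A \<theta> x x = \<zero>\<^bsub>W\<^esub>" if "x \<in> grade L 0" for x
    using that[THEN L.grade_carrier] by (simp add: st_cocycle_psi psi_alternating)
  show "ssign W p r (st_cocycle K A \<theta> (x \<otimes>\<^bsub>L\<^esub> y) z) \<oplus>\<^bsub>W\<^esub> ssign W p q (st_cocycle K A \<theta> (y \<otimes>\<^bsub>L\<^esub> z) x)
        \<oplus>\<^bsub>W\<^esub> ssign W q r (st_cocycle K A \<theta> (z \<otimes>\<^bsub>L\<^esub> x) y) = \<zero>\<^bsub>W\<^esub>"
    if "x \<in> grade L p" "y \<in> grade L q" "z \<in> grade L r" for x y z p q r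
    using that[THEN L.grade_carrier] psi_jacobi[of x y z]
    by (simp add: st_cocycle_psi W_ssign psi_closed L.mult_closed)
qed

lemma st_sharp_cocycle_extension: "st_sharp K A \<theta> = cocycle_extension L W (st_cocycle K A \<theta>)"
  by (simp add: st_sharp_def cocycle_extension_def steinberg_quot Let_def)

end

section \<open>The bracket of a central extension\<close>

lemma central_extensionD:
  assumes "central_extension K X L \<tau>"
  shows "lie_superalgebra K X" "lie_superalgebra K L" "\<tau> \<in> lie_superalgebra_hom K X L"
    "\<tau> ` carrier X = carrier L" "\<And>x. \<lbrakk>x \<in> carrier X; \<tau> x = \<zero>\<^bsub>L\<^esub>\<rbrakk> \<Longrightarrow> x \<in> lie_centre X"
  using assms unfolding central_extension_def a_kernel_def kernel_def by auto

lemma lie_hom_hpart: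
  assumes f: "f \<in> lie_superalgebra_hom K L M" and "supermodule K L" "supermodule K M" and x: "x \<in> carrier L"
  shows "hpart M p (f x) = f (hpart L p x)"
proof -
  interpret L: supermodule K L by fact
  interpret M: supermodule K M by fact
  note hom = lie_superalgebra_homD[OF f]
  obtain y z where yz: "y \<in> grade L p" "z \<in> grade L (p + 1)" "x = y \<oplus>\<^bsub>L\<^esub> z"
    using L.hpart_exE[OF x] .
  have "f x = f y \<oplus>\<^bsub>M\<^esub> f z" using yz L.grade_carrier hom(2) by blast
  then show ?thesis using M.hpart_eqI[OF hom(5) hom(5), OF yz(1,2)] L.hpart_eqI[OF yz(1,2)] yz(3) by simp
qed

locale central_extension_of = X: lie_superalgebra K X + L: lie_superalgebra K L
  for K :: "('k, 'c) ring_scheme" (structure) and X :: "('k, 'm) superalgebra" and L :: "('k, 'u) superalgebra" +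
  fixes \<tau>
  assumes central_ext: "central_extension K X L \<tau>"
begin

lemmas \<tau>_in_hom = central_extensionD(3)[OF central_ext]
lemmas \<tau>_hom = lie_superalgebra_homD[OF \<tau>_in_hom]
  lie_hom_zero_minus[OF \<tau>_in_hom X.M.abelian_group_axioms L.M.abelian_group_axioms]

lemma \<tau>_hpart: "x \<in> carrier X \<Longrightarrow> hpart L p (\<tau> x) = \<tau> (hpart X p x)"
  by (rule lie_hom_hpart[OF \<tau>_in_hom X.supermodule_axioms L.supermodule_axioms])

lemma central_left: "\<lbrakk>z \<in> carrier X; \<tau> z = \<zero>\<^bsub>L\<^esub>; x \<in> carrier X\<rbrakk> \<Longrightarrow> z \<otimes>\<^bsub>X\<^esub> x = \<zero>\<^bsub>X\<^esub>"
  using central_extensionD(5)[OF central_ext] unfolding lie_centre_def by blast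

lemma central_right:
  assumes z: "z \<in> carrier X" "\<tau> z = \<zero>\<^bsub>L\<^esub>" and x: "x \<in> carrier X"
  shows "x \<otimes>\<^bsub>X\<^esub> z = \<zero>\<^bsub>X\<^esub>"
proof -
  have hz: "hpart X p z \<in> carrier X" "\<tau> (hpart X p z) = \<zero>\<^bsub>L\<^esub>" for p
    using X.hpart_closed[OF z(1)] z(2) \<tau>_hpart[OF z(1), of p] L.hpart_same[OF L.grade_zero] by auto
  have hom: "x \<otimes>\<^bsub>X\<^esub> hpart X q z = \<zero>\<^bsub>X\<^esub>" if x: "x \<in> grade X p" for x p q
    using X.super_skew[OF x X.hpart_grade[OF z(1), of q]] central_left[OF hz] X.grade_carrier[OF x]
    by (simp add: ssign_def)
  have "x \<otimes>\<^bsub>X\<^esub> hpart X q z = \<zero>\<^bsub>X\<^esub>" for q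
    using x by (induction rule: X.homogeneous_induct) (use hom hz in \<open>auto simp: X.add_mult\<close>)
  then have "x \<otimes>\<^bsub>X\<^esub> (hpart X 0 z \<oplus>\<^bsub>X\<^esub> hpart X 1 z) = \<zero>\<^bsub>X\<^esub>"
    using x hz by (simp add: X.mult_add)
  then show ?thesis using X.hpart_sum[OF z(1), symmetric] by simp
qed

definition lift where "lift s = (SOME x. x \<in> carrier X \<and> \<tau> x = s)"

definition \<beta> where "\<beta> s t = lift s \<otimes>\<^bsub>X\<^esub> lift t"

lemma lift: "s \<in> carrier L \<Longrightarrow> lift s \<in> carrier X \<and> \<tau> (lift s) = s"
  unfolding lift_def central_extensionD(4)[OF central_ext, symmetric] by (rule someI_ex) blast

text \<open>Two preimages of the same element differ by an element of the centre.\<close>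
lemma \<beta>_eq:
  assumes x: "x \<in> carrier X" and y: "y \<in> carrier X"
  shows "\<beta> (\<tau> x) (\<tau> y) = x \<otimes>\<^bsub>X\<^esub> y"
proof -
  let ?x = "lift (\<tau> x)" and ?y = "lift (\<tau> y)"
  have l: "?x \<in> carrier X" "\<tau> ?x = \<tau> x" "?y \<in> carrier X" "\<tau> ?y = \<tau> y"
    using lift \<tau>_hom(1) x y by auto
  have "(?x \<ominus>\<^bsub>X\<^esub> x) \<otimes>\<^bsub>X\<^esub> ?y = \<zero>\<^bsub>X\<^esub>"
    by (rule central_left) (use l x in \<open>auto simp: \<tau>_hom L.M.minus_eq_zero_iff\<close>)
  then have "?x \<otimes>\<^bsub>X\<^esub> ?y \<ominus>\<^bsub>X\<^esub> x \<otimes>\<^bsub>X\<^esub> ?y = \<zero>\<^bsub>X\<^esub>"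
    using l x by (simp add: a_minus_def X.add_mult X.uminus_mult)
  then have 1: "?x \<otimes>\<^bsub>X\<^esub> ?y = x \<otimes>\<^bsub>X\<^esub> ?y"
    using X.M.minus_eq_zero_iff l x by (simp add: X.mult_closed)
  have "x \<otimes>\<^bsub>X\<^esub> (?y \<ominus>\<^bsub>X\<^esub> y) = \<zero>\<^bsub>X\<^esub>"
    by (rule central_right) (use l x y in \<open>auto simp: \<tau>_hom L.M.minus_eq_zero_iff\<close>)
  then have "x \<otimes>\<^bsub>X\<^esub> ?y \<ominus>\<^bsub>X\<^esub> x \<otimes>\<^bsub>X\<^esub> y = \<zero>\<^bsub>X\<^esub>"
    using l x y by (simp add: a_minus_def X.mult_add X.mult_uminus)
  then have "x \<otimes>\<^bsub>X\<^esub> ?y = x \<otimes>\<^bsub>X\<^esub> y"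
    using X.M.minus_eq_zero_iff l x y by (simp add: X.mult_closed)
  then show ?thesis using 1 by (simp add: \<beta>_def)
qed

lemma homogeneous_lift:
  assumes s: "s \<in> grade L p"
  shows "\<exists>x\<in>grade X p. \<tau> x = s"
proof -
  let ?x = "lift s"
  have l: "?x \<in> carrier X" "\<tau> ?x = s" using lift s L.grade_carrier by blast+
  have "\<tau> (hpart X p ?x) = s" using \<tau>_hpart[OF l(1), of p] l(2) L.hpart_same[OF s] by simp
  then show ?thesis using X.hpart_grade[OF l(1)] by blast
qed

lemma \<tau>_\<beta>: "\<lbrakk>s \<in> carrier L; t \<in> carrier L\<rbrakk> \<Longrightarrow> \<tau> (\<beta> s t) = s \<otimes>\<^bsub>L\<^esub> t"
  using lift by (simp add: \<beta>_def \<tau>_hom)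

sublocale be: lie_cocycle K L X \<beta>
proof (intro lie_cocycle.intro lie_cocycle_axioms.intro L.lie_superalgebra_axioms X.supermodule_axioms)
  have ex: "\<exists>x\<in>carrier X. s = \<tau> x" if "s \<in> carrier L" for s using lift[OF that] by metis
  show "bilinear_map K L L X \<beta>"
    unfolding bilinear_map_def
  proof (intro conjI ballI)
    fix s t assume "s \<in> carrier L" "t \<in> carrier L"
    then show "\<beta> s t \<in> carrier X" using lift by (simp add: \<beta>_def X.mult_closed)
  next
    fix s s' t assume "s \<in> carrier L" "s' \<in> carrier L" "t \<in> carrier L"
    then obtain x x' y where x: "x \<in> carrier X" "s = \<tau> x" "x' \<in> carrier X" "s' = \<tau> x'" "y \<in> carrier X" "t = \<tau> y"
      using ex by metis
    show "\<beta> (s \<oplus>\<^bsub>L\<^esub> s') t = \<beta> s t \<oplus>\<^bsub>X\<^esub> \<beta> s' t"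
      using x by (simp add: \<tau>_hom(2)[symmetric] \<beta>_eq X.add_mult)
  next
    fix s t t' assume "s \<in> carrier L" "t \<in> carrier L" "t' \<in> carrier L"
    then obtain x y y' where x: "x \<in> carrier X" "s = \<tau> x" "y \<in> carrier X" "t = \<tau> y" "y' \<in> carrier X" "t' = \<tau> y'"
      using ex by metis
    show "\<beta> s (t \<oplus>\<^bsub>L\<^esub> t') = \<beta> s t \<oplus>\<^bsub>X\<^esub> \<beta> s t'"
      using x by (simp add: \<tau>_hom(2)[symmetric] \<beta>_eq X.mult_add)
  next
    fix c s t assume c: "c \<in> carrier K" and "s \<in> carrier L" "t \<in> carrier L"
    then obtain x y where x: "x \<in> carrier X" "s = \<tau> x" "y \<in> carrier X" "t = \<tau> y"
      using ex by metis
    show "\<beta> (c \<odot>\<^bsub>L\<^esub> s) t = c \<odot>\<^bsub>X\<^esub> \<beta> s t" "\<beta> s (c \<odot>\<^bsub>L\<^esub> t) = c \<odot>\<^bsub>X\<^esub> \<beta> s t"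
      using x c by (simp_all add: \<tau>_hom(3)[symmetric] \<beta>_eq X.smult_mult X.mult_smult)
  qed
next
  fix s t p q assume "s \<in> grade L p" "t \<in> grade L q"
  then obtain x y where x: "x \<in> grade X p" "s = \<tau> x" "y \<in> grade X q" "t = \<tau> y"
    using homogeneous_lift by metis
  note c = x(1)[THEN X.grade_carrier] x(3)[THEN X.grade_carrier]
  show "\<beta> s t \<in> grade X (p + q)" using x c by (simp add: \<beta>_eq X.mult_grade)
  show "\<beta> s t = \<ominus>\<^bsub>X\<^esub> ssign X p q (\<beta> t s)"
    using X.super_skew[OF x(1,3)] by (simp add: x(2,4) \<beta>_eq c)
next
  fix s assume "s \<in> grade L 0"
  then obtain x where x: "x \<in> grade X 0" "s = \<tau> x" using homogeneous_lift by metis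
  then show "\<beta> s s = \<zero>\<^bsub>X\<^esub>" using X.even_alternating X.grade_carrier by (simp add: \<beta>_eq)
next
  fix s t u p q r assume "s \<in> grade L p" "t \<in> grade L q" "u \<in> grade L r"
  then obtain x y z where x: "x \<in> grade X p" "s = \<tau> x" "y \<in> grade X q" "t = \<tau> y" "z \<in> grade X r" "u = \<tau> z"
    using homogeneous_lift by metis
  note c = x(1)[THEN X.grade_carrier] x(3)[THEN X.grade_carrier] x(5)[THEN X.grade_carrier]
  show "ssign X p r (\<beta> (s \<otimes>\<^bsub>L\<^esub> t) u) \<oplus>\<^bsub>X\<^esub> ssign X p q (\<beta> (t \<otimes>\<^bsub>L\<^esub> u) s) \<oplus>\<^bsub>X\<^esub> ssign X q r (\<beta> (u \<otimes>\<^bsub>L\<^esub> s) t) = \<zero>\<^bsub>X\<^esub>"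
    using X.super_jacobi[OF x(1,3,5)] c
    by (simp add: x(2,4,6) \<tau>_hom(4)[symmetric] \<beta>_eq X.mult_closed jacobiator_def)
qed

lemma mult_\<beta>: "\<lbrakk>x \<in> carrier X; y \<in> carrier X\<rbrakk> \<Longrightarrow> x \<otimes>\<^bsub>X\<^esub> y = \<beta> (\<tau> x) (\<tau> y)"
  by (rule \<beta>_eq[symmetric])

end

abbreviation idx4 :: "nat \<Rightarrow> nat \<Rightarrow> nat \<Rightarrow> nat \<Rightarrow> bool" where
  "idx4 i j k l \<equiv> (i, j, k, l) \<in> quadruples"

lemma idx4D:
  assumes "idx4 i j k l"
  shows "i \<in> {1..4}" "j \<in> {1..4}" "k \<in> {1..4}" "l \<in> {1..4}" "i \<noteq> j" "i \<noteq> k" "i \<noteq> l" "j \<noteq> k" "j \<noteq> l" "k \<noteq> l"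
    "j \<noteq> i" "k \<noteq> i" "l \<noteq> i" "k \<noteq> j" "l \<noteq> j" "l \<noteq> k"
  using assms by (auto simp: quadruples_def)

lemma idx4_perms:
  assumes "idx4 i j k l"
  shows "idx4 i l k j" "idx4 k l i j" "idx4 k j i l" "idx4 i k j l" "idx4 i k l j"
  using assms by (auto simp: quadruples_def)

lemma idx4_parity:
  assumes "idx4 i j k l"
  shows "idx_parity i + idx_parity j + (idx_parity k + idx_parity l) = 1"
proof -
  have "{i, j, k, l} = {1..4}"
    by (rule card_subset_eq) (use assms in \<open>auto simp: quadruples_def\<close>)
  then have "4 \<in> {i, j, k, l}" by simp
  then show ?thesis using idx4D[OF assms] by (auto simp: idx_parity_def)
qed

locale steinberg_extension = steinberg_labelled K A \<theta> + CE: central_extension_of K X "super_quot (free_superalgebra K (st_letters A) st_degree) (lie_presentation_ideal K (st_letters A) st_degree (st_relators K A))" \<tau>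
  for K :: "('k, 'c) ring_scheme" (structure) and A :: "('k, 'a) superalgebra" (structure) and \<theta>
    and X :: "('k, 'm) superalgebra" and \<tau>
begin

abbreviation "\<beta> \<equiv> CE.\<beta>"
abbreviation "F_deg i j p \<equiv> idx_parity i + idx_parity j + p"

text \<open>
  Both sides are the bracket of \<open>F\<^sub>i\<^sub>l(a)\<close>, \<open>F\<^sub>l\<^sub>k(c)\<close>, \<open>F\<^sub>k\<^sub>j(b)\<close>, bracketed from the left and from the right;
  the outer two factors commute.
\<close>
lemma \<beta>_composite:
  assumes q: "idx4 i j k l" and a: "a \<in> grade A p" and c: "c \<in> grade A r" and b: "b \<in> grade A q"
  shows "\<beta> (F i k (p + r) (a \<otimes>\<^bsub>A\<^esub> c)) (F k j q b) = \<beta> (F i l p a) (F l j (r + q) (c \<otimes>\<^bsub>A\<^esub> b))"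
proof -
  note d = idx4D[OF q]
  have "F i k (p + r) (a \<otimes>\<^bsub>A\<^esub> c) = F i l p a \<otimes>\<^bsub>L\<^esub> F l k r c"
    using F_mult[of i l k a p c r] d a c by simp
  moreover have "F l j (r + q) (c \<otimes>\<^bsub>A\<^esub> b) = F l k r c \<otimes>\<^bsub>L\<^esub> F k j q b"
    using F_mult[of l k j c r b q] d c b by simp
  moreover have "F i l p a \<otimes>\<^bsub>L\<^esub> F k j q b = \<zero>\<^bsub>L\<^esub>"
    using F_commute[of i l k j a p b q] d a b by simp
  ultimately show ?thesis
    using CE.be.cocycle_assoc[OF F_grade[of i l a p] F_grade[of l k c r] F_grade[of k j b q]] d a b c by simp
qed

definition third :: "nat \<Rightarrow> nat \<Rightarrow> nat" where
  "third i j = (SOME k. k \<in> {1..4} \<and> k \<noteq> i \<and> k \<noteq> j)"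

lemma third: "third i j \<in> {1..4}" "third i j \<noteq> i" "third i j \<noteq> j"
proof -
  have "\<exists>k. k \<in> {1..4} \<and> k \<noteq> i \<and> k \<noteq> j" using exists_fourth[of i j j] by blast
  then have "third i j \<in> {1..4} \<and> third i j \<noteq> i \<and> third i j \<noteq> j" unfolding third_def by (rule someI_ex)
  then show "third i j \<in> {1..4}" "third i j \<noteq> i" "third i j \<noteq> j" by auto
qed

text \<open>
  The lift of \<open>F\<^sub>i\<^sub>j(a)\<close> on which the universal map will be built. By \<open>F_lift_eq\<close> the choice of the
  intermediate index does not affect it.
\<close>
definition F_lift :: "nat \<Rightarrow> nat \<Rightarrow> bit \<Rightarrow> 'a \<Rightarrow> 'm" where
  "F_lift i j p a = \<beta> (F i (third i j) p a) (F (third i j) j 0 \<one>\<^bsub>A\<^esub>)"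

lemma F_lift_eq:
  assumes ij: "i \<in> {1..4}" "j \<in> {1..4}" "k \<in> {1..4}" "i \<noteq> j" "j \<noteq> k" "i \<noteq> k"
    and a: "a \<in> grade A p" and b: "b \<in> grade A q"
  shows "\<beta> (F i j p a) (F j k q b) = F_lift i k (p + q) (a \<otimes>\<^bsub>A\<^esub> b)"
proof -
  note c = a[THEN grade_carrier] b[THEN grade_carrier]
  let ?m = "third i k"
  note m = third[of i k]
  show ?thesis
  proof (cases "?m = j")
    case True
    obtain n where n: "n \<in> {1..4}" "n \<noteq> i" "n \<noteq> j" "n \<noteq> k" using exists_fourth[of i j k] by blast
    have q4: "idx4 i k j n" using ij n by (auto simp: quadruples_def)
    have "\<beta> (F i j (p + 0) (a \<otimes>\<^bsub>A\<^esub> \<one>\<^bsub>A\<^esub>)) (F j k q b) = \<beta> (F i n p a) (F n k (0 + q) (\<one>\<^bsub>A\<^esub> \<otimes>\<^bsub>A\<^esub> b))"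
      by (rule \<beta>_composite[OF q4 a one_grade b])
    moreover have "\<beta> (F i j (p + q) (a \<otimes>\<^bsub>A\<^esub> b)) (F j k 0 \<one>\<^bsub>A\<^esub>) = \<beta> (F i n p a) (F n k (q + 0) (b \<otimes>\<^bsub>A\<^esub> \<one>\<^bsub>A\<^esub>))"
      by (rule \<beta>_composite[OF q4 a b one_grade])
    ultimately show ?thesis unfolding F_lift_def True using c by simp
  next
    case False
    have q4: "idx4 i k ?m j" using ij m False by (auto simp: quadruples_def)
    show ?thesis unfolding F_lift_def using \<beta>_composite[OF q4 a b one_grade] c by simp
  qed
qed

lemma F_as_bracket:
  assumes "i \<in> {1..4}" "j \<in> {1..4}" "i \<noteq> j" "m \<in> {1..4}" "m \<noteq> i" "m \<noteq> j" "a \<in> grade A p"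
  shows "F i j p a = F i m p a \<otimes>\<^bsub>L\<^esub> F m j 0 \<one>\<^bsub>A\<^esub>" "F i j p a = F i m 0 \<one>\<^bsub>A\<^esub> \<otimes>\<^bsub>L\<^esub> F m j p a"
  using assms F_mult[of i m j a p "\<one>\<^bsub>A\<^esub>" 0] F_mult[of i m j "\<one>\<^bsub>A\<^esub>" 0 a p] one_grade grade_carrier by simp_all

text \<open>
  With a fourth index \<open>m\<close>, one of the arguments is a bracket of two root elements that both commute
  with the other argument.
\<close>
lemma \<beta>_commute:
  assumes ij: "i \<in> {1..4}" "j \<in> {1..4}" "i \<noteq> j" and kl: "k \<in> {1..4}" "l \<in> {1..4}" "k \<noteq> l"
    and ne: "j \<noteq> k" "i \<noteq> l" and nd: "i = k \<or> j = l"
    and a: "a \<in> grade A p" and b: "b \<in> grade A q"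
  shows "\<beta> (F i j p a) (F k l q b) = \<zero>\<^bsub>X\<^esub>"
proof -
  have zero: "\<beta> \<zero>\<^bsub>L\<^esub> (F u v r c) = \<zero>\<^bsub>X\<^esub>" if "u \<in> {1..4}" "v \<in> {1..4}" "u \<noteq> v" "c \<in> grade A r" for u v r c
    using that F_closed by (intro CE.be.cocycle_zero_left)
  show ?thesis using nd
  proof
    assume ik: "i = k"
    obtain m where m: "m \<in> {1..4}" "m \<noteq> i" "m \<noteq> j" "m \<noteq> l" using exists_fourth[of i j l] by blast
    have "\<beta> (F i j p a) (F i m q b \<otimes>\<^bsub>L\<^esub> F m l 0 \<one>\<^bsub>A\<^esub>) = \<beta> (F i j p a \<otimes>\<^bsub>L\<^esub> F i m q b) (F m l 0 \<one>\<^bsub>A\<^esub>)"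
      using ij kl ne m ik a b one_grade
      by (intro CE.be.cocycle_assoc[OF F_grade F_grade F_grade, symmetric] F_commute) auto
    also have "F i j p a \<otimes>\<^bsub>L\<^esub> F i m q b = \<zero>\<^bsub>L\<^esub>"
      using ij m a b by (intro F_commute) auto
    finally show ?thesis
      using F_as_bracket(1)[of k l m b q] zero[of m l \<open>\<one>\<^bsub>A\<^esub>\<close> 0] ij kl m ik b one_grade by auto
  next
    assume jl: "j = l"
    obtain m where m: "m \<in> {1..4}" "m \<noteq> i" "m \<noteq> j" "m \<noteq> k" using exists_fourth[of i j k] by blast
    have "\<beta> (F i j p a) (F k m 0 \<one>\<^bsub>A\<^esub> \<otimes>\<^bsub>L\<^esub> F m j q b) = \<beta> (F i j p a \<otimes>\<^bsub>L\<^esub> F k m 0 \<one>\<^bsub>A\<^esub>) (F m j q b)"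
      using ij kl ne m jl a b one_grade
      by (intro CE.be.cocycle_assoc[OF F_grade F_grade F_grade, symmetric] F_commute) auto
    also have "F i j p a \<otimes>\<^bsub>L\<^esub> F k m 0 \<one>\<^bsub>A\<^esub> = \<zero>\<^bsub>L\<^esub>"
      using ij kl ne m a one_grade by (intro F_commute) auto
    finally show ?thesis
      using F_as_bracket(2)[of k l m b q] zero[of m j b q] ij kl m jl b by auto
  qed
qed

lemma \<beta>_closed: "\<lbrakk>x \<in> carrier L; y \<in> carrier L\<rbrakk> \<Longrightarrow> \<beta> x y \<in> carrier X"
  by (rule CE.be.cocycle_closed)

lemma P_closed:
  assumes "idx4 i j k l" "a \<in> grade A p" "b \<in> grade A q"
  shows "\<beta> (F i j p a) (F k l q b) \<in> carrier X"
  using idx4D[OF assms(1)] assms(2,3) by (intro \<beta>_closed F_closed)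

text \<open>
  From here on the four indices are distinct, so that the value of \<open>\<beta>\<close> is central but need not
  vanish. In this lemma \<open>F\<^sub>i\<^sub>j\<close> is written as \<open>[F\<^sub>i\<^sub>k, F\<^sub>k\<^sub>j]\<close>, and in the next one as \<open>[F\<^sub>i\<^sub>l, F\<^sub>l\<^sub>j]\<close>. Both
  lead to the quadruple \<open>(i, l, k, j)\<close>, but with signs that do not match.
\<close>
lemma P_swap:
  assumes q: "idx4 i j k l" and a: "a \<in> grade A p" and c: "c \<in> grade A r" and b: "b \<in> grade A q"
  shows "\<beta> (F i j (p + r) (a \<otimes>\<^bsub>A\<^esub> c)) (F k l q b) =
    ssign X (F_deg k j r) (F_deg k l q) (\<beta> (F i l (p + q) (a \<otimes>\<^bsub>A\<^esub> b)) (F k j r c))"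
proof -
  note d = idx4D[OF q]
  have "F i k p a \<otimes>\<^bsub>L\<^esub> F k j r c = F i j (p + r) (a \<otimes>\<^bsub>A\<^esub> c)" using d a c by (intro F_mult)
  moreover have "F i k p a \<otimes>\<^bsub>L\<^esub> F k l q b = F i l (p + q) (a \<otimes>\<^bsub>A\<^esub> b)" using d a b by (intro F_mult)
  moreover have "F k j r c \<otimes>\<^bsub>L\<^esub> F k l q b = \<zero>\<^bsub>L\<^esub>" using d c b by (intro F_commute)
  ultimately show ?thesis
    using CE.be.cocycle_swap[OF F_grade[OF d(1,3,6) a] F_grade[OF d(3,2,14) c] F_grade[OF d(3,4,10) b]] by simp
qed

lemma P_rotate:
  assumes q: "idx4 i j k l" and c: "c \<in> grade A r" and a: "a \<in> grade A p" and b: "b \<in> grade A q"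
  shows "\<beta> (F i j (r + p) (c \<otimes>\<^bsub>A\<^esub> a)) (F k l q b) =
    \<ominus>\<^bsub>X\<^esub> ssign X (F_deg l j p) (F_deg k l q) (\<beta> (F i l r c) (F k j (q + p) (b \<otimes>\<^bsub>A\<^esub> a)))"
proof -
  note d = idx4D[OF q]
  note ba = mult_grade[OF b a]
  have 1: "F i l r c \<otimes>\<^bsub>L\<^esub> F l j p a = F i j (r + p) (c \<otimes>\<^bsub>A\<^esub> a)" using d c a by (intro F_mult)
  have 2: "F i l r c \<otimes>\<^bsub>L\<^esub> F k l q b = \<zero>\<^bsub>L\<^esub>" using d c b by (intro F_commute)
  have 3: "F l j p a \<otimes>\<^bsub>L\<^esub> F k l q b = \<ominus>\<^bsub>L\<^esub> ssign L (F_deg l j p) (F_deg k l q) (F k j (q + p) (b \<otimes>\<^bsub>A\<^esub> a))"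
    unfolding L.super_skew[OF F_grade[OF d(4,2,15) a] F_grade[OF d(3,4,10) b]]
    using F_mult[OF d(3,4,2,10,15,14) b a] by simp
  have cl: "F i l r c \<in> carrier L" "F k j (q + p) (b \<otimes>\<^bsub>A\<^esub> a) \<in> carrier L"
    by (rule F_closed[OF d(1,4,7) c], rule F_closed[OF d(3,2,14) ba])
  have "\<beta> (F i j (r + p) (c \<otimes>\<^bsub>A\<^esub> a)) (F k l q b) = \<beta> (F i l r c) (F l j p a \<otimes>\<^bsub>L\<^esub> F k l q b)"
    unfolding 1[symmetric]
    by (rule CE.be.cocycle_assoc[OF F_grade[OF d(1,4,7) c] F_grade[OF d(4,2,15) a] F_grade[OF d(3,4,10) b] 2])
  then show ?thesis
    unfolding 3 using cl by (simp add: CE.be.cocycle_uminus_right CE.be.cocycle_ssign_right L.ssign_closed)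
qed

lemma double_eq_zero_of_eq_minus:
  assumes "x \<in> carrier X" "x = \<ominus>\<^bsub>X\<^esub> x"
  shows "x \<oplus>\<^bsub>X\<^esub> x = \<zero>\<^bsub>X\<^esub>"
  using assms CE.X.M.r_neg[of x] by simp

lemma double_zero_minus: "\<lbrakk>x \<in> carrier X; x \<oplus>\<^bsub>X\<^esub> x = \<zero>\<^bsub>X\<^esub>\<rbrakk> \<Longrightarrow> \<ominus>\<^bsub>X\<^esub> x = x"
  using CE.X.M.minus_equality by simp

text \<open>
  Let \<open>x = \<beta>(F\<^sub>i\<^sub>l(c), F\<^sub>k\<^sub>j(1))\<close> and \<open>y = \<beta>(F\<^sub>i\<^sub>j(c), F\<^sub>k\<^sub>l(1))\<close>. Since \<open>F\<^sub>k\<^sub>j(1)\<close> is even, no further signs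
  arise, and \<open>P_swap\<close> gives \<open>x = y\<close>, \<open>P_rotate\<close> gives \<open>x = - y\<close>. By \<open>P_rotate\<close> every value in question is,
  up to sign, such an \<open>x\<close>.
\<close>
lemma P_double_even:
  assumes q: "idx4 i j k l" and ne: "k \<noteq> 4" "j \<noteq> 4" and a: "a \<in> grade A p" and b: "b \<in> grade A q"
  shows "\<beta> (F i j p a) (F k l q b) \<oplus>\<^bsub>X\<^esub> \<beta> (F i j p a) (F k l q b) = \<zero>\<^bsub>X\<^esub>"
proof -
  note q' = idx4_perms(1)[OF q]
  have par: "idx_parity k + idx_parity j + 0 = 0" using ne by (simp add: idx_parity_def)
  have unit: "\<beta> (F i l r c) (F k j 0 \<one>\<^bsub>A\<^esub>) \<oplus>\<^bsub>X\<^esub> \<beta> (F i l r c) (F k j 0 \<one>\<^bsub>A\<^esub>) = \<zero>\<^bsub>X\<^esub>"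
    if c: "c \<in> grade A r" for c r
  proof (rule double_eq_zero_of_eq_minus)
    note cc = grade_carrier[OF c]
    have "\<beta> (F i l r c) (F k j 0 \<one>\<^bsub>A\<^esub>) = \<beta> (F i j r c) (F k l 0 \<one>\<^bsub>A\<^esub>)"
      using P_swap[OF q' c one_grade one_grade] cc par by (simp add: ssign_def)
    moreover have "\<beta> (F i l r c) (F k j 0 \<one>\<^bsub>A\<^esub>) = \<ominus>\<^bsub>X\<^esub> \<beta> (F i j r c) (F k l 0 \<one>\<^bsub>A\<^esub>)"
      using P_rotate[OF q' c one_grade one_grade] cc par by (simp add: ssign_def)
    ultimately show "\<beta> (F i l r c) (F k j 0 \<one>\<^bsub>A\<^esub>) = \<ominus>\<^bsub>X\<^esub> \<beta> (F i l r c) (F k j 0 \<one>\<^bsub>A\<^esub>)" by simp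
    show "\<beta> (F i l r c) (F k j 0 \<one>\<^bsub>A\<^esub>) \<in> carrier X" by (rule P_closed[OF q' c one_grade])
  qed
  let ?x = "\<beta> (F i j p a) (F k l q b)" and ?y = "\<beta> (F i l (p + q) (a \<otimes>\<^bsub>A\<^esub> b)) (F k j 0 \<one>\<^bsub>A\<^esub>)"
  have x: "?x \<in> carrier X" and y: "?y \<in> carrier X"
    by (rule P_closed[OF q a b], rule P_closed[OF q' mult_grade[OF a b] one_grade])
  have "?y = \<ominus>\<^bsub>X\<^esub> ssign X (F_deg j l q) (F_deg k j 0) ?x"
    using P_rotate[OF q' a b one_grade] grade_carrier[OF b] by simp
  then have "?y = \<ominus>\<^bsub>X\<^esub> ?x" using par by (simp add: ssign_def)
  then have "?x = \<ominus>\<^bsub>X\<^esub> ?y" using x by simp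
  then show ?thesis using unit[OF mult_grade[OF a b]] double_zero_minus[OF y] by simp
qed

text \<open>
  One of the two pairs \<open>{k, j}\<close>, \<open>{i, l}\<close> avoids the odd index; this is where the extension is
  forced to have exponent two.
\<close>
lemma P_double:
  assumes q: "idx4 i j k l" and a: "a \<in> grade A p" and b: "b \<in> grade A q"
  shows "\<beta> (F i j p a) (F k l q b) \<oplus>\<^bsub>X\<^esub> \<beta> (F i j p a) (F k l q b) = \<zero>\<^bsub>X\<^esub>"
proof (cases "k \<noteq> 4 \<and> j \<noteq> 4")
  case True
  then show ?thesis using P_double_even[OF q] a b by blast
next
  case False
  note d = idx4D[OF q]
  let ?x = "\<beta> (F i j p a) (F k l q b)" and ?y = "\<beta> (F k l q b) (F i j p a)"
  have y: "?y \<in> carrier X" by (rule P_closed[OF idx4_perms(2)[OF q] b a])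
  have "?y \<oplus>\<^bsub>X\<^esub> ?y = \<zero>\<^bsub>X\<^esub>"
    using False d by (intro P_double_even[OF idx4_perms(2)[OF q] _ _ b a]) auto
  moreover have "?x = \<ominus>\<^bsub>X\<^esub> ssign X (F_deg i j p) (F_deg k l q) ?y"
    by (rule CE.be.cocycle_skew[OF F_grade[OF d(1,2,5) a] F_grade[OF d(3,4,10) b]])
  ultimately show ?thesis using double_zero_minus[OF y] y by (simp add: ssign_def)
qed

lemma P_uminus: "\<lbrakk>idx4 i j k l; a \<in> grade A p; b \<in> grade A q\<rbrakk>
    \<Longrightarrow> \<ominus>\<^bsub>X\<^esub> \<beta> (F i j p a) (F k l q b) = \<beta> (F i j p a) (F k l q b)"
  by (rule double_zero_minus[OF P_closed P_double])

lemma P_ssign: "\<lbrakk>idx4 i j k l; a \<in> grade A p; b \<in> grade A q\<rbrakk>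
    \<Longrightarrow> ssign X r s (\<beta> (F i j p a) (F k l q b)) = \<beta> (F i j p a) (F k l q b)"
  by (simp add: ssign_def P_uminus)

definition Q_hom :: "nat \<Rightarrow> nat \<Rightarrow> nat \<Rightarrow> nat \<Rightarrow> bit \<Rightarrow> 'a \<Rightarrow> 'm" where
  "Q_hom i j k l p a = \<beta> (F i j p a) (F k l 0 \<one>\<^bsub>A\<^esub>)"

lemma Q_hom_swap:
  assumes q: "idx4 i j k l" and a: "a \<in> grade A p"
  shows "Q_hom i l k j p a = Q_hom i j k l p a"
  using P_swap[OF q a one_grade one_grade] P_ssign[OF idx4_perms(1)[OF q] a one_grade] grade_carrier[OF a]
  by (simp add: Q_hom_def)

text \<open>
  The first argument can absorb the coefficient of the second: apply \<open>P_swap\<close> and return with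
  \<open>Q_hom_swap\<close>.
\<close>
lemma P_eq_Q_hom:
  assumes q: "idx4 i j k l" and a: "a \<in> grade A p" and b: "b \<in> grade A q"
  shows "\<beta> (F i j p a) (F k l q b) = Q_hom i j k l (p + q) (a \<otimes>\<^bsub>A\<^esub> b)"
  using P_swap[OF q a one_grade b] P_ssign[OF idx4_perms(1)[OF q] mult_grade[OF a b] one_grade]
    grade_carrier[OF a] Q_hom_swap[OF q mult_grade[OF a b]]
  by (simp add: Q_hom_def)

text \<open>
  \<open>P_swap\<close> once more: it exchanges \<open>b\<close> and \<open>c\<close>, and \<open>Q_hom\<close> takes the same values for both quadruples.
\<close>
lemma Q_hom_comm:
  assumes q: "idx4 i j k l" and a: "a \<in> grade A p" and b: "b \<in> grade A q" and c: "c \<in> grade A r"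
  shows "Q_hom i j k l (p + q + r) (a \<otimes>\<^bsub>A\<^esub> b \<otimes>\<^bsub>A\<^esub> c) = Q_hom i j k l (p + r + q) (a \<otimes>\<^bsub>A\<^esub> c \<otimes>\<^bsub>A\<^esub> b)"
proof -
  note q' = idx4_perms(1)[OF q]
  note ab = mult_grade[OF a b] and ac = mult_grade[OF a c]
  have "Q_hom i j k l (p + q + r) (a \<otimes>\<^bsub>A\<^esub> b \<otimes>\<^bsub>A\<^esub> c) = \<beta> (F i j (p + q) (a \<otimes>\<^bsub>A\<^esub> b)) (F k l r c)"
    by (rule P_eq_Q_hom[OF q ab c, symmetric])
  also have "\<dots> = \<beta> (F i l (p + r) (a \<otimes>\<^bsub>A\<^esub> c)) (F k j q b)"
    using P_swap[OF q a b c] P_ssign[OF q' ac b] by simp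
  also have "\<dots> = Q_hom i l k j (p + r + q) (a \<otimes>\<^bsub>A\<^esub> c \<otimes>\<^bsub>A\<^esub> b)" by (rule P_eq_Q_hom[OF q' ac b])
  also have "\<dots> = Q_hom i j k l (p + r + q) (a \<otimes>\<^bsub>A\<^esub> c \<otimes>\<^bsub>A\<^esub> b)" by (rule Q_hom_swap[OF q mult_grade[OF ac b]])
  finally show ?thesis .
qed

lemma Q_hom_flip:
  assumes q: "idx4 i j k l" and a: "a \<in> grade A p"
  shows "Q_hom k l i j p a = Q_hom i j k l p a"
proof -
  note d = idx4D[OF q] and q' = idx4_perms(2)[OF q]
  have "Q_hom i j k l p a = \<beta> (F k l 0 \<one>\<^bsub>A\<^esub>) (F i j p a)"
    unfolding Q_hom_def CE.be.cocycle_skew[OF F_grade[OF d(1,2,5) a] F_grade[OF d(3,4,10) one_grade]]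
    using P_ssign[OF q' one_grade a] P_uminus[OF q' one_grade a] by simp
  also have "\<dots> = Q_hom k l i j (0 + p) (\<one>\<^bsub>A\<^esub> \<otimes>\<^bsub>A\<^esub> a)" by (rule P_eq_Q_hom[OF q' one_grade a])
  finally show ?thesis using grade_carrier[OF a] by simp
qed

lemma Q_hom_pair:
  assumes q: "idx4 i j k l" and q': "idx4 i' j' k' l'" and eq: "{i', k'} = {i, k}" and a: "a \<in> grade A p"
  shows "Q_hom i' j' k' l' p a = Q_hom i j k l p a"
proof -
  have "(i', j', k', l') \<in> quadruple_class (i, j, k, l)" using quadruple_class_iff[OF q q'] eq by simp
  then show ?thesis
    using Q_hom_swap[OF q a] Q_hom_flip[OF q a] Q_hom_swap[OF idx4_perms(2)[OF q] a] by auto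
qed

end

section \<open>The induced map on the kernel\<close>

context steinberg_extension
begin

text \<open>The homogeneous data \<open>Q_hom\<close>, extended to all of \<open>A\<close> by linearity.\<close>
definition Q_lin :: "nat \<Rightarrow> nat \<Rightarrow> nat \<Rightarrow> nat \<Rightarrow> 'a \<Rightarrow> 'm" where
  "Q_lin i j k l x = Q_hom i j k l 0 (hpart A 0 x) \<oplus>\<^bsub>X\<^esub> Q_hom i j k l 1 (hpart A 1 x)"

lemma Q_hom_closed: "\<lbrakk>idx4 i j k l; a \<in> grade A p\<rbrakk> \<Longrightarrow> Q_hom i j k l p a \<in> carrier X"
  unfolding Q_hom_def by (rule P_closed[OF _ _ one_grade])

lemma Q_hom_add:
  assumes q: "idx4 i j k l" and a: "a \<in> grade A p" and b: "b \<in> grade A p"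
  shows "Q_hom i j k l p (a \<oplus>\<^bsub>A\<^esub> b) = Q_hom i j k l p a \<oplus>\<^bsub>X\<^esub> Q_hom i j k l p b"
proof -
  note d = idx4D[OF q]
  show ?thesis unfolding Q_hom_def F_add[OF d(1,2,5) a b]
    by (rule CE.be.cocycle_add_left[OF F_closed[OF d(1,2,5) a] F_closed[OF d(1,2,5) b] F_closed[OF d(3,4,10) one_grade]])
qed

lemma Q_hom_smult:
  assumes q: "idx4 i j k l" and c: "c \<in> carrier K" and a: "a \<in> grade A p"
  shows "Q_hom i j k l p (c \<odot>\<^bsub>A\<^esub> a) = c \<odot>\<^bsub>X\<^esub> Q_hom i j k l p a"
proof -
  note d = idx4D[OF q]
  show ?thesis unfolding Q_hom_def F_smult[OF d(1,2,5) c a]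
    by (rule CE.be.cocycle_smult_left[OF c F_closed[OF d(1,2,5) a] F_closed[OF d(3,4,10) one_grade]])
qed

lemma Q_hom_zero: "idx4 i j k l \<Longrightarrow> Q_hom i j k l p \<zero>\<^bsub>A\<^esub> = \<zero>\<^bsub>X\<^esub>"
  unfolding Q_hom_def using F_zero CE.be.cocycle_zero_left F_closed[OF _ _ _ one_grade] idx4D by simp

lemma Q_lin_homogeneous:
  assumes q: "idx4 i j k l" and a: "a \<in> grade A p"
  shows "Q_lin i j k l a = Q_hom i j k l p a"
  using bit_cases[of p] Q_hom_closed[OF q a] a
  by (auto simp: Q_lin_def hpart_same hpart_other Q_hom_zero[OF q])

lemma Q_lin_closed: "\<lbrakk>idx4 i j k l; x \<in> carrier A\<rbrakk> \<Longrightarrow> Q_lin i j k l x \<in> carrier X"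
  unfolding Q_lin_def by (intro CE.X.M.a_closed Q_hom_closed hpart_grade)

lemma Q_lin_add:
  assumes q: "idx4 i j k l" and x: "x \<in> carrier A" and y: "y \<in> carrier A"
  shows "Q_lin i j k l (x \<oplus>\<^bsub>A\<^esub> y) = Q_lin i j k l x \<oplus>\<^bsub>X\<^esub> Q_lin i j k l y"
proof -
  have cl: "Q_hom i j k l p (hpart A p x) \<in> carrier X" "Q_hom i j k l p (hpart A p y) \<in> carrier X" for p
    using q x y by (auto intro!: Q_hom_closed hpart_grade)
  show ?thesis
    unfolding Q_lin_def hpart_add[OF x y] Q_hom_add[OF q hpart_grade[OF x] hpart_grade[OF y]]
    using cl by (simp add: CE.X.M.a_ac)
qed

lemma Q_lin_smult:
  assumes q: "idx4 i j k l" and c: "c \<in> carrier K" and x: "x \<in> carrier A"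
  shows "Q_lin i j k l (c \<odot>\<^bsub>A\<^esub> x) = c \<odot>\<^bsub>X\<^esub> Q_lin i j k l x"
  unfolding Q_lin_def hpart_smult[OF c x] Q_hom_smult[OF q c hpart_grade[OF x]]
  using CE.X.smult_r_distr[OF c Q_hom_closed[OF q hpart_grade[OF x]] Q_hom_closed[OF q hpart_grade[OF x]]] by simp

lemma Q_lin_comm:
  assumes q: "idx4 i j k l" and x: "x \<in> carrier A" and y: "y \<in> carrier A" and z: "z \<in> carrier A"
  shows "Q_lin i j k l (x \<otimes>\<^bsub>A\<^esub> y \<otimes>\<^bsub>A\<^esub> z) = Q_lin i j k l (x \<otimes>\<^bsub>A\<^esub> z \<otimes>\<^bsub>A\<^esub> y)"
proof -
  have 3: "Q_lin i j k l (x \<otimes>\<^bsub>A\<^esub> y \<otimes>\<^bsub>A\<^esub> z) = Q_lin i j k l (x \<otimes>\<^bsub>A\<^esub> z \<otimes>\<^bsub>A\<^esub> y)"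
    if "x \<in> grade A p" "y \<in> grade A p'" "z \<in> grade A p''" for x y z p p' p''
    using Q_hom_comm[OF q that] Q_lin_homogeneous[OF q] mult_grade that by metis
  have 2: "Q_lin i j k l (x \<otimes>\<^bsub>A\<^esub> y \<otimes>\<^bsub>A\<^esub> z) = Q_lin i j k l (x \<otimes>\<^bsub>A\<^esub> z \<otimes>\<^bsub>A\<^esub> y)"
    if x: "x \<in> grade A p" and y: "y \<in> grade A p'" and z: "z \<in> carrier A" for x y z p p'
    using z
  proof (induction rule: homogeneous_induct)
    case (homogeneous r z)
    then show ?case by (rule 3[OF x y])
  next
    case (add z w)
    then show ?case using grade_carrier[OF x] grade_carrier[OF y] by (simp add: mult_add add_mult Q_lin_add[OF q])
  qed
  have 1: "Q_lin i j k l (x \<otimes>\<^bsub>A\<^esub> y \<otimes>\<^bsub>A\<^esub> z) = Q_lin i j k l (x \<otimes>\<^bsub>A\<^esub> z \<otimes>\<^bsub>A\<^esub> y)"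
    if x: "x \<in> grade A p" and y: "y \<in> carrier A" and z: "z \<in> carrier A" for x y z p
    using y
  proof (induction rule: homogeneous_induct)
    case (homogeneous r y)
    then show ?case by (rule 2[OF x _ z])
  next
    case (add y w)
    then show ?case using grade_carrier[OF x] z by (simp add: mult_add add_mult Q_lin_add[OF q])
  qed
  show ?thesis using x
  proof (induction rule: homogeneous_induct)
    case (homogeneous r x)
    then show ?case by (rule 1[OF _ y z])
  next
    case (add x w)
    then show ?case using y z by (simp add: mult_add add_mult Q_lin_add[OF q])
  qed
qed

lemma Q_lin_double:
  assumes q: "idx4 i j k l" and x: "x \<in> carrier A"
  shows "Q_lin i j k l x \<oplus>\<^bsub>X\<^esub> Q_lin i j k l x = \<zero>\<^bsub>X\<^esub>"
  using x
proof (induction rule: homogeneous_induct)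
  case (homogeneous p x)
  then show ?case unfolding Q_lin_homogeneous[OF q homogeneous] Q_hom_def by (rule P_double[OF q _ one_grade])
next
  case (add x y)
  have "Q_lin i j k l (x \<oplus>\<^bsub>A\<^esub> y) \<oplus>\<^bsub>X\<^esub> Q_lin i j k l (x \<oplus>\<^bsub>A\<^esub> y) =
     (Q_lin i j k l x \<oplus>\<^bsub>X\<^esub> Q_lin i j k l x) \<oplus>\<^bsub>X\<^esub> (Q_lin i j k l y \<oplus>\<^bsub>X\<^esub> Q_lin i j k l y)"
    using add(1,2) Q_lin_closed[OF q] by (simp add: Q_lin_add[OF q] CE.X.M.a_ac)
  then show ?case using add(3,4) by simp
qed

lemma Q_lin_zero: "idx4 i j k l \<Longrightarrow> Q_lin i j k l \<zero>\<^bsub>A\<^esub> = \<zero>\<^bsub>X\<^esub>"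
  using Q_lin_homogeneous[OF _ grade_zero, of i j k l 0] Q_hom_zero by simp

lemma Q_lin_uminus: "\<lbrakk>idx4 i j k l; x \<in> carrier A\<rbrakk> \<Longrightarrow> Q_lin i j k l (\<ominus>\<^bsub>A\<^esub> x) = Q_lin i j k l x"
  using additive_map_zero_minus(2)[OF M.abelian_group_axioms CE.X.M.abelian_group_axioms, of "Q_lin i j k l" x]
    Q_lin_closed Q_lin_add double_zero_minus[OF Q_lin_closed Q_lin_double] by simp

text \<open>
  The elements \<open>x\<close> such that \<open>Q_lin\<close> vanishes on all \<open>y x z\<close> form an ideal. By \<open>Q_lin_comm\<close> the last two
  of three factors can be exchanged; with suitable groupings this exchanges \<open>a\<close> and \<open>b\<close> inside
  \<open>y a b z\<close>.
\<close>
lemma Q_lin_ideal2: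
  assumes q: "idx4 i j k l" and "x \<in> I2"
  shows "Q_lin i j k l x = \<zero>\<^bsub>X\<^esub>"
proof -
  let ?J = "{x \<in> carrier A. \<forall>y\<in>carrier A. \<forall>z\<in>carrier A. Q_lin i j k l (y \<otimes>\<^bsub>A\<^esub> x \<otimes>\<^bsub>A\<^esub> z) = \<zero>\<^bsub>X\<^esub>}"
  have "I2 \<subseteq> ?J"
  proof (rule ideal2_minimal)
    show "ideal ?J A"
    proof (rule ideal_of_closed)
      show "x \<otimes>\<^bsub>A\<^esub> w \<in> ?J" if x: "x \<in> ?J" and w: "w \<in> carrier A" for x w
      proof -
        have "Q_lin i j k l (y \<otimes>\<^bsub>A\<^esub> (x \<otimes>\<^bsub>A\<^esub> w) \<otimes>\<^bsub>A\<^esub> z) = \<zero>\<^bsub>X\<^esub>" if "y \<in> carrier A" "z \<in> carrier A" for y z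
        proof -
          have "Q_lin i j k l (y \<otimes>\<^bsub>A\<^esub> x \<otimes>\<^bsub>A\<^esub> (w \<otimes>\<^bsub>A\<^esub> z)) = \<zero>\<^bsub>X\<^esub>" using x w that by simp
          then show ?thesis using x w that by (simp add: A.m_assoc)
        qed
        then show ?thesis using x w by simp
      qed
      show "w \<otimes>\<^bsub>A\<^esub> x \<in> ?J" if x: "x \<in> ?J" and w: "w \<in> carrier A" for x w
      proof -
        have "Q_lin i j k l (y \<otimes>\<^bsub>A\<^esub> (w \<otimes>\<^bsub>A\<^esub> x) \<otimes>\<^bsub>A\<^esub> z) = \<zero>\<^bsub>X\<^esub>" if "y \<in> carrier A" "z \<in> carrier A" for y z
        proof -
          have "Q_lin i j k l ((y \<otimes>\<^bsub>A\<^esub> w) \<otimes>\<^bsub>A\<^esub> x \<otimes>\<^bsub>A\<^esub> z) = \<zero>\<^bsub>X\<^esub>" using x w that by simp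
          then show ?thesis using x w that by (simp add: A.m_assoc)
        qed
        then show ?thesis using x w by simp
      qed
    qed (auto simp: mult_add add_mult Q_lin_add[OF q] Q_lin_zero[OF q])
    show "a \<oplus>\<^bsub>A\<^esub> a \<in> ?J" if "a \<in> carrier A" for a
      using that by (auto simp: mult_add add_mult Q_lin_add[OF q] Q_lin_double[OF q])
    show "a \<otimes>\<^bsub>A\<^esub> b \<ominus>\<^bsub>A\<^esub> ssign A p r (b \<otimes>\<^bsub>A\<^esub> a) \<in> ?J" if ab: "a \<in> grade A p" "b \<in> grade A r" for p r a b
    proof -
      note c = ab[THEN grade_carrier]
      have "Q_lin i j k l (y \<otimes>\<^bsub>A\<^esub> (a \<otimes>\<^bsub>A\<^esub> b \<ominus>\<^bsub>A\<^esub> ssign A p r (b \<otimes>\<^bsub>A\<^esub> a)) \<otimes>\<^bsub>A\<^esub> z) = \<zero>\<^bsub>X\<^esub>"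
        if y: "y \<in> carrier A" and z: "z \<in> carrier A" for y z
      proof -
        let ?u = "y \<otimes>\<^bsub>A\<^esub> (a \<otimes>\<^bsub>A\<^esub> b) \<otimes>\<^bsub>A\<^esub> z" and ?v = "y \<otimes>\<^bsub>A\<^esub> (b \<otimes>\<^bsub>A\<^esub> a) \<otimes>\<^bsub>A\<^esub> z"
        have cl: "?u \<in> carrier A" "?v \<in> carrier A" using c y z by simp_all
        have "Q_lin i j k l ?u = Q_lin i j k l (y \<otimes>\<^bsub>A\<^esub> a \<otimes>\<^bsub>A\<^esub> (b \<otimes>\<^bsub>A\<^esub> z))" using c y z by (simp add: A.m_assoc)
        also have "\<dots> = Q_lin i j k l (y \<otimes>\<^bsub>A\<^esub> (b \<otimes>\<^bsub>A\<^esub> z) \<otimes>\<^bsub>A\<^esub> a)" using c y z by (intro Q_lin_comm[OF q]) auto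
        also have "\<dots> = Q_lin i j k l ((y \<otimes>\<^bsub>A\<^esub> b) \<otimes>\<^bsub>A\<^esub> z \<otimes>\<^bsub>A\<^esub> a)" using c y z by (simp add: A.m_assoc)
        also have "\<dots> = Q_lin i j k l ((y \<otimes>\<^bsub>A\<^esub> b) \<otimes>\<^bsub>A\<^esub> a \<otimes>\<^bsub>A\<^esub> z)" using c y z by (intro Q_lin_comm[OF q]) auto
        also have "\<dots> = Q_lin i j k l ?v" using c y z by (simp add: A.m_assoc)
        finally have uv: "Q_lin i j k l ?u = Q_lin i j k l ?v" .
        have "y \<otimes>\<^bsub>A\<^esub> (a \<otimes>\<^bsub>A\<^esub> b \<ominus>\<^bsub>A\<^esub> ssign A p r (b \<otimes>\<^bsub>A\<^esub> a)) \<otimes>\<^bsub>A\<^esub> z = ?u \<oplus>\<^bsub>A\<^esub> ?v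
          \<or> y \<otimes>\<^bsub>A\<^esub> (a \<otimes>\<^bsub>A\<^esub> b \<ominus>\<^bsub>A\<^esub> ssign A p r (b \<otimes>\<^bsub>A\<^esub> a)) \<otimes>\<^bsub>A\<^esub> z = ?u \<oplus>\<^bsub>A\<^esub> \<ominus>\<^bsub>A\<^esub> ?v"
          using c y z by (simp add: ssign_def a_minus_def mult_add add_mult mult_uminus uminus_mult)
        then show ?thesis
          using cl Q_lin_double[OF q cl(2)] by (auto simp: Q_lin_add[OF q] Q_lin_uminus[OF q] uv)
      qed
      then show ?thesis using c by (simp add: ssign_closed)
    qed
  qed
  then have x: "x \<in> ?J" using assms(2) by blast
  then have "Q_lin i j k l (\<one>\<^bsub>A\<^esub> \<otimes>\<^bsub>A\<^esub> x \<otimes>\<^bsub>A\<^esub> \<one>\<^bsub>A\<^esub>) = \<zero>\<^bsub>X\<^esub>" by blast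
  then show ?thesis using x by simp
qed

lemma \<tau>_Q_lin:
  assumes q: "idx4 i j k l" and x: "x \<in> carrier A"
  shows "\<tau> (Q_lin i j k l x) = \<zero>\<^bsub>L\<^esub>"
proof -
  note d = idx4D[OF q]
  have hom: "\<tau> (Q_hom i j k l p a) = \<zero>\<^bsub>L\<^esub>" if a: "a \<in> grade A p" for p a
    unfolding Q_hom_def CE.\<tau>_\<beta>[OF F_closed[OF d(1,2,5) a] F_closed[OF d(3,4,10) one_grade]]
    by (rule F_commute[OF d(1-5,10,8,7) a one_grade])
  show ?thesis
    unfolding Q_lin_def
    using CE.\<tau>_hom(2)[OF Q_hom_closed[OF q hpart_grade[OF x]] Q_hom_closed[OF q hpart_grade[OF x]]] hom[OF hpart_grade[OF x]]
    by simp
qed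

lemma Q_lin_pair:
  assumes q: "idx4 i j k l" and q': "idx4 i' j' k' l'" and eq: "{i', k'} = {i, k}" and x: "x \<in> carrier A"
  shows "Q_lin i' j' k' l' x = Q_lin i j k l x"
  unfolding Q_lin_def Q_hom_pair[OF q q' eq hpart_grade[OF x]] ..

definition class_rep :: "nat \<Rightarrow> nat \<times> nat \<times> nat \<times> nat" where
  "class_rep r = (SOME s. s \<in> quadruples \<and> \<theta> s = r)"

text \<open>
  The map that \<open>Q_lin i j k l\<close> induces on \<open>A\<^sub>2\<close>. By \<open>Q_lin_ideal2\<close> and \<open>Q_lin_pair\<close> it depends neither
  on the representative in \<open>A\<close> nor on the quadruple chosen in the \<open>r\<close>-th class.
\<close>
definition Q_class :: "nat \<Rightarrow> 'a set \<Rightarrow> 'm" where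
  "Q_class r Z = (case class_rep r of (i, j, k, l) \<Rightarrow> Q_lin i j k l (SOME x. x \<in> carrier A \<and> Z = cls x))"

lemma Q_class_cls:
  assumes q: "idx4 i j k l" and r: "\<theta> (i, j, k, l) = r" and x: "x \<in> carrier A"
  shows "Q_class r (cls x) = Q_lin i j k l x"
proof -
  let ?y = "SOME y. y \<in> carrier A \<and> cls x = cls y"
  have "?y \<in> carrier A \<and> cls x = cls ?y" by (rule someI[of _ x]) (simp add: x)
  then have y: "?y \<in> carrier A" "x \<ominus>\<^bsub>A\<^esub> ?y \<in> I2" using A2.coset_eq_iff x by blast+
  have "\<exists>s. s \<in> quadruples \<and> \<theta> s = r" using q r by blast
  then have qr: "class_rep r \<in> quadruples \<and> \<theta> (class_rep r) = r" unfolding class_rep_def by (rule someI_ex)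
  obtain i' j' k' l' where q': "class_rep r = (i', j', k', l')" by (cases "class_rep r")
  have i4: "idx4 i' j' k' l'" using qr q' by simp
  have eq: "{i', k'} = {i, k}" using \<theta>_eq_iff[OF q i4] qr q' r by simp
  have "Q_class r (cls x) = Q_lin i' j' k' l' ?y" by (simp add: Q_class_def q')
  also have "\<dots> = Q_lin i j k l ?y" by (rule Q_lin_pair[OF q i4 eq y(1)])
  finally have *: "Q_class r (cls x) = Q_lin i j k l ?y" .
  have "Q_lin i j k l x \<ominus>\<^bsub>X\<^esub> Q_lin i j k l ?y = Q_lin i j k l (x \<ominus>\<^bsub>A\<^esub> ?y)"
    using additive_map_zero_minus(3)[OF M.abelian_group_axioms CE.X.M.abelian_group_axioms, of "Q_lin i j k l" x ?y]
      Q_lin_closed[OF q] Q_lin_add[OF q] x y(1) by simp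
  then have "Q_lin i j k l x \<ominus>\<^bsub>X\<^esub> Q_lin i j k l ?y = \<zero>\<^bsub>X\<^esub>" using Q_lin_ideal2[OF q y(2)] by simp
  then show ?thesis using * CE.X.M.minus_eq_zero_iff Q_lin_closed[OF q] x y(1) by simp
qed

lemma B_E:
  assumes "Z \<in> carrier B"
  obtains x where "x \<in> carrier A" "Z = cls x"
  using assms by (auto simp: A2.quot_carrier)

lemma class_E:
  assumes "r \<in> {1..6}"
  obtains i j k l where "idx4 i j k l" "\<theta> (i, j, k, l) = r"
  using \<theta>_surj[OF assms] by auto

lemma Q_class_closed:
  assumes r: "r \<in> {1..6}" and Z: "Z \<in> carrier B"
  shows "Q_class r Z \<in> carrier X" "\<tau> (Q_class r Z) = \<zero>\<^bsub>L\<^esub>"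
proof -
  obtain i j k l where q: "idx4 i j k l" "\<theta> (i, j, k, l) = r" using class_E[OF r] .
  obtain x where x: "x \<in> carrier A" "Z = cls x" using B_E[OF Z] .
  show "Q_class r Z \<in> carrier X" "\<tau> (Q_class r Z) = \<zero>\<^bsub>L\<^esub>"
    unfolding x(2) Q_class_cls[OF q x(1)] using Q_lin_closed[OF q(1) x(1)] \<tau>_Q_lin[OF q(1) x(1)] by auto
qed

lemma Q_class_add:
  assumes r: "r \<in> {1..6}" and Z: "Z \<in> carrier B" and Y: "Y \<in> carrier B"
  shows "Q_class r (Z \<oplus>\<^bsub>B\<^esub> Y) = Q_class r Z \<oplus>\<^bsub>X\<^esub> Q_class r Y"
proof -
  obtain i j k l where q: "idx4 i j k l" "\<theta> (i, j, k, l) = r" using class_E[OF r] .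
  obtain x where x: "x \<in> carrier A" "Z = cls x" using B_E[OF Z] .
  obtain y where y: "y \<in> carrier A" "Y = cls y" using B_E[OF Y] .
  show ?thesis
    unfolding x(2) y(2) A2.quot_add[OF x(1) y(1)] Q_class_cls[OF q x(1)] Q_class_cls[OF q y(1)]
      Q_class_cls[OF q M.a_closed[OF x(1) y(1)]] by (rule Q_lin_add[OF q(1) x(1) y(1)])
qed

lemma Q_class_smult:
  assumes r: "r \<in> {1..6}" and c: "c \<in> carrier K" and Z: "Z \<in> carrier B"
  shows "Q_class r (c \<odot>\<^bsub>B\<^esub> Z) = c \<odot>\<^bsub>X\<^esub> Q_class r Z"
proof -
  obtain i j k l where q: "idx4 i j k l" "\<theta> (i, j, k, l) = r" using class_E[OF r] .
  obtain x where x: "x \<in> carrier A" "Z = cls x" using B_E[OF Z] .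
  show ?thesis
    unfolding x(2) A2.quot_smult[OF c x(1)] Q_class_cls[OF q x(1)] Q_class_cls[OF q smult_closed[OF c x(1)]]
    by (rule Q_lin_smult[OF q(1) c x(1)])
qed

lemma Q_class_zero: "r \<in> {1..6} \<Longrightarrow> Q_class r \<zero>\<^bsub>B\<^esub> = \<zero>\<^bsub>X\<^esub>"
  by (rule additive_map_zero_minus(1)[OF A2.quot_abelian_group CE.X.M.abelian_group_axioms])
    (auto intro: Q_class_closed Q_class_add)

lemma Q_hom_grade:
  assumes q: "idx4 i j k l" and a: "a \<in> grade A p"
  shows "Q_hom i j k l p a \<in> grade X (p + 1)"
proof -
  note d = idx4D[OF q]
  have "Q_hom i j k l p a \<in> grade X (F_deg i j p + F_deg k l 0)"
    unfolding Q_hom_def by (rule CE.be.cocycle_grade[OF F_grade[OF d(1,2,5) a] F_grade[OF d(3,4,10) one_grade]])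
  moreover have "F_deg i j p + F_deg k l 0 = p + (idx_parity i + idx_parity j + (idx_parity k + idx_parity l))"
    by (simp add: ac_simps)
  then have "F_deg i j p + F_deg k l 0 = p + 1" unfolding idx4_parity[OF q] .
  ultimately show ?thesis by (simp only:)
qed

lemma Q_class_grade:
  assumes r: "r \<in> {1..6}" and Z: "Z \<in> grade B (p + 1)"
  shows "Q_class r Z \<in> grade X p"
proof -
  obtain i j k l where q: "idx4 i j k l" "\<theta> (i, j, k, l) = r" using class_E[OF r] .
  obtain x where x: "x \<in> grade A (p + 1)" "Z = cls x" using Z by (auto simp: A2.quot_grade)
  have "Q_class r Z = Q_hom i j k l (p + 1) x"
    unfolding x(2) Q_class_cls[OF q grade_carrier[OF x(1)]] by (rule Q_lin_homogeneous[OF q(1) x(1)])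
  moreover have "p + 1 + 1 = p" using bit_cases[of p] by auto
  ultimately show ?thesis using Q_hom_grade[OF q(1) x(1)] by simp
qed

definition W_map :: "(nat \<Rightarrow> 'a set) \<Rightarrow> 'm" where
  "W_map w = finsum X (\<lambda>r. Q_class r (w r)) {1..6}"

lemma Q_class_Pi: "w \<in> carrier W \<Longrightarrow> (\<lambda>r. Q_class r (w r)) \<in> {1..6} \<rightarrow> carrier X"
  using Q_class_closed(1) W_entry by blast

lemma W_map_closed: "w \<in> carrier W \<Longrightarrow> W_map w \<in> carrier X"
  unfolding W_map_def by (rule CE.X.M.finsum_closed[OF Q_class_Pi])

lemma W_map_add:
  assumes "v \<in> carrier W" "w \<in> carrier W"
  shows "W_map (v \<oplus>\<^bsub>W\<^esub> w) = W_map v \<oplus>\<^bsub>X\<^esub> W_map w"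
proof -
  have "W_map (v \<oplus>\<^bsub>W\<^esub> w) = finsum X (\<lambda>r. Q_class r (v r) \<oplus>\<^bsub>X\<^esub> Q_class r (w r)) {1..6}"
    unfolding W_map_def
  proof (rule CE.X.M.finsum_cong'[OF refl])
    show "(\<lambda>r. Q_class r (v r) \<oplus>\<^bsub>X\<^esub> Q_class r (w r)) \<in> {1..6} \<rightarrow> carrier X"
      using Q_class_Pi[OF assms(1)] Q_class_Pi[OF assms(2)] by blast
    show "Q_class r ((v \<oplus>\<^bsub>W\<^esub> w) r) = Q_class r (v r) \<oplus>\<^bsub>X\<^esub> Q_class r (w r)" if r: "r \<in> {1..6}" for r
      unfolding W_entries(2)[OF r] by (rule Q_class_add[OF r W_entry[OF assms(1) r] W_entry[OF assms(2) r]])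
  qed
  then show ?thesis
    unfolding W_map_def using CE.X.M.finsum_addf[OF Q_class_Pi[OF assms(1)] Q_class_Pi[OF assms(2)]] by simp
qed

lemma W_map_smult:
  assumes c: "c \<in> carrier K" and w: "w \<in> carrier W"
  shows "W_map (c \<odot>\<^bsub>W\<^esub> w) = c \<odot>\<^bsub>X\<^esub> W_map w"
proof -
  have "W_map (c \<odot>\<^bsub>W\<^esub> w) = finsum X (\<lambda>r. c \<odot>\<^bsub>X\<^esub> Q_class r (w r)) {1..6}"
    unfolding W_map_def
  proof (rule CE.X.M.finsum_cong'[OF refl])
    show "(\<lambda>r. c \<odot>\<^bsub>X\<^esub> Q_class r (w r)) \<in> {1..6} \<rightarrow> carrier X"
      using Q_class_Pi[OF w] c by blast
    show "Q_class r ((c \<odot>\<^bsub>W\<^esub> w) r) = c \<odot>\<^bsub>X\<^esub> Q_class r (w r)" if r: "r \<in> {1..6}" for r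
      unfolding W_entries(3)[OF r] by (rule Q_class_smult[OF r c W_entry[OF w r]])
  qed
  also have "\<dots> = c \<odot>\<^bsub>X\<^esub> W_map w"
    unfolding W_map_def using CE.X.finsum_smult_ldistr[OF _ c Q_class_Pi[OF w]] by simp
  finally show ?thesis .
qed

lemma W_map_central:
  assumes w: "w \<in> carrier W"
  shows "\<tau> (W_map w) = \<zero>\<^bsub>L\<^esub>"
proof -
  have "\<tau> (finsum X (\<lambda>r. Q_class r (w r)) S) = \<zero>\<^bsub>L\<^esub>" if "finite S" "S \<subseteq> {1..6}" for S
    using that
  proof (induction S rule: finite_induct)
    case empty
    then show ?case by (simp add: CE.\<tau>_hom(6))
  next
    case (insert r S)
    have cl: "(\<lambda>r. Q_class r (w r)) \<in> S \<rightarrow> carrier X" "Q_class r (w r) \<in> carrier X" "\<tau> (Q_class r (w r)) = \<zero>\<^bsub>L\<^esub>"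
      using Q_class_Pi[OF w] Q_class_closed[OF _ W_entry[OF w]] insert.prems by blast+
    then show ?case using insert CE.X.M.finsum_closed[OF cl(1)] by (simp add: CE.\<tau>_hom(2))
  qed
  then show ?thesis unfolding W_map_def by blast
qed

lemma W_map_grade:
  assumes "w \<in> grade W p"
  shows "W_map w \<in> grade X p"
  unfolding W_map_def
proof (rule CE.X.finsum_grade)
  show "Q_class r (w r) \<in> grade X p" if r: "r \<in> {1..6}" for r
    by (rule Q_class_grade[OF r PiE_mem[OF assms[unfolded W_simps(5)] r]])
qed simp

lemma W_map_minus: "\<lbrakk>v \<in> carrier W; w \<in> carrier W\<rbrakk> \<Longrightarrow> W_map (v \<ominus>\<^bsub>W\<^esub> w) = W_map v \<ominus>\<^bsub>X\<^esub> W_map w"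
  and W_map_zero: "W_map \<zero>\<^bsub>W\<^esub> = \<zero>\<^bsub>X\<^esub>"
  using additive_map_zero_minus(1,3)[OF W.M.abelian_group_axioms CE.X.M.abelian_group_axioms, of W_map]
    W_map_closed W_map_add by auto

lemma W_map_incl:
  assumes q: "idx4 i j k l" and x: "x \<in> carrier A"
  shows "W_map (W_incl A (\<theta> (i, j, k, l)) (cls x)) = Q_lin i j k l x"
proof -
  let ?r = "\<theta> (i, j, k, l)"
  have r: "?r \<in> {1..6}" by (rule \<theta>_range[OF q])
  have "W_map (W_incl A ?r (cls x)) = finsum X (\<lambda>s. if ?r = s then Q_class s (cls x) else \<zero>\<^bsub>X\<^esub>) {1..6}"
    unfolding W_map_def
  proof (rule CE.X.M.finsum_cong'[OF refl])
    show "(\<lambda>s. if ?r = s then Q_class s (cls x) else \<zero>\<^bsub>X\<^esub>) \<in> {1..6} \<rightarrow> carrier X"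
      using Q_class_closed(1)[OF _ cls_closed[OF x]] by auto
    show "Q_class s (W_incl A ?r (cls x) s) = (if ?r = s then Q_class s (cls x) else \<zero>\<^bsub>X\<^esub>)" if s: "s \<in> {1..6}" for s
      unfolding W_incl_simp using s Q_class_zero[OF s] by (auto simp del: atLeastAtMost_iff)
  qed
  also have "\<dots> = Q_class ?r (cls x)"
    by (rule CE.X.M.finsum_singleton[OF r]) (simp, use Q_class_closed(1)[OF _ cls_closed[OF x]] in blast)
  finally show ?thesis unfolding Q_class_cls[OF q refl x] .
qed

end

section \<open>Universality\<close>

lemma (in abelian_group) diff_swap:
  assumes "a \<in> carrier G" "b \<in> carrier G" "c \<in> carrier G" "d \<in> carrier G" "a \<ominus> b = c \<ominus> d"
  shows "a \<ominus> c = b \<ominus> d"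
proof -
  have "(a \<ominus> c) \<ominus> (b \<ominus> d) = (a \<ominus> b) \<ominus> (c \<ominus> d)"
    using assms(1-4) by (simp add: a_minus_def minus_add a_ac)
  then have "(a \<ominus> c) \<ominus> (b \<ominus> d) = \<zero>"
    using assms minus_eq_zero_iff[of "c \<ominus> d" "c \<ominus> d"] by simp
  then show ?thesis using assms(1-4) minus_eq_zero_iff[of "a \<ominus> c" "b \<ominus> d"] by simp
qed

context steinberg_labelled
begin

abbreviation "\<psi>\<^sub>0 \<equiv> st_cocycle K A \<theta>"
abbreviation "E \<equiv> cocycle_extension L W \<psi>\<^sub>0"

lemma \<psi>\<^sub>0_F:
  assumes ij: "i \<in> {1..4}" "j \<in> {1..4}" "i \<noteq> j" and kl: "k \<in> {1..4}" "l \<in> {1..4}" "k \<noteq> l"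
    and a: "a \<in> grade A p" and b: "b \<in> grade A q"
  shows "\<psi>\<^sub>0 (F i j p a) (F k l q b) =
    (if distinct [i, j, k, l] then W_incl A (\<theta> (i, j, k, l)) (cls (a \<otimes>\<^bsub>A\<^esub> b)) else \<zero>\<^bsub>W\<^esub>)"
  unfolding st_cocycle_psi[OF F_closed[OF ij a] F_closed[OF kl b]] by (rule psi_F[OF assms])

text \<open>
  The extension is perfect: \<open>(F\<^sub>i\<^sub>j(a), 0)\<close> is the bracket of \<open>(F\<^sub>i\<^sub>m(a), 0)\<close> and \<open>(F\<^sub>m\<^sub>j(1), 0)\<close>, and for
  distinct indices the bracket of \<open>(F\<^sub>i\<^sub>j(a), 0)\<close> and \<open>(F\<^sub>k\<^sub>l(1), 0)\<close> is the class of \<open>a\<close> in one of the six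
  summands of \<open>\<W>\<close>.
\<close>
lemma extension_perfect:
  assumes x: "x \<in> carrier E"
    and bracket: "\<And>y z. \<lbrakk>y \<in> carrier E; z \<in> carrier E\<rbrakk> \<Longrightarrow> T (y \<otimes>\<^bsub>E\<^esub> z)"
    and add: "\<And>y z. \<lbrakk>y \<in> carrier E; z \<in> carrier E; T y; T z\<rbrakk> \<Longrightarrow> T (y \<oplus>\<^bsub>E\<^esub> z)"
    and smult: "\<And>c y. \<lbrakk>c \<in> carrier K; y \<in> carrier E; T y\<rbrakk> \<Longrightarrow> T (c \<odot>\<^bsub>E\<^esub> y)"
  shows "T x"
proof -
  have br: "T (s \<otimes>\<^bsub>L\<^esub> t, \<psi>\<^sub>0 s t)" if "s \<in> carrier L" "t \<in> carrier L" for s t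
    using bracket[of "(s, \<zero>\<^bsub>W\<^esub>)" "(t, \<zero>\<^bsub>W\<^esub>)"] that by (simp add: sharp.ext_simps)
  have zero: "T (\<zero>\<^bsub>L\<^esub>, \<zero>\<^bsub>W\<^esub>)"
    using br[OF L.M.zero_closed L.M.zero_closed] by (simp add: L.zero_mult sharp.cocycle_zero_left)
  have incl: "T (\<zero>\<^bsub>L\<^esub>, W_incl A r Z)" if r: "r \<in> {1..6}" and Z: "Z \<in> carrier B" for r Z
  proof -
    obtain i j k l where q: "idx4 i j k l" "\<theta> (i, j, k, l) = r" using \<theta>_surj[OF r] by auto
    note d = idx4D[OF q(1)]
    have d4: "distinct [i, j, k, l]" using d by simp
    have hom: "T (\<zero>\<^bsub>L\<^esub>, W_incl A r (cls a))" if a: "a \<in> grade A p" for a p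
    proof -
      have "F i j p a \<otimes>\<^bsub>L\<^esub> F k l 0 \<one>\<^bsub>A\<^esub> = \<zero>\<^bsub>L\<^esub>" by (rule F_commute[OF d(1-5,10,8,7) a one_grade])
      moreover have "\<psi>\<^sub>0 (F i j p a) (F k l 0 \<one>\<^bsub>A\<^esub>) = W_incl A r (cls a)"
        unfolding \<psi>\<^sub>0_F[OF d(1,2,5,3,4,10) a one_grade] using d4 q(2) grade_carrier[OF a] by simp
      ultimately show ?thesis using br[OF F_closed[OF d(1,2,5) a] F_closed[OF d(3,4,10) one_grade]] by simp
    qed
    obtain a where a: "a \<in> carrier A" "Z = cls a" using Z by (auto simp: A2.quot_carrier)
    have "T (\<zero>\<^bsub>L\<^esub>, W_incl A r (cls a))" using a(1)
    proof (induction rule: homogeneous_induct)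
      case (homogeneous p a)
      then show ?case by (rule hom)
    next
      case (add a b)
      have "W_incl A r (cls (a \<oplus>\<^bsub>A\<^esub> b)) = W_incl A r (cls a) \<oplus>\<^bsub>W\<^esub> W_incl A r (cls b)"
      proof (rule W_eqI)
        fix s :: nat assume s: "s \<in> {1..6}"
        have "\<zero>\<^bsub>B\<^esub> \<oplus>\<^bsub>B\<^esub> \<zero>\<^bsub>B\<^esub> = \<zero>\<^bsub>B\<^esub>" by (simp only: mat.M.l_zero mat.M.zero_closed)
        then show "W_incl A r (cls (a \<oplus>\<^bsub>A\<^esub> b)) s = (W_incl A r (cls a) \<oplus>\<^bsub>W\<^esub> W_incl A r (cls b)) s"
          unfolding W_entries(2)[OF s] W_incl_simp using s add(1,2)
          by (cases "s = r") (simp_all del: atLeastAtMost_iff add: A2.quot_add)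
      qed (use add(1,2) in \<open>auto intro: W_incl_closed cls_closed\<close>)
      then show ?case
        using assms(3)[OF _ _ add(3,4)] add(1,2) by (simp add: sharp.ext_simps W_incl_closed cls_closed)
    qed
    then show ?thesis by (simp add: a(2))
  qed
  have central: "T (\<zero>\<^bsub>L\<^esub>, w)" if w: "w \<in> carrier W" for w
  proof -
    have "\<forall>w\<in>carrier W. (\<forall>r\<in>{1..6} - S. w r = \<zero>\<^bsub>B\<^esub>) \<longrightarrow> T (\<zero>\<^bsub>L\<^esub>, w)" if "finite S" "S \<subseteq> {1..6}" for S
      using that
    proof (induction S rule: finite_induct)
      case empty
      have "w = \<zero>\<^bsub>W\<^esub>" if "w \<in> carrier W" "\<forall>r\<in>{1..6}. w r = \<zero>\<^bsub>B\<^esub>" for w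
        by (rule W_eqI[OF that(1) W.M.zero_closed]) (simp only: that(2) W_entries(1))
      then show ?case using zero by auto
    next
      case (insert r S)
      have r: "r \<in> {1..6}" using insert.prems by blast
      show ?case
      proof (intro ballI impI)
        fix w assume w: "w \<in> carrier W" and supp: "\<forall>s\<in>{1..6} - insert r S. w s = \<zero>\<^bsub>B\<^esub>"
        let ?v = "\<lambda>s\<in>{1..6}. if s = r then \<zero>\<^bsub>B\<^esub> else w s" and ?u = "W_incl A r (w r)"
        have v: "?v \<in> carrier W" unfolding W_simps(1) using W_entry[OF w] by (auto simp del: atLeastAtMost_iff)
        have u: "?u \<in> carrier W" by (rule W_incl_closed[OF W_entry[OF w r]])
        have "\<forall>s\<in>{1..6} - S. ?v s = \<zero>\<^bsub>B\<^esub>" using supp by auto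
        then have "T (\<zero>\<^bsub>L\<^esub>, ?v)" using insert.IH insert.prems v by blast
        moreover have "T (\<zero>\<^bsub>L\<^esub>, ?u)" by (rule incl[OF r W_entry[OF w r]])
        ultimately have "T ((\<zero>\<^bsub>L\<^esub>, ?v) \<oplus>\<^bsub>E\<^esub> (\<zero>\<^bsub>L\<^esub>, ?u))"
          using v u by (intro add) (simp_all add: sharp.ext_simps(1))
        moreover have "?v \<oplus>\<^bsub>W\<^esub> ?u = w"
        proof (rule W_eqI[OF W.M.a_closed[OF v u] w])
          fix s :: nat assume s: "s \<in> {1..6}"
          show "(?v \<oplus>\<^bsub>W\<^esub> ?u) s = w s"
            unfolding W_entries(2)[OF s] W_incl_simp using s W_entry[OF w s]
            by (cases "s = r") (simp_all del: atLeastAtMost_iff)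
        qed
        ultimately show "T (\<zero>\<^bsub>L\<^esub>, w)" by (simp add: sharp.ext_simps(4))
      qed
    qed
    from this[of "{1..6}"] w show ?thesis by simp
  qed
  have ex: "\<exists>w\<in>carrier W. T (s, w)" if "s \<in> carrier L" for s
    using that
  proof (induction rule: pr.presented_induct)
    case (gen g)
    obtain i j p a where g: "g = (i, j, p, a)" "i \<in> {1..4}" "j \<in> {1..4}" "i \<noteq> j" "a \<in> grade A p"
      using gen by (auto simp: st_letters_def)
    obtain m where m: "m \<in> {1..4}" "m \<noteq> i" "m \<noteq> j" using exists_fourth[of i j j] by blast
    have "F i m p a \<otimes>\<^bsub>L\<^esub> F m j 0 \<one>\<^bsub>A\<^esub> = F i j p a"
      using F_mult[OF g(2) m(1) g(3) m(2)[symmetric] m(3) g(4) g(5) one_grade] grade_carrier[OF g(5)] by simp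
    then have "T (F i j p a, \<psi>\<^sub>0 (F i m p a) (F m j 0 \<one>\<^bsub>A\<^esub>))"
      using br[OF F_closed[OF g(2) m(1) m(2)[symmetric] g(5)] F_closed[OF m(1) g(3) m(3) one_grade]] by simp
    then show ?case
      unfolding g(1) F_coset[symmetric]
      using sharp.cocycle_closed[OF F_closed[OF g(2) m(1) m(2)[symmetric] g(5)] F_closed[OF m(1) g(3) m(3) one_grade]]
      by blast
  next
    case zero
    show ?case using zero W.M.zero_closed \<open>T (\<zero>\<^bsub>L\<^esub>, \<zero>\<^bsub>W\<^esub>)\<close> by blast
  next
    case (add s t)
    then obtain v w where vw: "v \<in> carrier W" "T (s, v)" "w \<in> carrier W" "T (t, w)" by blast
    then have "T ((s, v) \<oplus>\<^bsub>E\<^esub> (t, w))" using add(1,2) by (intro assms(3)) (simp_all add: sharp.ext_simps(1))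
    then show ?case using vw by (auto simp: sharp.ext_simps(4))
  next
    case (smult c s)
    then obtain v where v: "v \<in> carrier W" "T (s, v)" by blast
    then have "T (c \<odot>\<^bsub>E\<^esub> (s, v))" using smult(1,2) by (intro assms(4)) (simp_all add: sharp.ext_simps(1))
    then show ?case using v smult(1) by (auto simp: sharp.ext_simps(5))
  next
    case (mult s t)
    then show ?case using br sharp.cocycle_closed by blast
  qed
  obtain s w where sw: "x = (s, w)" "s \<in> carrier L" "w \<in> carrier W" using x by (auto simp: sharp.ext_simps(1))
  obtain v where v: "v \<in> carrier W" "T (s, v)" using ex[OF sw(2)] by blast
  have "T ((s, v) \<oplus>\<^bsub>E\<^esub> (\<zero>\<^bsub>L\<^esub>, w \<ominus>\<^bsub>W\<^esub> v))"
    using v sw central by (intro add) (simp_all add: sharp.ext_simps(1))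
  moreover have "v \<oplus>\<^bsub>W\<^esub> (w \<ominus>\<^bsub>W\<^esub> v) = w"
    using v sw by (simp add: a_minus_def W.M.a_comm[of w] W.M.r_neg2)
  ultimately show ?thesis using sw by (simp add: sharp.ext_simps(4))
qed

end

context steinberg_extension
begin

definition gens_X :: "'a st_letter \<Rightarrow> 'm" where "gens_X = (\<lambda>(i, j, p, a). F_lift i j p a)"
definition gens_E where "gens_E = (\<lambda>(i, j, p, a). (F i j p a, \<zero>\<^bsub>W\<^esub>))"

lemma F_lift_arg_closed:
  assumes "i \<in> {1..4}" "j \<in> {1..4}" "a \<in> grade A p"
  shows "F i (third i j) p a \<in> carrier L" "F (third i j) j 0 \<one>\<^bsub>A\<^esub> \<in> carrier L"
  using assms third[of i j] by (auto intro!: F_closed one_grade simp del: atLeastAtMost_iff)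

lemma F_lift_closed: "\<lbrakk>i \<in> {1..4}; j \<in> {1..4}; a \<in> grade A p\<rbrakk> \<Longrightarrow> F_lift i j p a \<in> carrier X"
  unfolding F_lift_def by (rule \<beta>_closed[OF F_lift_arg_closed])

lemma \<tau>_F_lift:
  assumes ij: "i \<in> {1..4}" "j \<in> {1..4}" "i \<noteq> j" and a: "a \<in> grade A p"
  shows "\<tau> (F_lift i j p a) = F i j p a"
  unfolding F_lift_def CE.\<tau>_\<beta>[OF F_lift_arg_closed[OF ij(1,2) a]]
  using F_as_bracket(1)[OF ij third[of i j] a] by simp

lemma F_lift_add:
  assumes ij: "i \<in> {1..4}" "j \<in> {1..4}" and a: "a \<in> grade A p" and b: "b \<in> grade A p"
  shows "F_lift i j p (a \<oplus>\<^bsub>A\<^esub> b) = F_lift i j p a \<oplus>\<^bsub>X\<^esub> F_lift i j p b"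
  unfolding F_lift_def F_add[OF ij(1) third(1) third(2)[symmetric] a b]
  by (rule CE.be.cocycle_add_left[OF F_lift_arg_closed(1)[OF ij a] F_lift_arg_closed(1)[OF ij b] F_lift_arg_closed(2)[OF ij a]])

lemma F_lift_smult:
  assumes ij: "i \<in> {1..4}" "j \<in> {1..4}" and c: "c \<in> carrier K" and a: "a \<in> grade A p"
  shows "F_lift i j p (c \<odot>\<^bsub>A\<^esub> a) = c \<odot>\<^bsub>X\<^esub> F_lift i j p a"
  unfolding F_lift_def F_smult[OF ij(1) third(1) third(2)[symmetric] c a]
  by (rule CE.be.cocycle_smult_left[OF c F_lift_arg_closed[OF ij a]])

lemma F_lift_grade:
  assumes ij: "i \<in> {1..4}" "j \<in> {1..4}" and a: "a \<in> grade A p"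
  shows "F_lift i j p a \<in> grade X (F_deg i j p)"
proof -
  let ?m = "third i j"
  have "F_lift i j p a \<in> grade X (F_deg i ?m p + F_deg ?m j 0)"
    unfolding F_lift_def
    by (rule CE.be.cocycle_grade[OF F_grade[OF ij(1) third(1) third(2)[symmetric] a] F_grade[OF third(1) ij(2) third(3) one_grade]])
  moreover have "F_deg i ?m p + F_deg ?m j 0 = F_deg i j p"
    using bit_cases[of "idx_parity ?m"] by (auto simp: ac_simps)
  ultimately show ?thesis by (simp only:)
qed

sublocale ef: free_extension K "st_letters A" st_degree X gens_X
proof
  fix g assume "g \<in> st_letters A"
  then obtain i j p a where g: "g = (i, j, p, a)" "i \<in> {1..4}" "j \<in> {1..4}" "i \<noteq> j" "a \<in> grade A p"
    by (auto simp: st_letters_def)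
  then show "gens_X g \<in> grade X (st_degree g)" using F_lift_grade by (simp del: atLeastAtMost_iff add: gens_X_def st_degree_def)
qed

sublocale eg: free_extension K "st_letters A" st_degree E gens_E
proof (intro free_extension.intro free_extension_axioms.intro fr.free_generators_axioms sharp.ext_superalgebra)
  fix g assume "g \<in> st_letters A"
  then obtain i j p a where g: "g = (i, j, p, a)" "i \<in> {1..4}" "j \<in> {1..4}" "i \<noteq> j" "a \<in> grade A p"
    by (auto simp: st_letters_def)
  have "gens_E g = (F i j p a, \<zero>\<^bsub>W\<^esub>)" "st_degree g = F_deg i j p" by (simp_all add: g(1) gens_E_def st_degree_def)
  then show "gens_E g \<in> grade E (st_degree g)"
    using F_grade[OF g(2-5)] W.grade_zero by (simp only: sharp.ext_simps(6) mem_Sigma_iff)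
qed

abbreviation "ev_X \<equiv> free_ext K X gens_X"
abbreviation "ev_E \<equiv> free_ext K E gens_E"

lemmas ev_X_hom = lie_superalgebra_homD[OF ef.free_ext_hom]
  lie_hom_zero_minus[OF ef.free_ext_hom fr.N.M.abelian_group_axioms CE.X.M.abelian_group_axioms]
lemmas ev_E_hom = lie_superalgebra_homD[OF eg.free_ext_hom]
  lie_hom_zero_minus[OF eg.free_ext_hom fr.N.M.abelian_group_axioms sharp.ext_abelian_group]

lemma ev_X_gen: "\<lbrakk>i \<in> {1..4}; j \<in> {1..4}; i \<noteq> j; a \<in> grade A p\<rbrakk> \<Longrightarrow> ev_X (gen i j p a) = F_lift i j p a"
  using ef.free_ext_gen[OF st_letterI] by (simp add: gens_X_def)

lemma ev_E_gen: "\<lbrakk>i \<in> {1..4}; j \<in> {1..4}; i \<noteq> j; a \<in> grade A p\<rbrakk> \<Longrightarrow> ev_E (gen i j p a) = (F i j p a, \<zero>\<^bsub>W\<^esub>)"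
  using eg.free_ext_gen[OF st_letterI] by (simp add: gens_E_def)

lemma \<tau>_ev_X:
  assumes "x \<in> carrier N"
  shows "\<tau> (ev_X x) = pr.PI +>\<^bsub>N\<^esub> x"
  using assms
proof (induction rule: fr.free_subalgebra_induct)
  case (gen l)
  then obtain i j p a where l: "l = (i, j, p, a)" "i \<in> {1..4}" "j \<in> {1..4}" "i \<noteq> j" "a \<in> grade A p"
    by (auto simp: st_letters_def)
  show ?case unfolding l(1) ev_X_gen[OF l(2-5)] \<tau>_F_lift[OF l(2-5)] F_coset ..
next
  case zero
  have "pr.PI +>\<^bsub>N\<^esub> \<zero>\<^bsub>N\<^esub> = \<zero>\<^bsub>L\<^esub>" by (simp add: pr.quot.quot_zero pr.quot.I.a_subset)
  then show ?case by (simp add: ev_X_hom(6) CE.\<tau>_hom(6))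
next
  case (add x y)
  then show ?case by (simp add: ev_X_hom CE.\<tau>_hom pr.quot.quot_add)
next
  case (smult c x)
  then show ?case by (simp add: ev_X_hom CE.\<tau>_hom pr.quot.quot_smult)
next
  case (mult x y)
  then show ?case by (simp add: ev_X_hom CE.\<tau>_hom pr.quot.quot_mult)
qed

lemma fst_ev_E:
  assumes "x \<in> carrier N"
  shows "fst (ev_E x) = pr.PI +>\<^bsub>N\<^esub> x"
  using assms
proof (induction rule: fr.free_subalgebra_induct)
  case (gen l)
  then obtain i j p a where l: "l = (i, j, p, a)" "i \<in> {1..4}" "j \<in> {1..4}" "i \<noteq> j" "a \<in> grade A p"
    by (auto simp: st_letters_def)
  show ?case unfolding l(1) ev_E_gen[OF l(2-5)] fst_conv F_coset ..
next
  case zero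
  have "pr.PI +>\<^bsub>N\<^esub> \<zero>\<^bsub>N\<^esub> = \<zero>\<^bsub>L\<^esub>" by (simp add: pr.quot.quot_zero pr.quot.I.a_subset)
  then show ?case by (simp add: ev_E_hom(6) sharp.ext_simps(3))
next
  case (add x y)
  then show ?case using pr.quot.quot_add[of x y]
    by (cases "ev_E x"; cases "ev_E y") (simp add: ev_E_hom sharp.ext_simps(4))
next
  case (smult c x)
  then show ?case using pr.quot.quot_smult[of c x]
    by (cases "ev_E x") (simp add: ev_E_hom sharp.ext_simps(5))
next
  case (mult x y)
  then show ?case using pr.quot.quot_mult[of x y]
    by (cases "ev_E x"; cases "ev_E y") (simp add: ev_E_hom sharp.ext_simps(2))
qed

definition W_part where "W_part x = snd (ev_E x)"

lemma W_part_closed: "x \<in> carrier N \<Longrightarrow> W_part x \<in> carrier W"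
  using ev_E_hom(1)[of x] unfolding W_part_def by (auto simp: sharp.ext_simps(1))

lemma ev_E_eq: "x \<in> carrier N \<Longrightarrow> ev_E x = (pr.PI +>\<^bsub>N\<^esub> x, W_part x)"
  using fst_ev_E[of x] by (simp add: W_part_def prod_eq_iff)

lemma W_part_zero: "W_part \<zero>\<^bsub>N\<^esub> = \<zero>\<^bsub>W\<^esub>"
  by (simp add: W_part_def ev_E_hom(6) sharp.ext_simps(3))

lemma W_part_add:
  assumes "x \<in> carrier N" "y \<in> carrier N"
  shows "W_part (x \<oplus>\<^bsub>N\<^esub> y) = W_part x \<oplus>\<^bsub>W\<^esub> W_part y"
  unfolding W_part_def[of "x \<oplus>\<^bsub>N\<^esub> y"] ev_E_hom(2)[OF assms] ev_E_eq[OF assms(1)] ev_E_eq[OF assms(2)] sharp.ext_simps(4) snd_conv ..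

lemma W_part_smult:
  assumes "c \<in> carrier K" "x \<in> carrier N"
  shows "W_part (c \<odot>\<^bsub>N\<^esub> x) = c \<odot>\<^bsub>W\<^esub> W_part x"
  unfolding W_part_def[of "c \<odot>\<^bsub>N\<^esub> x"] ev_E_hom(3)[OF assms] ev_E_eq[OF assms(2)] sharp.ext_simps(5) snd_conv ..

lemma W_part_mult:
  assumes "x \<in> carrier N" "y \<in> carrier N"
  shows "W_part (x \<otimes>\<^bsub>N\<^esub> y) = \<psi>\<^sub>0 (pr.PI +>\<^bsub>N\<^esub> x) (pr.PI +>\<^bsub>N\<^esub> y)"
  unfolding W_part_def[of "x \<otimes>\<^bsub>N\<^esub> y"] ev_E_hom(4)[OF assms] ev_E_eq[OF assms(1)] ev_E_eq[OF assms(2)] sharp.ext_simps(2) snd_conv ..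

lemma W_part_minus: "\<lbrakk>x \<in> carrier N; y \<in> carrier N\<rbrakk> \<Longrightarrow> W_part (x \<ominus>\<^bsub>N\<^esub> y) = W_part x \<ominus>\<^bsub>W\<^esub> W_part y"
  and W_part_uminus: "x \<in> carrier N \<Longrightarrow> W_part (\<ominus>\<^bsub>N\<^esub> x) = \<ominus>\<^bsub>W\<^esub> W_part x"
  using additive_map_zero_minus(2,3)[OF fr.N.M.abelian_group_axioms W.M.abelian_group_axioms, of W_part] W_part_closed W_part_add
  by auto

lemma W_part_grade: "x \<in> grade N p \<Longrightarrow> W_part x \<in> grade W p"
  using ev_E_hom(5)[of x p] unfolding W_part_def by (auto simp: sharp.ext_simps(6))

lemma W_part_gen: "\<lbrakk>i \<in> {1..4}; j \<in> {1..4}; i \<noteq> j; a \<in> grade A p\<rbrakk> \<Longrightarrow> W_part (gen i j p a) = \<zero>\<^bsub>W\<^esub>"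
  by (simp add: W_part_def ev_E_gen)

lemma W_zero_minus: "\<zero>\<^bsub>W\<^esub> \<ominus>\<^bsub>W\<^esub> \<zero>\<^bsub>W\<^esub> = \<zero>\<^bsub>W\<^esub>"
  using W.M.minus_eq_zero_iff[OF W.M.zero_closed W.M.zero_closed] by blast

text \<open>
  On the first three kinds of relators both sides vanish. On a bracket of root elements with distinct
  indices, the left-hand side is \<open>\<beta>\<close> of these elements and \<open>W_part\<close> is the cocycle of them.
\<close>
lemma relator_agreement:
  assumes "r \<in> st_relators K A"
  shows "ev_X r = W_map (W_part r)"
  using assms
proof (cases rule: st_relatorsE)
  case (add i j p a b)
  note gens = gen_closed[OF add(2-5)] gen_closed[OF add(2-4,6)] gen_closed[OF add(2-4) grade_add[OF add(5,6)]]
  have "ev_X r = F_lift i j p (a \<oplus>\<^bsub>A\<^esub> b) \<ominus>\<^bsub>X\<^esub> (F_lift i j p a \<oplus>\<^bsub>X\<^esub> F_lift i j p b)"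
    using gens by (simp add: add(1) ev_X_hom ev_X_gen[OF add(2-5)] ev_X_gen[OF add(2-4,6)] ev_X_gen[OF add(2-4) grade_add[OF add(5,6)]])
  also have "\<dots> = \<zero>\<^bsub>X\<^esub>"
    unfolding F_lift_add[OF add(2,3,5,6)] using F_lift_closed[OF add(2,3,5)] F_lift_closed[OF add(2,3,6)]
    by (simp add: CE.X.M.minus_eq_zero_iff)
  finally have "ev_X r = \<zero>\<^bsub>X\<^esub>" .
  moreover have "W_part r = \<zero>\<^bsub>W\<^esub> \<ominus>\<^bsub>W\<^esub> (\<zero>\<^bsub>W\<^esub> \<oplus>\<^bsub>W\<^esub> \<zero>\<^bsub>W\<^esub>)"
    using gens by (simp add: add(1) W_part_minus W_part_add W_part_gen[OF add(2-5)] W_part_gen[OF add(2-4,6)] W_part_gen[OF add(2-4) grade_add[OF add(5,6)]])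
  ultimately show ?thesis by (simp add: W_map_zero W_zero_minus)
next
  case (smult i j p c a)
  note gens = gen_closed[OF smult(2-4,6)] gen_closed[OF smult(2-4) grade_smult[OF smult(5,6)]]
  have "ev_X r = F_lift i j p (c \<odot>\<^bsub>A\<^esub> a) \<ominus>\<^bsub>X\<^esub> c \<odot>\<^bsub>X\<^esub> F_lift i j p a"
    using gens smult(5) by (simp add: smult(1) ev_X_hom ev_X_gen[OF smult(2-4,6)] ev_X_gen[OF smult(2-4) grade_smult[OF smult(5,6)]])
  also have "\<dots> = \<zero>\<^bsub>X\<^esub>"
    unfolding F_lift_smult[OF smult(2,3,5,6)] using F_lift_closed[OF smult(2,3,6)] smult(5)
    by (simp add: CE.X.M.minus_eq_zero_iff)
  finally have "ev_X r = \<zero>\<^bsub>X\<^esub>" .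
  moreover have "W_part r = \<zero>\<^bsub>W\<^esub> \<ominus>\<^bsub>W\<^esub> (c \<odot>\<^bsub>W\<^esub> \<zero>\<^bsub>W\<^esub>)"
    using gens smult(5) by (simp add: smult(1) W_part_minus W_part_smult W_part_gen[OF smult(2-4,6)] W_part_gen[OF smult(2-4) grade_smult[OF smult(5,6)]])
  ultimately show ?thesis using smult(5) by (simp add: W_map_zero W_zero_minus)
next
  case (comp i j k p q a b)
  note ab = mult_grade[OF comp(8,9)]
  note gens = gen_closed[OF comp(2,3,5,8)] gen_closed[OF comp(3,4,6,9)] gen_closed[OF comp(2,4,7) ab]
  have "ev_X r = F_lift i j p a \<otimes>\<^bsub>X\<^esub> F_lift j k q b \<ominus>\<^bsub>X\<^esub> F_lift i k (p + q) (a \<otimes>\<^bsub>A\<^esub> b)"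
    using gens fr.N.mult_closed[OF gens(1,2)]
    by (simp add: comp(1) ev_X_hom ev_X_gen[OF comp(2,3,5,8)] ev_X_gen[OF comp(3,4,6,9)] ev_X_gen[OF comp(2,4,7) ab])
  also have "F_lift i j p a \<otimes>\<^bsub>X\<^esub> F_lift j k q b = F_lift i k (p + q) (a \<otimes>\<^bsub>A\<^esub> b)"
    unfolding CE.mult_\<beta>[OF F_lift_closed[OF comp(2,3,8)] F_lift_closed[OF comp(3,4,9)]]
      \<tau>_F_lift[OF comp(2,3,5,8)] \<tau>_F_lift[OF comp(3,4,6,9)]
    by (rule F_lift_eq[OF comp(2-9)])
  finally have "ev_X r = \<zero>\<^bsub>X\<^esub>" using F_lift_closed[OF comp(2,4) ab] by (simp add: CE.X.M.minus_eq_zero_iff)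
  moreover have "W_part r = \<psi>\<^sub>0 (F i j p a) (F j k q b) \<ominus>\<^bsub>W\<^esub> \<zero>\<^bsub>W\<^esub>"
    using gens fr.N.mult_closed[OF gens(1,2)]
    by (simp add: comp(1) W_part_minus W_part_mult W_part_gen[OF comp(2,4,7) ab] F_coset)
  moreover have "\<psi>\<^sub>0 (F i j p a) (F j k q b) = \<zero>\<^bsub>W\<^esub>"
    unfolding \<psi>\<^sub>0_F[OF comp(2,3,5,3,4,6,8,9)] by simp
  ultimately show ?thesis by (simp add: W_map_zero W_zero_minus)
next
  case (zero i j k l p q a b)
  note gens = gen_closed[OF zero(2,3,6,10)] gen_closed[OF zero(4,5,7,11)]
  have ev_X_r: "ev_X r = \<beta> (F i j p a) (F k l q b)"
    using gens CE.mult_\<beta>[OF F_lift_closed[OF zero(2,3,10)] F_lift_closed[OF zero(4,5,11)]]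
    by (simp add: zero(1) ev_X_hom ev_X_gen[OF zero(2,3,6,10)] ev_X_gen[OF zero(4,5,7,11)]
        \<tau>_F_lift[OF zero(2,3,6,10)] \<tau>_F_lift[OF zero(4,5,7,11)])
  have W_part_r: "W_part r = \<psi>\<^sub>0 (F i j p a) (F k l q b)"
    using gens by (simp add: zero(1) W_part_mult F_coset)
  show ?thesis
  proof (cases "distinct [i, j, k, l]")
    case True
    then have q4: "idx4 i j k l" using zero by (simp add: quadruples_def)
    have ab: "a \<otimes>\<^bsub>A\<^esub> b \<in> grade A (p + q)" by (rule mult_grade[OF zero(10,11)])
    have "ev_X r = Q_lin i j k l (a \<otimes>\<^bsub>A\<^esub> b)"
      unfolding ev_X_r P_eq_Q_hom[OF q4 zero(10,11)] Q_lin_homogeneous[OF q4 ab] ..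
    then show ?thesis
      unfolding W_part_r \<psi>\<^sub>0_F[OF zero(2,3,6,4,5,7,10,11)] using True W_map_incl[OF q4 grade_carrier[OF ab]] by simp
  next
    case False
    then have "i = k \<or> j = l" using zero by auto
    then have "ev_X r = \<zero>\<^bsub>X\<^esub>" unfolding ev_X_r by (rule \<beta>_commute[OF zero(2,3,6,4,5,7,8,9) _ zero(10,11)])
    moreover have "W_part r = \<zero>\<^bsub>W\<^esub>"
      unfolding W_part_r \<psi>\<^sub>0_F[OF zero(2,3,6,4,5,7,10,11)] using False by (rule if_not_P)
    ultimately show ?thesis by (simp add: W_map_zero)
  qed
qed

text \<open>
  The two homomorphisms from the free superalgebra, to \<open>X\<close> and to the extension by \<open>\<W>\<close>, agree on
  the ideal of relations, up to the map \<open>W_map\<close>: those elements of the ideal for which they do so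
  form an ideal.
\<close>
lemma ideal_agreement:
  assumes "x \<in> pr.PI"
  shows "ev_X x = W_map (W_part x)"
proof -
  let ?J = "{x \<in> pr.PI. ev_X x = W_map (W_part x)}"
  have zero: "pr.PI +>\<^bsub>N\<^esub> x = \<zero>\<^bsub>L\<^esub>" if "x \<in> pr.PI" for x
    using pr.quot.coset_zero_iff[OF pr.quot.ideal_carrier[OF that]] that pr.quot.quot_zero by simp
  have central: "\<tau> (ev_X x) = \<zero>\<^bsub>L\<^esub>" if "x \<in> pr.PI" for x
    using \<tau>_ev_X[OF pr.quot.ideal_carrier[OF that]] zero[OF that] by simp
  have cos: "pr.PI +>\<^bsub>N\<^esub> x \<in> carrier L" if "x \<in> carrier N" for x
    using that by (auto simp: pr.quot.quot_carrier)
  have "nonassoc_ideal_gen K N (lie_identities N \<union> st_relators K A) \<subseteq> ?J"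
  proof (rule fr.N.nonassoc_ideal_gen_minimal)
    note sub = pr.quot.ideal_submodule
    note car = pr.quot.ideal_carrier
    show "submodule ?J K N"
    proof (rule fr.N.submoduleI)
      show "?J \<subseteq> carrier N" using car by blast
      show "\<zero>\<^bsub>N\<^esub> \<in> ?J" by (simp add: ev_X_hom(6) W_part_zero W_map_zero)
      show "\<ominus>\<^bsub>N\<^esub> x \<in> ?J" if "x \<in> ?J" for x
        using that car[of x] fr.N.submoduleE(3)[OF sub, of x] W_part_closed[of x]
          additive_map_zero_minus(2)[OF W.M.abelian_group_axioms CE.X.M.abelian_group_axioms, of W_map "W_part x"]
          W_map_closed W_map_add
        by (simp add: ev_X_hom(7) W_part_uminus)
      show "x \<oplus>\<^bsub>N\<^esub> y \<in> ?J" if "x \<in> ?J" "y \<in> ?J" for x y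
        using that car[of x] car[of y] fr.N.submoduleE(5)[OF sub, of x y]
        by (simp add: ev_X_hom(2) W_part_add W_part_closed W_map_add)
      show "c \<odot>\<^bsub>N\<^esub> x \<in> ?J" if "c \<in> carrier K" "x \<in> ?J" for c x
        using that car[of x] fr.N.submoduleE(4)[OF sub, of c x]
        by (simp add: ev_X_hom(3) W_part_smult W_part_closed W_map_smult)
    qed
    show "x \<otimes>\<^bsub>N\<^esub> y \<in> ?J" if x: "x \<in> ?J" and y: "y \<in> carrier N" for x y
    proof -
      have x': "x \<in> pr.PI" "x \<in> carrier N" using x car by blast+
      have "ev_X (x \<otimes>\<^bsub>N\<^esub> y) = \<zero>\<^bsub>X\<^esub>"
        unfolding ev_X_hom(4)[OF x'(2) y] by (rule CE.central_left[OF ev_X_hom(1)[OF x'(2)] central[OF x'(1)] ev_X_hom(1)[OF y]])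
      moreover have "W_part (x \<otimes>\<^bsub>N\<^esub> y) = \<zero>\<^bsub>W\<^esub>"
        unfolding W_part_mult[OF x'(2) y] zero[OF x'(1)] by (rule sharp.cocycle_zero_left[OF cos[OF y]])
      ultimately show ?thesis using pr.quot.ideal_mult_right[OF x'(1) y] by (simp add: W_map_zero)
    qed
    show "y \<otimes>\<^bsub>N\<^esub> x \<in> ?J" if x: "x \<in> ?J" and y: "y \<in> carrier N" for x y
    proof -
      have x': "x \<in> pr.PI" "x \<in> carrier N" using x car by blast+
      have "ev_X (y \<otimes>\<^bsub>N\<^esub> x) = \<zero>\<^bsub>X\<^esub>"
        unfolding ev_X_hom(4)[OF y x'(2)] by (rule CE.central_right[OF ev_X_hom(1)[OF x'(2)] central[OF x'(1)] ev_X_hom(1)[OF y]])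
      moreover have "W_part (y \<otimes>\<^bsub>N\<^esub> x) = \<zero>\<^bsub>W\<^esub>"
        unfolding W_part_mult[OF y x'(2)] zero[OF x'(1)] by (rule sharp.cocycle_zero_right[OF cos[OF y]])
      ultimately show ?thesis using pr.quot.ideal_mult_left[OF x'(1) y] by (simp add: W_map_zero)
    qed
    show "lie_identities N \<union> st_relators K A \<subseteq> ?J"
    proof
      fix s assume s: "s \<in> lie_identities N \<union> st_relators K A"
      then have "s \<in> pr.PI" using pr.relators_in_ideal by blast
      moreover have "ev_X s = W_map (W_part s)" using s
      proof
        assume s: "s \<in> lie_identities N"
        have "ev_X s = \<zero>\<^bsub>X\<^esub>"
          by (rule lie_hom_kills_lie_identities[OF ef.free_ext_hom fr.N.superalgebra_axioms CE.X.lie_superalgebra_axioms s])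
        moreover have "ev_E s = \<zero>\<^bsub>E\<^esub>"
          by (rule lie_hom_kills_lie_identities[OF eg.free_ext_hom fr.N.superalgebra_axioms sharp.ext_lie_superalgebra s])
        ultimately show ?thesis by (simp add: W_part_def sharp.ext_simps(3) W_map_zero)
      qed (rule relator_agreement)
      ultimately show "s \<in> ?J" by blast
    qed
  qed
  moreover have "x \<in> nonassoc_ideal_gen K N (lie_identities N \<union> st_relators K A)"
    using assms by (simp only: lie_presentation_ideal_def)
  ultimately show ?thesis by blast
qed

definition coset_rep where "coset_rep s = (SOME x. x \<in> carrier N \<and> s = pr.PI +>\<^bsub>N\<^esub> x)"

text \<open>
  Any preimage \<open>x\<close> of \<open>s\<close> in the free superalgebra could be used here, by \<open>ideal_agreement\<close>: the second
  summand corrects the discrepancy between \<open>(s, w)\<close> and the image of \<open>x\<close>.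
\<close>
definition \<rho> where "\<rho> = (\<lambda>(s, w). ev_X (coset_rep s) \<oplus>\<^bsub>X\<^esub> W_map (w \<ominus>\<^bsub>W\<^esub> W_part (coset_rep s)))"

lemma \<rho>_eq:
  assumes x: "x \<in> carrier N" and w: "w \<in> carrier W"
  shows "\<rho> (pr.PI +>\<^bsub>N\<^esub> x, w) = ev_X x \<oplus>\<^bsub>X\<^esub> W_map (w \<ominus>\<^bsub>W\<^esub> W_part x)"
proof -
  let ?y = "coset_rep (pr.PI +>\<^bsub>N\<^esub> x)"
  have "?y \<in> carrier N \<and> pr.PI +>\<^bsub>N\<^esub> x = pr.PI +>\<^bsub>N\<^esub> ?y"
    unfolding coset_rep_def by (rule someI[of _ x]) (simp add: x)
  then have y: "?y \<in> carrier N" "?y \<ominus>\<^bsub>N\<^esub> x \<in> pr.PI" using pr.quot.coset_eq_iff x by metis+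
  have cl: "ev_X ?y \<in> carrier X" "ev_X x \<in> carrier X" "W_map (W_part ?y) \<in> carrier X" "W_map (W_part x) \<in> carrier X" "W_map w \<in> carrier X"
    using x y(1) w by (auto intro!: ev_X_hom(1) W_map_closed W_part_closed)
  have shift: "u \<oplus>\<^bsub>X\<^esub> W_map (w \<ominus>\<^bsub>W\<^esub> W_part z) = (u \<ominus>\<^bsub>X\<^esub> W_map (W_part z)) \<oplus>\<^bsub>X\<^esub> W_map w"
    if u: "u \<in> carrier X" and z: "z \<in> carrier N" for u z
    unfolding W_map_minus[OF w W_part_closed[OF z]]
    using u cl(5) W_map_closed[OF W_part_closed[OF z]] by (simp add: a_minus_def CE.X.M.a_ac)
  have "ev_X ?y \<ominus>\<^bsub>X\<^esub> ev_X x = W_map (W_part ?y) \<ominus>\<^bsub>X\<^esub> W_map (W_part x)"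
    using ideal_agreement[OF y(2)] x y(1) by (simp add: ev_X_hom(8) W_part_minus W_map_minus W_part_closed)
  then have eq: "ev_X ?y \<ominus>\<^bsub>X\<^esub> W_map (W_part ?y) = ev_X x \<ominus>\<^bsub>X\<^esub> W_map (W_part x)"
    by (rule CE.X.M.diff_swap[OF cl(1-4)])
  have "\<rho> (pr.PI +>\<^bsub>N\<^esub> x, w) = (ev_X ?y \<ominus>\<^bsub>X\<^esub> W_map (W_part ?y)) \<oplus>\<^bsub>X\<^esub> W_map w"
    unfolding \<rho>_def prod.case by (rule shift[OF cl(1) y(1)])
  also have "\<dots> = ev_X x \<oplus>\<^bsub>X\<^esub> W_map (w \<ominus>\<^bsub>W\<^esub> W_part x)"
    unfolding eq by (rule shift[OF cl(2) x, symmetric])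
  finally show ?thesis .
qed

lemma E_elim:
  assumes "e \<in> carrier E"
  obtains x w where "x \<in> carrier N" "w \<in> carrier W" "e = (pr.PI +>\<^bsub>N\<^esub> x, w)"
  using assms by (auto simp: sharp.ext_simps(1) pr.quot.quot_carrier)

lemma \<rho>_part_closed: "\<lbrakk>x \<in> carrier N; w \<in> carrier W\<rbrakk> \<Longrightarrow> W_map (w \<ominus>\<^bsub>W\<^esub> W_part x) \<in> carrier X"
  by (simp add: W_map_closed W_part_closed)

lemma \<tau>_\<rho>:
  assumes "e \<in> carrier E"
  shows "\<rho> e \<in> carrier X" "\<tau> (\<rho> e) = fst e"
proof -
  obtain x w where e: "x \<in> carrier N" "w \<in> carrier W" "e = (pr.PI +>\<^bsub>N\<^esub> x, w)" using E_elim[OF assms] .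
  note c = \<rho>_part_closed[OF e(1,2)]
  have t: "\<tau> (W_map (w \<ominus>\<^bsub>W\<^esub> W_part x)) = \<zero>\<^bsub>L\<^esub>" using e by (intro W_map_central) (simp add: W_part_closed)
  have "pr.PI +>\<^bsub>N\<^esub> x \<in> carrier L" using e by (auto simp: pr.quot.quot_carrier)
  then show "\<rho> e \<in> carrier X" "\<tau> (\<rho> e) = fst e"
    unfolding e(3) \<rho>_eq[OF e(1,2)] using c e t ev_X_hom(1)[OF e(1)] by (simp_all add: CE.\<tau>_hom(2) \<tau>_ev_X)
qed

lemma \<rho>_hom: "\<rho> \<in> lie_superalgebra_hom K E X"
proof (rule lie_superalgebra_homI)
  show "\<rho> e \<in> carrier X" if "e \<in> carrier E" for e using that by (rule \<tau>_\<rho>)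
  show "\<rho> (e \<oplus>\<^bsub>E\<^esub> e') = \<rho> e \<oplus>\<^bsub>X\<^esub> \<rho> e'" if ee: "e \<in> carrier E" "e' \<in> carrier E" for e e'
  proof -
    obtain x w where e: "x \<in> carrier N" "w \<in> carrier W" "e = (pr.PI +>\<^bsub>N\<^esub> x, w)" using E_elim[OF ee(1)] .
    obtain y v where e': "y \<in> carrier N" "v \<in> carrier W" "e' = (pr.PI +>\<^bsub>N\<^esub> y, v)" using E_elim[OF ee(2)] .
    have "e \<oplus>\<^bsub>E\<^esub> e' = (pr.PI +>\<^bsub>N\<^esub> (x \<oplus>\<^bsub>N\<^esub> y), w \<oplus>\<^bsub>W\<^esub> v)"
      by (simp add: e(3) e'(3) sharp.ext_simps(4) pr.quot.quot_add e e')
    then have "\<rho> (e \<oplus>\<^bsub>E\<^esub> e') = ev_X (x \<oplus>\<^bsub>N\<^esub> y) \<oplus>\<^bsub>X\<^esub> W_map ((w \<oplus>\<^bsub>W\<^esub> v) \<ominus>\<^bsub>W\<^esub> W_part (x \<oplus>\<^bsub>N\<^esub> y))"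
      using \<rho>_eq[of "x \<oplus>\<^bsub>N\<^esub> y" "w \<oplus>\<^bsub>W\<^esub> v"] e(1,2) e'(1,2) by simp
    also have "(w \<oplus>\<^bsub>W\<^esub> v) \<ominus>\<^bsub>W\<^esub> W_part (x \<oplus>\<^bsub>N\<^esub> y) = (w \<ominus>\<^bsub>W\<^esub> W_part x) \<oplus>\<^bsub>W\<^esub> (v \<ominus>\<^bsub>W\<^esub> W_part y)"
      using e(1,2) e'(1,2) by (simp add: W_part_add W_part_closed a_minus_def W.M.minus_add W.M.a_ac)
    finally show ?thesis
      unfolding e(3) e'(3) \<rho>_eq[OF e(1,2)] \<rho>_eq[OF e'(1,2)]
      using e(1,2) e'(1,2) \<rho>_part_closed[OF e(1,2)] \<rho>_part_closed[OF e'(1,2)]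
      by (simp add: ev_X_hom(1,2) W_map_add W_part_closed CE.X.M.a_ac)
  qed
  show "\<rho> (c \<odot>\<^bsub>E\<^esub> e) = c \<odot>\<^bsub>X\<^esub> \<rho> e" if c: "c \<in> carrier K" and ee: "e \<in> carrier E" for c e
  proof -
    obtain x w where e: "x \<in> carrier N" "w \<in> carrier W" "e = (pr.PI +>\<^bsub>N\<^esub> x, w)" using E_elim[OF ee] .
    have "c \<odot>\<^bsub>E\<^esub> e = (pr.PI +>\<^bsub>N\<^esub> (c \<odot>\<^bsub>N\<^esub> x), c \<odot>\<^bsub>W\<^esub> w)"
      by (simp add: e(3) sharp.ext_simps(5) pr.quot.quot_smult e c)
    then have "\<rho> (c \<odot>\<^bsub>E\<^esub> e) = ev_X (c \<odot>\<^bsub>N\<^esub> x) \<oplus>\<^bsub>X\<^esub> W_map (c \<odot>\<^bsub>W\<^esub> w \<ominus>\<^bsub>W\<^esub> W_part (c \<odot>\<^bsub>N\<^esub> x))"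
      using \<rho>_eq[of "c \<odot>\<^bsub>N\<^esub> x" "c \<odot>\<^bsub>W\<^esub> w"] e(1,2) c by simp
    also have "c \<odot>\<^bsub>W\<^esub> w \<ominus>\<^bsub>W\<^esub> W_part (c \<odot>\<^bsub>N\<^esub> x) = c \<odot>\<^bsub>W\<^esub> (w \<ominus>\<^bsub>W\<^esub> W_part x)"
      using e(1,2) c by (simp add: W_part_smult W_part_closed a_minus_def W.smult_r_distr W.smult_r_minus)
    finally show ?thesis
      unfolding e(3) \<rho>_eq[OF e(1,2)] using e(1,2) c \<rho>_part_closed[OF e(1,2)]
      by (simp add: ev_X_hom(1,3) W_map_smult W_part_closed CE.X.smult_r_distr)
  qed
  show "\<rho> (e \<otimes>\<^bsub>E\<^esub> e') = \<rho> e \<otimes>\<^bsub>X\<^esub> \<rho> e'" if ee: "e \<in> carrier E" "e' \<in> carrier E" for e e'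
  proof -
    obtain x w where e: "x \<in> carrier N" "w \<in> carrier W" "e = (pr.PI +>\<^bsub>N\<^esub> x, w)" using E_elim[OF ee(1)] .
    obtain y v where e': "y \<in> carrier N" "v \<in> carrier W" "e' = (pr.PI +>\<^bsub>N\<^esub> y, v)" using E_elim[OF ee(2)] .
    have xy: "x \<otimes>\<^bsub>N\<^esub> y \<in> carrier N" using e e' by (simp add: fr.N.mult_closed)
    have "e \<otimes>\<^bsub>E\<^esub> e' = (pr.PI +>\<^bsub>N\<^esub> (x \<otimes>\<^bsub>N\<^esub> y), W_part (x \<otimes>\<^bsub>N\<^esub> y))"
      by (simp add: e(3) e'(3) sharp.ext_simps(2) pr.quot.quot_mult W_part_mult e(1) e'(1))
    then have "\<rho> (e \<otimes>\<^bsub>E\<^esub> e') = ev_X (x \<otimes>\<^bsub>N\<^esub> y) \<oplus>\<^bsub>X\<^esub> W_map (W_part (x \<otimes>\<^bsub>N\<^esub> y) \<ominus>\<^bsub>W\<^esub> W_part (x \<otimes>\<^bsub>N\<^esub> y))"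
      using \<rho>_eq[OF xy W_part_closed[OF xy]] by simp
    also have "W_part (x \<otimes>\<^bsub>N\<^esub> y) \<ominus>\<^bsub>W\<^esub> W_part (x \<otimes>\<^bsub>N\<^esub> y) = \<zero>\<^bsub>W\<^esub>" using W_part_closed[OF xy] W.M.minus_eq_zero_iff by simp
    finally have 1: "\<rho> (e \<otimes>\<^bsub>E\<^esub> e') = ev_X x \<otimes>\<^bsub>X\<^esub> ev_X y"
      using e(1) e'(1) ev_X_hom(1)[OF xy] by (simp add: W_map_zero ev_X_hom(4))
    have "\<rho> e \<otimes>\<^bsub>X\<^esub> \<rho> e' = \<beta> (fst e) (fst e')"
      unfolding CE.mult_\<beta>[OF \<tau>_\<rho>(1)[OF ee(1)] \<tau>_\<rho>(1)[OF ee(2)]] \<tau>_\<rho>(2)[OF ee(1)] \<tau>_\<rho>(2)[OF ee(2)] ..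
    moreover have "ev_X x \<otimes>\<^bsub>X\<^esub> ev_X y = \<beta> (fst e) (fst e')"
      unfolding CE.mult_\<beta>[OF ev_X_hom(1)[OF e(1)] ev_X_hom(1)[OF e'(1)]] \<tau>_ev_X[OF e(1)] \<tau>_ev_X[OF e'(1)]
      by (simp only: e(3) e'(3) fst_conv)
    ultimately show ?thesis using 1 by simp
  qed
  show "\<rho> e \<in> grade X p" if ep: "e \<in> grade E p" for e p
  proof -
    obtain x w where e: "x \<in> grade N p" "w \<in> grade W p" "e = (pr.PI +>\<^bsub>N\<^esub> x, w)"
      using ep by (auto simp: sharp.ext_simps(6) pr.quot.quot_grade)
    show ?thesis
      unfolding e(3) \<rho>_eq[OF fr.N.grade_carrier[OF e(1)] W.grade_carrier[OF e(2)]]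
      by (intro CE.X.grade_add ev_X_hom(5) W_map_grade W.grade_minus W_part_grade e(1,2))
  qed
qed

text \<open>
  Brackets in \<open>X\<close> depend only on the images under \<open>\<tau>\<close>, so two lifts agree on brackets.
\<close>
lemma \<rho>_unique:
  assumes "\<sigma> \<in> lie_superalgebra_hom K E X" "\<And>e. e \<in> carrier E \<Longrightarrow> \<tau> (\<sigma> e) = fst e"
    and "\<sigma>' \<in> lie_superalgebra_hom K E X" "\<And>e. e \<in> carrier E \<Longrightarrow> \<tau> (\<sigma>' e) = fst e"
    and "e \<in> carrier E"
  shows "\<sigma> e = \<sigma>' e"
  using assms(5)
proof (rule extension_perfect)
  note s = lie_superalgebra_homD[OF assms(1)] and s' = lie_superalgebra_homD[OF assms(3)]
  show "\<sigma> (y \<otimes>\<^bsub>E\<^esub> z) = \<sigma>' (y \<otimes>\<^bsub>E\<^esub> z)" if "y \<in> carrier E" "z \<in> carrier E" for y z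
    using that by (simp add: s s' CE.mult_\<beta> assms(2,4))
  show "\<sigma> (y \<oplus>\<^bsub>E\<^esub> z) = \<sigma>' (y \<oplus>\<^bsub>E\<^esub> z)"
    if "y \<in> carrier E" "z \<in> carrier E" "\<sigma> y = \<sigma>' y" "\<sigma> z = \<sigma>' z" for y z
    using that by (simp add: s s')
  show "\<sigma> (c \<odot>\<^bsub>E\<^esub> y) = \<sigma>' (c \<odot>\<^bsub>E\<^esub> y)"
    if "c \<in> carrier K" "y \<in> carrier E" "\<sigma> y = \<sigma>' y" for c y
    using that by (simp add: s s')
qed

lemma unique_lift:
  "\<exists>!\<sigma>. \<sigma> \<in> extensional (carrier E) \<and> \<sigma> \<in> lie_superalgebra_hom K E X \<and>
    (\<forall>e\<in>carrier E. \<tau> (\<sigma> e) = fst e)"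
proof (rule ex1I)
  note hom = lie_superalgebra_homD[OF \<rho>_hom]
  have "restrict \<rho> (carrier E) \<in> lie_superalgebra_hom K E X"
    by (rule lie_superalgebra_homI) (use eg.M.grade_carrier in \<open>auto simp: hom eg.M.mult_closed\<close>)
  then show "restrict \<rho> (carrier E) \<in> extensional (carrier E) \<and> restrict \<rho> (carrier E) \<in> lie_superalgebra_hom K E X \<and>
    (\<forall>e\<in>carrier E. \<tau> (restrict \<rho> (carrier E) e) = fst e)"
    using \<tau>_\<rho>(2) by simp
  fix \<sigma> assume s: "\<sigma> \<in> extensional (carrier E) \<and> \<sigma> \<in> lie_superalgebra_hom K E X \<and>
    (\<forall>e\<in>carrier E. \<tau> (\<sigma> e) = fst e)"
  show "\<sigma> = restrict \<rho> (carrier E)"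
  proof (rule extensionalityI)
    show "\<sigma> e = restrict \<rho> (carrier E) e" if e: "e \<in> carrier E" for e
      using \<rho>_unique[OF _ _ \<rho>_hom \<tau>_\<rho>(2) e, of \<sigma>] s e by simp
  qed (use s in auto)
qed

end

theorem theorem5p2:
  fixes K :: "('k, 'c) ring_scheme" and A :: "('k, 'a) superalgebra"
    and \<theta> :: "nat \<times> nat \<times> nat \<times> nat \<Rightarrow> nat"
  assumes "cring K"
    and "associative_superalgebra K A"
    and "has_basis_with_one K A"
    and "class_labelling \<theta>"
  shows "a_kernel (st_sharp K A \<theta>) (steinberg K A) fst = {\<zero>\<^bsub>steinberg K A\<^esub>} \<times> carrier (W_mod A) \<and>
    universal_central_extension TYPE('m) K (st_sharp K A \<theta>) (steinberg K A) fst"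
proof -
  interpret S: steinberg_labelled K A \<theta>
    using assms(2,4) coefficient_superalgebraI
    by (intro steinberg_labelled.intro steinberg_algebra.intro steinberg_labelled_axioms.intro)
  note ext = cocycle_extension_central[OF S.sharp.lie_cocycle_axioms]
  have "\<exists>!\<rho>. \<rho> \<in> extensional (carrier S.E) \<and> \<rho> \<in> lie_superalgebra_hom K S.E M \<and>
      (\<forall>x\<in>carrier S.E. \<tau> (\<rho> x) = fst x)"
    if M: "central_extension K M S.L \<tau>" for M :: "('k, 'm) superalgebra" and \<tau>
  proof -
    interpret T: steinberg_extension K A \<theta> M \<tau>
      using S.steinberg_labelled_axioms central_extensionD(1,2)[OF M] M
      by (intro steinberg_extension.intro central_extension_of.intro central_extension_of_axioms.intro)
    show ?thesis by (rule T.unique_lift)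
  qed
  then show ?thesis
    unfolding S.st_sharp_cocycle_extension S.steinberg_quot universal_central_extension_def
    using ext by blast
qed

end
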